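(* In the setting of the optimal control problem (P) described in the context, let $\bar u$ be a local solution of (P). Then there exists $\bar\lambda\in\partial g(\nabla\bar u)\subset[M(\omega)^n]^*$ such that $$\alpha\langle\bar\lambda,\nabla v\rangle_{[M(\omega)^n]^*,M(\omega)^n}+\int_\omega\Big(\bar\varphi+\gamma\bar u+\beta\int_\omega\bar u\,dz\Big)v\,dx=0\quad\forall v\in BV(\omega)\cap L^2(\omega),$$ where $\bar\varphi\in H_0^1(\Omega)\cap C(\bar\Omega)$ is the adjoint state corresponding to $\bar u$.
   Context: $\Omega\subset\mathbb{R}^n$, $n\in\{2,3\}$, bounded domain with Lipschitz boundary $\Gamma$; $\omega\subset\Omega$ open; $\alpha>0$, $\beta\ge0$, $\gamma\ge0$, $y_d\in L^2(\Omega)$; if $n=3$ then $\gamma>0$. $f:\Omega\times\mathbb{R}\to\mathbb{R}$ is Borel, $C^2$ in $y$, and for a.e. $x$: $f(\cdot,0)\in L^{\hat p}(\Omega)$, $\hat p>n/2$; $\partial_yf(x,y)\ge0$; for every $M>0$ there is $C_M$ with $|\partial_yf(x,y)|+|\partial^2_{yy}f(x,y)|\le C_M$ for $|y|\le M$; $\partial^2_{yy}f(x,\cdot)$ is uniformly (in $x$) continuous on bounded sets. For a control $u$, $y_u\in C(\bar\Omega)\cap H^1_0(\Omega)$ is the solution of $-\Delta y+f(x,y)=u\chi_\omega$ in $\Omega$, $y=0$ on $\Gamma$, and the adjoint state $\varphi_u$ solves $-\Delta\varphi+\partial_yf(x,y_u)\varphi=y_u-y_d$ in $\Omega$, $\varphi=0$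 on $\Gamma$; $\bar\varphi=\varphi_{\bar u}$. $M(\omega)$ are the real regular Borel measures on $\omega$, $C_0(\omega)$ the continuous functions on $\bar\omega$ vanishing on $\partial\omega$; given a norm $|\cdot|$ on $\mathbb{R}^n$, $\|\mu\|_{M(\omega)^n}=\sup\{\int_\omega z\cdot d\mu:z\in C_0(\omega)^n,|z(x)|\le1\ \forall x\}$, $g(\mu)=\|\mu\|_{M(\omega)^n}$, and $\partial g$ is its convex subdifferential. $BV(\omega)$ is the space of $u\in L^1(\omega)$ with distributional gradient $\nabla u\in M(\omega)^n$. Problem (P): minimize over $u\in BV(\omega)$ (with $u\in L^2(\omega)$ when $n=3$) $$J(u)=\frac12\int_\Omega|y_u-y_d|^2dx+\alpha\|\nabla u\|_{M(\omega)^n}+\frac\beta2\Big(\int_\omega u\,dx\Big)^2+\frac\gamma2\int_\omega u^2dx.$$ A local solution is $\bar u\in BV(\omega)\cap L^2(\omega)$ such that $J(\bar u)\le J(u)$ for all $u\in BV(\omega)\cap L^2(\omega)$ in a neighborhood of $\bar u$. *)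

theory Defs
  imports "HOL-Analysis.Analysis"
begin

type_synonym 'n pt = "real ^ 'n"

definition lipschitz_domain :: "('n::finite) pt set \<Rightarrow> bool" where
  "lipschitz_domain \<Omega> \<longleftrightarrow> open \<Omega> \<and> bounded \<Omega> \<and> connected \<Omega> \<and> \<Omega> \<noteq> {} \<and>
     (\<forall>p\<in>frontier \<Omega>. \<exists>e r L h. norm e = 1 \<and> r > 0 \<and>
        L-lipschitz_on {v. v \<bullet> e = 0} (h :: 'n pt \<Rightarrow> real) \<and>
        \<Omega> \<inter> ball p r = {x \<in> ball p r. x \<bullet> e > h (x - (x \<bullet> e) *\<^sub>R e)})"

definition is_norm :: "('n::finite pt \<Rightarrow> real) \<Rightarrow> bool" where
  "is_norm N \<longleftrightarrow> (\<forall>x y. N (x + y) \<le> N x + N y) \<and> (\<forall>c x. N (c *\<^sub>R x) = \<bar>c\<bar> * N x) \<and>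
     (\<forall>x. N x = 0 \<longleftrightarrow> x = 0)"

fun iter_dd :: "('n::finite) pt list \<Rightarrow> ('n pt \<Rightarrow> real) \<Rightarrow> 'n pt \<Rightarrow> real" where
  "iter_dd [] g = g"
| "iter_dd (v # vs) g = (\<lambda>x. frechet_derivative (iter_dd vs g) (at x) v)"

definition smooth_fun :: "('n::finite pt \<Rightarrow> real) \<Rightarrow> bool" where
  "smooth_fun g \<longleftrightarrow> (\<forall>vs. iter_dd vs g differentiable_on UNIV)"

definition test_fun :: "('n::finite) pt set \<Rightarrow> ('n pt \<Rightarrow> real) \<Rightarrow> bool" where
  "test_fun U \<psi> \<longleftrightarrow> smooth_fun \<psi> \<and> compact (closure {x. \<psi> x \<noteq> 0}) \<and>
     closure {x. \<psi> x \<noteq> 0} \<subseteq> U"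

definition partial :: "'n \<Rightarrow> ('n::finite pt \<Rightarrow> real) \<Rightarrow> 'n pt \<Rightarrow> real" where
  "partial i g x = frechet_derivative g (at x) (axis i 1)"

definition grad :: "('n::finite pt \<Rightarrow> real) \<Rightarrow> 'n pt \<Rightarrow> 'n pt" where
  "grad g x = (\<chi> i. partial i g x)"

definition Lp :: "real \<Rightarrow> ('n::finite) pt set \<Rightarrow> ('n pt \<Rightarrow> real) \<Rightarrow> bool" where
  "Lp p U y \<longleftrightarrow> y \<in> borel_measurable (lebesgue_on U) \<and>
     integrable (lebesgue_on U) (\<lambda>x. \<bar>y x\<bar> powr p)"

definition weak_grad :: "('n::finite) pt set \<Rightarrow> ('n pt \<Rightarrow> real) \<Rightarrow> ('n pt \<Rightarrow> 'n pt) \<Rightarrow> bool" where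
  "weak_grad U y G \<longleftrightarrow> (\<forall>\<psi>. test_fun U \<psi> \<longrightarrow> (\<forall>i.
      (LINT x|lebesgue_on U. y x * partial i \<psi> x) = - (LINT x|lebesgue_on U. G x $ i * \<psi> x)))"

definition H1 :: "('n::finite) pt set \<Rightarrow> ('n pt \<Rightarrow> real) \<Rightarrow> ('n pt \<Rightarrow> 'n pt) \<Rightarrow> bool" where
  "H1 U y G \<longleftrightarrow> Lp 2 U y \<and> (\<forall>i. Lp 2 U (\<lambda>x. G x $ i)) \<and> weak_grad U y G"

definition H10 :: "('n::finite) pt set \<Rightarrow> ('n pt \<Rightarrow> real) \<Rightarrow> bool" where
  "H10 U y \<longleftrightarrow> (\<exists>G \<psi>s. H1 U y G \<and> (\<forall>k. test_fun U (\<psi>s k)) \<and>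
     (\<lambda>k. (LINT x|lebesgue_on U. (\<psi>s k x - y x)\<^sup>2) +
          (\<Sum>i\<in>UNIV. LINT x|lebesgue_on U. (partial i (\<psi>s k) x - G x $ i)\<^sup>2)) \<longlonglongrightarrow> 0)"

definition state_sol :: "('n::finite) pt set \<Rightarrow> 'n pt set \<Rightarrow> ('n pt \<Rightarrow> real \<Rightarrow> real)
    \<Rightarrow> ('n pt \<Rightarrow> real) \<Rightarrow> ('n pt \<Rightarrow> real) \<Rightarrow> bool" where
  "state_sol \<Omega> \<omega> f u y \<longleftrightarrow> continuous_on (closure \<Omega>) y \<and> (\<forall>x. x \<notin> closure \<Omega> \<longrightarrow> y x = 0) \<and>
     H10 \<Omega> y \<and> (\<exists>G. H1 \<Omega> y G \<and> (\<forall>\<psi>. test_fun \<Omega> \<psi> \<longrightarrow>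
       (LINT x|lebesgue_on \<Omega>. G x \<bullet> grad \<psi> x + f x (y x) * \<psi> x)
        = (LINT x|lebesgue_on \<omega>. u x * \<psi> x)))"

definition state :: "('n::finite) pt set \<Rightarrow> 'n pt set \<Rightarrow> ('n pt \<Rightarrow> real \<Rightarrow> real)
    \<Rightarrow> ('n pt \<Rightarrow> real) \<Rightarrow> ('n pt \<Rightarrow> real)" where
  "state \<Omega> \<omega> f u = (THE y. state_sol \<Omega> \<omega> f u y)"

definition adjoint_sol :: "('n::finite) pt set \<Rightarrow> ('n pt \<Rightarrow> real \<Rightarrow> real)
    \<Rightarrow> ('n pt \<Rightarrow> real) \<Rightarrow> ('n pt \<Rightarrow> real) \<Rightarrow> ('n pt \<Rightarrow> real) \<Rightarrow> bool" where
  "adjoint_sol \<Omega> f1 y yd \<phi> \<longleftrightarrow> continuous_on (closure \<Omega>) \<phi> \<and>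
     (\<forall>x. x \<notin> closure \<Omega> \<longrightarrow> \<phi> x = 0) \<and>
     H10 \<Omega> \<phi> \<and> (\<exists>G. H1 \<Omega> \<phi> G \<and> (\<forall>\<psi>. test_fun \<Omega> \<psi> \<longrightarrow>
       (LINT x|lebesgue_on \<Omega>. G x \<bullet> grad \<psi> x + f1 x (y x) * \<phi> x * \<psi> x)
        = (LINT x|lebesgue_on \<Omega>. (y x - yd x) * \<psi> x)))"

definition adjoint :: "('n::finite) pt set \<Rightarrow> ('n pt \<Rightarrow> real \<Rightarrow> real)
    \<Rightarrow> ('n pt \<Rightarrow> real) \<Rightarrow> ('n pt \<Rightarrow> real) \<Rightarrow> ('n pt \<Rightarrow> real)" where
  "adjoint \<Omega> f1 y yd = (THE \<phi>. adjoint_sol \<Omega> f1 y yd \<phi>)"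

definition borel_sets_on :: "('n::finite) pt set \<Rightarrow> 'n pt set set" where
  "borel_sets_on \<omega> = {A. A \<in> sets borel \<and> A \<subseteq> \<omega>}"

text \<open>A countably additive \<open>\<real>\<^sup>n\<close>-valued set function on the Borel subsets of \<open>\<omega>\<close>
  (set to 0 on other sets). Finite Borel measures on open subsets of \<open>\<real>\<^sup>n\<close> are regular.\<close>
definition vmeasure :: "('n::finite) pt set \<Rightarrow> ('n pt set \<Rightarrow> 'n pt) \<Rightarrow> bool" where
  "vmeasure \<omega> \<mu> \<longleftrightarrow> (\<forall>A. A \<notin> borel_sets_on \<omega> \<longrightarrow> \<mu> A = 0) \<and> \<mu> {} = 0 \<and>
     (\<forall>A :: nat \<Rightarrow> 'n pt set. range A \<subseteq> borel_sets_on \<omega> \<longrightarrow> disjoint_family A \<longrightarrow>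
        (\<lambda>k. \<mu> (A k)) sums \<mu> (\<Union>k. A k))"

definition pos_part :: "('n::finite) pt set \<Rightarrow> ('n pt set \<Rightarrow> real) \<Rightarrow> 'n pt set \<Rightarrow> real" where
  "pos_part \<omega> \<nu> A = Sup {\<nu> B | B. B \<in> borel_sets_on \<omega> \<and> B \<subseteq> A}"

definition pos_measure :: "('n::finite) pt set \<Rightarrow> ('n pt set \<Rightarrow> real) \<Rightarrow> 'n pt measure" where
  "pos_measure \<omega> \<nu> = measure_of \<omega> (borel_sets_on \<omega>) (\<lambda>A. ennreal (pos_part \<omega> \<nu> A))"

definition sint :: "('n::finite) pt set \<Rightarrow> ('n pt set \<Rightarrow> real) \<Rightarrow> ('n pt \<Rightarrow> real) \<Rightarrow> real" where
  "sint \<omega> \<nu> g = (\<integral>x. g x \<partial>pos_measure \<omega> \<nu>) - (\<integral>x. g x \<partial>pos_measure \<omega> (\<lambda>A. - \<nu> A))"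

definition vint :: "('n::finite) pt set \<Rightarrow> ('n pt set \<Rightarrow> 'n pt) \<Rightarrow> ('n pt \<Rightarrow> 'n pt) \<Rightarrow> real" where
  "vint \<omega> \<mu> z = (\<Sum>i\<in>UNIV. sint \<omega> (\<lambda>A. \<mu> A $ i) (\<lambda>x. z x $ i))"

definition C0 :: "('n::finite) pt set \<Rightarrow> ('n pt \<Rightarrow> 'n pt) \<Rightarrow> bool" where
  "C0 \<omega> z \<longleftrightarrow> continuous_on (closure \<omega>) z \<and> (\<forall>x\<in>frontier \<omega>. z x = 0)"

definition mnorm :: "('n::finite pt \<Rightarrow> real) \<Rightarrow> 'n pt set \<Rightarrow> ('n pt set \<Rightarrow> 'n pt) \<Rightarrow> real" where
  "mnorm N \<omega> \<mu> = Sup {vint \<omega> \<mu> z | z. C0 \<omega> z \<and> (\<forall>x\<in>closure \<omega>. N (z x) \<le> 1)}"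

definition is_Dgrad :: "('n::finite) pt set \<Rightarrow> ('n pt \<Rightarrow> real) \<Rightarrow> ('n pt set \<Rightarrow> 'n pt) \<Rightarrow> bool" where
  "is_Dgrad \<omega> u \<mu> \<longleftrightarrow> vmeasure \<omega> \<mu> \<and> (\<forall>\<psi>. test_fun \<omega> \<psi> \<longrightarrow> (\<forall>i.
      (LINT x|lebesgue_on \<omega>. u x * partial i \<psi> x) = - sint \<omega> (\<lambda>A. \<mu> A $ i) \<psi>))"

definition BV :: "('n::finite) pt set \<Rightarrow> ('n pt \<Rightarrow> real) \<Rightarrow> bool" where
  "BV \<omega> u \<longleftrightarrow> Lp 1 \<omega> u \<and> (\<exists>\<mu>. is_Dgrad \<omega> u \<mu>)"

definition Dgrad :: "('n::finite) pt set \<Rightarrow> ('n pt \<Rightarrow> real) \<Rightarrow> ('n pt set \<Rightarrow> 'n pt)" where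
  "Dgrad \<omega> u = (THE \<mu>. is_Dgrad \<omega> u \<mu>)"

definition bvl2_norm :: "('n::finite pt \<Rightarrow> real) \<Rightarrow> 'n pt set \<Rightarrow> ('n pt \<Rightarrow> real) \<Rightarrow> real" where
  "bvl2_norm N \<omega> u = (LINT x|lebesgue_on \<omega>. \<bar>u x\<bar>) + mnorm N \<omega> (Dgrad \<omega> u)
      + sqrt (LINT x|lebesgue_on \<omega>. (u x)\<^sup>2)"

definition Jcost :: "('n::finite) pt set \<Rightarrow> 'n pt set \<Rightarrow> ('n pt \<Rightarrow> real \<Rightarrow> real) \<Rightarrow> ('n pt \<Rightarrow> real)
    \<Rightarrow> ('n pt \<Rightarrow> real) \<Rightarrow> real \<Rightarrow> real \<Rightarrow> real \<Rightarrow> ('n pt \<Rightarrow> real) \<Rightarrow> real" where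
  "Jcost \<Omega> \<omega> f yd N \<alpha> \<beta> \<gamma> u =
     1/2 * (LINT x|lebesgue_on \<Omega>. (state \<Omega> \<omega> f u x - yd x)\<^sup>2)
     + \<alpha> * mnorm N \<omega> (Dgrad \<omega> u)
     + \<beta>/2 * (LINT x|lebesgue_on \<omega>. u x)\<^sup>2
     + \<gamma>/2 * (LINT x|lebesgue_on \<omega>. (u x)\<^sup>2)"

definition local_solution :: "('n::finite) pt set \<Rightarrow> 'n pt set \<Rightarrow> ('n pt \<Rightarrow> real \<Rightarrow> real) \<Rightarrow> ('n pt \<Rightarrow> real)
    \<Rightarrow> ('n pt \<Rightarrow> real) \<Rightarrow> real \<Rightarrow> real \<Rightarrow> real \<Rightarrow> ('n pt \<Rightarrow> real) \<Rightarrow> bool" where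
  "local_solution \<Omega> \<omega> f yd N \<alpha> \<beta> \<gamma> ub \<longleftrightarrow> BV \<omega> ub \<and> Lp 2 \<omega> ub \<and>
     (\<exists>\<epsilon>>0. \<forall>u. BV \<omega> u \<and> Lp 2 \<omega> u \<and> bvl2_norm N \<omega> (\<lambda>x. u x - ub x) < \<epsilon> \<longrightarrow>
        Jcost \<Omega> \<omega> f yd N \<alpha> \<beta> \<gamma> ub \<le> Jcost \<Omega> \<omega> f yd N \<alpha> \<beta> \<gamma> u)"

definition mdual :: "('n::finite pt \<Rightarrow> real) \<Rightarrow> 'n pt set \<Rightarrow> (('n pt set \<Rightarrow> 'n pt) \<Rightarrow> real) \<Rightarrow> bool" where
  "mdual N \<omega> \<Lambda> \<longleftrightarrow>
     (\<forall>\<mu> \<nu> a b. vmeasure \<omega> \<mu> \<longrightarrow> vmeasure \<omega> \<nu> \<longrightarrow>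
        \<Lambda> (\<lambda>A. a *\<^sub>R \<mu> A + b *\<^sub>R \<nu> A) = a * \<Lambda> \<mu> + b * \<Lambda> \<nu>) \<and>
     (\<exists>C. \<forall>\<mu>. vmeasure \<omega> \<mu> \<longrightarrow> \<bar>\<Lambda> \<mu>\<bar> \<le> C * mnorm N \<omega> \<mu>)"

definition subdiff_g :: "('n::finite pt \<Rightarrow> real) \<Rightarrow> 'n pt set \<Rightarrow> ('n pt set \<Rightarrow> 'n pt)
    \<Rightarrow> (('n pt set \<Rightarrow> 'n pt) \<Rightarrow> real) set" where
  "subdiff_g N \<omega> \<mu>0 = {\<Lambda>. mdual N \<omega> \<Lambda> \<and>
     (\<forall>\<mu>. vmeasure \<omega> \<mu> \<longrightarrow> mnorm N \<omega> \<mu>0 + \<Lambda> (\<lambda>A. \<mu> A - \<mu>0 A) \<le> mnorm N \<omega> \<mu>)}"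

end

theory Submission
 imports Defs "HOL-Library.Function_Algebras"
begin

text \<open>
 The reduced cost is \<open>F(u) + \<alpha> g(\<nabla>u)\<close> with \<open>F\<close> differentiable along lines and \<open>g\<close> convex. Local optimality of \<open>u\<close>
 therefore gives \<open>- F'(u)v / \<alpha> \<le> g(\<nabla>u + \<nabla>v) - g(\<nabla>u)\<close> for all \<open>v\<close>. In particular the left-hand side depends on \<open>\<nabla>v\<close>
 only; it is a linear functional on the space of gradients, below the convex function \<open>\<mu> \<mapsto> g(\<nabla>u + \<mu>) - g(\<nabla>u)\<close>, and
 by the Hahn-Banach theorem it extends below this function to all vector measures. The extension is the multiplier.

 State and adjoint state are defined by definite descriptions, so the formula for \<open>F'\<close> needs existence and uniqueness
 of solutions that are continuous up to the boundary. Weak solutions come from a minimisation and a contraction, and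
 everything pointwise from the comparison principle: barriers at the vertices of exterior cones control the boundary
 values, translates of a solution control its modulus of continuity, and a regularised fundamental solution bounds
 the solution by the \<open>L\<^sup>p\<close> norm of the right-hand side for \<open>p > n/2\<close>.
\<close>

text \<open>Local optimality concerns small v only. The inequality for all v comes from convexity:
  for 0 < t < 1 the increment of g along t \<nabla>v is at most t times its increment along
  \<nabla>v, so that one may divide by t and let t tend to 0. Inserting v and - v with \<nabla>v = 0
  gives F'(u)v = 0; this makes the functional well defined on gradients, although nothing is known
  about the components of \<omega> or about the range of the gradient map. The extension is bounded
  because the increment is at most g itself.

  Two levels of integrability shape the treatment of the equations. Controls lie in
  \<open>L\<^sup>2\<close>, and 2 > n/2 since n is 2 or 3; but f(., 0) lies only in some
  \<open>L\<^sup>p\<close> with p > n/2 and may fail to be square integrable. Its share of the state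
  is obtained as a limit of solutions for bounded data, and the remainder solves a monotone equation
  in \<open>L\<^sup>2\<close>, truncated at a level that the solution turns out not to
  reach.\<close>

abbreviation (input) lb :: "'a::euclidean_space measure" where "lb \<equiv> lebesgue"

abbreviation (input) bml :: "('a::euclidean_space => 'b::euclidean_space) set" where "bml \<equiv> borel_measurable lb"

abbreviation (input) lint :: "('a::euclidean_space => 'b::euclidean_space) => 'b" (binder "LB " 10) where
 "lint f \<equiv> integral\<^sup>L lebesgue f"

abbreviation (input) tends_seq :: "(nat => 'a::topological_space) => 'a => bool" ("((_)/ ----> (_))" [60, 60] 60) where
 "X ----> L \<equiv> X \<longlonglongrightarrow> L"

lemmas int_cong = Bochner_Integration.integral_cong and int_bound = Bochner_Integration.integrable_bound
 and int_diff = Bochner_Integration.integrable_diff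

section \<open>Square integrable functions\<close>

text \<open>The Euclidean range lets one predicate serve functions and their gradients. Elements are
  functions and not classes, because continuous representatives are singled out later.\<close>

definition l2 :: "'a measure => ('a => 'b::euclidean_space) => bool" where
 "l2 M f \<longleftrightarrow> f : borel_measurable M \<and> integrable M (%x. (norm (f x))\<^sup>2)"

definition l2n :: "'a measure => ('a => 'b::euclidean_space) => real" where
 "l2n M f = sqrt (LINT x|M. (norm (f x))\<^sup>2)"

definition l2lim :: "'a measure => (nat => 'a => 'b::euclidean_space) => ('a => 'b) => bool" where
 "l2lim M fs f \<longleftrightarrow> (\<forall>k. l2 M (fs k)) \<and> l2 M f \<and> (%k. l2n M (%x. fs k x - f x)) ----> 0"

lemma l2_measurable [measurable_dest]: "l2 M f ==> f : borel_measurable M"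
 and l2_integrable_sq: "l2 M f ==> integrable M (%x. (norm (f x))\<^sup>2)"
 by (auto simp: l2_def)

lemma l2_cong_AE:
 assumes "l2 M f" "g : borel_measurable M" "AE x in M. f x = g x"
 shows "l2 M g"
proof -
 have "integrable M (%x. (norm (g x))\<^sup>2) = integrable M (%x. (norm (f x))\<^sup>2)"
  using assms by (intro integrable_cong_AE) (auto simp: l2_def)
 then show ?thesis using assms by (simp add: l2_def)
qed

lemma l2n_cong_AE:
 assumes [measurable]: "f : borel_measurable M" "g : borel_measurable M" and "AE x in M. f x = g x"
 shows "l2n M f = l2n M g"
 unfolding l2n_def using assms(3) by (subst integral_cong_AE[where g="%x. (norm (g x))\<^sup>2"]) auto

lemma l2n_nonneg [simp]: "l2n M f >= 0"
 by (simp add: l2n_def)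

lemma l2n_sq: "(l2n M f)\<^sup>2 = (LINT x|M. (norm (f x))\<^sup>2)"
 by (simp add: l2n_def)

lemma l2_bound:
 assumes "l2 M g" "f : borel_measurable M" "AE x in M. norm (f x) <= norm (g x)"
 shows "l2 M f" "l2n M f <= l2n M g"
proof -
 have *: "AE x in M. (norm (f x))\<^sup>2 <= (norm (g x))\<^sup>2"
  using assms(3) by eventually_elim (simp add: power_mono)
 have i: "integrable M (%x. (norm (f x))\<^sup>2)"
  by (rule int_bound[OF l2_integrable_sq[OF assms(1)]])
   (use assms * in \<open>auto simp: l2_def\<close>)
 then show "l2 M f" using assms by (simp add: l2_def)
 show "l2n M f <= l2n M g"
  unfolding l2n_def using i assms * by (intro real_sqrt_le_mono integral_mono_AE) (auto simp: l2_def)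
qed

lemma l2_zero [simp]: "l2 M (%x. 0)"
 by (simp add: l2_def)

lemma l2_scaleR: "l2 M f ==> l2 M (%x. c *\<^sub>R f x)"
 by (auto simp: l2_def power_mult_distrib)

lemma l2_add: assumes "l2 M f" "l2 M g" shows "l2 M (%x. f x + g x)"
proof -
 have [measurable]: "f : borel_measurable M" "g : borel_measurable M" using assms by (auto simp: l2_def)
 have b: "(norm (f x + g x))\<^sup>2 <= 2 * (norm (f x))\<^sup>2 + 2 * (norm (g x))\<^sup>2" for x
 proof -
  have "(norm (f x + g x))\<^sup>2 <= (norm (f x) + norm (g x))\<^sup>2"
   by (intro power_mono norm_triangle_ineq) auto
  also have "... <= 2 * (norm (f x))\<^sup>2 + 2 * (norm (g x))\<^sup>2"
   using zero_le_power2[of "norm (f x) - norm (g x)"] by (simp add: power2_eq_square algebra_simps)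
  finally show ?thesis .
 qed
 have "integrable M (%x. 2 * (norm (f x))\<^sup>2 + 2 * (norm (g x))\<^sup>2)"
  using assms by (auto simp: l2_def)
 then have "integrable M (%x. (norm (f x + g x))\<^sup>2)"
  by (rule int_bound) (use b in \<open>auto intro!: AE_I2\<close>)
 then show ?thesis by (simp add: l2_def)
qed

lemma l2_diff: "l2 M f ==> l2 M g ==> l2 M (%x. f x - g x)"
 using l2_add[of M f "%x. - 1 *\<^sub>R g x"] l2_scaleR[of M g "-1"] by simp

lemma l2n_scaleR: "l2n M (%x. c *\<^sub>R f x) = \<bar>c\<bar> * l2n M f"
 by (simp add: l2n_def power_mult_distrib real_sqrt_mult)

lemma l2n_minus_commute: "l2n M (%x. f x - g x) = l2n M (%x. g x - f x)"
 by (simp add: l2n_def norm_minus_commute)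

lemma l2_inner_integrable: assumes "l2 M f" "l2 M g" shows "integrable M (%x. f x \<bullet> g x)"
proof -
 have [measurable]: "f : borel_measurable M" "g : borel_measurable M" using assms by (auto simp: l2_def)
 have "integrable M (%x. (norm (f x))\<^sup>2 + (norm (g x))\<^sup>2)"
  using assms by (auto simp: l2_def)
 then show ?thesis
 proof (rule int_bound)
  have "norm (f x \<bullet> g x) <= norm ((norm (f x))\<^sup>2 + (norm (g x))\<^sup>2)" for x
  proof -
   have "\<bar>f x \<bullet> g x\<bar> <= norm (f x) * norm (g x)" by (rule Cauchy_Schwarz_ineq2)
   also have "... <= (norm (f x))\<^sup>2 + (norm (g x))\<^sup>2"
    using zero_le_power2[of "norm (f x) - norm (g x)"] zero_le_power2[of "norm (f x)"] zero_le_power2[of "norm (g x)"]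
    unfolding power2_diff by linarith
   finally show ?thesis by simp
  qed
  then show "AE x in M. norm (f x \<bullet> g x) <= norm ((norm (f x))\<^sup>2 + (norm (g x))\<^sup>2)" by simp
 qed simp
qed

text \<open>The quadratic polynomial in t behind the Cauchy-Schwarz inequality, and later behind the
  variation of the energy in \<open>linear_solver\<close>.\<close>

lemma l2_inner_sq:
 assumes "l2 M f" "l2 M g"
 shows "(l2n M (%x. f x + t *\<^sub>R g x))\<^sup>2 = (l2n M f)\<^sup>2 + 2 * t * (LINT x|M. f x \<bullet> g x) + t\<^sup>2 * (l2n M g)\<^sup>2"
proof -
 have "(l2n M (%x. f x + t *\<^sub>R g x))\<^sup>2 = (LINT x|M. (norm (f x))\<^sup>2 + (2 * t * (f x \<bullet> g x) + t\<^sup>2 * (norm (g x))\<^sup>2))"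
  unfolding l2n_sq power2_norm_eq_inner by (intro int_cong refl)
   (simp add: inner_add_left inner_add_right inner_commute power2_eq_square[of t] algebra_simps)
 also have "... = (l2n M f)\<^sup>2 + (2 * t * (LINT x|M. f x \<bullet> g x) + t\<^sup>2 * (l2n M g)\<^sup>2)"
  unfolding l2n_sq using assms l2_inner_integrable[OF assms]
  by (simp add: l2_integrable_sq)
 finally show ?thesis by simp
qed

lemma l2_Cauchy_Schwarz:
 assumes "l2 M f" "l2 M g"
 shows "\<bar>LINT x|M. f x \<bullet> g x\<bar> <= l2n M f * l2n M g"
proof -
 let ?a = "l2n M f" and ?b = "l2n M g" and ?i = "LINT x|M. f x \<bullet> g x"
 have q: "?a\<^sup>2 + 2 * t * ?i + t\<^sup>2 * ?b\<^sup>2 >= 0" for t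
  using l2_inner_sq[OF assms, of t] by (metis zero_le_power2)
 have "?i\<^sup>2 <= ?a\<^sup>2 * ?b\<^sup>2"
 proof (cases "?b = 0")
  case True
  have "?i = 0"
  proof (rule ccontr)
   assume "?i \<noteq> 0"
   \<comment> \<open>For \<open>l2n M g = 0\<close> the polynomial is affine in t; at this t its
     value is -1.\<close>
   then have "2 * (- (?a\<^sup>2 + 1) / (2 * ?i)) * ?i = - (?a\<^sup>2 + 1)" by simp
   then show False using q[of "- (?a\<^sup>2 + 1) / (2 * ?i)"] True by simp
  qed
  then show ?thesis by simp
 next
  case False
  then have "?a\<^sup>2 - ?i\<^sup>2 / ?b\<^sup>2 >= 0"
   using q[of "- ?i / ?b\<^sup>2"] by (simp add: power2_eq_square field_simps)
  then show ?thesis using False by (simp add: field_simps)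
 qed
 then have "\<bar>?i\<bar>\<^sup>2 <= (?a * ?b)\<^sup>2" by (simp add: power_mult_distrib)
 then show ?thesis by (rule power2_le_imp_le) simp
qed

lemma l2n_triangle:
 assumes "l2 M f" "l2 M g"
 shows "l2n M (%x. f x + g x) <= l2n M f + l2n M g"
proof (rule power2_le_imp_le)
 have "(l2n M (%x. f x + g x))\<^sup>2 = (l2n M f)\<^sup>2 + 2 * (LINT x|M. f x \<bullet> g x) + (l2n M g)\<^sup>2"
  using l2_inner_sq[OF assms, of 1] by simp
 also have "... <= (l2n M f + l2n M g)\<^sup>2"
  using l2_Cauchy_Schwarz[OF assms] by (simp add: power2_sum)
 finally show "(l2n M (%x. f x + g x))\<^sup>2 <= (l2n M f + l2n M g)\<^sup>2" .
qed simp

lemma l2n_triangle3: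
 assumes "l2 M f" "l2 M g" "l2 M h"
 shows "l2n M (%x. f x - h x) <= l2n M (%x. f x - g x) + l2n M (%x. g x - h x)"
 using l2n_triangle[OF l2_diff[OF assms(1,2)] l2_diff[OF assms(2,3)]] by simp

lemma l2n_eq_0: assumes "l2 M f" "l2n M f = 0" shows "AE x in M. f x = 0"
proof -
 have "(LINT x|M. (norm (f x))\<^sup>2) = 0" using assms(2) by (simp add: l2n_def)
 then have "AE x in M. (norm (f x))\<^sup>2 = 0"
  using integral_nonneg_eq_0_iff_AE[OF l2_integrable_sq[OF assms(1)]] by simp
 then show ?thesis by eventually_elim simp
qed

lemma l2limD:
 assumes "l2lim M fs f"
 shows "l2 M (fs k)" "l2 M f" "(%k. l2n M (%x. fs k x - f x)) ----> 0"
 using assms by (auto simp: l2lim_def)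

lemma l2limI_le:
 assumes "!!k. l2 M (fs k)" "l2 M f" "!!k. l2n M (%x. fs k x - f x) <= e k" "e ----> 0"
 shows "l2lim M fs f"
 unfolding l2lim_def using assms
 by (auto intro!: tendsto_sandwich[OF _ _ tendsto_const assms(4)] always_eventually)

lemma l2lim_const: "l2 M f ==> l2lim M (%k. f) f"
 by (simp add: l2lim_def l2n_def)

lemma l2lim_add:
 assumes "l2lim M fs f" "l2lim M gs g"
 shows "l2lim M (%k x. fs k x + gs k x) (%x. f x + g x)"
proof (rule l2limI_le)
 note D = l2limD[OF assms(1)] l2limD[OF assms(2)]
 show "l2n M (%x. fs k x + gs k x - (f x + g x)) <= l2n M (%x. fs k x - f x) + l2n M (%x. gs k x - g x)" for k
  using l2n_triangle[OF l2_diff[OF D(1,2)] l2_diff[OF D(4,5)], of k k] by (simp add: algebra_simps)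
 show "(%k. l2n M (%x. fs k x - f x) + l2n M (%x. gs k x - g x)) ----> 0"
  using tendsto_add[OF D(3,6)] by simp
qed (use l2limD[OF assms(1)] l2limD[OF assms(2)] in \<open>auto intro: l2_add\<close>)

lemma l2lim_scaleR:
 assumes "l2lim M fs f"
 shows "l2lim M (%k x. c *\<^sub>R fs k x) (%x. c *\<^sub>R f x)"
proof (rule l2limI_le)
 note D = l2limD[OF assms(1)]
 show "l2n M (%x. c *\<^sub>R fs k x - c *\<^sub>R f x) <= \<bar>c\<bar> * l2n M (%x. fs k x - f x)" for k
  using l2n_scaleR[of M c "%x. fs k x - f x"] by (simp add: algebra_simps)
 show "(%k. \<bar>c\<bar> * l2n M (%x. fs k x - f x)) ----> 0"
  using tendsto_mult[OF tendsto_const D(3)] by auto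
qed (use l2limD[OF assms(1)] in \<open>auto intro: l2_scaleR\<close>)

lemma l2lim_diff:
 assumes "l2lim M fs f" "l2lim M gs g"
 shows "l2lim M (%k x. fs k x - gs k x) (%x. f x - g x)"
 using l2lim_add[OF assms(1) l2lim_scaleR[OF assms(2), of "-1"]] by simp

lemma l2lim_cong_AE:
 assumes "l2lim M fs f" "g : borel_measurable M" "AE x in M. f x = g x"
 shows "l2lim M fs g"
proof -
 note D = l2limD[OF assms(1)]
 have "l2 M g" using l2_cong_AE[OF D(2) assms(2,3)] .
 moreover have "l2n M (%x. fs k x - f x) = l2n M (%x. fs k x - g x)" for k
  using l2_diff[OF D(1,2)] l2_diff[OF D(1) \<open>l2 M g\<close>] assms(3)
  by (intro l2n_cong_AE) (auto simp: l2_def)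
 ultimately show ?thesis using D by (simp add: l2lim_def)
qed

lemma l2lim_subseq: "l2lim M fs f ==> strict_mono r ==> l2lim M (%k. fs (r k)) f"
 unfolding l2lim_def by (auto dest: LIMSEQ_subseq_LIMSEQ simp: comp_def)

lemma l2lim_bounded:
 assumes "l2lim M fs f" shows "\<exists>C. \<forall>k. l2n M (fs k) <= C"
proof -
 note D = l2limD[OF assms]
 obtain B where B: "!!k. norm (l2n M (%x. fs k x - f x)) <= B"
  using convergent_imp_Bseq[OF convergentI[OF D(3)]] by (auto simp: Bseq_def)
 have "l2n M (fs k) <= B + l2n M f" for k
  using l2n_triangle[OF l2_diff[OF D(1,2)] D(2), of k] B[of k] by simp
 then show ?thesis by blast
qed

lemma l2lim_inner:
 assumes "l2lim M fs f" "l2lim M gs g"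
 shows "(%k. LINT x|M. fs k x \<bullet> gs k x) ----> (LINT x|M. f x \<bullet> g x)"
proof -
 note D = l2limD[OF assms(1)] l2limD[OF assms(2)]
 obtain C where C: "!!k. l2n M (gs k) <= C" using l2lim_bounded[OF assms(2)] by blast
 have b: "norm ((LINT x|M. fs k x \<bullet> gs k x) - (LINT x|M. f x \<bullet> g x))
   <= l2n M (%x. fs k x - f x) * C + l2n M f * l2n M (%x. gs k x - g x)" for k
 proof -
  have "(LINT x|M. fs k x \<bullet> gs k x) - (LINT x|M. f x \<bullet> g x) =
    (LINT x|M. (fs k x - f x) \<bullet> gs k x) + (LINT x|M. f x \<bullet> (gs k x - g x))"
   by (simp add: inner_diff_left inner_diff_right l2_inner_integrable D)
  also have "norm ... <= l2n M (%x. fs k x - f x) * l2n M (gs k) + l2n M f * l2n M (%x. gs k x - g x)"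
   using l2_Cauchy_Schwarz[OF l2_diff[OF D(1,2)] D(4), of k k] l2_Cauchy_Schwarz[OF D(2) l2_diff[OF D(4,5)], of k]
   by simp
  also have "... <= l2n M (%x. fs k x - f x) * C + l2n M f * l2n M (%x. gs k x - g x)"
   using C by (intro add_right_mono mult_left_mono) auto
  finally show ?thesis .
 qed
 have "(%k. l2n M (%x. fs k x - f x) * C + l2n M f * l2n M (%x. gs k x - g x)) ----> 0 * C + l2n M f * 0"
  by (intro tendsto_intros D)
 then have "(%k. (LINT x|M. fs k x \<bullet> gs k x) - (LINT x|M. f x \<bullet> g x)) ----> 0"
  using Lim_null_comparison[OF always_eventually[OF allI[OF b]]] by simp
 then show ?thesis by (rule Lim_null[THEN iffD2])
qed

lemma l2lim_AE_subseq:
 assumes "l2lim M fs f"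
 obtains r where "strict_mono (r::nat=>nat)" "AE x in M. (%k. fs (r k) x) ----> f x"
proof -
 note D = l2limD[OF assms]
 have "\<exists>r::nat=>nat. strict_mono r \<and> (AE x in M. (%n. (norm (fs (r n) x - f x))\<^sup>2) ----> 0)"
 proof (rule tendsto_L1_AE_subseq[where u="%k x. (norm (fs k x - f x))\<^sup>2"])
  show "(%n. LINT x|M. norm ((norm (fs n x - f x))\<^sup>2)) ----> 0"
   using tendsto_power[OF D(3), of 2] by (simp add: l2n_sq)
 qed (use l2_diff[OF D(1,2)] in \<open>auto simp: l2_def\<close>)
 then obtain r where r: "strict_mono (r::nat=>nat)" "AE x in M. (%n. (norm (fs (r n) x - f x))\<^sup>2) ----> 0" by blast
 have "AE x in M. (%k. fs (r k) x) ----> f x"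
  using r(2)
 proof eventually_elim
  case (elim x)
  then have "(%n. norm (fs (r n) x - f x)) ----> 0"
   using tendsto_real_sqrt[OF elim] by simp
  then show ?case by (simp add: tendsto_norm_zero_iff Lim_null[symmetric])
 qed
 then show ?thesis using that r(1) by blast
qed

lemma l2lim_dominated:
 fixes fs :: "nat => 'a => 'b::euclidean_space"
 assumes fm: "!!k. fs k : borel_measurable M" "f : borel_measurable M" and w: "l2 M (w::'a => 'c::euclidean_space)"
  and b: "!!k. AE x in M. norm (fs k x) <= norm (w x)" and c: "AE x in M. (%k. fs k x) ----> f x"
 shows "l2lim M fs f"
proof -
 have [measurable]: "w : borel_measurable M" and [measurable]: "!!k. fs k : borel_measurable M" "f : borel_measurable M"
  using w fm by (auto simp: l2_def)
 have ba: "AE x in M. \<forall>k. norm (fs k x) <= norm (w x)" using b by (simp add: AE_all_countable)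
 have bf: "AE x in M. norm (f x) <= norm (w x)"
  using ba c by eventually_elim (auto intro: LIMSEQ_le_const2[OF tendsto_norm])
 have l: "!!k. l2 M (fs k)" "l2 M f" using l2_bound(1)[OF w fm(1) b] l2_bound(1)[OF w fm(2) bf] by auto
 have "(%k. LINT x|M. (norm (fs k x - f x))\<^sup>2) ----> (LINT x|M. 0)"
 proof (rule integral_dominated_convergence[where w="%x. 4 * (norm (w x))\<^sup>2"])
  show "AE x in M. (%k. (norm (fs k x - f x))\<^sup>2) ----> 0"
   using c
  proof eventually_elim
   case (elim x)
   have "(%k. (norm (fs k x - f x))\<^sup>2) ----> (norm (f x - f x))\<^sup>2" by (intro tendsto_intros elim)
   then show ?case by simp
  qed
  show "AE x in M. norm ((norm (fs k x - f x))\<^sup>2) <= 4 * (norm (w x))\<^sup>2" for k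
   using b[of k] bf
  proof eventually_elim
   case (elim x)
   have "norm (fs k x - f x) <= 2 * norm (w x)"
    using elim norm_triangle_ineq4[of "fs k x" "f x"] by linarith
   then have "(norm (fs k x - f x))\<^sup>2 <= (2 * norm (w x))\<^sup>2" by (rule power_mono) simp
   then show ?case by (simp add: power_mult_distrib)
  qed
  show "integrable M (%x. 4 * (norm (w x))\<^sup>2)" using w by (simp add: l2_def)
 qed measurable
 then have "(%k. l2n M (%x. fs k x - f x)) ----> sqrt (LINT x|M. 0)"
  unfolding l2n_def by (intro tendsto_real_sqrt)
 then show ?thesis using l by (simp add: l2lim_def)
qed

lemma l2_mult_bounded:
 assumes "l2 M f" "g : borel_measurable M" "AE x in M. \<bar>g x\<bar> <= C"
 shows "l2 M (%x. g x *\<^sub>R f x)" "l2n M (%x. g x *\<^sub>R f x) <= \<bar>C\<bar> * l2n M f"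
proof -
 have b: "AE x in M. norm (g x *\<^sub>R f x) <= norm (C *\<^sub>R f x)"
  using assms(3) by eventually_elim (auto intro!: mult_right_mono)
 have m: "(%x. g x *\<^sub>R f x) : borel_measurable M" using assms by (auto simp: l2_def)
 show "l2 M (%x. g x *\<^sub>R f x)" by (rule l2_bound(1)[OF l2_scaleR[OF assms(1)] m b])
 show "l2n M (%x. g x *\<^sub>R f x) <= \<bar>C\<bar> * l2n M f"
  using l2_bound(2)[OF l2_scaleR[OF assms(1)] m b] by (simp add: l2n_scaleR)
qed

text \<open>Split \<open>gs k * fs k\<close> into \<open>gs k * (fs k - f)\<close>, small because
  the factors are bounded, and \<open>gs k * f\<close>, to which dominated convergence applies.
  Convergence almost everywhere of the bounded factors is therefore enough.\<close>

lemma l2lim_mult_bounded: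
 assumes fs: "l2lim M fs f" and gm: "!!k. gs k : borel_measurable M" "g : borel_measurable M"
  and gb: "!!k. AE x in M. \<bar>gs k x\<bar> <= C" and gc: "AE x in M. (%k. gs k x) ----> g x"
 shows "l2lim M (%k x. gs k x *\<^sub>R fs k x) (%x. g x *\<^sub>R f x)"
proof -
 note D = l2limD[OF fs]
 have [measurable]: "!!k. gs k : borel_measurable M" "g : borel_measurable M" "f : borel_measurable M"
  using gm D by (auto simp: l2_def)
 have 1: "l2lim M (%k x. gs k x *\<^sub>R f x) (%x. g x *\<^sub>R f x)"
 proof (rule l2lim_dominated[OF _ _ l2_scaleR[OF D(2), of C]])
  show "AE x in M. norm (gs k x *\<^sub>R f x) <= norm (C *\<^sub>R f x)" for k
   using gb[of k] by eventually_elim (auto intro!: mult_right_mono)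
  show "AE x in M. (%k. gs k x *\<^sub>R f x) ----> g x *\<^sub>R f x"
   using gc by eventually_elim (auto intro!: tendsto_intros)
 qed auto
 have 2: "l2lim M (%k x. gs k x *\<^sub>R (fs k x - f x)) (%x. 0)"
 proof (rule l2limI_le)
  show "l2 M (%x. gs k x *\<^sub>R (fs k x - f x))" for k
   by (rule l2_mult_bounded(1)[OF l2_diff[OF D(1,2)] gm(1) gb])
  show "l2n M (%x. gs k x *\<^sub>R (fs k x - f x) - 0) <= \<bar>C\<bar> * l2n M (%x. fs k x - f x)" for k
   using l2_mult_bounded(2)[OF l2_diff[OF D(1,2)] gm(1) gb, of k k] by simp
  show "(%k. \<bar>C\<bar> * l2n M (%x. fs k x - f x)) ----> 0"
   using tendsto_mult[OF tendsto_const D(3)] by auto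
 qed simp
 show ?thesis using l2lim_add[OF 2 1] by (simp add: algebra_simps)
qed

lemma l2lim_mult_const:
 assumes "l2lim M fs f" "g : borel_measurable M" "AE x in M. \<bar>g x\<bar> <= C"
 shows "l2lim M (%k x. g x *\<^sub>R fs k x) (%x. g x *\<^sub>R f x)"
 by (rule l2lim_mult_bounded[OF assms(1)]) (use assms in auto)

text \<open>The theorem of Riesz and Fischer, by a subsequence with increments below
  \<open>(1/4)^m\<close>, which converges almost everywhere.\<close>

lemma l2_complete:
 fixes fs :: "nat => 'a => 'b::euclidean_space"
 assumes l: "!!k. l2 M (fs k)"
  and C: "!!e. e > 0 ==> \<exists>K. \<forall>i\<ge>K. \<forall>j\<ge>K. l2n M (%x. fs i x - fs j x) < e"
 obtains f where "l2lim M fs f"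
proof -
 have [measurable]: "!!k. fs k : borel_measurable M" using l by (auto simp: l2_def)
 have "\<forall>m. \<exists>K. \<forall>i\<ge>K. \<forall>j\<ge>K. l2n M (%x. fs i x - fs j x) < (1/4)^m"
  using C by simp
 then obtain K where K: "!!m i j. i >= K m ==> j >= K m ==> l2n M (%x. fs i x - fs j x) < (1/4)^m"
  by metis
 define r where "r = rec_nat (K 0) (%m s. max (Suc s) (K (Suc m)))"
 have rS: "r (Suc m) > r m" "r m >= K m" for m
  by (simp_all add: r_def, cases m, auto)
 have rm: "strict_mono r" using rS by (simp add: strict_mono_Suc_iff)
 have rd: "l2n M (%x. fs (r (Suc m)) x - fs (r m) x) < (1/4)^m" for m
  using K[of m "r (Suc m)" "r m"] rS(1)[of m] rS(2)[of m] by simp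
 \<comment> \<open>the increments, inflated by the factor \<open>2 ^ m\<close>, still have summable squares\<close>
 let ?d = "%m x. (norm (2^m *\<^sub>R (fs (r (Suc m)) x - fs (r m) x)))\<^sup>2"
 have dl: "l2 M (%x. 2^m *\<^sub>R (fs (r (Suc m)) x - fs (r m) x))" for m
  by (intro l2_scaleR l2_diff l)
 have "(LINT x|M. ?d m x) <= (1/4)^m" for m
 proof -
  have "(LINT x|M. ?d m x) = (2^m * l2n M (%x. fs (r (Suc m)) x - fs (r m) x))\<^sup>2"
   unfolding l2n_sq[symmetric] by (simp add: l2n_scaleR)
  also have "... <= (2^m * (1/4)^m)\<^sup>2"
   using rd[of m] by (intro power_mono mult_left_mono) auto
  also have "... = (1/4)^m"
   by (simp add: power2_eq_square power_mult_distrib[symmetric])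
  finally show ?thesis .
 qed
 then have s: "summable (%m. LINT x|M. norm (?d m x))"
  by (intro summable_comparison_test[OF _ summable_geometric[of "1/4::real"]]) (auto intro!: exI[of _ 0])
 have "(\<integral>\<^sup>+x. (\<Sum>m. ennreal (?d m x)) \<partial>M) = (\<Sum>m. \<integral>\<^sup>+x. ennreal (?d m x) \<partial>M)"
  by (rule nn_integral_suminf) measurable
 also have "... = (\<Sum>m. ennreal (LINT x|M. ?d m x))"
  using l2_integrable_sq[OF dl] by (intro suminf_cong nn_integral_eq_integral) auto
 also have "... \<noteq> \<infinity>"
  using s by (subst suminf_ennreal2) (auto simp: integral_nonneg_AE)
 finally have "AE x in M. (\<Sum>m. ennreal (?d m x)) \<noteq> \<infinity>"
  by (intro nn_integral_PInf_AE) measurable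
 then have cv: "AE x in M. convergent (%k. fs (r k) x)"
 proof eventually_elim
  case (elim x)
  have "summable (%m. ?d m x)"
   using elim by (intro summable_suminf_not_top) auto
  then have "(%m. ?d m x) ----> 0" by (rule summable_LIMSEQ_zero)
  then have "eventually (%m. ?d m x < 1) sequentially" by (rule order_tendstoD) simp
  then obtain m0 where m0: "!!m. m >= m0 ==> ?d m x < 1" by (auto simp: eventually_sequentially)
  have "norm (fs (r (Suc m)) x - fs (r m) x) <= (1/2)^m" if "m >= m0" for m
  proof -
   have "norm (2^m *\<^sub>R (fs (r (Suc m)) x - fs (r m) x)) <= 1"
    using less_imp_le[OF m0[OF that]] by (simp only: abs_square_le_1 abs_norm_cancel)
   then have "norm (fs (r (Suc m)) x - fs (r m) x) * 2^m <= 1" by (simp add: mult.commute)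
   then show ?thesis by (simp add: pos_le_divide_eq power_divide)
  qed
  then have "summable (%m. fs (r (Suc m)) x - fs (r m) x)"
   by (intro summable_comparison_test[OF _ summable_geometric[of "1/2::real"]]) (auto intro!: exI[of _ m0])
  then have "convergent (%n. \<Sum>m<n. fs (r (Suc m)) x - fs (r m) x)"
   by (simp add: summable_iff_convergent)
  then have "convergent (%n. fs (r n) x - fs (r 0) x)" by (simp only: sum_lessThan_telescope[of "%m. fs (r m) x"])
  then obtain a where "(%n. fs (r n) x - fs (r 0) x) ----> a" by (auto simp: convergent_def)
  from tendsto_add[OF this tendsto_const[of "fs (r 0) x"]]
  show ?case by (auto simp: convergent_def)
 qed
 define f where "f x = lim (%k. fs (r k) x)" for x
 have [measurable]: "f : borel_measurable M"
  unfolding f_def by measurable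
 have fc: "AE x in M. (%k. fs (r k) x) ----> f x"
  using cv by eventually_elim (simp add: f_def convergent_LIMSEQ_iff)
 \<comment> \<open>Fatou's lemma along the subsequence carries the Cauchy estimate over to the
   limit, for every index beyond \<open>K m\<close> and not only for those of the
   subsequence.\<close>
 have est: "l2 M (%x. fs i x - f x) \<and> l2n M (%x. fs i x - f x) <= (1/4)^m" if "i >= K m" for i m
 proof -
  let ?c = "((1/4)^m)\<^sup>2 :: real"
  have nn: "(\<integral>\<^sup>+x. ennreal ((norm (fs i x - f x))\<^sup>2) \<partial>M) <= ennreal ?c"
  proof -
   have "(\<integral>\<^sup>+x. ennreal ((norm (fs i x - f x))\<^sup>2) \<partial>M) = (\<integral>\<^sup>+x. liminf (%k. ennreal ((norm (fs i x - fs (r k) x))\<^sup>2)) \<partial>M)"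
   proof (rule nn_integral_cong_AE)
    show "AE x in M. ennreal ((norm (fs i x - f x))\<^sup>2) = liminf (%k. ennreal ((norm (fs i x - fs (r k) x))\<^sup>2))"
     using fc
    proof eventually_elim
     case (elim x)
     have "(%k. ennreal ((norm (fs i x - fs (r k) x))\<^sup>2)) ----> ennreal ((norm (fs i x - f x))\<^sup>2)"
      by (intro tendsto_ennrealI tendsto_intros elim)
     from lim_imp_Liminf[OF sequentially_bot this] show ?case by simp
    qed
   qed
   also have "... <= liminf (%k. \<integral>\<^sup>+x. ennreal ((norm (fs i x - fs (r k) x))\<^sup>2) \<partial>M)"
    by (rule nn_integral_liminf) measurable
   also have "... <= ennreal ?c"
   proof -
    have "(\<integral>\<^sup>+x. ennreal ((norm (fs i x - fs (r k) x))\<^sup>2) \<partial>M) <= ennreal ?c" if "k >= m" for k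
    proof -
     have "r k >= K m"
      using rS(2)[of m] strict_mono_leD[OF rm \<open>k >= m\<close>] by linarith
     then have "l2n M (%x. fs i x - fs (r k) x) <= (1/4)^m" using K[OF \<open>i >= K m\<close>] by (meson less_imp_le)
     then have "(LINT x|M. (norm (fs i x - fs (r k) x))\<^sup>2) <= ?c"
      unfolding l2n_sq[symmetric] by (intro power_mono) auto
     then show ?thesis
      using l2_integrable_sq[OF l2_diff[OF l[of i] l[of "r k"]]]
      by (subst nn_integral_eq_integral) (auto intro!: ennreal_leI)
    qed
    then have "eventually (%k. (\<integral>\<^sup>+x. ennreal ((norm (fs i x - fs (r k) x))\<^sup>2) \<partial>M) <= ennreal ?c) sequentially"
     by (auto simp: eventually_sequentially)
    then have "Limsup sequentially (%k. \<integral>\<^sup>+x. ennreal ((norm (fs i x - fs (r k) x))\<^sup>2) \<partial>M) <= ennreal ?c"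
     by (rule Limsup_bounded)
    then show ?thesis using Liminf_le_Limsup[OF sequentially_bot] order_trans by blast
   qed
   finally show ?thesis .
  qed
  have i: "integrable M (%x. (norm (fs i x - f x))\<^sup>2)"
   using nn by (intro integrableI_bounded) (auto simp: less_top[symmetric] top_unique)
  have "(LINT x|M. (norm (fs i x - f x))\<^sup>2) <= ?c"
   using nn i by (subst (asm) nn_integral_eq_integral) (auto simp: ennreal_le_iff)
  then have "l2n M (%x. fs i x - f x) <= sqrt ?c" unfolding l2n_def by (rule real_sqrt_le_mono)
  then show ?thesis using i by (auto simp: l2_def)
 qed
 have lf: "l2 M f"
  using l2_diff[OF l[of "K 0"] conjunct1[OF est[of 0 "K 0"]]] by simp
 have "l2lim M fs f"
  unfolding l2lim_def
 proof (intro conjI allI l lf LIMSEQ_I)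
  fix e :: real assume "e > 0"
  then obtain m where "(1/4)^m < e" using real_arch_pow_inv[of e "1/4"] by auto
  then show "\<exists>n0. \<forall>n\<ge>n0. norm (l2n M (%x. fs n x - f x) - 0) < e"
   using est by (intro exI[of _ "K m"]) (fastforce)
 qed
 then show ?thesis by (rule that)
qed

section \<open>Compactly supported continuously differentiable functions\<close>

lemma
 fixes a :: "'a::euclidean_space"
 shows lebesgue_shift_measurable [measurable]: "(%x. x + a) : lb \<rightarrow>\<^sub>M lb"
  and lebesgue_shift_distr: "distr lb lb (%x. x + a) = lb"
proof -
 have e: "(%x. a + (\<Sum>j\<in>Basis. (1 * (x \<bullet> j)) *\<^sub>R j)) = (%x::'a. x + a)"
  by (simp add: euclidean_representation add.commute)
 show "(%x. x + a) : lb \<rightarrow>\<^sub>M lb"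
  using lebesgue_affine_measurable[of "%_. 1" a] by (simp add: e[simplified] euclidean_representation add.commute)
 show "distr lb lb (%x. x + a) = lb"
  using lebesgue_affine_euclidean[of "%_. 1" a]
  by (simp add: euclidean_representation add.commute density_1)
qed

lemma shift_borel_measurable:
 fixes a :: "'a::euclidean_space"
 assumes "f : bml" shows "(%x. f (x + a)) : bml"
 using measurable_compose[OF lebesgue_shift_measurable assms] .

lemma integrable_shift:
 fixes f :: "'a::euclidean_space => 'b::euclidean_space"
 assumes "integrable lb f" shows "integrable lb (%x. f (x + a))"
 using assms integrable_distr[OF lebesgue_shift_measurable, of a f] unfolding lebesgue_shift_distr by simp

lemma integral_shift:
 fixes f :: "'a::euclidean_space => 'b::euclidean_space"
 assumes "f : bml"
 shows "(LB x. f (x + a)) = (LB x. f x)"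
 using integral_distr[OF lebesgue_shift_measurable assms, of a] unfolding lebesgue_shift_distr by simp

lemma AE_shift:
 fixes a :: "'a::euclidean_space"
 assumes "AE x in lb. P x" shows "AE x in lb. P (x + a)"
 using AE_distrD[OF lebesgue_shift_measurable, of P a] assms unfolding lebesgue_shift_distr by simp

lemma l2_shift:
 fixes a :: "'a::euclidean_space" and f :: "'a => 'b::euclidean_space"
 assumes "l2 lb f" shows "l2 lb (%x. f (x + a))" "l2n lb (%x. f (x + a)) = l2n lb f"
proof -
 show "l2 lb (%x. f (x + a))"
  using assms integrable_shift[of "%x. (norm (f x))\<^sup>2"] by (auto simp: l2_def intro: shift_borel_measurable)
 show "l2n lb (%x. f (x + a)) = l2n lb f"
  using integral_shift[of "%x. (norm (f x))\<^sup>2" a] assms by (simp add: l2_def l2n_def)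
qed

lemma l2lim_shift:
 fixes a :: "'a::euclidean_space" and f :: "'a => 'b::euclidean_space"
 assumes "l2lim lb fs f" shows "l2lim lb (%k x. fs k (x + a)) (%x. f (x + a))"
proof -
 note D = l2limD[OF assms]
 show ?thesis using D l2_shift(2)[OF l2_diff[OF D(1,2)]] l2_shift(1)[OF D(1)] l2_shift(1)[OF D(2)] by (auto simp: l2lim_def)
qed

lemma continuous_borel_lebesgue: "continuous_on UNIV f ==> f : borel_measurable (lb :: 'a::euclidean_space measure)"
 using borel_measurable_continuous_onI[of f] by (simp add: borel_measurable_continuous_onI measurable_completion)

lemma compact_lebesgue: "compact (K::'a::euclidean_space set) ==> K : sets lb" "compact K ==> emeasure lb K < \<infinity>"
 using lmeasurable_compact[of K] by (auto simp: fmeasurable_def)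

lemma l2_bounded_support:
 fixes f :: "'a::euclidean_space => 'b::euclidean_space"
 assumes "f : bml" "bounded S" "AE x in lb. norm (f x) <= B" "AE x in lb. x \<notin> S --> f x = 0"
 shows "l2 lb f" "integrable lb f"
proof -
 have c: "compact (closure S)" using assms(2) by (simp add: compact_closure)
 have i: "integrable lb (%x. indicator (closure S) x *\<^sub>R c)" for c :: real
  using compact_lebesgue[OF c] by (intro integrable_scaleR_left integrable_real_indicator) auto
 have b: "AE x in lb. norm (f x) <= indicator (closure S) x * \<bar>B\<bar>"
  using assms(3,4)
 proof eventually_elim
  case (elim x)
  then show ?case using closure_subset[of S] by (cases "x : S") auto
 qed
 show "integrable lb f"
  by (rule int_bound[OF i[of "\<bar>B\<bar>"] assms(1)]) (use b in \<open>auto simp: abs_mult\<close>)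
 have "integrable lb (%x. (norm (f x))\<^sup>2)"
 proof (rule int_bound[OF i[of "\<bar>B\<bar>\<^sup>2"]])
  show "AE x in lb. norm ((norm (f x))\<^sup>2) <= norm (indicator (closure S) x *\<^sub>R \<bar>B\<bar>\<^sup>2)"
   using b
  proof eventually_elim
   case (elim x)
   then have "(norm (f x))\<^sup>2 <= (indicator (closure S) x * \<bar>B\<bar>)\<^sup>2" by (intro power_mono) auto
   then show ?case by (cases "x : closure S") (simp_all add: power_mult_distrib)
  qed
 qed (use assms in auto)
 then show "l2 lb f" using assms by (simp add: l2_def)
qed

text \<open>Test functions are only continuously differentiable, with the gradient as a second
  argument: products with barriers and cut-offs and compositions with a truncation of class C^1 stay
  in this class. Density of the smooth ones is \<open>C1c_approx\<close>.\<close>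

definition C1c :: "'a::euclidean_space set => ('a => real) => ('a => 'a) => bool" where
 "C1c U z Z \<longleftrightarrow> (\<forall>x. GDERIV z x :> Z x) \<and> continuous_on UNIV Z \<and>
   (\<exists>K. compact K \<and> K \<subseteq> U \<and> (\<forall>x. x \<notin> K --> z x = 0 \<and> Z x = 0))"

lemma GDERIV_continuous: "GDERIV f x :> D ==> isCont f x"
 unfolding gderiv_def by (rule has_derivative_continuous)

lemma GDERIV_unique: assumes "GDERIV f x :> D" "GDERIV f x :> E" shows "D = E"
proof -
 have "(%h. h \<bullet> D) = (%h. h \<bullet> E)"
  using assms unfolding gderiv_def by (rule has_derivative_unique)
 then show ?thesis by (metis vector_eq_ldot)
qed

lemma C1c_I:
 assumes "!!x. x : U ==> GDERIV z x :> Z x" "continuous_on U Z" "open U" "compact K" "K \<subseteq> U"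
  "!!x. x \<notin> K ==> z x = 0" "!!x. x \<notin> K ==> Z x = 0"
 shows "C1c U z Z"
 unfolding C1c_def
proof (intro conjI allI)
 have o: "open (- K)" using assms(4) by (simp add: compact_imp_closed open_Compl)
 show "GDERIV z x :> Z x" for x
 proof (cases "x : U")
  case False
  then have x: "x : - K" using assms by auto
  have "((%x. 0::real) has_derivative (%h. h \<bullet> 0)) (at x)" by simp
  then have "(z has_derivative (%h. h \<bullet> 0)) (at x)"
   by (rule has_derivative_transform_within_open[OF _ o x]) (use assms(6) in auto)
  then show ?thesis using assms(7) x by (auto simp: gderiv_def)
 qed (use assms in auto)
 have "continuous_on (- K) Z" by (rule continuous_on_eq[of _ "%x. 0"]) (use assms(7) in auto)
 from continuous_on_open_Un[OF assms(3) o assms(2) this]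
 moreover have "U \<union> - K = UNIV" using assms(5) by auto
 ultimately show "continuous_on UNIV Z" by simp
 show "\<exists>K. compact K \<and> K \<subseteq> U \<and> (\<forall>x. x \<notin> K --> z x = 0 \<and> Z x = 0)" using assms by blast
qed

lemma C1cD:
 assumes "C1c U z Z"
 shows "GDERIV z x :> Z x" "continuous_on UNIV Z" "continuous_on UNIV z"
  "\<exists>K. compact K \<and> K \<subseteq> U \<and> (\<forall>x. x \<notin> K --> z x = 0 \<and> Z x = 0)"
  "x \<notin> U ==> z x = 0" "x \<notin> U ==> Z x = 0"
proof -
 have d: "!!x. GDERIV z x :> Z x" using assms unfolding C1c_def by blast
 then show "GDERIV z x :> Z x" "continuous_on UNIV z" using GDERIV_continuous by (auto simp: continuous_on_eq_continuous_at)
 show "continuous_on UNIV Z" "\<exists>K. compact K \<and> K \<subseteq> U \<and> (\<forall>x. x \<notin> K --> z x = 0 \<and> Z x = 0)"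
  using assms unfolding C1c_def by blast+
 then show "x \<notin> U ==> z x = 0" "x \<notin> U ==> Z x = 0" by blast+
qed

lemma C1c_measurable:
 assumes "C1c U z Z" shows "z : bml" "Z : bml"
 using C1cD[OF assms] by (auto intro: continuous_borel_lebesgue)

lemma bounded_compact_support:
 fixes f :: "'a::euclidean_space => 'b::real_normed_vector"
 assumes "continuous_on UNIV f" "compact K" "!!x. x \<notin> K ==> f x = 0"
 shows "\<exists>B\<ge>0. \<forall>x. norm (f x) <= B"
proof -
 have "compact (f ` K)" using assms by (intro compact_continuous_image) (auto intro: continuous_on_subset)
 then obtain B where B: "\<forall>y\<in>f ` K. norm y <= B" using compact_imp_bounded bounded_iff by blast
 have "norm (f x) <= max 0 B" for x using B assms(3)[of x] by (cases "x : K") auto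
 then show ?thesis by (intro exI[of _ "max 0 B"]) auto
qed

lemma C1c_bounded:
 assumes "C1c U z Z" shows "\<exists>B\<ge>0. \<forall>x. \<bar>z x\<bar> <= B \<and> norm (Z x) <= B"
proof -
 obtain K where K: "compact K" "!!x. x \<notin> K ==> z x = 0" "!!x. x \<notin> K ==> Z x = 0" using C1cD(4)[OF assms] by blast
 obtain B1 where B1: "B1 >= 0" "!!x. \<bar>z x\<bar> <= B1"
  using bounded_compact_support[OF C1cD(3)[OF assms] K(1,2)] by auto
 obtain B2 where B2: "B2 >= 0" "!!x. norm (Z x) <= B2"
  using bounded_compact_support[OF C1cD(2)[OF assms] K(1,3)] by auto
 show ?thesis
  using B1 B2 by (intro exI[of _ "max B1 B2"]) (auto simp: le_max_iff_disj)
qed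

lemma C1c_l2:
 assumes "C1c U z Z" shows "l2 lb z" "l2 lb Z" "integrable lb z" "integrable lb Z"
proof -
 obtain K where K: "compact K" "!!x. x \<notin> K ==> z x = 0" "!!x. x \<notin> K ==> Z x = 0" using C1cD(4)[OF assms] by blast
 obtain B where B: "!!x. \<bar>z x\<bar> <= B" "!!x. norm (Z x) <= B" using C1c_bounded[OF assms] by blast
 show "l2 lb z" "l2 lb Z" "integrable lb z" "integrable lb Z"
  using l2_bounded_support[OF C1c_measurable(1)[OF assms] compact_imp_bounded[OF K(1)], of B]
   l2_bounded_support[OF C1c_measurable(2)[OF assms] compact_imp_bounded[OF K(1)], of B] B K by auto
qed

lemma C1c_add:
 assumes "C1c U y Y" "C1c U z Z" shows "C1c U (%x. y x + z x) (%x. Y x + Z x)"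
proof -
 obtain K L where "compact K" "K \<subseteq> U" "\<forall>x. x \<notin> K --> z x = 0 \<and> Z x = 0"
   "compact L" "L \<subseteq> U" "\<forall>x. x \<notin> L --> y x = 0 \<and> Y x = 0" using C1cD(4)[OF assms(1)] C1cD(4)[OF assms(2)] by blast
 then have "compact (K \<union> L) \<and> K \<union> L \<subseteq> U \<and> (\<forall>x. x \<notin> K \<union> L --> y x + z x = 0 \<and> Y x + Z x = 0)" by auto
 then show ?thesis using assms unfolding C1c_def by (auto intro!: GDERIV_add continuous_intros)
qed

lemma C1c_scaleR: "C1c U z Z ==> C1c U (%x. c * z x) (%x. c *\<^sub>R Z x)"
 unfolding C1c_def by (auto intro!: continuous_intros GDERIV_subst[OF GDERIV_mult[OF GDERIV_const]])

lemma C1c_diff: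
 assumes "C1c U y Y" "C1c U z Z" shows "C1c U (%x. y x - z x) (%x. Y x - Z x)"
 using C1c_add[OF assms(1) C1c_scaleR[OF assms(2), of "-1"]] by simp

lemma C1c_mono: "C1c U z Z ==> U \<subseteq> V ==> C1c V z Z"
 unfolding C1c_def by blast

lemma C1c_zero: "C1c U (%x. 0) (%x. 0)"
 unfolding C1c_def by (auto intro!: GDERIV_const exI[of _ "{}"])

lemma C1c_mult:
 assumes "C1c U z Z" "!!x. x : U ==> GDERIV b x :> B x" "continuous_on U B" "open U"
 shows "C1c U (%x. z x * b x) (%x. z x *\<^sub>R B x + b x *\<^sub>R Z x)"
proof -
 obtain K where K: "compact K" "K \<subseteq> U" "!!x. x \<notin> K ==> z x = 0" "!!x. x \<notin> K ==> Z x = 0" using C1cD(4)[OF assms(1)] by blast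
 have cb: "continuous_on U b"
  using assms(2) GDERIV_continuous by (intro continuous_at_imp_continuous_on) blast
 show ?thesis
 proof (rule C1c_I[OF _ _ assms(4) K(1,2)])
  show "GDERIV (%x. z x * b x) x :> z x *\<^sub>R B x + b x *\<^sub>R Z x" if "x : U" for x
   by (rule GDERIV_mult[OF C1cD(1)[OF assms(1)] assms(2)[OF that]])
  show "continuous_on U (%x. z x *\<^sub>R B x + b x *\<^sub>R Z x)"
   using continuous_on_subset[OF C1cD(2)[OF assms(1)], of U] continuous_on_subset[OF C1cD(3)[OF assms(1)], of U]
   by (intro continuous_intros cb assms) auto
 qed (use K in auto)
qed

lemma GDERIV_bound:
 fixes f :: "'a::euclidean_space => real"
 assumes "!!x. GDERIV f x :> D x" "!!x. norm (D x) <= B"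
 shows "\<bar>f x - f y\<bar> <= B * norm (x - y)"
proof -
 have "norm (f x - f y) <= B * norm (x - y)"
 proof (rule differentiable_bound[of UNIV f "%x h. h \<bullet> D x"])
  show "(f has_derivative (%h. h \<bullet> D x)) (at x within UNIV)" for x using assms(1) by (simp add: gderiv_def)
  show "onorm (%h. h \<bullet> D x) <= B" for x
  proof (rule onorm_bound)
   show "0 <= B" using assms(2)[of x] norm_ge_zero order_trans by blast
   show "norm (h \<bullet> D x) <= B * norm h" for h
    using Cauchy_Schwarz_ineq2[of h "D x"] mult_left_mono[OF assms(2)[of x], of "norm h"]
    by (simp add: mult.commute)
  qed
 qed auto
 then show ?thesis by simp
qed

text \<open>The source of every integration by parts. Difference quotients in the direction v have
  integral zero by translation invariance; they are bounded by B |v| and vanish outside a fixed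
  ball, so dominated convergence applies.\<close>

lemma integral_gradient_zero:
 fixes g :: "'a::euclidean_space => real"
 assumes d: "!!x. GDERIV g x :> D x" and B: "!!x. norm (D x) <= B" and K: "compact K" "!!x. x \<notin> K ==> g x = 0"
 shows "(LB x. D x \<bullet> v) = 0" "(%x. D x \<bullet> v) : bml"
proof -
 define h where "h k = inverse (real (Suc k))" for k
 have h: "h k > 0" "h k <= 1" for k by (auto simp: h_def inverse_le_1_iff)
 have h0: "h ----> 0" unfolding h_def by (rule LIMSEQ_inverse_real_of_nat)
 have gc: "continuous_on UNIV g" using d GDERIV_continuous by (auto simp: continuous_on_eq_continuous_at)
 have [measurable]: "g : bml" by (rule continuous_borel_lebesgue[OF gc])
 have [measurable]: "(%x. g (x + a)) : bml" for a by (rule shift_borel_measurable) measurable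
 have gi: "integrable lb g"
 proof -
  obtain C where "\<forall>x. norm (g x) <= C" using bounded_compact_support[OF gc K] by blast
  then show ?thesis using l2_bounded_support(2)[of g K C] K compact_imp_bounded[OF K(1)] by auto
 qed
 let ?s = "%k x. (g (x + h k *\<^sub>R v) - g x) / h k"
 have s0: "(LB x. ?s k x) = 0" for k
  using integral_shift[of g "h k *\<^sub>R v"] gi integrable_shift[OF gi] by simp
 have lim: "(%k. ?s k x) ----> D x \<bullet> v" for x
 proof -
  have "((%t. g (x + t *\<^sub>R v)) has_real_derivative D x \<bullet> v) (at 0)"
  proof -
   have "((%t. x + t *\<^sub>R v) has_derivative (%t. t *\<^sub>R v)) (at 0)" by (auto intro!: derivative_eq_intros)
   moreover have "(g has_derivative (%h. h \<bullet> D x)) (at (x + 0 *\<^sub>R v))" using d by (simp add: gderiv_def)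
   ultimately have "(g \<circ> (%t. x + t *\<^sub>R v) has_derivative (%h. h \<bullet> D x) \<circ> (%t. t *\<^sub>R v)) (at 0)" by (rule diff_chain_at)
   then show ?thesis unfolding has_field_derivative_def by (simp add: comp_def inner_commute mult_commute_abs)
  qed
  then have "((%t. (g (x + t *\<^sub>R v) - g x) / t) \<longlongrightarrow> D x \<bullet> v) (at 0)"
   by (simp add: DERIV_def)
  then show ?thesis
   by (rule filterlim_compose) (use h h0 in \<open>auto simp: filterlim_at intro!: always_eventually less_imp_neq[THEN not_sym]\<close>)
 qed
 show m: "(%x. D x \<bullet> v) : bml"
  by (rule borel_measurable_LIMSEQ_real[OF lim]) measurable
 obtain R where R: "!!x. x : K ==> norm x <= R" using compact_imp_bounded[OF K(1)] bounded_iff by blast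
 let ?S = "cball 0 (R + norm v) :: 'a set"
 have "(%k. LB x. ?s k x) ----> (LB x. D x \<bullet> v)"
 proof (rule integral_dominated_convergence[where w="%x. indicator ?S x *\<^sub>R (B * norm v)"])
  show "AE x in lb. norm (?s k x) <= indicator ?S x *\<^sub>R (B * norm v)" for k
  proof (rule AE_I2)
   fix x
   show "norm (?s k x) <= indicator ?S x *\<^sub>R (B * norm v)"
   proof (cases "x : ?S")
    case True
    have "\<bar>g (x + h k *\<^sub>R v) - g x\<bar> <= B * norm (h k *\<^sub>R v)"
     using GDERIV_bound[OF d B, of "x + h k *\<^sub>R v" x] by simp
    then show ?thesis using True h[of k] by (simp add: field_simps)
   next
    case False
    have "norm x <= norm (x + h k *\<^sub>R v) + norm (h k *\<^sub>R v)" using norm_triangle_ineq4[of "x + h k *\<^sub>R v" "h k *\<^sub>R v"] by simp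
    also have "norm (h k *\<^sub>R v) <= norm v" using h[of k] by (simp add: mult_left_le_one_le)
    finally have "norm x <= norm (x + h k *\<^sub>R v) + norm v" by simp
    moreover have "norm x > R + norm v" using False by simp
    ultimately have "norm (x + h k *\<^sub>R v) > R" "norm x > R" using norm_ge_zero[of v] by linarith+
    then have "g (x + h k *\<^sub>R v) = 0" "g x = 0" using K(2) R by (meson not_le)+
    then show ?thesis using False by simp
   qed
  qed
  show "integrable lb (%x. indicator ?S x *\<^sub>R (B * norm v))"
   using compact_lebesgue[of ?S] by (intro integrable_scaleR_left integrable_real_indicator) auto
 qed (use lim in \<open>auto intro: m\<close>)
 then show "(LB x. D x \<bullet> v) = 0" unfolding s0 LIMSEQ_const_iff by simp
qed

lemma C1c_integral_zero: "C1c U z Z ==> (LB x. Z x \<bullet> v) = 0"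
 using integral_gradient_zero(1)[of z Z] C1c_bounded[of U z Z] C1cD[of U z Z] by metis

lemma GDERIV_inner: "GDERIV (%x. x \<bullet> e) x :> e"
 unfolding gderiv_def by (auto intro!: derivative_eq_intros)

text \<open>A single direction e suffices: the field \<open>z\<^sup>2 (x \<bullet> e) e\<close> has
  divergence \<open>z\<^sup>2 + 2 (x \<bullet> e) z (Z \<bullet> e)\<close> with integral zero, and
  |x \<bullet> e| \<le> R on U. This gives the constant 2 R.\<close>

lemma poincare:
 fixes U :: "'a::euclidean_space set"
 assumes "C1c U z Z" "U \<subseteq> cball 0 R" "R >= 0"
 shows "l2n lb z <= 2 * R * l2n lb Z"
proof -
 obtain e :: 'a where e: "e : Basis" using nonempty_Basis by blast
 have ne: "norm e = 1" using e by simp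
 have d1: "C1c UNIV z Z" using C1c_mono[OF assms(1)] by simp
 have d2: "C1c UNIV (%x. z x * z x) (%x. z x *\<^sub>R Z x + z x *\<^sub>R Z x)"
  by (rule C1c_mult[OF d1]) (use C1cD[OF assms(1)] in auto)
 have d3: "C1c UNIV (%x. z x * z x * (x \<bullet> e)) (%x. (z x * z x) *\<^sub>R e + (x \<bullet> e) *\<^sub>R (z x *\<^sub>R Z x + z x *\<^sub>R Z x))"
  by (rule C1c_mult[OF d2 GDERIV_inner]) auto
 have l: "l2 lb z" "l2 lb Z" using C1c_l2[OF assms(1)] by auto
 let ?w = "%x. (x \<bullet> e) *\<^sub>R z x"
 have wb: "\<bar>indicator (cball 0 R) x * (x \<bullet> e)\<bar> <= R" for x
  using Cauchy_Schwarz_ineq2[of x e] ne assms(3) by (auto simp: indicator_def)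
 \<comment> \<open>The indicator makes the weight bounded on the whole space and changes nothing,
   since z vanishes outside U.\<close>
 have we: "?w = (%x. (indicator (cball 0 R) x * (x \<bullet> e)) *\<^sub>R z x)"
  using C1cD(5)[OF assms(1)] assms(2) by (fastforce simp: indicator_def fun_eq_iff)
 have "(%x. indicator (cball 0 R) x * (x \<bullet> e)) : bml"
  using compact_lebesgue(1)[of "cball 0 R"]
  by (intro borel_measurable_times borel_measurable_indicator continuous_borel_lebesgue continuous_intros) auto
 then have wl: "l2 lb ?w" "l2n lb ?w <= R * l2n lb z"
  unfolding we using l2_mult_bounded[OF l(1), of "%x. indicator (cball 0 R) x * (x \<bullet> e)" R] wb assms(3) by auto
 have zl: "l2 lb (%x. Z x \<bullet> e)" "l2n lb (%x. Z x \<bullet> e) <= l2n lb Z"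
  using l2_bound[OF l(2), of "%x. Z x \<bullet> e"] Cauchy_Schwarz_ineq2[of _ e] ne l(2) by (auto simp: l2_def)
 have "0 = (LB x. ((z x * z x) *\<^sub>R e + (x \<bullet> e) *\<^sub>R (z x *\<^sub>R Z x + z x *\<^sub>R Z x)) \<bullet> e)"
  using C1c_integral_zero[OF d3, of e] by simp
 also have "... = (LB x. (norm (z x))\<^sup>2 + 2 * (?w x \<bullet> (Z x \<bullet> e)))"
  using ne by (intro int_cong refl)
   (simp add: inner_add_left power2_eq_square norm_eq_1 algebra_simps)
 also have "... = (l2n lb z)\<^sup>2 + 2 * (LB x. ?w x \<bullet> (Z x \<bullet> e))"
  using l2_inner_integrable[OF wl(1) zl(1)] l2_integrable_sq[OF l(1)] by (simp add: l2n_sq)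
 finally have "(l2n lb z)\<^sup>2 <= 2 * \<bar>LB x. ?w x \<bullet> (Z x \<bullet> e)\<bar>" by linarith
 also have "... <= 2 * (l2n lb ?w * l2n lb (%x. Z x \<bullet> e))"
  using l2_Cauchy_Schwarz[OF wl(1) zl(1)] by simp
 also have "... <= 2 * ((R * l2n lb z) * l2n lb Z)"
  using wl zl assms(3) by (intro mult_left_mono mult_mono) auto
 finally have "l2n lb z * l2n lb z <= (2 * R * l2n lb Z) * l2n lb z"
  by (simp add: power2_eq_square algebra_simps)
 then show ?thesis
  using assms(3) by (cases "l2n lb z = 0") (auto dest!: mult_right_le_imp_le simp: less_le)
qed

section \<open>Mollification\<close>

text \<open>The functions \<open>th k\<close> span a space closed under differentiation, which makes them smooth.\<close>
definition th :: "nat => real => real" where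
 "th k t = (if t > 0 then inverse t ^ k * exp (- inverse t) else 0)"

lemma th_tendsto_0: "(th k \<longlongrightarrow> 0) (at 0)"
proof -
 have "((%x. x ^ k / exp x) \<longlongrightarrow> (0::real)) at_top" by (rule tendsto_power_div_exp_0)
 from filterlim_compose[OF this filterlim_inverse_at_top_right]
 have "((%t. inverse t ^ k / exp (inverse t)) \<longlongrightarrow> (0::real)) (at_right 0)" .
 then have "(th k \<longlongrightarrow> 0) (at_right 0)"
  by (rule Lim_transform_eventually)
   (auto simp: eventually_at_right_less th_def exp_minus field_simps intro: eventually_mono[OF eventually_at_right_less])
 moreover have "(th k \<longlongrightarrow> 0) (at_left 0)"
  by (rule Lim_transform_eventually[OF tendsto_const]) (auto simp: eventually_at_filter th_def)
 ultimately show ?thesis by (simp add: filterlim_at_split)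
qed

lemma th_deriv: "(th k has_real_derivative th (k + 2) t - real k * th (k + 1) t) (at t)"
proof -
 consider "t > 0" | "t < 0" | "t = 0" by linarith
 then show ?thesis
 proof cases
  case 1
  have "((%t. inverse t ^ k * exp (- inverse t)) has_real_derivative th (k + 2) t - real k * th (k + 1) t) (at t)"
   using 1 by (auto intro!: derivative_eq_intros simp: th_def power2_eq_square)
    (cases k; simp add: field_simps)
  then show ?thesis
   by (rule has_field_derivative_transform_within_open[of _ _ _ "{0<..}"]) (use 1 in \<open>auto simp: th_def\<close>)
 next
  case 2
  have "((%t. 0) has_real_derivative th (k + 2) t - real k * th (k + 1) t) (at t)"
   using 2 by (auto simp: th_def)
  then show ?thesis
   by (rule has_field_derivative_transform_within_open[of _ _ _ "{..<0}"]) (use 2 in \<open>auto simp: th_def\<close>)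
 next
  case 3
  have "(%h. (th k (0 + h) - th k 0) / h) = th (k + 1)"
   by (auto simp: th_def fun_eq_iff field_simps)
  then have "(th k has_real_derivative 0) (at 0)"
   unfolding DERIV_def using th_tendsto_0[of "k + 1"] by simp
  then show ?thesis using 3 by (simp add: th_def)
 qed
qed

text \<open>An algebra of functions that contains the bump and is closed under directional
  derivatives. Smoothness of all orders, defined through lists of directions, thus follows by
  induction without a formula for any higher derivative.\<close>

inductive_set smf :: "real => ('n::finite pt => real) set" for e where
 smf_th: "(%x. th k (e - x \<bullet> x)) : smf e"
| smf_const: "(%x. c) : smf e"
| smf_inner: "(%x. x \<bullet> v) : smf e"
| smf_add: "f : smf e ==> g : smf e ==> (%x. f x + g x) : smf e"
| smf_mult: "f : smf e ==> g : smf e ==> (%x. f x * g x) : smf e"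

lemma smf_deriv:
 fixes g :: "'n::finite pt => real"
 shows "g : smf e ==> \<exists>D. (\<forall>x. (g has_derivative D x) (at x)) \<and> (\<forall>v. (%x. D x v) : smf e)"
proof (induction rule: smf.induct)
 case (smf_th k)
 let ?D = "%x v. (th (k + 2) (e - x \<bullet> x) + (- real k) * th (k + 1) (e - x \<bullet> x)) * ((-2) * (x \<bullet> v))"
 have "((%x. th k (e - x \<bullet> x)) has_derivative ?D x) (at x)" for x :: "'n pt"
 proof -
  have "((%x. e - x \<bullet> x) has_derivative (%v. (-2) * (x \<bullet> v))) (at x)"
   by (auto intro!: derivative_eq_intros simp: inner_commute)
  from has_derivative_compose[OF this th_deriv[of k "e - x \<bullet> x", unfolded has_field_derivative_def]]
  show ?thesis by (simp add: mult.commute)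
 qed
 moreover have "(%x. ?D x v) : smf e" for v :: "'n pt"
  by (intro smf.intros)
 ultimately show ?case by (intro exI[of _ ?D]) blast
next
 case (smf_const c)
 show ?case by (intro exI[of _ "%x v. 0"]) (auto intro: smf.intros)
next
 case (smf_inner v)
 show ?case by (intro exI[of _ "%x w. w \<bullet> v"]) (auto intro!: smf.intros derivative_eq_intros)
next
 case (smf_add f g)
 then obtain D E where "\<forall>x. (f has_derivative D x) (at x)" "\<forall>v. (%x. D x v) : smf e"
  "\<forall>x. (g has_derivative E x) (at x)" "\<forall>v. (%x. E x v) : smf e" by blast
 then show ?case by (intro exI[of _ "%x v. D x v + E x v"]) (auto intro!: smf.intros derivative_eq_intros)
next
 case (smf_mult f g)
 then obtain D E where DE: "\<forall>x. (f has_derivative D x) (at x)" "\<forall>v. (%x. D x v) : smf e"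
  "\<forall>x. (g has_derivative E x) (at x)" "\<forall>v. (%x. E x v) : smf e" by blast
 have "((%x. f x * g x) has_derivative (%v. f x * E x v + D x v * g x)) (at x)" for x
  using DE by (intro has_derivative_mult) auto
 then show ?case using DE smf_mult
  by (intro exI[of _ "%x v. f x * E x v + D x v * g x"]) (auto intro!: smf.intros)
qed

lemma smf_continuous: "g : smf e ==> continuous_on UNIV g"
 using smf_deriv[of g e] has_derivative_continuous by (fastforce simp: continuous_on_eq_continuous_at)

text \<open>Of two points closer than 1, either one lies in K, and then both belong to the compact
  neighbourhood of radius 1 on which f is uniformly continuous, or f vanishes at both.\<close>

lemma uniform_continuity_compact_support:
 fixes f :: "'a::euclidean_space => 'b::real_normed_vector"
 assumes "continuous_on UNIV f" "compact K" "!!x. x \<notin> K ==> f x = 0" "e > 0"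
 shows "\<exists>d>0. \<forall>x y. norm (x - y) < d --> norm (f x - f y) < e"
proof -
 let ?S = "{x + y | x y. x : K \<and> y : cball 0 1}"
 have "uniformly_continuous_on ?S f"
  using assms by (intro compact_uniformly_continuous compact_sums) (auto intro: continuous_on_subset)
 from this[unfolded uniformly_continuous_on_def, rule_format, OF assms(4)]
 obtain d where d: "d > 0" "\<forall>x\<in>?S. \<forall>y\<in>?S. dist y x < d --> dist (f y) (f x) < e"
  by blast
 have "norm (f x - f y) < e" if xy: "norm (x - y) < min d 1" for x y
 proof (cases "x : K \<or> y : K")
  case True
  have "x : ?S \<and> y : ?S"
   using True
  proof
   assume "x : K"
   moreover have "x = x + 0" "y = x + (y - x)" "norm (y - x) <= 1" using xy by (auto simp: norm_minus_commute)
   ultimately show ?thesis by (metis (mono_tags, lifting) mem_Collect_eq mem_cball_0 norm_zero zero_le_one)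
  next
   assume "y : K"
   moreover have "y = y + 0" "x = y + (x - y)" "norm (x - y) <= 1" using xy by auto
   ultimately show ?thesis by (metis (mono_tags, lifting) mem_Collect_eq mem_cball_0 norm_zero zero_le_one)
  qed
  then show ?thesis using d(2)[rule_format, of y x] xy by (simp add: dist_norm)
 qed (use assms in auto)
 then show ?thesis using d(1) by (intro exI[of _ "min d 1"]) auto
qed

lemma reflect_measurable:
 fixes f :: "'a::euclidean_space => 'b::euclidean_space"
 assumes "continuous_on UNIV f" shows "(%z. f (x - z)) : bml"
 by (rule continuous_borel_lebesgue) (intro continuous_on_compose2[OF assms] continuous_intros, auto)

lemma conv_integrable:
 fixes f :: "'a::euclidean_space => real" and g :: "'a => 'b::euclidean_space"
 assumes "integrable lb f" "continuous_on UNIV g" "!!x. norm (g x) <= B"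
 shows "integrable lb (%z. f z *\<^sub>R g (x - z))"
proof (rule int_bound[where f="%z. B * f z"])
 show "(%z. f z *\<^sub>R g (x - z)) : bml"
  using assms(1) reflect_measurable[OF assms(2), of x] by measurable
 show "AE z in lb. norm (f z *\<^sub>R g (x - z)) <= norm (B * f z)"
  using order_trans[OF assms(3) abs_ge_self]
  by (intro AE_I2) (simp add: abs_mult mult.commute[of "\<bar>B\<bar>"] mult_left_mono)
qed (use assms in auto)

text \<open>The linearisation error of k is uniform in the base point because K is uniformly
  continuous; integrated against f it is at most a small multiple of the \<open>L\<^sup>1\<close>
  norm of f.\<close>

lemma conv_GDERIV:
 fixes f :: "'a::euclidean_space => real"
 assumes f: "integrable lb f" and k: "C1c UNIV k K"
 shows "GDERIV (%x. LB z. f z * k (x - z)) x :> (LB z. f z *\<^sub>R K (x - z))"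
proof -
 obtain B where B: "B >= 0" "!!x. \<bar>k x\<bar> <= B" "!!x. norm (K x) <= B" using C1c_bounded[OF k] by blast
 obtain S where S: "compact S" "!!x. x \<notin> S ==> K x = 0" using C1cD(4)[OF k] by blast
 have i1: "integrable lb (%z. f z * k (x - z))" for x
  using conv_integrable[OF f C1cD(3)[OF k], of B] B by simp
 have i2: "integrable lb (%z. f z *\<^sub>R K (x - z))" for x
  using conv_integrable[OF f C1cD(2)[OF k], of B] B by simp
 let ?F = "%x. LB z. f z * k (x - z)" and ?L = "LB z. f z *\<^sub>R K (x - z)"
 let ?A = "LB z. \<bar>f z\<bar>"
 have A: "?A >= 0" by (simp add: integral_nonneg_AE)
 have main: "\<exists>d>0. \<forall>y. norm (y - x) < d --> norm (?F y - ?F x - (y - x) \<bullet> ?L) <= e * norm (y - x)" if "e > 0" for e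
 proof -
  define e' where "e' = e / (?A + 1)"
  have e': "e' > 0" unfolding e'_def using that A by (intro divide_pos_pos) linarith+
  have "e * ?A <= e * (?A + 1)" using that by (simp add: algebra_simps)
  moreover have "?A + 1 > 0" using A by linarith
  ultimately have e'A: "e' * ?A <= e" unfolding e'_def by (simp add: pos_divide_le_eq)
  obtain d where d: "d > 0" "!!x y. norm (x - y) < d ==> norm (K x - K y) < e'"
   using uniform_continuity_compact_support[OF C1cD(2)[OF k] S e'] by blast
  have lin: "norm (k b - k a - (b - a) \<bullet> K a) <= norm (b - a) * e'" if "norm (b - a) < d" for a b
  proof (rule differentiable_bound_linearization[where S="ball a d" and f'="%x h. h \<bullet> K x"])
   show "a + t *\<^sub>R (b - a) : ball a d" if "t : {0..1}" for t
    using that \<open>norm (b - a) < d\<close> mult_left_le_one_le[of "norm (b - a)" t] by (simp add: dist_norm)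
   show "(k has_derivative (%h. h \<bullet> K x)) (at x within ball a d)" for x
    using C1cD(1)[OF k] unfolding gderiv_def by (rule has_derivative_at_withinI)
   show "onorm ((%h. h \<bullet> K x) - (%h. h \<bullet> K a)) <= e'" if "x : ball a d" for x
   proof (rule onorm_bound)
    have "norm (K x - K a) < e'" using that d(2)[of x a] by (simp add: dist_norm norm_minus_commute)
    then have hh: "norm h * norm (K x - K a) <= e' * norm h" for h
     using mult_left_mono[of "norm (K x - K a)" e' "norm h"] by (simp add: mult.commute)
    show "norm (((%h. h \<bullet> K x) - (%h. h \<bullet> K a)) h) <= e' * norm h" for h
     using order_trans[OF Cauchy_Schwarz_ineq2[of h "K x - K a"] hh] by (simp add: inner_diff_right)
   qed (use e' in simp)
  qed (use d in auto)
  have "norm (?F y - ?F x - (y - x) \<bullet> ?L) <= e * norm (y - x)" if y: "norm (y - x) < d" for y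
  proof -
   have i3: "(LB z. (y - x) \<bullet> (f z *\<^sub>R K (x - z))) = (y - x) \<bullet> ?L"
    by (rule integral_inner_right) (use i2 in blast)
   have "?F y - ?F x - (y - x) \<bullet> ?L = (LB z. f z * k (y - z) - f z * k (x - z) - (y - x) \<bullet> (f z *\<^sub>R K (x - z)))"
    by (simp only: Bochner_Integration.integral_diff int_diff i1 i3 integrable_inner_right[OF i2])
   also have "norm ... <= (LB z. norm (y - x) * e' * \<bar>f z\<bar>)"
   proof (rule Bochner_Integration.integral_norm_bound_integral)
    show "norm (f z * k (y - z) - f z * k (x - z) - (y - x) \<bullet> (f z *\<^sub>R K (x - z))) <= norm (y - x) * e' * \<bar>f z\<bar>" for z
    proof -
     have "norm (k (y - z) - k (x - z) - (y - x) \<bullet> K (x - z)) <= norm (y - x) * e'"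
      using lin[of "y - z" "x - z"] y by simp
     then have "\<bar>f z\<bar> * norm (k (y - z) - k (x - z) - (y - x) \<bullet> K (x - z)) <= \<bar>f z\<bar> * (norm (y - x) * e')"
      by (intro mult_left_mono) auto
     then show ?thesis by (simp add: abs_mult[symmetric] algebra_simps)
    qed
   next
    show "integrable lb (%z. f z * k (y - z) - f z * k (x - z) - (y - x) \<bullet> (f z *\<^sub>R K (x - z)))"
     by (intro int_diff i1 integrable_inner_right i2)
   qed (use f in simp)
   also have "... = norm (y - x) * (e' * ?A)" by simp
   also have "... <= norm (y - x) * e" using e'A by (intro mult_left_mono) auto
   finally show ?thesis by (simp add: mult.commute)
  qed
  then show ?thesis using d(1) by blast
 qed
 show ?thesis
  unfolding gderiv_def has_derivative_at_alt using main by (auto intro: bounded_linear_inner_left)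
qed

lemma grad_eq: "GDERIV f x :> D ==> grad f x = D"
 by (simp add: gderiv_def grad_def partial_def frechet_derivative_at[symmetric] inner_axis' vec_eq_iff)

lemma GDERIV_grad:
 assumes "f differentiable (at x)" shows "GDERIV f x :> grad f x"
proof -
 have d: "(f has_derivative frechet_derivative f (at x)) (at x)" using assms by (simp add: frechet_derivative_works)
 then have l: "linear (frechet_derivative f (at x))" using has_derivative_linear by blast
 have "frechet_derivative f (at x) h = h \<bullet> grad f x" for h
 proof -
  have "frechet_derivative f (at x) h = frechet_derivative f (at x) (\<Sum>i\<in>UNIV. h $ i *\<^sub>R axis i 1)"
   by (simp add: basis_expansion[of h, unfolded scalar_mult_eq_scaleR])
  also have "... = h \<bullet> grad f x"
   by (simp add: linear_sum[OF l] linear_scale[OF l] inner_vec_def grad_def partial_def)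
  finally show ?thesis .
 qed
 then show ?thesis using d unfolding gderiv_def by (metis (no_types, lifting) ext)
qed

lemma test_fun_C1c:
 fixes U :: "'n::finite pt set"
 assumes "test_fun U p" shows "C1c U p (grad p)"
proof -
 have s: "iter_dd vs p differentiable_on UNIV" for vs using assms by (simp add: test_fun_def smooth_fun_def)
 have d: "GDERIV p x :> grad p x" for x
  using s[of "[]"] by (intro GDERIV_grad) (simp add: differentiable_on_def)
 have "continuous_on UNIV (partial i p)" for i
 proof -
  have "iter_dd [axis i 1] p = partial i p" by (simp add: partial_def fun_eq_iff)
  then show ?thesis using differentiable_imp_continuous_on[OF s[of "[axis i 1]"]] by simp
 qed
 then have c: "continuous_on UNIV (grad p)" unfolding grad_def by (intro continuous_on_vec_lambda)
 let ?K = "closure {x. p x \<noteq> 0}"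
 have K: "compact ?K" "?K \<subseteq> U" using assms by (auto simp: test_fun_def)
 have z: "p x = 0" if "x \<notin> ?K" for x using that closure_subset[of "{x. p x \<noteq> 0}"] by auto
 have "grad p x = 0" if "x \<notin> ?K" for x
 proof -
  have eq: "!!x. x : - ?K ==> 0 = p x" by (rule z[symmetric]) (rule ComplD)
  have "(p has_derivative (%h. 0)) (at x)"
   by (rule has_derivative_transform_within_open[OF has_derivative_const open_Compl[OF closed_closure] _ eq])
    (use that in auto)
  then have "GDERIV p x :> 0" unfolding gderiv_def by simp
  then show ?thesis using d GDERIV_unique by blast
 qed
 then show ?thesis unfolding C1c_def using c d K z by blast
qed

text \<open>A directional derivative of the convolution is the convolution with another member of
  \<open>smf e\<close>, which carries the induction over the list of directions. The vanishing
  condition is imposed on an open set so that derivatives inherit it.\<close>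

lemma conv_test_fun_smooth:
 fixes f :: "'n::finite pt => real"
 assumes f: "integrable lb f"
 shows "k : smf e ==> (!!x. x \<bullet> x > e ==> k x = 0) ==>
  (\<exists>k'\<in>smf e. (\<forall>x. x \<bullet> x > e --> k' x = 0) \<and> iter_dd vs (%x. LB z. f z * k (x - z)) = (%x. LB z. f z * k' (x - z)))"
 "k : smf e ==> (!!x. x \<bullet> x > e ==> k x = 0) ==> smooth_fun (%x. LB z. f z * k (x - z))"
proof -
 have C: "\<exists>K. C1c UNIV k K \<and> (\<forall>v. (%x. v \<bullet> K x) : smf e) \<and> (\<forall>x. x \<bullet> x > e --> K x = 0)"
  if k: "k : smf e" "!!x. x \<bullet> x > e ==> k x = 0" for k :: "'n pt => real"
 proof -
  obtain D where D: "!!x. (k has_derivative D x) (at x)" "!!v. (%x. D x v) : smf e" using smf_deriv[OF k(1)] by blast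
  have G: "GDERIV k x :> grad k x" for x using D(1) by (intro GDERIV_grad) (auto simp: differentiable_def)
  have De: "D x v = v \<bullet> grad k x" for x v
   using has_derivative_unique[OF D(1) G[unfolded gderiv_def]] by metis
  have "continuous_on UNIV (%x. grad k x $ i)" for i
   using smf_continuous[OF D(2)[of "axis i 1"]] by (simp add: De inner_axis')
  then have c: "continuous_on UNIV (grad k)"
   using continuous_on_vec_lambda[of UNIV "%i x. grad k x $ i"] by simp
  have z: "grad k x = 0" if "x \<bullet> x > e" for x
  proof -
   have "open {x. e < x \<bullet> (x::'n pt)}" by (intro open_Collect_less continuous_intros)
   from has_derivative_transform_within_open[of "%x. 0" "%h. 0", OF _ this, of x UNIV k]
   have "GDERIV k x :> 0" unfolding gderiv_def using that k by auto
   then show ?thesis using G GDERIV_unique by blast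
  qed
  have "x \<bullet> x > e" if "x \<notin> cball 0 (1 + \<bar>e\<bar>)" for x :: "'n pt"
  proof -
   have "norm x > 1 + \<bar>e\<bar>" using that by simp
   then have "(1 + \<bar>e\<bar>) * 1 <= norm x * norm x" by (intro mult_mono) auto
   then show ?thesis by (simp add: power2_norm_eq_inner[symmetric] power2_eq_square)
  qed
  then have "C1c UNIV k (grad k)"
   unfolding C1c_def using G c z k(2) by (auto intro!: exI[of _ "cball 0 (1 + \<bar>e\<bar>)"])
  then show ?thesis using D(2) z by (auto simp: De)
 qed
 have step: "(%x. LB z. f z * k (x - z)) differentiable_on UNIV \<and> (\<exists>k'\<in>smf e. (\<forall>x. x \<bullet> x > e --> k' x = 0) \<and>
   (%x. frechet_derivative (%x. LB z. f z * k (x - z)) (at x) v) = (%x. LB z. f z * k' (x - z)))"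
  if k: "k : smf e" "!!x. x \<bullet> x > e ==> k x = 0" for k :: "'n pt => real" and v
 proof -
  obtain K where K: "C1c UNIV k K" "!!v. (%x. v \<bullet> K x) : smf e" "!!x. x \<bullet> x > e ==> K x = 0" using C[OF k] by blast
  obtain B where B: "B >= 0" "!!x. norm (K x) <= B" using C1c_bounded[OF K(1)] by blast
  have i2: "integrable lb (%z. f z *\<^sub>R K (x - z))" for x
   using conv_integrable[OF f C1cD(2)[OF K(1)], of B] B by simp
  note g = conv_GDERIV[OF f K(1)]
  have "frechet_derivative (%x. LB z. f z * k (x - z)) (at x) v = (LB z. f z * (v \<bullet> K (x - z)))" for x
   using frechet_derivative_at[OF g[unfolded gderiv_def, of x]] i2
   by (simp add: fun_eq_iff[symmetric] integral_inner_right[symmetric])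
    (metis (no_types, lifting) integral_inner_right)
  moreover have "(%x. LB z. f z * k (x - z)) differentiable_on UNIV"
   using g unfolding gderiv_def differentiable_on_def differentiable_def by blast
  ultimately show ?thesis using K by (intro conjI bexI[of _ "%x. v \<bullet> K x"]) auto
 qed
 have it: "\<exists>k'\<in>smf e. (\<forall>x. x \<bullet> x > e --> k' x = 0) \<and> iter_dd vs (%x. LB z. f z * k (x - z)) = (%x. LB z. f z * k' (x - z))"
  if "k : smf e" "!!x. x \<bullet> x > e ==> k x = 0" for k vs
 proof (induction vs)
  case Nil
  show ?case using that by auto
 next
  case (Cons v vs)
  then obtain k' where "k' : smf e" "!!x. x \<bullet> x > e ==> k' x = 0"
   "iter_dd vs (%x. LB z. f z * k (x - z)) = (%x. LB z. f z * k' (x - z))" by blast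
  then show ?case using step[of k' v] by simp
 qed
 show "k : smf e ==> (!!x. x \<bullet> x > e ==> k x = 0) ==>
  (\<exists>k'\<in>smf e. (\<forall>x. x \<bullet> x > e --> k' x = 0) \<and> iter_dd vs (%x. LB z. f z * k (x - z)) = (%x. LB z. f z * k' (x - z)))"
  by (rule it)
 show "k : smf e ==> (!!x. x \<bullet> x > e ==> k x = 0) ==> smooth_fun (%x. LB z. f z * k (x - z))"
  unfolding smooth_fun_def
 proof
  fix vs assume "k : smf e" "!!x. x \<bullet> x > e ==> k x = 0"
  from it[OF this, of vs] obtain k' where "k' : smf e" "\<forall>x. x \<bullet> x > e --> k' x = 0"
   "iter_dd vs (%x. LB z. f z * k (x - z)) = (%x. LB z. f z * k' (x - z))" by blast
  then show "iter_dd vs (%x. LB z. f z * k (x - z)) differentiable_on UNIV"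
   using step[of k'] by simp
 qed
qed

lemma AE_open_ex:
 fixes U :: "'a::euclidean_space set"
 assumes "AE x in lb. P x" "open U" "U \<noteq> {}" shows "\<exists>x\<in>U. P x"
proof (rule ccontr)
 assume "\<not> ?thesis"
 then have U: "U \<subseteq> {x. \<not> P x}" by auto
 obtain N where N: "N : null_sets lb" "{x : space lb. \<not> P x} \<subseteq> N"
  using assms(1) unfolding eventually_ae_filter by blast
 then have "negligible U" using U negligible_subset[of N U] by (auto simp: negligible_iff_null_sets)
 then show False using open_not_negligible assms by blast
qed

definition bump :: "real => 'n::finite pt => real" where
 "bump r x = th 0 (r\<^sup>2 - x \<bullet> x)"

lemma th_bounds: "0 <= th 0 t" "th 0 t <= 1" by (auto simp: th_def)

lemma th_continuous: "continuous_on S (%x. th k (h x))" if "continuous_on S h"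
proof -
 have "continuous_on UNIV (th k)"
  using th_deriv[of k] by (meson DERIV_isCont continuous_at_imp_continuous_on)
 then show ?thesis by (rule continuous_on_compose2[OF _ that]) auto
qed

lemma bump_bounds: "0 <= bump r x" "bump r x <= 1"
 by (auto simp: bump_def th_bounds)

lemma bump_zero: "norm x >= r ==> r >= 0 ==> bump r x = 0"
 by (auto simp: bump_def th_def dot_square_norm dest: power_mono[of r "norm x" 2])

lemma bump_pos: "norm x < r ==> bump r x > 0"
 by (auto simp: bump_def th_def dot_square_norm intro!: power_strict_mono)

lemma bump_minus: "bump r (x - z) = bump r (z - x)"
 by (simp add: bump_def inner_commute algebra_simps)

lemma bump_C1c:
 assumes "r > 0" shows "C1c UNIV (bump r) (%x. (- 2 * th 2 (r\<^sup>2 - x \<bullet> x)) *\<^sub>R x)"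
proof (rule C1c_I[of _ _ _ "cball 0 r"])
 show "GDERIV (bump r) x :> (- 2 * th 2 (r\<^sup>2 - x \<bullet> x)) *\<^sub>R x" for x :: "'a pt"
 proof -
  have "((%x. r\<^sup>2 - x \<bullet> x) has_derivative (%v. (-2) * (x \<bullet> v))) (at x)"
   by (auto intro!: derivative_eq_intros simp: inner_commute)
  from has_derivative_compose[OF this th_deriv[of 0 "r\<^sup>2 - x \<bullet> x", unfolded has_field_derivative_def]]
  show ?thesis by (simp add: bump_def[abs_def] gderiv_def inner_commute mult.assoc mult.left_commute numeral_2_eq_2)
 qed
 show "continuous_on UNIV (%x::'a pt. (- 2 * th 2 (r\<^sup>2 - x \<bullet> x)) *\<^sub>R x)"
  by (intro continuous_intros th_continuous)
 show "(- 2 * th 2 (r\<^sup>2 - x \<bullet> x)) *\<^sub>R x = 0" if "x \<notin> cball 0 r" for x :: "'a pt"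
 proof -
  have "r\<^sup>2 <= x \<bullet> x" using that power_mono[of r "norm x" 2] assms by (simp add: power2_norm_eq_inner)
  then show ?thesis by (simp add: th_def)
 qed
qed (use assms in \<open>auto intro!: bump_zero\<close>)

definition bump_mass :: "'n::finite itself => real => real" where
 "bump_mass _ r = (LB x. bump r (x::'n pt))"

lemma bump_mass_pos: assumes "r > 0" shows "bump_mass TYPE('n::finite) r > 0"
proof -
 have "(LB x. bump r (x::'n pt)) \<noteq> 0"
 proof
  assume "(LB x. bump r (x::'n pt)) = 0"
  then have "AE x in lb. bump r (x::'n pt) = 0"
   using integral_nonneg_eq_0_iff_AE[OF C1c_l2(3)[OF bump_C1c[OF assms]]] bump_bounds by auto
  from AE_open_ex[OF this open_ball, of 0 r] assms obtain x :: "'n pt" where "norm x < r" "bump r x = 0" by auto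
  then show False using bump_pos[of x r] by simp
 qed
 moreover have "(LB x. bump r (x::'n pt)) >= 0" by (simp add: integral_nonneg_AE bump_bounds)
 ultimately show ?thesis by (simp add: bump_mass_def)
qed

lemma bump_avg_integrable:
 fixes G :: "'n::finite pt => 'b::euclidean_space"
 assumes "r > 0" "continuous_on UNIV G"
 shows "integrable lb (%z. bump r (x - z) *\<^sub>R G z)"
proof -
 have c: "continuous_on UNIV (%z. bump r (x - z) *\<^sub>R G z)"
  by (intro continuous_on_scaleR assms continuous_on_compose2[OF C1cD(3)[OF bump_C1c[OF assms(1)]], of UNIV "%z. x - z"] continuous_intros) auto
 have z: "bump r (x - z) *\<^sub>R G z = 0" if "z \<notin> cball x r" for z
  using that bump_zero[of r "x - z"] assms(1) by (auto simp: dist_norm)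
 obtain B where "\<forall>z. norm (bump r (x - z) *\<^sub>R G z) <= B" using bounded_compact_support[OF c compact_cball z] by blast
 then show ?thesis
  using l2_bounded_support(2)[OF continuous_borel_lebesgue[OF c] bounded_cball[of x r], of B] z by auto
qed

lemma bump_avg_mass:
 fixes x :: "'n::finite pt"
 assumes "r > 0" shows "(LB z. bump r (x - z)) = bump_mass TYPE('n) r"
proof -
 have "(LB z. bump r (x - z)) = (LB z. bump r (z + - x))"
  using bump_minus[of r x] by simp
 also have "... = bump_mass TYPE('n) r"
  unfolding bump_mass_def by (rule integral_shift[OF C1c_measurable(1)[OF bump_C1c[OF assms]]])
 finally show ?thesis .
qed

lemma bump_avg:
 fixes G :: "'n::finite pt => 'b::euclidean_space"
 assumes "r > 0" "continuous_on UNIV G" "!!z. norm (z - x) <= r ==> norm (G z - a) <= e"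
 shows "norm ((1 / bump_mass TYPE('n) r) *\<^sub>R (LB z. bump r (x - z) *\<^sub>R G z) - a) <= e"
proof -
 let ?c = "bump_mass TYPE('n) r"
 have c: "?c > 0" by (rule bump_mass_pos[OF assms(1)])
 have i1: "integrable lb (%z. bump r (x - z) *\<^sub>R G z)" by (rule bump_avg_integrable[OF assms(1,2)])
 have i2: "integrable lb (%z. bump r (x - z))" using bump_avg_integrable[OF assms(1), of "%z. 1::real" x] by simp
 have "(LB z. bump r (x - z) *\<^sub>R a) = (LB z. bump r (x - z)) *\<^sub>R a"
  by (rule integral_scaleR_left) (use i2 in blast)
 then have s: "(LB z. bump r (x - z) *\<^sub>R a) = ?c *\<^sub>R a" by (simp add: bump_avg_mass[OF assms(1)])
 have "(LB z. bump r (x - z) *\<^sub>R G z) - ?c *\<^sub>R a = (LB z. bump r (x - z) *\<^sub>R (G z - a))"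
  unfolding s[symmetric] using i1 i2 by (simp add: scaleR_diff_right)
 also have "norm ... <= (LB z. bump r (x - z) * e)"
 proof (rule Bochner_Integration.integral_norm_bound_integral)
  show "integrable lb (%z. bump r (x - z) *\<^sub>R (G z - a))"
   by (intro bump_avg_integrable assms continuous_intros)
  show "norm (bump r (x - z) *\<^sub>R (G z - a)) <= bump r (x - z) * e" for z
  proof (cases "norm (z - x) <= r")
   case True
   then show ?thesis using assms(3)[OF True] bump_bounds[of r "x - z"] by (simp add: mult_left_mono)
  next
   case False
   then show ?thesis using bump_zero[of r "x - z"] assms(1) by (simp add: norm_minus_commute)
  qed
 qed (use i2 in simp)
 also have "... = ?c * e" by (simp add: bump_avg_mass[OF assms(1)])
 finally have b: "norm ((LB z. bump r (x - z) *\<^sub>R G z) - ?c *\<^sub>R a) <= ?c * e" .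
 have "(1 / ?c) *\<^sub>R (LB z. bump r (x - z) *\<^sub>R G z) - a = (1 / ?c) *\<^sub>R ((LB z. bump r (x - z) *\<^sub>R G z) - ?c *\<^sub>R a)"
  using c by (simp add: scaleR_diff_right)
 then have "norm ((1 / ?c) *\<^sub>R (LB z. bump r (x - z) *\<^sub>R G z) - a) = norm ((LB z. bump r (x - z) *\<^sub>R G z) - ?c *\<^sub>R a) / ?c"
  using c by simp
 also have "... <= e" using b c by (simp add: pos_divide_le_eq mult.commute)
 finally show ?thesis .
qed

text \<open>The normalising factor is attached to f, so that the kernel itself remains a member of
  \<open>smf\<close>.\<close>

definition moll :: "real => ('n::finite pt => real) => 'n pt => real" where
 "moll r f x = (LB z. (f z / bump_mass TYPE('n) r) * bump r (x - z))"

lemma moll_avg: "moll r f x = (1 / bump_mass TYPE('n) r) *\<^sub>R (LB z. bump r (x - z) *\<^sub>R f z)"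
 for f :: "'n::finite pt => real"
 unfolding moll_def by (subst Bochner_Integration.integral_scaleR_right[symmetric]) (simp add: mult.commute)

lemma moll_close:
 fixes f :: "'n::finite pt => real"
 assumes "r > 0" "continuous_on UNIV f" "!!z. norm (z - x) <= r ==> \<bar>f z - a\<bar> <= e"
 shows "\<bar>moll r f x - a\<bar> <= e"
 using bump_avg[OF assms(1,2), of x a e] assms(3) by (simp add: moll_avg)

lemma continuous_compact_integrable:
 fixes f :: "'a::euclidean_space => 'b::euclidean_space"
 assumes "continuous_on UNIV f" "compact K" "!!x. x \<notin> K ==> f x = 0"
 shows "integrable lb f" "l2 lb f"
proof -
 obtain B where "\<forall>x. norm (f x) <= B" using bounded_compact_support[OF assms] by blast
 then show "integrable lb f" "l2 lb f"
  using l2_bounded_support[OF continuous_borel_lebesgue[OF assms(1)] compact_imp_bounded[OF assms(2)], of B] assms(3) by auto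
qed

lemma moll_GDERIV:
 fixes f :: "'n::finite pt => real"
 assumes "r > 0" "continuous_on UNIV f" "compact K" "!!x. x \<notin> K ==> f x = 0"
 shows "GDERIV (moll r f) x :> (LB z. (f z / bump_mass TYPE('n) r) *\<^sub>R ((- 2 * th 2 (r\<^sup>2 - (x - z) \<bullet> (x - z))) *\<^sub>R (x - z)))"
 unfolding moll_def[abs_def]
 using conv_GDERIV[OF _ bump_C1c[OF assms(1)], of "%z. f z / bump_mass TYPE('n) r" x] continuous_compact_integrable(1)[OF assms(2-4)]
 by simp

lemma moll_smooth:
 fixes f :: "'n::finite pt => real"
 assumes "r > 0" "continuous_on UNIV f" "compact K" "!!x. x \<notin> K ==> f x = 0"
 shows "smooth_fun (moll r f)"
proof -
 have i: "integrable lb (%z. f z / bump_mass TYPE('n) r)" using continuous_compact_integrable(1)[OF assms(2-4)] by simp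
 have "bump r : smf (r\<^sup>2)" unfolding bump_def[abs_def] by (rule smf_th)
 then show ?thesis unfolding moll_def[abs_def]
  by (rule conv_test_fun_smooth(2)[OF i]) (auto simp: bump_def th_def)
qed

lemma moll_support:
 fixes f :: "'n::finite pt => real"
 assumes "r > 0" "continuous_on UNIV f" "!!z. norm (z - x) <= r ==> f z = 0"
 shows "moll r f x = 0"
 using moll_close[OF assms(1,2), of x 0 0] assms(3) by simp

text \<open>The gradient of the mollification is an average of F: the derivative passes from the
  kernel to f because the product \<open>f z * bump r (x - z)\<close> has a gradient with integral
  zero.\<close>

lemma moll_grad_close:
 fixes f :: "'n::finite pt => real"
 assumes r: "r > 0" and f: "C1c U f F" and e: "!!z. norm (z - x) <= r ==> norm (F z - F x) <= e"
 shows "norm (grad (moll r f) x - F x) <= e"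
proof -
 let ?c = "bump_mass TYPE('n) r" and ?B = "%x::'n pt. (- 2 * th 2 (r\<^sup>2 - x \<bullet> x)) *\<^sub>R x"
 obtain K where K: "compact K" "!!x. x \<notin> K ==> f x = 0" using C1cD(4)[OF f] by blast
 note bC = bump_C1c[OF r, where 'a='n]
 have gB: "GDERIV (%z. bump r (x - z)) z :> - ?B (x - z)" for z
 proof -
  have "((%z. x - z) has_derivative (%h. - h)) (at z)" by (auto intro!: derivative_eq_intros)
  from has_derivative_compose[OF this C1cD(1)[OF bC, of "x - z", unfolded gderiv_def]]
  show ?thesis by (simp add: gderiv_def)
 qed
 have cB: "continuous_on UNIV (%z. - ?B (x - z))"
  by (intro continuous_intros th_continuous)
 have "C1c UNIV f F" using C1c_mono[OF f] by simp
 from C1c_mult[OF this gB cB open_UNIV]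
 have P: "C1c UNIV (%z. f z * bump r (x - z)) (%z. f z *\<^sub>R - ?B (x - z) + bump r (x - z) *\<^sub>R F z)" by simp
 have i1: "integrable lb (%z. bump r (x - z) *\<^sub>R F z)" by (rule bump_avg_integrable[OF r C1cD(2)[OF f]])
 have i2: "integrable lb (%z. f z *\<^sub>R ?B (x - z))"
 proof -
  obtain B where "\<forall>x. norm (?B x) <= B" using C1c_bounded[OF bC] by blast
  then show ?thesis using conv_integrable[OF C1c_l2(3)[OF f] C1cD(2)[OF bC], of B x] by simp
 qed
 have "(LB z. f z *\<^sub>R ?B (x - z)) = (LB z. bump r (x - z) *\<^sub>R F z)"
 proof (rule vector_eq_rdot[THEN iffD1, rule_format])
  fix v
  have "0 = (LB z. (f z *\<^sub>R - ?B (x - z) + bump r (x - z) *\<^sub>R F z) \<bullet> v)"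
   using C1c_integral_zero[OF P, of v] by simp
  also have "... = (LB z. (bump r (x - z) *\<^sub>R F z - f z *\<^sub>R ?B (x - z)) \<bullet> v)"
   by (intro int_cong refl) (simp only: inner_diff_left inner_add_left scaleR_minus_right inner_minus_left)
  also have "... = (LB z. bump r (x - z) *\<^sub>R F z - f z *\<^sub>R ?B (x - z)) \<bullet> v"
   by (rule integral_inner_left) (intro int_diff i1 i2)
  also have "... = (LB z. bump r (x - z) *\<^sub>R F z) \<bullet> v - (LB z. f z *\<^sub>R ?B (x - z)) \<bullet> v"
   by (subst Bochner_Integration.integral_diff[OF i1 i2]) (simp only: inner_diff_left)
  finally show "(LB z. f z *\<^sub>R ?B (x - z)) \<bullet> v = (LB z. bump r (x - z) *\<^sub>R F z) \<bullet> v" by simp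
 qed
 moreover have "grad (moll r f) x = (1 / ?c) *\<^sub>R (LB z. f z *\<^sub>R ?B (x - z))"
 proof -
  have "grad (moll r f) x = (LB z. (f z / ?c) *\<^sub>R ?B (x - z))"
   by (rule grad_eq[OF moll_GDERIV[OF r C1cD(3)[OF f] K]])
  also have "... = (LB z. (1 / ?c) *\<^sub>R (f z *\<^sub>R ?B (x - z)))"
   by (intro int_cong refl) simp
  also have "... = (1 / ?c) *\<^sub>R (LB z. f z *\<^sub>R ?B (x - z))"
   by (rule Bochner_Integration.integral_scaleR_right)
  finally show ?thesis .
 qed
 ultimately have g: "grad (moll r f) x = (1 / ?c) *\<^sub>R (LB z. bump r (x - z) *\<^sub>R F z)" by simp
 show ?thesis unfolding g by (rule bump_avg[OF r C1cD(2)[OF f] e])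
qed

section \<open>Approximation by test functions, and cut-off functions\<close>

lemma compact_nbhd:
 fixes K :: "'a::euclidean_space set"
 assumes "compact K" "K \<subseteq> U" "open U"
 obtains d K' where "d > 0" "compact K'" "K' \<subseteq> U" "K \<subseteq> K'" "!!x y. x : K ==> norm (y - x) <= d ==> y : K'"
proof -
 obtain d where d: "d > 0" "(\<Union>x\<in>K. cball x d) \<subseteq> U"
  using compact_subset_open_imp_cball_epsilon_subset[OF assms(1,3,2)] by blast
 let ?K = "{x + y | x y. x : K \<and> y : cball 0 d}"
 have i: "y : ?K" if "x : K" "norm (y - x) <= d" for x y
 proof -
  have "y = x + (y - x)" by simp
  then show ?thesis using that by (metis (mono_tags, lifting) mem_Collect_eq mem_cball_0)
 qed
 show ?thesis
 proof (rule that[OF d(1)])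
  show "compact ?K" by (intro compact_sums assms compact_cball)
  show "?K \<subseteq> U"
  proof
   fix z assume "z : ?K"
   then obtain x y where "z = x + y" "x : K" "y : cball 0 d" by blast
   then have "z : cball x d" "x : K" by (auto simp: dist_norm)
   then show "z : U" using d(2) by blast
  qed
  show "K \<subseteq> ?K" using i[of x x for x] d(1) by auto
 qed (use i in blast)
qed

text \<open>K' is chosen before e, so that a whole approximating sequence is supported in one
  compact set. The claim on gradients is conditional on f being of class C^1, so that the lemma also
  serves for merely continuous f, as in \<open>smeas_eq_0\<close>.\<close>

lemma approx_test_fun:
 fixes U :: "'n::finite pt set" and f :: "'n pt => real"
 assumes U: "open U" and K: "compact K" "K \<subseteq> U" and f: "continuous_on UNIV f" "!!x. x \<notin> K ==> f x = 0"
 obtains K' where "compact K'" "K' \<subseteq> U"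
  "!!e. e > 0 ==> \<exists>p. test_fun U p \<and> (\<forall>x. x \<notin> K' --> p x = 0 \<and> f x = 0) \<and> (\<forall>x. \<bar>p x - f x\<bar> <= e) \<and>
     (\<forall>F. C1c U f F --> (\<forall>x. norm (grad p x - F x) <= e))"
proof -
 obtain d K' where d: "d > 0" "compact K'" "K' \<subseteq> U" "K \<subseteq> K'" "!!x y. x : K ==> norm (y - x) <= d ==> y : K'"
  using compact_nbhd[OF K U] by blast
 have "\<exists>p. test_fun U p \<and> (\<forall>x. x \<notin> K' --> p x = 0 \<and> f x = 0) \<and> (\<forall>x. \<bar>p x - f x\<bar> <= e) \<and>
     (\<forall>F. C1c U f F --> (\<forall>x. norm (grad p x - F x) <= e))" if e: "e > 0" for e
 proof -
  obtain d1 where d1: "d1 > 0" "!!x y. norm (x - y) < d1 ==> norm (f x - f y) < e"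
   using uniform_continuity_compact_support[OF f(1) K(1) f(2) e] by metis
  have "\<exists>d2>0. \<forall>F. C1c U f F --> (\<forall>x y. norm (x - y) < d2 --> norm (F x - F y) < e)"
  proof (cases "\<exists>F. C1c U f F")
   case True
   then obtain F where F: "C1c U f F" by blast
   then obtain L where L: "compact L" "!!x. x \<notin> L ==> F x = 0" using C1cD(4)[OF F] by blast
   obtain d2 where d2: "d2 > 0" "!!x y. norm (x - y) < d2 ==> norm (F x - F y) < e"
    using uniform_continuity_compact_support[OF C1cD(2)[OF F] L e] by metis
   have "F' = F" if "C1c U f F'" for F' using C1cD(1)[OF that] C1cD(1)[OF F] GDERIV_unique by blast
   then show ?thesis using d2 by metis
  qed (auto intro: zero_less_one)
  then obtain d2 where d2: "d2 > 0" "!!F x y. C1c U f F ==> norm (x - y) < d2 ==> norm (F x - F y) < e" by metis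
  define r where "r = min d (min (d1/2) (d2/2))"
  have r: "r > 0" "r <= d" "r < d1" "r < d2" using d d1 d2 by (auto simp: r_def)
  have z: "moll r f x = 0" if "x \<notin> K'" for x
  proof (rule moll_support[OF r(1) f(1)])
   fix z assume "norm (z - x) <= r"
   then have "norm (x - z) <= d" using r by (simp add: norm_minus_commute)
   then show "f z = 0" using d(5)[of z x] that f(2)[of z] by blast
  qed
  have cl: "closure {x. moll r f x \<noteq> 0} \<subseteq> K'"
   by (rule closure_minimal) (use z compact_imp_closed[OF d(2)] in auto)
  have "compact (closure {x. moll r f x \<noteq> 0})"
   using compact_Int_closed[OF d(2) closed_closure, of "{x. moll r f x \<noteq> 0}"] cl by (simp add: Int_absorb1)
  then have "test_fun U (moll r f)"
   unfolding test_fun_def using moll_smooth[OF r(1) f(1) K(1) f(2)] cl d(3) by auto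
  moreover have "\<bar>moll r f x - f x\<bar> <= e" for x
   by (rule moll_close[OF r(1) f(1)]) (use d1(2) r in \<open>force intro: less_imp_le\<close>)
  moreover have "norm (grad (moll r f) x - F x) <= e" if "C1c U f F" for F x
   by (rule moll_grad_close[OF r(1) that]) (use d2(2)[OF that] r in \<open>force intro: less_imp_le\<close>)
  moreover have "f x = 0" if "x \<notin> K'" for x using that f(2) d(4) by blast
  ultimately show ?thesis using z by (intro exI[of _ "moll r f"]) auto
 qed
 then show ?thesis using that[OF d(2,3)] by blast
qed

text \<open>The common compact support turns uniform convergence of the functions and of their
  gradients into convergence in \<open>L\<^sup>2\<close>.\<close>

lemma C1c_approx:
 fixes U :: "'n::finite pt set"
 assumes U: "open U" and z: "C1c U z Z"
 obtains K ps where "compact K" "K \<subseteq> U" "!!k. test_fun U (ps k)" "!!k x. x \<notin> K ==> ps k x = 0" "!!x. x \<notin> K ==> z x = 0"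
  "!!k x. \<bar>ps k x - z x\<bar> <= inverse (real (Suc k))"
  "l2lim lb ps z" "l2lim lb (%k. grad (ps k)) Z"
proof -
 obtain K0 where K0: "compact K0" "K0 \<subseteq> U" "!!x. x \<notin> K0 ==> z x = 0" using C1cD(4)[OF z] by blast
 obtain K where K: "compact K" "K \<subseteq> U" and a:
  "!!e. e > 0 ==> \<exists>p. test_fun U p \<and> (\<forall>x. x \<notin> K --> p x = 0 \<and> z x = 0) \<and> (\<forall>x. \<bar>p x - z x\<bar> <= e) \<and>
     (\<forall>F. C1c U z F --> (\<forall>x. norm (grad p x - F x) <= e))"
  using approx_test_fun[OF U K0(1,2) C1cD(3)[OF z] K0(3)] by metis
 have "\<forall>k. \<exists>p. test_fun U p \<and> (\<forall>x. x \<notin> K --> p x = 0 \<and> z x = 0) \<and> (\<forall>x. \<bar>p x - z x\<bar> <= inverse (real (Suc k))) \<and>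
     (\<forall>x. norm (grad p x - Z x) <= inverse (real (Suc k)))"
  using a z by (metis inverse_positive_iff_positive of_nat_0_less_iff zero_less_Suc)
 then obtain ps where ps: "!!k. test_fun U (ps k)" "!!k x. x \<notin> K ==> ps k x = 0" "!!x. x \<notin> K ==> z x = 0"
  "!!k x. \<bar>ps k x - z x\<bar> <= inverse (real (Suc k))" "!!k x. norm (grad (ps k) x - Z x) <= inverse (real (Suc k))"
  by metis
 note C = test_fun_C1c[OF ps(1)]
 have o: "open (- K)" using K(1) by (simp add: compact_imp_closed open_Compl)
 have zero: "G x = 0" if "x \<notin> K" "!!x. GDERIV g x :> G x" "!!x. x \<notin> K ==> g x = 0" for g :: "'n pt => real" and G x
 proof -
  have "(g has_derivative (%h. 0)) (at x)"
   by (rule has_derivative_transform_within_open[OF has_derivative_const o]) (use that in auto)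
  then have "GDERIV g x :> 0" unfolding gderiv_def by simp
  then show ?thesis using that GDERIV_unique by blast
 qed
 have gz: "grad (ps k) x = 0" "Z x = 0" if "x \<notin> K" for k x
  using zero[OF that C1cD(1)[OF C] ps(2)] zero[OF that C1cD(1)[OF z] ps(3)] by auto
 have conv: "l2lim lb fs f"
  if m: "!!k. fs k : bml" "f : bml"
   and l: "l2 lb f" and d: "!!k x. norm (fs k x - f x) <= inverse (real (Suc k))"
   and s: "!!k x. x \<notin> K ==> fs k x = 0" "!!x. x \<notin> K ==> f x = 0"
  for fs and f :: "'n pt => 'c::euclidean_space"
 proof -
  have c: "l2 lb (%x. indicator K x :: real)"
   using l2_bounded_support(1)[of "%x. indicator K x :: real" K 1] compact_imp_bounded[OF K(1)] compact_lebesgue(1)[OF K(1)]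
   by (auto simp: indicator_def)
  have le: "norm (fs k x - f x) <= norm (inverse (real (Suc k)) *\<^sub>R (indicator K x :: real))" for k x
   using d[of k x] s[of x] by (cases "x : K") auto
  have mk: "(%x. fs k x - f x) : bml" for k using m by simp
  note b = l2_bound[OF l2_scaleR[OF c] mk AE_I2[OF le]]
  show ?thesis
  proof (rule l2limI_le[OF _ l])
   show "l2 lb (fs k)" for k using l2_add[OF b(1) l, of k] by simp
   show "l2n lb (%x. fs k x - f x) <= inverse (real (Suc k)) * l2n lb (%x. indicator K x :: real)" for k
    using b(2)[of k] unfolding l2n_scaleR by simp
   show "(%k. inverse (real (Suc k)) * l2n lb (%x. indicator K x :: real)) ----> 0"
    using tendsto_mult_left_zero[OF LIMSEQ_inverse_real_of_nat] .
  qed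
 qed
 show ?thesis
  using that[OF K ps(1-4)] conv[of ps z] conv[of "%k. grad (ps k)" Z] C1c_measurable[OF C] C1c_measurable[OF z] C1c_l2[OF z] ps gz
  by simp
qed

lemma cutoff:
 fixes K :: "'n::finite pt set"
 assumes K: "compact K" "K \<subseteq> U" and U: "open U"
 obtains c C where "C1c U c C" "!!x. x : K ==> c x = 1" "!!x. x : K ==> C x = 0" "!!x. 0 <= c x" "!!x. c x <= 1"
proof (cases "K = {}")
 case True
 then show ?thesis using that[of "%x. 0" "%x. 0"] C1c_zero by auto
next
 case False
 obtain d K' where d: "d > 0" "compact K'" "K' \<subseteq> U" "K \<subseteq> K'" "!!x y. x : K ==> norm (y - x) <= d ==> y : K'"
  using compact_nbhd[OF K U] by blast
 \<comment> \<open>This f is 1 up to distance d/3 from K and 0 from distance 2d/3 on; mollification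
   with radius d/3 then leaves the value 1 on K and the value 0 outside K'.\<close>
 define f where "f x = max 0 (min 1 (2 - infdist x K / (d/3)))" for x
 have cf: "continuous_on UNIV f" unfolding f_def using d by (intro continuous_intros) auto
 have f1: "f x = 1" if "infdist x K <= d/3" for x using that d by (simp add: f_def)
 have f0: "f x = 0" if "infdist x K >= 2*d/3" for x using that d by (simp add: f_def field_simps)
 have fb: "0 <= f x" "f x <= 1" for x by (auto simp: f_def)
 have inK: "y : K'" if "infdist y K <= d" for y
 proof -
  obtain x where "x : K" "infdist y K = dist y x" using infdist_attains_inf[OF compact_imp_closed[OF K(1)] False] by metis
  then show ?thesis using d(5)[of x y] that by (simp add: dist_norm)
 qed
 have fK: "f x = 0" if "x \<notin> K'" for x using f0[of x] inK[of x] that d(1) by fastforce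
 let ?r = "d/3"
 have r: "?r > 0" using d by simp
 have mz: "moll ?r f x = 0" if "x \<notin> K'" for x
 proof (rule moll_support[OF r cf])
  fix z assume "norm (z - x) <= d/3"
  then have "infdist x K <= infdist z K + d/3" using infdist_triangle[of x K z] by (simp add: dist_norm norm_minus_commute)
  moreover have "infdist x K > d" using inK[of x] that by fastforce
  ultimately show "f z = 0" using f0[of z] by simp
 qed
 have m1: "moll ?r f x = 1" if "x : K" for x
 proof -
  have "\<bar>moll ?r f x - 1\<bar> <= 0"
  proof (rule moll_close[OF r cf])
   fix z assume "norm (z - x) <= d/3"
   then have "infdist z K <= d/3" using infdist_le[OF that, of z] by (simp add: dist_norm)
   then show "\<bar>f z - 1\<bar> <= 0" using f1[of z] by simp
  qed
  then show ?thesis by simp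
 qed
 have mb: "0 <= moll ?r f x" "moll ?r f x <= 1" for x
  using moll_close[OF r cf, of x "1/2" "1/2"] fb by (auto simp: abs_le_iff field_simps)
 have sm: "smooth_fun (moll ?r f)" by (rule moll_smooth[OF r cf d(2) fK])
 have cl: "closure {x. moll ?r f x \<noteq> 0} \<subseteq> K'"
  by (rule closure_minimal) (use mz compact_imp_closed[OF d(2)] in auto)
 have "compact (closure {x. moll ?r f x \<noteq> 0})"
  using compact_Int_closed[OF d(2) closed_closure, of "{x. moll ?r f x \<noteq> 0}"] cl by (simp add: Int_absorb1)
 then have "test_fun U (moll ?r f)" unfolding test_fun_def using sm cl d(3) by auto
 note C = test_fun_C1c[OF this]
 \<comment> \<open>At points of K the cut-off attains its maximum 1, so its gradient vanishes there,
   also at boundary points of K.\<close>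
 have "grad (moll ?r f) x = 0" if "x : K" for x
 proof -
  have "(%h. h \<bullet> grad (moll ?r f) x) = (%v. 0)"
   by (rule differential_zero_maxmin[of x UNIV "moll ?r f"]) (use C1cD(1)[OF C] mb m1[OF that] in \<open>auto simp: gderiv_def\<close>)
  then show ?thesis by (metis inner_eq_zero_iff)
 qed
 then show ?thesis using that[OF C m1 _ mb] by blast
qed

section \<open>Weak solutions\<close>

text \<open>Functions on \<open>U\<close> are extended by zero, so that all integrals are over the whole space: \<open>h10 U y G\<close> means
 \<open>y\<in>H\<^sup>1\<^sub>0(U)\<close> with \<open>\<nabla>y = G\<close>, and then \<open>wsol U G r\<close> is the weak form of \<open>- \<Delta>y = r\<close> in \<open>U\<close>.\<close>
definition h10 :: "'a::euclidean_space set => ('a => real) => ('a => 'a) => bool" where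
 "h10 U y G \<longleftrightarrow> (\<exists>ps Ps. (\<forall>k. C1c U (ps k) (Ps k)) \<and> l2lim lb ps y \<and> l2lim lb Ps G)"

definition wsol :: "'a::euclidean_space set => ('a => 'a) => ('a => real) => bool" where
 "wsol U G r \<longleftrightarrow> (\<forall>z Z. C1c U z Z --> (LB x. G x \<bullet> Z x) = (LB x. r x * z x))"

lemma h10_l2: assumes "h10 U y G" shows "l2 lb y" "l2 lb G"
 using assms unfolding h10_def by (auto dest: l2limD(2))

lemma h10_add: assumes "h10 U y G" "h10 U z Z" shows "h10 U (%x. y x + z x) (%x. G x + Z x)"
proof -
 obtain ps Ps qs Qs where "!!k. C1c U (ps k) (Ps k)" "l2lim lb ps y" "l2lim lb Ps G"
  "!!k. C1c U (qs k) (Qs k)" "l2lim lb qs z" "l2lim lb Qs Z"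
  using assms unfolding h10_def by blast
 then show ?thesis unfolding h10_def
  by (intro exI[of _ "%k x. ps k x + qs k x"] exI[of _ "%k x. Ps k x + Qs k x"]) (auto intro!: C1c_add l2lim_add)
qed

lemma h10_scaleR: assumes "h10 U y G" shows "h10 U (%x. c * y x) (%x. c *\<^sub>R G x)"
proof -
 obtain ps Ps where p: "!!k. C1c U (ps k) (Ps k)" "l2lim lb ps y" "l2lim lb Ps G"
  using assms unfolding h10_def by blast
 then show ?thesis unfolding h10_def
  using l2lim_scaleR[OF p(2), of c] l2lim_scaleR[OF p(3), of c] C1c_scaleR[OF p(1), of c]
  by (intro exI[of _ "%k x. c * ps k x"] exI[of _ "%k x. c *\<^sub>R Ps k x"]) auto
qed

lemma h10_diff: assumes "h10 U y G" "h10 U z Z" shows "h10 U (%x. y x - z x) (%x. G x - Z x)"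
 using h10_add[OF assms(1) h10_scaleR[OF assms(2), of "-1"]] by simp

lemma h10_cong_AE:
 assumes "h10 U y G" "AE x in lb. y x = z x" "z : bml" shows "h10 U z G"
 using assms l2lim_cong_AE unfolding h10_def by blast

lemma h10_zero_outside: assumes "h10 U y G" shows "AE x in lb. x \<notin> U --> y x = 0"
proof -
 obtain ps Ps where p: "!!k. C1c U (ps k) (Ps k)" "l2lim lb ps y"
  using assms unfolding h10_def by blast
 obtain r where "strict_mono (r::nat=>nat)" "AE x in lb. (%k. ps (r k) x) ----> y x" using l2lim_AE_subseq[OF p(2)] .
 from this(2) show ?thesis
 proof eventually_elim
  case (elim x)
  show ?case
  proof
   assume "x \<notin> U"
   then have "ps (r k) x = 0" for k using C1cD(5)[OF p(1)] by blast
   then show "y x = 0" using elim by (simp add: LIMSEQ_const_iff)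
  qed
 qed
qed

lemma l2lim_norm: assumes "l2lim M fs f" shows "(%k. l2n M (fs k)) ----> l2n M f"
proof -
 note D = l2limD[OF assms]
 have "norm (l2n M (fs k) - l2n M f) <= l2n M (%x. fs k x - f x)" for k
  using l2n_triangle[OF l2_diff[OF D(1,2)] D(2), of k] l2n_triangle[OF l2_diff[OF D(2) D(1)[of k]] D(1)[of k]]
   l2n_minus_commute[of M f "fs k"] by (simp add: abs_le_iff)
 then have "(%k. l2n M (fs k) - l2n M f) ----> 0"
  by (rule Lim_null_comparison[OF always_eventually[OF allI] D(3)])
 then show ?thesis by (rule Lim_null[THEN iffD2])
qed

lemma h10_poincare:
 assumes "h10 U y G" "U \<subseteq> cball 0 R" "R >= 0" shows "l2n lb y <= 2 * R * l2n lb G"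
proof -
 obtain ps Ps where p: "!!k. C1c U (ps k) (Ps k)" "l2lim lb ps y" "l2lim lb Ps G"
  using assms unfolding h10_def by blast
 show ?thesis
  by (rule LIMSEQ_le[OF l2lim_norm[OF p(2)] tendsto_mult_left[OF l2lim_norm[OF p(3)]]])
   (use poincare[OF p(1) assms(2,3)] in blast)
qed

lemma l2_real_mult: "integrable M (%x. f x * g x)" if "l2 M f" "l2 M g" for f g :: "_ => real"
 using l2_inner_integrable[OF that] by simp

lemma wsol_h10:
 assumes "wsol U G r" "l2 lb G" "l2 lb r" "h10 U z Z"
 shows "(LB x. G x \<bullet> Z x) = (LB x. r x * z x)"
proof -
 obtain ps Ps where p: "!!k. C1c U (ps k) (Ps k)" "l2lim lb ps z" "l2lim lb Ps Z"
  using assms unfolding h10_def by blast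
 have e: "(LB x. G x \<bullet> Ps k x) = (LB x. r x * ps k x)" for k
  using assms(1) p(1) unfolding wsol_def by blast
 have "(%k. LB x. G x \<bullet> Ps k x) ----> (LB x. G x \<bullet> Z x)"
  by (rule l2lim_inner[OF l2lim_const[OF assms(2)] p(3)])
 moreover have "(%k. LB x. r x * ps k x) ----> (LB x. r x * z x)"
  using l2lim_inner[OF l2lim_const[OF assms(3)] p(2)] by simp
 ultimately show ?thesis unfolding e by (rule LIMSEQ_unique)
qed

lemma wsol_cong_AE:
 assumes "wsol U G r" "AE x in lb. r x = s x" "r : bml" "s : bml" shows "wsol U G s"
 unfolding wsol_def
proof (intro allI impI)
 fix z Z assume z: "C1c U z Z"
 have "(LB x. r x * z x) = (LB x. s x * z x)"
  using assms(2-4) C1c_measurable[OF z] by (intro integral_cong_AE) (auto elim: eventually_mono)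
 then show "(LB x. G x \<bullet> Z x) = (LB x. s x * z x)" using assms(1) z unfolding wsol_def by metis
qed

lemma wsol_diff:
 assumes "wsol U G r" "wsol U F s" "l2 lb G" "l2 lb F" "l2 lb r" "l2 lb s"
 shows "wsol U (%x. G x - F x) (%x. r x - s x)"
 unfolding wsol_def
proof (intro allI impI)
 fix z Z assume z: "C1c U z Z"
 note l = C1c_l2[OF z]
 show "(LB x. (G x - F x) \<bullet> Z x) = (LB x. (r x - s x) * z x)"
  using assms z l unfolding wsol_def
  by (simp add: inner_diff_left left_diff_distrib l2_inner_integrable l2_real_mult)
qed

lemma wsol_scaleR: "wsol U G r ==> wsol U (%x. c *\<^sub>R G x) (%x. c * r x)"
 unfolding wsol_def by (simp add: mult.assoc)

section \<open>The linear problem by Dirichlet's principle\<close>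

lemma l2_parallelogram:
 assumes "l2 M f" "l2 M g"
 shows "(l2n M (%x. f x + (1/2) *\<^sub>R (g x - f x)))\<^sup>2 = (l2n M f)\<^sup>2 / 2 + (l2n M g)\<^sup>2 / 2 - (l2n M (%x. g x - f x))\<^sup>2 / 4"
proof -
 have "(l2n M (%x. f x + (1/2) *\<^sub>R (g x - f x)))\<^sup>2 = (l2n M f)\<^sup>2 + (LINT x|M. f x \<bullet> (g x - f x)) + (l2n M (%x. g x - f x))\<^sup>2 / 4"
  using l2_inner_sq[OF assms(1) l2_diff[OF assms(2,1)], of "1/2"] by (simp add: power_divide)
 moreover have "(l2n M g)\<^sup>2 = (l2n M f)\<^sup>2 + 2 * (LINT x|M. f x \<bullet> (g x - f x)) + (l2n M (%x. g x - f x))\<^sup>2"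
  using l2_inner_sq[OF assms(1) l2_diff[OF assms(2,1)], of 1] by simp
 ultimately show ?thesis by linarith
qed

text \<open>The parallelogram law makes the gradients of a minimising sequence of \<open>E\<close> a
  Cauchy sequence, and the Poincare inequality transfers this to the functions themselves. The weak
  equation is the vanishing of the first variation at the limit.\<close>

theorem linear_solver:
 fixes U :: "'a::euclidean_space set"
 assumes U: "U \<subseteq> cball 0 R" "R >= 0" and L: "L >= 0" and h: "l2 lb (h :: 'a => real)"
 obtains y G where "h10 U y G" "wsol U G (%x. h x - L * y x)"
proof -
 define E where "E z Z = (l2n lb Z)\<^sup>2 / 2 + L / 2 * (l2n lb z)\<^sup>2 - (LB x. h x * z x)" for z :: "'a => real" and Z :: "'a => 'a"
 define S where "S = {E z Z | z Z. C1c U z Z}"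
 have low: "E z Z >= - (2 * R\<^sup>2 * (l2n lb h)\<^sup>2)" if z: "C1c U z Z" for z Z
 proof -
  note l = C1c_l2[OF z]
  have "(LB x. h x * z x) <= l2n lb h * l2n lb z"
   using l2_Cauchy_Schwarz[OF h l(1)] by (simp add: abs_le_iff)
  also have "... <= l2n lb h * (2 * R * l2n lb Z)"
   by (intro mult_left_mono poincare[OF z U]) simp
  also have "... <= (l2n lb Z)\<^sup>2 / 2 + 2 * R\<^sup>2 * (l2n lb h)\<^sup>2"
   using zero_le_power2[of "l2n lb Z - 2 * R * l2n lb h"]
   by (simp add: power2_eq_square algebra_simps)
  finally show ?thesis using L unfolding E_def by (smt (verit) mult_nonneg_nonneg zero_le_power2 divide_nonneg_nonneg)
 qed
 have bdd: "bdd_below S" using low by (auto simp: S_def intro!: bdd_belowI)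
 have ne: "S \<noteq> {}" using C1c_zero by (auto simp: S_def)
 define m where "m = Inf S"
 have mlow: "m <= E z Z" if "C1c U z Z" for z Z
  unfolding m_def by (rule cInf_lower[OF _ bdd]) (use that in \<open>auto simp: S_def\<close>)
 have "\<exists>z Z. C1c U z Z \<and> E z Z < m + inverse (real (Suc k))" for k
  using cInf_lessD[OF ne, of "m + inverse (real (Suc k))"] unfolding m_def[symmetric] by (auto simp: S_def)
 then obtain ps Ps where p: "!!k. C1c U (ps k) (Ps k)" "!!k. E (ps k) (Ps k) < m + inverse (real (Suc k))" by metis
 note pl = C1c_l2[OF p(1)]
 have key: "(l2n lb (%x. Ps i x - Ps j x))\<^sup>2 <= 4 * (inverse (real (Suc i)) + inverse (real (Suc j)))" for i j
 proof -
  let ?q = "%x. ps j x + (1/2) *\<^sub>R (ps i x - ps j x)" and ?Q = "%x. Ps j x + (1/2) *\<^sub>R (Ps i x - Ps j x)"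
  have q: "C1c U ?q ?Q"
   using C1c_add[OF p(1) C1c_scaleR[OF C1c_diff[OF p(1) p(1)]], of j "1/2" i j] by simp
  have "(LB x. h x * ?q x) = (LB x. h x * ps j x) / 2 + (LB x. h x * ps i x) / 2"
  proof -
   have "(LB x. h x * ?q x) = (LB x. (1/2) * (h x * ps j x) + (1/2) * (h x * ps i x))"
    by (intro int_cong refl) (simp add: algebra_simps)
   then show ?thesis using l2_real_mult[OF h pl(1)] by simp
  qed
  moreover have "L * (l2n lb ?q)\<^sup>2 = L * (l2n lb (ps j))\<^sup>2 / 2 + L * (l2n lb (ps i))\<^sup>2 / 2 - L * (l2n lb (%x. ps i x - ps j x))\<^sup>2 / 4"
   unfolding l2_parallelogram[OF pl(1) pl(1)] by (simp only: right_diff_distrib distrib_left times_divide_eq_right)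
  moreover note l2_parallelogram[OF pl(2) pl(2), of j i]
  ultimately have "8 * E ?q ?Q = 4 * E (ps j) (Ps j) + 4 * E (ps i) (Ps i) - (l2n lb (%x. Ps i x - Ps j x))\<^sup>2
    - L * (l2n lb (%x. ps i x - ps j x))\<^sup>2"
   unfolding E_def by argo
  moreover have "m <= E ?q ?Q" by (rule mlow[OF q])
  moreover have "L * (l2n lb (%x. ps i x - ps j x))\<^sup>2 >= 0" using L by simp
  moreover note p(2)[of i] p(2)[of j]
  ultimately show ?thesis by argo
 qed
 have CP: "\<exists>K. \<forall>i\<ge>K. \<forall>j\<ge>K. l2n lb (%x. Ps i x - Ps j x) < e" if "e > 0" for e
 proof -
  have "e\<^sup>2 / 8 > 0" using that by simp
  from reals_Archimedean[OF this] obtain K where K: "inverse (real (Suc K)) < e\<^sup>2 / 8" by blast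
  have "l2n lb (%x. Ps i x - Ps j x) < e" if "i >= K" "j >= K" for i j
  proof -
   have "inverse (real (Suc i)) <= inverse (real (Suc K))" "inverse (real (Suc j)) <= inverse (real (Suc K))"
    using that by (auto intro!: le_imp_inverse_le)
   then have "(l2n lb (%x. Ps i x - Ps j x))\<^sup>2 < e\<^sup>2" using key[of i j] K by argo
   then show ?thesis using \<open>e > 0\<close> by (metis less_imp_le power_less_imp_less_base)
  qed
  then show ?thesis by blast
 qed
 obtain G where G: "l2lim lb Ps G" using l2_complete[OF pl(2) CP] by blast
 have Cp: "\<exists>K. \<forall>i\<ge>K. \<forall>j\<ge>K. l2n lb (%x. ps i x - ps j x) < e" if "e > 0" for e
 proof -
  have "e / (2 * R + 1) > 0" using that U by auto
  from CP[OF this] obtain K where K: "!!i j. i >= K ==> j >= K ==> l2n lb (%x. Ps i x - Ps j x) < e / (2 * R + 1)" by blast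
  have "l2n lb (%x. ps i x - ps j x) < e" if "i >= K" "j >= K" for i j
  proof -
   have "l2n lb (%x. ps i x - ps j x) <= 2 * R * l2n lb (%x. Ps i x - Ps j x)"
    by (rule poincare[OF C1c_diff[OF p(1) p(1)] U])
   also have "... <= (2 * R + 1) * l2n lb (%x. Ps i x - Ps j x)" by (intro mult_right_mono) auto
   also have "... < (2 * R + 1) * (e / (2 * R + 1))" by (intro mult_strict_left_mono K that) (use U in auto)
   also have "... = e" using U by simp
   finally show ?thesis .
  qed
  then show ?thesis by blast
 qed
 obtain y where y: "l2lim lb ps y" using l2_complete[OF pl(1) Cp] by blast
 have "h10 U y G" using p(1) y G unfolding h10_def by blast
 moreover have "wsol U G (%x. h x - L * y x)"
  unfolding wsol_def
 proof (intro allI impI)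
  fix z Z assume z: "C1c U z Z"
  note l = C1c_l2[OF z]
  define a where "a k = (LB x. Ps k x \<bullet> Z x) + L * (LB x. ps k x * z x) - (LB x. h x * z x)" for k
  define al where "al = (LB x. G x \<bullet> Z x) + L * (LB x. y x * z x) - (LB x. h x * z x)"
  define q where "q = (l2n lb Z)\<^sup>2 / 2 + L / 2 * (l2n lb z)\<^sup>2"
  have q0: "q >= 0" using L by (simp add: q_def)
  have al: "a ----> al"
   unfolding a_def al_def using l2lim_inner[OF y l2lim_const[OF l(1)]]
   by (intro tendsto_intros l2lim_inner[OF G l2lim_const[OF l(2)]]) simp
  have ex: "E (%x. ps k x + t *\<^sub>R z x) (%x. Ps k x + t *\<^sub>R Z x) = E (ps k) (Ps k) + t * a k + t\<^sup>2 * q" for k t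
  proof -
   have "(LB x. h x * (ps k x + t *\<^sub>R z x)) = (LB x. h x * ps k x + t * (h x * z x))"
    by (intro int_cong refl) (simp add: algebra_simps)
   also have "... = (LB x. h x * ps k x) + t * (LB x. h x * z x)"
    using l2_real_mult[OF h pl(1)] l2_real_mult[OF h l(1)] by simp
   finally show ?thesis
    unfolding E_def l2_inner_sq[OF pl(1) l(1)] l2_inner_sq[OF pl(2) l(2)] a_def q_def by (simp add: algebra_simps)
  qed
  have pos: "0 <= t * al + t\<^sup>2 * q" for t
  proof (rule LIMSEQ_le_const)
   show "(%k. inverse (real (Suc k)) + (t * a k + t\<^sup>2 * q)) ----> t * al + t\<^sup>2 * q"
   proof -
    have "(%k. t * a k + t\<^sup>2 * q) ----> t * al + t\<^sup>2 * q" by (intro tendsto_intros al)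
    from tendsto_add[OF LIMSEQ_inverse_real_of_nat this] show ?thesis by simp
   qed
   have "0 <= inverse (real (Suc k)) + (t * a k + t\<^sup>2 * q)" for k
    using mlow[OF C1c_add[OF p(1) C1c_scaleR[OF z]], of k t] ex[of k t] p(2)[of k] by simp
   then show "\<exists>N. \<forall>n\<ge>N. 0 <= inverse (real (Suc n)) + (t * a n + t\<^sup>2 * q)" by blast
  qed
  have "al = 0"
  proof (rule ccontr)
   assume "al \<noteq> 0"
   \<comment> \<open>The parabola \<open>t * al + t\<^sup>2 * q\<close> takes the negative value
     \<open>- d\<^sup>2\<close> at t = - d.\<close>
   define d where "d = al / (q + 1)"
   have al_d: "al = d * (q + 1)" using q0 by (simp add: d_def)
   then have "d \<noteq> 0" using \<open>al \<noteq> 0\<close> by auto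
   have "0 <= (- d) * al + (- d)\<^sup>2 * q" by (rule pos)
   also have "... = - d\<^sup>2" unfolding al_d by (simp add: power2_eq_square algebra_simps)
   also have "... < 0" using \<open>d \<noteq> 0\<close> by simp
   finally show False by simp
  qed
  then show "(LB x. G x \<bullet> Z x) = (LB x. (h x - L * y x) * z x)"
   using l2_real_mult[OF h l(1)] l2_real_mult[OF l2limD(2)[OF y] l(1)]
   by (simp add: al_def left_diff_distrib mult.assoc)
 qed
 ultimately show ?thesis using that by blast
qed

text \<open>\<open>Ph\<close> replaces the positive part: being \<open>C\<^sup>1\<close>, it keeps truncations within \<open>C1c\<close>.\<close>
definition sg :: "real => real" where "sg t = max 0 t / (1 + max 0 t)"
definition Ph :: "real => real" where "Ph t = sg t * t"
definition dPh :: "real => real" where "dPh t = 1 - 1 / (1 + max 0 t)\<^sup>2"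

text \<open>The bounds on \<open>sg\<close> present \<open>Ph t = sg t * t\<close> as a bounded
  multiple of t, which is the form in which \<open>l2lim_mult_bounded\<close> passes to the limit in
  truncated functions.\<close>

lemma sg_props: "0 <= sg t" "sg t <= 1" "t <= 0 ==> sg t = 0" "t > 0 ==> sg t > 0" "continuous_on S sg"
proof -
 show "0 <= sg t" "sg t <= 1" "t <= 0 ==> sg t = 0" "t > 0 ==> sg t > 0" by (auto simp: sg_def divide_le_eq)
 show "continuous_on S sg" unfolding sg_def by (intro continuous_intros) (auto simp: max_def)
qed

lemma dPh_props: "0 <= dPh t" "dPh t <= 1" "t <= 0 ==> dPh t = 0" "t > 0 ==> dPh t > 0" "continuous_on S dPh"
proof -
 have "(1 + max 0 t)\<^sup>2 >= 1" by (rule one_le_power) auto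
 then show "0 <= dPh t" "dPh t <= 1" "t <= 0 ==> dPh t = 0" by (auto simp: dPh_def)
 show "t > 0 ==> dPh t > 0" using one_less_power[of "1 + t" 2] by (auto simp: dPh_def)
 show "continuous_on S dPh" unfolding dPh_def by (intro continuous_intros) (auto simp: max_def)
qed

lemma Ph_props: "0 <= Ph t" "t <= 0 ==> Ph t = 0"
 using sg_props(1,3)[of t] by (auto simp: Ph_def) (metis linear mult_eq_0_iff zero_le_mult_iff)

lemma Ph_deriv: "(Ph has_real_derivative dPh t) (at t)"
proof -
 consider "t > 0" | "t < 0" | "t = 0" by linarith
 then show ?thesis
 proof cases
  case 1
  have "((%t. t / (1 + t) * t) has_real_derivative dPh t) (at t)"
   using 1 by (auto intro!: derivative_eq_intros simp: dPh_def power2_eq_square divide_simps) (simp add: algebra_simps)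
  then show ?thesis
   by (rule has_field_derivative_transform_within_open[of _ _ _ "{0<..}"]) (use 1 in \<open>auto simp: Ph_def sg_def\<close>)
 next
  case 2
  have "((%t. 0) has_real_derivative dPh t) (at t)" using 2 by (auto simp: dPh_def)
  then show ?thesis
   by (rule has_field_derivative_transform_within_open[of _ _ _ "{..<0}"]) (use 2 in \<open>auto simp: Ph_def sg_def\<close>)
 next
  case 3
  have "(sg \<longlongrightarrow> sg 0) (at 0)" using sg_props(5)[of UNIV] by (simp add: continuous_on_def)
  moreover have "sg 0 = 0" by (simp add: sg_def)
  ultimately have l: "(sg \<longlongrightarrow> 0) (at 0)" by simp
  have "((%h. (Ph (0 + h) - Ph 0) / h) \<longlongrightarrow> 0) (at 0)"
   by (rule Lim_transform_eventually[OF l]) (auto simp: eventually_at_filter Ph_def)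
  then show ?thesis using 3 by (simp add: DERIV_def dPh_def)
 qed
qed

lemma l2lim_mult_vector:
 fixes C :: "'a => 'b::euclidean_space" and f :: "'a => real"
 assumes "l2lim M fs f" "C : borel_measurable M" "!!x. norm (C x) <= B"
 shows "l2lim M (%k x. fs k x *\<^sub>R C x) (%x. f x *\<^sub>R C x)"
proof -
 note D = l2limD[OF assms(1)]
 have B: "B >= 0" using assms(3) norm_ge_zero order_trans by blast
 have b: "l2 M (%x. g x *\<^sub>R C x)" "l2n M (%x. g x *\<^sub>R C x) <= B * l2n M g" if g: "l2 M g" for g :: "'a => real"
 proof -
  have m: "(%x. g x *\<^sub>R C x) : borel_measurable M" using g assms(2) by (auto simp: l2_def)
  have n: "AE x in M. norm (g x *\<^sub>R C x) <= norm (B *\<^sub>R g x)"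
   using mult_right_mono[OF assms(3), of "\<bar>g x\<bar>" for x] B by (intro AE_I2) (simp add: abs_mult mult.commute)
  show "l2 M (%x. g x *\<^sub>R C x)" by (rule l2_bound(1)[OF l2_scaleR[OF g] m n])
  show "l2n M (%x. g x *\<^sub>R C x) <= B * l2n M g"
   using l2_bound(2)[OF l2_scaleR[OF g] m n] B by (simp only: l2n_scaleR abs_of_nonneg)
 qed
 show ?thesis
 proof (rule l2limI_le)
  show "l2n M (%x. fs k x *\<^sub>R C x - f x *\<^sub>R C x) <= B * l2n M (%x. fs k x - f x)" for k
   using b(2)[OF l2_diff[OF D(1,2)], of k] by (simp add: scaleR_diff_left)
  show "(%k. B * l2n M (%x. fs k x - f x)) ----> 0" using tendsto_mult[OF tendsto_const D(3)] by auto
 qed (use b(1) D in auto)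
qed

lemma borel_measurable_continuous_comp:
 assumes "continuous_on UNIV (g::real => real)" "f : borel_measurable M" shows "(%x. g (f x)) : borel_measurable M"
 using measurable_compose[OF assms(2) borel_measurable_continuous_onI[OF assms(1)]] .

text \<open>The inequality is tested with \<open>c * Ph (wk k)\<close>; \<open>supp\<close> says
  precisely that this has compact support in V. Where w > 0 the cut-off c is 1 with zero gradient,
  so in the limit its derivative disappears and the integral of \<open>dPh w * |H|\<^sup>2\<close>
  is at most 0. Hence H vanishes where w > 0, the gradients of the test functions tend to 0, and the
  Poincare inequality, valid for the test functions, yields \<open>c * Ph w = 0\<close>. The
  condition near the boundary is imposed on w alone, through \<open>w0\<close>; the approximations
  \<open>wk\<close> may violate it.\<close>

theorem comparison:
 fixes V :: "'a::euclidean_space set"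
 assumes V: "open V" "V \<subseteq> cball 0 R" "R >= 0"
  and wk: "!!k x. x : V ==> GDERIV (wk k) x :> Wk k x" "!!k. continuous_on V (Wk k)"
  and lim: "l2lim lb (%k x. indicator V x *\<^sub>R wk k x) w" "l2lim lb (%k x. indicator V x *\<^sub>R Wk k x) H"
  and c: "!!x. GDERIV c x :> C x" "continuous_on UNIV C" "!!x. 0 <= c x" "!!x. c x <= 1" "!!x. norm (C x) <= B"
  and supp: "!!k. \<exists>K. compact K \<and> K \<subseteq> V \<and> (\<forall>x\<in>V - K. (c x = 0 \<and> C x = 0) \<or> wk k x <= 0)"
  and w0: "AE x in lb. w x <= 0 \<or> (c x = 1 \<and> C x = 0)"
  and weak: "!!z Z. C1c V z Z ==> (!!x. z x >= 0) ==> (LB x. H x \<bullet> Z x) <= (LB x. r x * z x)"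
  and r: "l2 lb r" "AE x in lb. w x > 0 --> r x <= 0"
 shows "AE x in lb. w x <= 0"
proof -
 obtain s where s: "strict_mono (s::nat=>nat)" "AE x in lb. (%k. indicator V x *\<^sub>R wk (s k) x) ----> w x"
  using l2lim_AE_subseq[OF lim(1)] .
 define v where "v k x = indicator V x *\<^sub>R wk (s k) x" for k x
 define W where "W k x = indicator V x *\<^sub>R Wk (s k) x" for k x
 have lv: "l2lim lb v w" unfolding v_def using l2lim_subseq[OF lim(1) s(1)] .
 have lW: "l2lim lb W H" unfolding W_def using l2lim_subseq[OF lim(2) s(1)] .
 have av: "AE x in lb. (%k. v k x) ----> w x" using s(2) by (simp add: v_def)
 have vm [measurable]: "!!k. v k : bml" "w : bml"
  using l2limD[OF lv] by (auto simp: l2_def)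
 have Hl: "l2 lb H" using l2limD[OF lW] by simp
 have cc: "continuous_on UNIV c" using c(1) GDERIV_continuous by (auto simp: continuous_on_eq_continuous_at)
 have cm [measurable]: "c : bml" "C : bml"
  by (auto intro: continuous_borel_lebesgue cc c(2))
 have sm: "(%x. sg (v k x)) : bml" "(%x. sg (w x)) : bml"
   "(%x. dPh (v k x)) : bml" "(%x. dPh (w x)) : bml" for k
  by (rule borel_measurable_continuous_comp[OF sg_props(5) vm(1)] borel_measurable_continuous_comp[OF sg_props(5) vm(2)]
    borel_measurable_continuous_comp[OF dPh_props(5) vm(1)] borel_measurable_continuous_comp[OF dPh_props(5) vm(2)])+
 define z where "z k x = c x * Ph (v k x)" for k x
 define Z where "Z k x = (c x * dPh (v k x)) *\<^sub>R W k x + (sg (v k x) * v k x) *\<^sub>R C x" for k x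
 have zC: "C1c V (z k) (Z k)" for k
 proof -
  obtain K where K: "compact K" "K \<subseteq> V" "!!x. x : V - K ==> (c x = 0 \<and> C x = 0) \<or> wk (s k) x <= 0" using supp[of "s k"] by blast
  have out: "z k x = 0 \<and> Z k x = 0" if "x \<notin> K" for x
  proof (cases "x : V")
   case True
   then show ?thesis using K(3)[of x] that
    by (auto simp: z_def Z_def v_def Ph_props sg_props dPh_props)
  next
   case False
   then show ?thesis by (auto simp: z_def Z_def v_def Ph_props sg_props dPh_props W_def)
  qed
  show ?thesis
  proof (rule C1c_I[OF _ _ V(1) K(1,2)])
   fix x assume x: "x : V"
   have "((%x. Ph (wk (s k) x)) has_derivative (%h. dPh (wk (s k) x) * (h \<bullet> Wk (s k) x))) (at x)"
    using has_derivative_compose[OF wk(1)[OF x, unfolded gderiv_def] Ph_deriv[unfolded has_field_derivative_def]] .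
   then have 1: "GDERIV (%x. Ph (wk (s k) x)) x :> dPh (wk (s k) x) *\<^sub>R Wk (s k) x" by (simp add: gderiv_def)
   have 2: "GDERIV (%x. c x * Ph (wk (s k) x)) x :> c x *\<^sub>R (dPh (wk (s k) x) *\<^sub>R Wk (s k) x) + Ph (wk (s k) x) *\<^sub>R C x"
    by (rule GDERIV_mult[OF c(1) 1])
   have "(z k has_derivative (%h. h \<bullet> (c x *\<^sub>R (dPh (wk (s k) x) *\<^sub>R Wk (s k) x) + Ph (wk (s k) x) *\<^sub>R C x))) (at x)"
    by (rule has_derivative_transform_within_open[OF 2[unfolded gderiv_def] V(1) x]) (simp add: z_def v_def)
   then show "GDERIV (z k) x :> Z k x" using x by (simp add: gderiv_def Z_def v_def W_def Ph_def)
  next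
   have cw: "continuous_on V (wk (s k))"
    using wk(1) GDERIV_continuous by (intro continuous_at_imp_continuous_on) blast
   have "continuous_on V (%x. (c x * dPh (wk (s k) x)) *\<^sub>R Wk (s k) x + (sg (wk (s k) x) * wk (s k) x) *\<^sub>R C x)"
    by (intro continuous_intros cw wk(2) continuous_on_subset[OF cc] continuous_on_subset[OF c(2)]
     continuous_on_compose2[OF sg_props(5)[of UNIV] cw] continuous_on_compose2[OF dPh_props(5)[of UNIV] cw]) auto
   then show "continuous_on V (Z k)"
    by (rule continuous_on_eq) (simp add: Z_def v_def W_def)
  qed (use out in auto)
 qed
 have z0: "z k x >= 0" for k x by (simp add: z_def c Ph_props)
 have lz0: "l2lim lb (%k x. sg (v k x) *\<^sub>R v k x) (%x. sg (w x) *\<^sub>R w x)"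
 proof (rule l2lim_mult_bounded[OF lv sm(1,2), where C=1])
  show "AE x in lb. (%k. sg (v k x)) ----> sg (w x)"
   using av by eventually_elim (rule continuous_on_tendsto_compose[OF sg_props(5)[of UNIV]], auto)
 qed (use sg_props in auto)
 have lz: "l2lim lb z (%x. c x *\<^sub>R (sg (w x) *\<^sub>R w x))"
  using l2lim_mult_const[OF lz0 cm(1), where C=1] c by (simp add: z_def[abs_def] Ph_def)
 have lZ: "l2lim lb Z (%x. (c x * dPh (w x)) *\<^sub>R H x + (sg (w x) * w x) *\<^sub>R C x)"
  unfolding Z_def
 proof (rule l2lim_add)
  show "l2lim lb (%k x. (c x * dPh (v k x)) *\<^sub>R W k x) (%x. (c x * dPh (w x)) *\<^sub>R H x)"
  proof (rule l2lim_mult_bounded[OF lW, where C=1])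
   show "AE x in lb. (%k. c x * dPh (v k x)) ----> c x * dPh (w x)"
    using av by eventually_elim (intro tendsto_intros continuous_on_tendsto_compose[OF dPh_props(5)[of UNIV]], auto)
  qed (use sm c dPh_props in \<open>auto simp: abs_mult intro!: mult_le_one\<close>)
  show "l2lim lb (%k x. (sg (v k x) * v k x) *\<^sub>R C x) (%x. (sg (w x) * w x) *\<^sub>R C x)"
   using l2lim_mult_vector[OF lz0 cm(2) c(5)] by simp
 qed
 have eZ: "AE x in lb. (c x * dPh (w x)) *\<^sub>R H x + (sg (w x) * w x) *\<^sub>R C x = dPh (w x) *\<^sub>R H x"
  using w0 by eventually_elim (auto simp: sg_props dPh_props)
 have lZ': "l2lim lb Z (%x. dPh (w x) *\<^sub>R H x)"
  by (rule l2lim_cong_AE[OF lZ _ eZ]) (use sm Hl in \<open>auto simp: l2_def\<close>)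
 have "(LB x. H x \<bullet> (dPh (w x) *\<^sub>R H x)) <= (LB x. r x * (c x *\<^sub>R (sg (w x) *\<^sub>R w x)))"
 proof (rule LIMSEQ_le)
  show "(%k. LB x. H x \<bullet> Z k x) ----> (LB x. H x \<bullet> (dPh (w x) *\<^sub>R H x))"
   by (rule l2lim_inner[OF l2lim_const[OF Hl] lZ'])
  show "(%k. LB x. r x * z k x) ----> (LB x. r x * (c x *\<^sub>R (sg (w x) *\<^sub>R w x)))"
   using l2lim_inner[OF l2lim_const[OF r(1)] lz] by simp
  show "\<exists>N. \<forall>n\<ge>N. (LB x. H x \<bullet> Z n x) <= (LB x. r x * z n x)" using weak[OF zC z0] by blast
 qed
 also have "... <= 0"
 proof -
  have "AE x in lb. r x * (c x *\<^sub>R (sg (w x) *\<^sub>R w x)) <= 0"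
   using r(2)
  proof eventually_elim
   case (elim x)
   show ?case
   proof (cases "w x > 0")
    case True
    then have "c x * (sg (w x) * w x) >= 0" using c(3) sg_props(1)[of "w x"] by simp
    then show ?thesis using elim True by (simp add: mult_nonpos_nonneg)
   qed (use sg_props in auto)
  qed
  then have "AE x in lb. 0 <= - (r x * (c x *\<^sub>R (sg (w x) *\<^sub>R w x)))" by eventually_elim simp
  then have "0 <= (LB x. - (r x * (c x *\<^sub>R (sg (w x) *\<^sub>R w x))))" by (rule integral_nonneg_AE)
  then show ?thesis by simp
 qed
 finally have le0: "(LB x. H x \<bullet> (dPh (w x) *\<^sub>R H x)) <= 0" .
 have i: "integrable lb (%x. H x \<bullet> (dPh (w x) *\<^sub>R H x))" by (rule l2_inner_integrable[OF Hl l2limD(2)[OF lZ']])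
 have nn: "AE x in lb. 0 <= H x \<bullet> (dPh (w x) *\<^sub>R H x)" using dPh_props by simp
 have "(LB x. H x \<bullet> (dPh (w x) *\<^sub>R H x)) = 0" using le0 integral_nonneg_AE[OF nn] by linarith
 then have "AE x in lb. H x \<bullet> (dPh (w x) *\<^sub>R H x) = 0"
  using integral_nonneg_eq_0_iff_AE[OF i nn] by simp
 then have H0: "AE x in lb. dPh (w x) *\<^sub>R H x = 0" by eventually_elim auto
 have "l2lim lb Z (%x. 0)" by (rule l2lim_cong_AE[OF lZ' _ H0]) simp
 from l2lim_norm[OF this] have Z0: "(%k. l2n lb (Z k)) ----> 0" by (simp add: l2n_def)
 have "l2n lb (%x. c x *\<^sub>R (sg (w x) *\<^sub>R w x)) <= 2 * R * 0"
  by (rule LIMSEQ_le[OF l2lim_norm[OF lz] tendsto_mult_left[OF Z0]]) (use poincare[OF zC V(2,3)] in blast)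
 then have "l2n lb (%x. c x *\<^sub>R (sg (w x) *\<^sub>R w x)) = 0" by (simp add: order_antisym)
 from l2n_eq_0[OF l2limD(2)[OF lz] this] w0 show ?thesis
 proof eventually_elim
  case (elim x)
  then show ?case using sg_props(4)[of "w x"] by (cases "w x > 0") auto
 qed
qed

section \<open>Comparison principles\<close>

lemma continuous_mult_compact_support:
 fixes h :: "'a::euclidean_space => real" and f :: "'a => 'b::real_normed_vector"
 assumes V: "open V" and f: "continuous_on V f" and K: "compact K" "K \<subseteq> V" and h: "continuous_on UNIV h" "!!x. x \<notin> K ==> h x = 0"
 shows "continuous_on UNIV (%x. h x *\<^sub>R f x)"
proof -
 have o: "open (- K)" using K(1) by (simp add: compact_imp_closed open_Compl)
 have "continuous_on V (%x. h x *\<^sub>R f x)" by (intro continuous_intros f continuous_on_subset[OF h(1)]) auto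
 moreover have "continuous_on (- K) (%x. h x *\<^sub>R f x)" by (rule continuous_on_eq[of _ "%x. 0"]) (use h in auto)
 ultimately have "continuous_on (V \<union> - K) (%x. h x *\<^sub>R f x)" by (rule continuous_on_open_Un[OF V o])
 moreover have "V \<union> - K = UNIV" using K by auto
 ultimately show ?thesis by simp
qed

lemma C1c_mult_integrable:
 fixes z :: "'a::euclidean_space => real" and f :: "'a => real" and F :: "'a => 'a"
 assumes V: "open V" and z: "C1c V z Z"
 shows "continuous_on V f ==> integrable lb (%x. f x * z x)"
  "continuous_on V F ==> integrable lb (%x. F x \<bullet> Z x)"
proof -
 obtain K where K: "compact K" "K \<subseteq> V" "!!x. x \<notin> K ==> z x = 0" "!!x. x \<notin> K ==> Z x = 0" using C1cD(4)[OF z] by blast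
 show "integrable lb (%x. f x * z x)" if "continuous_on V f"
  using continuous_compact_integrable(1)[OF continuous_mult_compact_support[OF V that K(1,2) C1cD(3)[OF z] K(3)] K(1)] K(3)
  by (simp add: mult.commute)
 show "integrable lb (%x. F x \<bullet> Z x)" if F: "continuous_on V F"
 proof -
  have c: "continuous_on UNIV (%x. (Z x \<bullet> i) *\<^sub>R F x)" if "i : Basis" for i
   by (rule continuous_mult_compact_support[OF V F K(1,2)]) (use K C1cD(2)[OF z] in \<open>auto intro!: continuous_intros\<close>)
  have "integrable lb (%x. ((Z x \<bullet> i) *\<^sub>R F x) \<bullet> i)" if "i : Basis" for i
   using continuous_compact_integrable(1)[OF c[OF that] K(1)] K(4) by (intro integrable_inner_left) auto
  then have "integrable lb (%x. \<Sum>i\<in>Basis. ((Z x \<bullet> i) *\<^sub>R F x) \<bullet> i)" by (intro Bochner_Integration.integrable_sum) auto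
  moreover have "F x \<bullet> Z x = (\<Sum>i\<in>Basis. ((Z x \<bullet> i) *\<^sub>R F x) \<bullet> i)" for x
   by (subst euclidean_inner) (simp add: mult.commute)
  ultimately show ?thesis by simp
 qed
qed

text \<open>Integration by parts against the field x - q, whose divergence is the dimension.\<close>

lemma C1c_div_identity:
 fixes w :: "'a::euclidean_space => real"
 assumes w: "C1c UNIV w W"
 shows "(LB x. W x \<bullet> (x - q)) = - real DIM('a) * (LB x. w x)"
proof -
 have g: "GDERIV (%x. (x - q) \<bullet> i) x :> i" for i x :: 'a
  unfolding gderiv_def by (auto intro!: derivative_eq_intros)
 have i1: "integrable lb (%x. ((x - q) \<bullet> i) * (W x \<bullet> i))" if "i : Basis" for i
  using C1c_mult_integrable(2)[OF open_UNIV w, of "%x. ((x - q) \<bullet> i) *\<^sub>R i"] by (simp add: continuous_intros inner_commute)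
 have "(LB x. ((x - q) \<bullet> i) * (W x \<bullet> i)) = - (LB x. w x)" if i: "i : Basis" for i
 proof -
  have "C1c UNIV (%x. w x * ((x - q) \<bullet> i)) (%x. w x *\<^sub>R i + ((x - q) \<bullet> i) *\<^sub>R W x)"
   by (rule C1c_mult[OF w g]) auto
  from C1c_integral_zero[OF this, of i] have "0 = (LB x. w x + ((x - q) \<bullet> i) * (W x \<bullet> i))"
   using i by (simp add: inner_add_left)
  then show ?thesis using i1[OF i] C1c_l2(3)[OF w] by simp
 qed
 then have "(\<Sum>i\<in>Basis. LB x. ((x - q) \<bullet> i) * (W x \<bullet> i)) = - real DIM('a) * (LB x. w x)" by simp
 moreover have "(LB x. W x \<bullet> (x - q)) = (\<Sum>i\<in>Basis. LB x. ((x - q) \<bullet> i) * (W x \<bullet> i))"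
  by (subst euclidean_inner, subst Bochner_Integration.integral_sum) (use i1 in \<open>auto simp: mult.commute\<close>)
 ultimately show ?thesis by simp
qed

text \<open>All barriers used below, namely paraboloid, cone barrier and fundamental solution, have
  a gradient of the form \<open>\<alpha> (x - q) + \<beta> e\<close>. Their Laplacians are therefore
  available from the first derivatives of two scalar functions.\<close>

lemma ibp_radial:
 fixes V :: "'a::euclidean_space set" and \<alpha> \<beta> :: "'a => real"
 assumes V: "open V" and z: "C1c V z Z"
  and a: "!!x. x : V ==> GDERIV \<alpha> x :> A x" "continuous_on V A"
  and b: "!!x. x : V ==> GDERIV \<beta> x :> B x" "continuous_on V B"
 shows "(LB x. (\<alpha> x *\<^sub>R (x - q) + \<beta> x *\<^sub>R e) \<bullet> Z x)
   = - (LB x. (A x \<bullet> (x - q) + real DIM('a) * \<alpha> x + B x \<bullet> e) * z x)"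
proof -
 have ca: "continuous_on V \<alpha>" "continuous_on V \<beta>"
  using a(1) b(1) GDERIV_continuous by (intro continuous_at_imp_continuous_on, blast)+
 have wa: "C1c UNIV (%x. z x * \<alpha> x) (%x. z x *\<^sub>R A x + \<alpha> x *\<^sub>R Z x)"
  by (rule C1c_mono[OF C1c_mult[OF z a V]]) auto
 have wb: "C1c UNIV (%x. z x * \<beta> x) (%x. z x *\<^sub>R B x + \<beta> x *\<^sub>R Z x)"
  by (rule C1c_mono[OF C1c_mult[OF z b V]]) auto
 note I = C1c_mult_integrable(1)[OF V z] C1c_mult_integrable(2)[OF V z]
 have i: "integrable lb (%x. (A x \<bullet> (x - q)) * z x)" "integrable lb (%x. (\<alpha> x *\<^sub>R (x - q)) \<bullet> Z x)"
  "integrable lb (%x. (B x \<bullet> e) * z x)" "integrable lb (%x. (\<beta> x *\<^sub>R e) \<bullet> Z x)" "integrable lb (%x. \<alpha> x * z x)"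
  by (rule I, intro continuous_intros a(2) b(2) ca)+
 have "(LB x. (z x *\<^sub>R A x + \<alpha> x *\<^sub>R Z x) \<bullet> (x - q)) = (LB x. (A x \<bullet> (x - q)) * z x + (\<alpha> x *\<^sub>R (x - q)) \<bullet> Z x)"
  by (intro int_cong refl) (simp add: inner_add_left inner_add_right inner_commute mult.commute)
 also have "... = (LB x. (A x \<bullet> (x - q)) * z x) + (LB x. (\<alpha> x *\<^sub>R (x - q)) \<bullet> Z x)"
  by (rule Bochner_Integration.integral_add) (rule i)+
 finally have 1: "(LB x. (\<alpha> x *\<^sub>R (x - q)) \<bullet> Z x) = - (LB x. (A x \<bullet> (x - q)) * z x) - real DIM('a) * (LB x. \<alpha> x * z x)"
  using C1c_div_identity[OF wa, of q] by (simp add: mult.commute)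
 have "0 = (LB x. (z x *\<^sub>R B x + \<beta> x *\<^sub>R Z x) \<bullet> e)" using C1c_integral_zero[OF wb, of e] by simp
 also have "... = (LB x. (B x \<bullet> e) * z x + (\<beta> x *\<^sub>R e) \<bullet> Z x)"
  by (intro int_cong refl) (simp add: inner_add_left inner_add_right inner_commute mult.commute)
 also have "... = (LB x. (B x \<bullet> e) * z x) + (LB x. (\<beta> x *\<^sub>R e) \<bullet> Z x)"
  by (rule Bochner_Integration.integral_add) (rule i)+
 finally have 2: "(LB x. (\<beta> x *\<^sub>R e) \<bullet> Z x) = - (LB x. (B x \<bullet> e) * z x)" by simp
 have "(LB x. (\<alpha> x *\<^sub>R (x - q) + \<beta> x *\<^sub>R e) \<bullet> Z x) = (LB x. (\<alpha> x *\<^sub>R (x - q)) \<bullet> Z x) + (LB x. (\<beta> x *\<^sub>R e) \<bullet> Z x)"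
  unfolding inner_add_left by (rule Bochner_Integration.integral_add) (rule i)+
 also have "... = - ((LB x. (A x \<bullet> (x - q)) * z x) + real DIM('a) * (LB x. \<alpha> x * z x) + (LB x. (B x \<bullet> e) * z x))"
  using 1 2 by simp
 also have "(LB x. (A x \<bullet> (x - q)) * z x) + real DIM('a) * (LB x. \<alpha> x * z x) + (LB x. (B x \<bullet> e) * z x)
   = (LB x. ((A x \<bullet> (x - q)) * z x + real DIM('a) * (\<alpha> x * z x)) + (B x \<bullet> e) * z x)"
  using i by simp
 also have "... = (LB x. (A x \<bullet> (x - q) + real DIM('a) * \<alpha> x + B x \<bullet> e) * z x)"
  by (intro int_cong refl) (simp add: algebra_simps)
 finally show ?thesis .
qed

lemma indicator_continuous_l2:
 fixes f :: "'a::euclidean_space => 'b::euclidean_space"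
 assumes "open V" "bounded V" "continuous_on V f" "!!x. x : V ==> norm (f x) <= M"
 shows "l2 lb (%x. indicator V x *\<^sub>R f x)"
proof (rule l2_bounded_support(1)[OF _ assms(2), of _ "\<bar>M\<bar>"])
 have "(%x. indicator V x *\<^sub>R f x) : borel_measurable borel"
  using assms by (intro borel_measurable_continuous_on_indicator) auto
 then show "(%x. indicator V x *\<^sub>R f x) : bml" by (simp add: measurable_completion)
 show "AE x in lb. norm (indicator V x *\<^sub>R f x) <= \<bar>M\<bar>"
  using assms(4) by (intro AE_I2) (force simp: indicator_def)
qed (auto simp: indicator_def)

lemma open_lebesgue [simp]: "open (V :: 'a::euclidean_space set) ==> V : sets lb"
 by auto

text \<open>Two parts of the boundary of \<open>Om \<inter> W\<close> are handled differently. At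
  the boundary of Om the C^1 approximations of y have compact support in Om and b is nonnegative, so
  their difference is at most 0 there. At the boundary of W the cut-off for K takes over, and y
  \<le> b outside K is a hypothesis.\<close>

theorem comparison_smooth:
 fixes Om W K :: "'n::finite pt set"
 assumes Om: "open Om" "Om \<subseteq> cball 0 R" "R >= 0" and W: "open W" "compact K" "K \<subseteq> W"
  and y: "h10 Om y G" and g: "l2 lb g"
  and yw: "!!z Z. C1c (Om \<inter> W) z Z ==> (!!x. z x >= 0) ==> (LB x. G x \<bullet> Z x) <= (LB x. g x * z x)"
  and b: "!!x. x : Om \<inter> W ==> GDERIV b x :> B x" "continuous_on (Om \<inter> W) B"
  and bM: "!!x. x : Om \<inter> W ==> 0 <= b x \<and> b x <= M \<and> norm (B x) <= M"
  and L: "l2 lb (%x. indicator (Om \<inter> W) x * L x)"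
  and bw: "!!z Z. C1c (Om \<inter> W) z Z ==> (!!x. z x >= 0) ==> (LB x. B x \<bullet> Z x) >= (LB x. L x * z x)"
  and bd: "AE x in lb. x : Om \<inter> W - K --> y x <= b x"
  and gL: "AE x in lb. x : Om \<inter> W \<and> y x > b x --> g x <= L x"
 shows "AE x in lb. x : Om \<inter> W --> y x <= b x"
proof -
 let ?V = "Om \<inter> W" and ?I = "%x. indicator (Om \<inter> W) x :: real"
 have V: "open ?V" "?V \<subseteq> cball 0 R" "bounded ?V" using Om W bounded_subset[OF bounded_cball, of "Om \<inter> W" 0 R] by auto
 obtain ps Ps where p: "!!k. C1c Om (ps k) (Ps k)" "l2lim lb ps y" "l2lim lb Ps G"
  using y unfolding h10_def by blast
 obtain c C where c: "C1c W c C" "!!x. x : K ==> c x = 1" "!!x. x : K ==> C x = 0" "!!x. 0 <= c x" "!!x. c x <= 1"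
  using cutoff[OF W(2,3,1)] by metis
 obtain Bc where Bc: "!!x. norm (C x) <= Bc" using C1c_bounded[OF c(1)] by blast
 have cb: "continuous_on ?V b" using b(1) GDERIV_continuous by (intro continuous_at_imp_continuous_on) blast
 have lb: "l2 lb (%x. ?I x *\<^sub>R b x)" "l2 lb (%x. ?I x *\<^sub>R B x)"
  by (rule indicator_continuous_l2[OF V(1,3) cb, of M] indicator_continuous_l2[OF V(1,3) b(2), of M], use bM in force)+
 have Im: "?I : bml" by (rule borel_measurable_indicator[OF open_lebesgue[OF V(1)]])
 have Ib: "AE x in lb. \<bar>?I x\<bar> <= 1" by (auto simp: indicator_def)
 have l1: "l2lim lb (%k x. ?I x *\<^sub>R (ps k x - b x)) (%x. ?I x *\<^sub>R (y x - b x))"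
  using l2lim_diff[OF l2lim_mult_const[OF p(2) Im Ib] l2lim_const[OF lb(1)]] by (simp add: algebra_simps)
 have l2': "l2lim lb (%k x. ?I x *\<^sub>R (Ps k x - B x)) (%x. ?I x *\<^sub>R (G x - B x))"
  using l2lim_diff[OF l2lim_mult_const[OF p(3) Im Ib] l2lim_const[OF lb(2)]] by (simp add: algebra_simps)
 have rl: "l2 lb (%x. ?I x *\<^sub>R g x - ?I x * L x)"
  using l2_diff[OF l2_mult_bounded(1)[OF g Im Ib] L] by simp
 have "AE x in lb. ?I x *\<^sub>R (y x - b x) <= 0"
 proof (rule comparison[OF V(1,2) Om(3) _ _ l1 l2' C1cD(1,2)[OF c(1)] c(4,5) Bc])
  show "GDERIV (%x. ps k x - b x) x :> Ps k x - B x" if "x : ?V" for k x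
   by (rule GDERIV_diff[OF C1cD(1)[OF p(1)] b(1)[OF that]])
  show "continuous_on ?V (%x. Ps k x - B x)" for k
   by (intro continuous_intros b(2) continuous_on_subset[OF C1cD(2)[OF p(1)]]) auto
  show "\<exists>K. compact K \<and> K \<subseteq> ?V \<and> (\<forall>x\<in>?V - K. (c x = 0 \<and> C x = 0) \<or> ps k x - b x <= 0)" for k
  proof -
   obtain K1 where K1: "compact K1" "K1 \<subseteq> W" "!!x. x \<notin> K1 ==> c x = 0 \<and> C x = 0" using C1cD(4)[OF c(1)] by blast
   obtain K2 where K2: "compact K2" "K2 \<subseteq> Om" "!!x. x \<notin> K2 ==> ps k x = 0" using C1cD(4)[OF p(1)[of k]] by blast
   show ?thesis
   proof (intro exI[of _ "K1 \<inter> K2"] conjI ballI)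
    show "compact (K1 \<inter> K2)" using K1 K2 by (intro compact_Int) auto
    show "(c x = 0 \<and> C x = 0) \<or> ps k x - b x <= 0" if "x : ?V - K1 \<inter> K2" for x
     using that K1(3)[of x] K2(3)[of x] bM[of x] by auto
   qed (use K1 K2 in auto)
  qed
  show "AE x in lb. ?I x *\<^sub>R (y x - b x) <= 0 \<or> (c x = 1 \<and> C x = 0)"
   using bd by eventually_elim (use c in \<open>auto simp: indicator_def\<close>)
  show "l2 lb (%x. ?I x *\<^sub>R g x - ?I x * L x)" by (rule rl)
  show "AE x in lb. 0 < ?I x *\<^sub>R (y x - b x) --> ?I x *\<^sub>R g x - ?I x * L x <= 0"
   using gL by eventually_elim (auto simp: indicator_def)
  show "(LB x. (?I x *\<^sub>R (G x - B x)) \<bullet> Z x) <= (LB x. (?I x *\<^sub>R g x - ?I x * L x) * z x)"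
   if z: "C1c ?V z Z" "!!x. z x >= 0" for z Z
  proof -
   have Iz: "?I x * z x = z x" "?I x *\<^sub>R Z x = Z x" for x using C1cD(5,6)[OF z(1), of x] by (auto simp: indicator_def)
   have "(LB x. (?I x *\<^sub>R (G x - B x)) \<bullet> Z x) = (LB x. G x \<bullet> Z x - B x \<bullet> Z x)"
    by (intro int_cong refl) (metis Iz(2) inner_diff_left inner_scaleR_left inner_scaleR_right)
   also have "... = (LB x. G x \<bullet> Z x) - (LB x. B x \<bullet> Z x)"
    by (intro Bochner_Integration.integral_diff l2_inner_integrable h10_l2(2)[OF y] C1c_l2(2)[OF z(1)] C1c_mult_integrable(2)[OF V(1) z(1) b(2)])
   also have "... <= (LB x. g x * z x) - (LB x. L x * z x)" using yw[OF z] bw[OF z] by simp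
   also have "(LB x. L x * z x) = (LB x. (?I x * L x) * z x)"
    by (intro int_cong refl) (metis Iz(1) mult.assoc mult.commute)
   also have "(LB x. g x * z x) - ... = (LB x. g x * z x - (?I x * L x) * z x)"
    by (intro Bochner_Integration.integral_diff[symmetric] l2_real_mult g L C1c_l2(1)[OF z(1)])
   also have "... = (LB x. (?I x *\<^sub>R g x - ?I x * L x) * z x)"
    using C1cD(5)[OF z(1)] by (intro int_cong refl) (auto simp: indicator_def left_diff_distrib)
   finally show ?thesis .
  qed
 qed
 then show ?thesis by eventually_elim (auto simp: indicator_def)
qed

section \<open>Maximum principles and the bound by a paraboloid\<close>

lemma max_level:
 fixes Om :: "'n::finite pt set"
 assumes Om: "open Om" "Om \<subseteq> cball 0 R" "R >= 0" and y: "h10 Om y G" and g: "l2 lb g"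
  and yw: "!!z Z. C1c Om z Z ==> (!!x. z x >= 0) ==> (LB x. G x \<bullet> Z x) <= (LB x. g x * z x)"
  and gL: "AE x in lb. x : Om \<and> y x > c --> g x <= 0" and c: "c >= 0"
 shows "AE x in lb. y x <= c"
proof -
 have "AE x in lb. x : Om \<inter> UNIV --> y x <= c"
 proof (rule comparison_smooth[OF Om open_UNIV compact_cball[of 0 R] subset_UNIV y g, where L="%x. 0" and B="%x. 0" and M=c])
  show "AE x in lb. x : Om \<inter> UNIV - cball 0 R --> y x <= c" by (intro AE_I2) (use Om(2) in auto)
  show "AE x in lb. x : Om \<inter> UNIV \<and> c < y x --> g x <= 0" using gL by eventually_elim auto
  show "(LB x. G x \<bullet> Z x) <= (LB x. g x * z x)" if "C1c (Om \<inter> UNIV) z Z" "!!x. 0 <= z x" for z Z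
   using yw[of z Z] that by simp
 qed (use c in \<open>auto intro: GDERIV_const\<close>)
 then show ?thesis using h10_zero_outside[OF y] by eventually_elim (use c in auto)
qed

theorem max_principle:
 fixes Om :: "'n::finite pt set"
 assumes Om: "open Om" "Om \<subseteq> cball 0 R" "R >= 0" and y: "h10 Om y G" and g: "l2 lb g"
  and yw: "!!z Z. C1c Om z Z ==> (!!x. z x >= 0) ==> (LB x. G x \<bullet> Z x) <= (LB x. g x * z x)"
  and gL: "AE x in lb. y x > 0 --> g x <= 0"
 shows "AE x in lb. y x <= 0"
 by (rule max_level[OF assms(1-6)]) (use gL in \<open>auto elim!: eventually_mono\<close>)

text \<open>The field is the gradient of \<open>c * (R\<^sup>2 - x \<bullet> x) / (2 * n)\<close>,
  which for c \<ge> 0 is nonnegative on the ball of radius R and has the constant c as its negative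
  Laplacian.\<close>

lemma paraboloid:
 fixes z :: "'n::finite pt => real"
 assumes z: "C1c V z Z" "open V"
 shows "(LB x. ((- c / real CARD('n)) *\<^sub>R x) \<bullet> Z x) = (LB x. c * z x)"
 using ibp_radial[OF z(2,1), of "%x. - c / real CARD('n)" "%x. 0" "%x. 0" "%x. 0" 0 0] by (simp add: GDERIV_const)

lemma paraboloid_GDERIV:
 "GDERIV (%x. c * (R\<^sup>2 - x \<bullet> x) / (2 * real CARD('n))) x :> (- c / real CARD('n)) *\<^sub>R x" for x :: "'n::finite pt"
 unfolding gderiv_def by (auto intro!: derivative_eq_intros simp: inner_commute field_simps)

theorem sup_bound:
 fixes Om :: "'n::finite pt set"
 assumes Om: "open Om" "Om \<subseteq> cball 0 R" "R >= 0" and y: "h10 Om y G" and g: "l2 lb g"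
  and yw: "!!z Z. C1c Om z Z ==> (!!x. z x >= 0) ==> (LB x. G x \<bullet> Z x) <= (LB x. g x * z x)"
  and gc: "AE x in lb. x : Om --> g x <= c" "c >= 0"
 shows "AE x in lb. y x <= c * R\<^sup>2"
proof -
 let ?b = "%x::'n pt. c * (R\<^sup>2 - x \<bullet> x) / (2 * real CARD('n))" and ?B = "%x::'n pt. (- c / real CARD('n)) *\<^sub>R x"
 have n1: "real CARD('n) >= 1" by (simp add: Suc_leI)
 have xR: "x \<bullet> x <= R\<^sup>2" "norm x <= R" if "x : Om" for x
  using that Om(2,3) by (auto simp: dot_square_norm intro!: power_mono)
 have b1: "0 <= ?b x" "?b x <= c * R\<^sup>2" "norm (?B x) <= c * R" if "x : Om" for x
 proof -
  show "0 <= ?b x" using xR[OF that] gc(2) by simp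
  have "c * (R\<^sup>2 - x \<bullet> x) / (2 * real CARD('n)) <= c * (R\<^sup>2 - x \<bullet> x) / 1"
   using xR[OF that] gc(2) n1 by (intro divide_left_mono mult_nonneg_nonneg) linarith+
  also have "... <= c * R\<^sup>2" using gc(2) by (simp add: mult_left_mono)
  finally show "?b x <= c * R\<^sup>2" .
  have "c / real CARD('n) <= c" using gc(2) n1 by (simp add: divide_le_eq mult_le_cancel_left1)
  then have "c / real CARD('n) * norm x <= c * R" using xR[OF that] gc(2) by (intro mult_mono) auto
  then show "norm (?B x) <= c * R" using gc(2) by simp
 qed
 have bo: "bounded Om" using Om(2) bounded_cball bounded_subset by blast
 have "AE x in lb. x : Om \<inter> UNIV --> y x <= ?b x"
 proof (rule comparison_smooth[OF Om open_UNIV compact_cball[of 0 R] subset_UNIV y g, where L="%x. c" and B="?B" and M="max (c * R\<^sup>2) (c * R)"])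
  show "l2 lb (%x. indicator (Om \<inter> UNIV) x * c)"
   using indicator_continuous_l2[OF Om(1) bo, of "%x. c" c] gc(2) by simp
  show "AE x in lb. x : Om \<inter> UNIV - cball 0 R --> y x <= ?b x" by (intro AE_I2) (use Om(2) in auto)
  show "AE x in lb. x : Om \<inter> UNIV \<and> ?b x < y x --> g x <= c" using gc(1) by eventually_elim auto
  show "(LB x. G x \<bullet> Z x) <= (LB x. g x * z x)" if "C1c (Om \<inter> UNIV) z Z" "!!x. 0 <= z x" for z Z
   using yw[of z Z] that by simp
  show "GDERIV ?b x :> ?B x" for x by (rule paraboloid_GDERIV)
  show "continuous_on (Om \<inter> UNIV) ?B" by (intro continuous_intros)
  show "0 <= ?b x \<and> ?b x <= max (c * R\<^sup>2) (c * R) \<and> norm (?B x) <= max (c * R\<^sup>2) (c * R)" if "x : Om \<inter> UNIV" for x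
   using b1[of x] that by (simp add: le_max_iff_disj del: norm_scaleR)
  show "(LB x. c * z x) <= (LB x. ?B x \<bullet> Z x)" if "C1c (Om \<inter> UNIV) z Z" for z Z
   using paraboloid[OF that, of c] Om(1) by simp
 qed
 then show ?thesis using h10_zero_outside[OF y]
 proof eventually_elim
  case (elim x)
  then show ?case using b1[of x] gc(2) by (cases "x : Om") auto
 qed
qed

section \<open>Barriers at the boundary of a Lipschitz domain\<close>

text \<open>In polar coordinates around the vertex \<open>q\<close> of an exterior cone with axis \<open>- e\<close>, \<open>b = r\<^sup>l (C + ln (1 + cos \<theta>))\<close>;
 for small \<open>l\<close> it is a supersolution in dimensions 2 and 3.\<close>
lemma cone_barrier:
 fixes q e :: "'n::finite pt" and V :: "'n pt set"
 assumes n: "CARD('n) = 2 \<or> CARD('n) = 3" and e: "norm e = 1" and V: "open V"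
  and d: "0 < d" "!!x. x : V ==> (x - q) \<bullet> e >= (d - 1) * norm (x - q)" and V0: "!!x. x : V ==> x \<noteq> q"
  and D: "!!x. x : V ==> norm (x - q) <= D" "D >= 1"
  and Fm: "Fm = 1 - ln d + ln 2" and l: "0 < l" "l <= 1" "l * Fm <= 1/8"
 defines "b \<equiv> %x. norm (x - q) powr l * (1 - ln d + ln (norm (x - q) + (x - q) \<bullet> e) - ln (norm (x - q)))"
 shows "x : V ==> norm (x - q) powr l <= b x" "x : V ==> b x <= Fm * norm (x - q) powr l"
  "\<exists>B L. (\<forall>x\<in>V. GDERIV b x :> B x) \<and> continuous_on V B \<and> continuous_on V L \<and> (\<forall>x\<in>V. L x >= D powr (l - 2) / 4) \<and>
    (\<forall>x\<in>V. norm (B x) <= (l * Fm + 2 + 2 / d) * norm (x - q) powr l / norm (x - q)) \<and>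
    (\<forall>z Z. C1c V z Z --> (LB x. B x \<bullet> Z x) = (LB x. L x * z x))"
proof -
 define X where "X x = x - q" for x
 define r where "r x = norm (x - q)" for x
 define m where "m x = (x - q) \<bullet> e" for x
 \<comment> \<open>With theta the angle between x - q and e, s = r (1 + cos theta). The cone
   condition says s \<ge> d r, so s stays away from 0 relative to r.\<close>
 define s where "s x = r x + m x" for x
 \<comment> \<open>The constant 1 - ln d is the one that gives F \<ge> 1 on V, since s / r \<ge> d
   there.\<close>
 define F where "F x = 1 - ln d + ln (s x) - ln (r x)" for x
 define P where "P x = r x powr l" for x
 have bE: "b x = P x * F x" for x by (simp add: b_def P_def F_def r_def s_def m_def)
 have r0: "r x > 0" if "x : V" for x using V0[OF that] by (simp add: r_def)
 have s_lo: "s x >= d * r x" if "x : V" for x using d(2)[OF that] by (simp add: s_def m_def r_def algebra_simps)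
 have s0: "s x > 0" if "x : V" for x using s_lo[OF that] r0[OF that] d(1) by (smt (verit) mult_pos_pos)
 have mr: "m x <= r x" for x using Cauchy_Schwarz_ineq2[of "x - q" e] e by (simp add: m_def r_def abs_le_iff)
 have s_hi: "s x <= 2 * r x" for x using mr[of x] by (simp add: s_def)
 have P0: "P x > 0" if "x : V" for x using r0[OF that] by (simp add: P_def)
 have F1: "1 <= F x" "F x <= Fm" if "x : V" for x
 proof -
  have e: "F x = 1 - ln d + ln (s x / r x)" using s0[OF that] r0[OF that] by (simp add: F_def ln_div)
  have "d <= s x / r x" "s x / r x <= 2" using s_lo[OF that] s_hi[of x] r0[OF that] by (simp_all add: pos_le_divide_eq pos_divide_le_eq)
  moreover from this have "0 < s x / r x" using d(1) by linarith
  ultimately have "ln d <= ln (s x / r x)" "ln (s x / r x) <= ln 2" using d(1) by simp_all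
  then show "1 <= F x" "F x <= Fm" using e Fm by linarith+
 qed
 show "x : V ==> norm (x - q) powr l <= b x"
  using F1(1) P0 mult_left_mono[of 1 "F x" "P x"] by (simp add: bE P_def r_def less_imp_le)
 show "x : V ==> b x <= Fm * norm (x - q) powr l"
  using F1(2) P0 mult_left_mono[of "F x" Fm "P x"] by (simp add: bE P_def r_def less_imp_le mult.commute)
 have Xr: "X x \<bullet> X x = (r x)\<^sup>2" "e \<bullet> X x = m x" "X x \<bullet> e = m x" "e \<bullet> e = 1" "norm (X x) = r x" for x
  using e by (simp_all add: X_def r_def m_def power2_norm_eq_inner inner_commute norm_eq_1)
 have gr: "GDERIV r x :> (1 / r x) *\<^sub>R X x" if "x : V" for x
 proof -
  have "((%x. x - q) has_derivative (%h. h)) (at x)" by (auto intro!: derivative_eq_intros)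
  moreover have "(norm has_derivative (%h. h \<bullet> sgn (x - q))) (at (x - q))"
   using GDERIV_norm[of "x - q"] V0[OF that] by (simp add: gderiv_def)
  ultimately have "((%x. norm (x - q)) has_derivative (%h. h \<bullet> sgn (x - q))) (at x)" by (rule has_derivative_compose)
  then show ?thesis by (simp add: gderiv_def r_def[abs_def] X_def sgn_div_norm divide_inverse)
 qed
 have gm: "GDERIV m x :> e" for x unfolding gderiv_def m_def by (auto intro!: derivative_eq_intros)
 have gs: "GDERIV s x :> (1 / r x) *\<^sub>R X x + e" if "x : V" for x
  unfolding s_def by (rule GDERIV_add[OF gr[OF that] gm])
 have glns: "GDERIV (%x. ln (s x)) x :> (1 / s x) *\<^sub>R ((1 / r x) *\<^sub>R X x + e)" if "x : V" for x
  by (rule GDERIV_DERIV_compose[OF gs[OF that] DERIV_ln_divide[OF s0[OF that]]])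
 have glnr: "GDERIV (%x. ln (r x)) x :> (1 / r x) *\<^sub>R ((1 / r x) *\<^sub>R X x)" if "x : V" for x
  by (rule GDERIV_DERIV_compose[OF gr[OF that] DERIV_ln_divide[OF r0[OF that]]])
 have gF: "GDERIV F x :> (1 / s x) *\<^sub>R ((1 / r x) *\<^sub>R X x + e) - (1 / r x) *\<^sub>R ((1 / r x) *\<^sub>R X x)" if "x : V" for x
  unfolding F_def using GDERIV_diff[OF GDERIV_add[OF GDERIV_const[of "1 - ln d"] glns[OF that]] glnr[OF that]] by simp
 have gP: "GDERIV P x :> (l * P x / r x) *\<^sub>R ((1 / r x) *\<^sub>R X x)" if "x : V" for x
 proof -
  have "((%t. t powr l) has_real_derivative l * P x / r x) (at (r x))"
   using r0[OF that] by (auto intro!: derivative_eq_intros simp: P_def powr_diff)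
  from GDERIV_DERIV_compose[OF gr[OF that] this] show ?thesis by (simp add: P_def[abs_def])
 qed
 \<comment> \<open>E collects the coefficients of x - q, so that the gradient of b takes the form
   \<open>P E (x - q) + (P / s) e\<close> required by \<open>ibp_radial\<close>.\<close>
 define E where "E x = (l * F x - 1) / (r x)\<^sup>2 + 1 / (r x * s x)" for x
 define \<alpha> where "\<alpha> x = P x * E x" for x
 define \<beta> where "\<beta> x = P x / s x" for x
 have gb: "GDERIV b x :> \<alpha> x *\<^sub>R (x - q) + \<beta> x *\<^sub>R e" if "x : V" for x
 proof -
  have "GDERIV (%x. P x * F x) x :> P x *\<^sub>R ((1 / s x) *\<^sub>R ((1 / r x) *\<^sub>R X x + e) - (1 / r x) *\<^sub>R ((1 / r x) *\<^sub>R X x)) + F x *\<^sub>R ((l * P x / r x) *\<^sub>R ((1 / r x) *\<^sub>R X x))"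
   by (rule GDERIV_mult[OF gP[OF that] gF[OF that]])
  moreover have "P x *\<^sub>R ((1 / s x) *\<^sub>R ((1 / r x) *\<^sub>R X x + e) - (1 / r x) *\<^sub>R ((1 / r x) *\<^sub>R X x)) + F x *\<^sub>R ((l * P x / r x) *\<^sub>R ((1 / r x) *\<^sub>R X x))
   = (P x * (1 / s x) * (1 / r x) - P x * (1 / r x) * (1 / r x) + F x * (l * P x / r x) * (1 / r x)) *\<^sub>R X x + (P x * (1 / s x)) *\<^sub>R e"
   by (simp add: scaleR_add_right scaleR_diff_right scaleR_add_left scaleR_diff_left algebra_simps)
  moreover have "P x * (1 / s x) * (1 / r x) - P x * (1 / r x) * (1 / r x) + F x * (l * P x / r x) * (1 / r x) = \<alpha> x"
   using r0[OF that] s0[OF that] by (simp add: \<alpha>_def E_def power2_eq_square field_simps)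
  ultimately show ?thesis by (simp add: bE[abs_def] \<beta>_def X_def)
 qed
 define A where "A x = P x *\<^sub>R (((1 / (r x)\<^sup>2) * l) *\<^sub>R ((1 / s x) *\<^sub>R ((1 / r x) *\<^sub>R X x + e) - (1 / r x) *\<^sub>R ((1 / r x) *\<^sub>R X x))
   + (l * F x - 1) *\<^sub>R ((- 2 / (r x)^3) *\<^sub>R ((1 / r x) *\<^sub>R X x))
   + (- 1 / (r x * s x)\<^sup>2) *\<^sub>R (r x *\<^sub>R ((1 / r x) *\<^sub>R X x + e) + s x *\<^sub>R ((1 / r x) *\<^sub>R X x)))
  + E x *\<^sub>R ((l * P x / r x) *\<^sub>R ((1 / r x) *\<^sub>R X x))" for x
 have ga: "GDERIV \<alpha> x :> A x" if x: "x : V" for x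
 proof -
  have 1: "GDERIV (%x. 1 / (r x)\<^sup>2) x :> (- 2 / (r x)^3) *\<^sub>R ((1 / r x) *\<^sub>R X x)"
  proof -
   have "((%t. 1 / t\<^sup>2) has_real_derivative (- 2 / (r x)^3)) (at (r x))"
    using r0[OF x] by (auto intro!: derivative_eq_intros simp: field_simps power2_eq_square power3_eq_cube)
   from GDERIV_DERIV_compose[OF gr[OF x] this] show ?thesis .
  qed
  have 2: "GDERIV (%x. 1 / (r x * s x)) x :> (- 1 / (r x * s x)\<^sup>2) *\<^sub>R (r x *\<^sub>R ((1 / r x) *\<^sub>R X x + e) + s x *\<^sub>R ((1 / r x) *\<^sub>R X x))"
  proof -
   have "((%t. 1 / t) has_real_derivative (- 1 / (r x * s x)\<^sup>2)) (at (r x * s x))"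
    using r0[OF x] s0[OF x] by (auto intro!: derivative_eq_intros simp: field_simps power2_eq_square)
   from GDERIV_DERIV_compose[OF GDERIV_mult[OF gr[OF x] gs[OF x]] this] show ?thesis .
  qed
  have 3: "GDERIV (%x. l * F x - 1) x :> l *\<^sub>R ((1 / s x) *\<^sub>R ((1 / r x) *\<^sub>R X x + e) - (1 / r x) *\<^sub>R ((1 / r x) *\<^sub>R X x))"
   using GDERIV_diff[OF GDERIV_mult[OF GDERIV_const[of l] gF[OF x]] GDERIV_const[of 1]] by simp
  have 4: "GDERIV E x :> (l * F x - 1) *\<^sub>R ((- 2 / (r x)^3) *\<^sub>R ((1 / r x) *\<^sub>R X x)) + (1 / (r x)\<^sup>2) *\<^sub>R (l *\<^sub>R ((1 / s x) *\<^sub>R ((1 / r x) *\<^sub>R X x + e) - (1 / r x) *\<^sub>R ((1 / r x) *\<^sub>R X x)))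
   + (- 1 / (r x * s x)\<^sup>2) *\<^sub>R (r x *\<^sub>R ((1 / r x) *\<^sub>R X x + e) + s x *\<^sub>R ((1 / r x) *\<^sub>R X x))"
   using GDERIV_add[OF GDERIV_mult[OF 3 1] 2] by (simp add: E_def[abs_def])
  show ?thesis
   unfolding \<alpha>_def[abs_def] by (rule GDERIV_subst[OF GDERIV_mult[OF gP[OF x] 4]]) (simp only: A_def scaleR_scaleR add_ac)
 qed
 define B where "B x = P x *\<^sub>R ((- 1 / (s x)\<^sup>2) *\<^sub>R ((1 / r x) *\<^sub>R X x + e)) + (1 / s x) *\<^sub>R ((l * P x / r x) *\<^sub>R ((1 / r x) *\<^sub>R X x))" for x
 have gB: "GDERIV \<beta> x :> B x" if x: "x : V" for x
 proof -
  have 1: "GDERIV (%x. 1 / s x) x :> (- 1 / (s x)\<^sup>2) *\<^sub>R ((1 / r x) *\<^sub>R X x + e)"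
  proof -
   have "((%t. 1 / t) has_real_derivative (- 1 / (s x)\<^sup>2)) (at (s x))"
    using s0[OF x] by (auto intro!: derivative_eq_intros simp: field_simps power2_eq_square)
   from GDERIV_DERIV_compose[OF gs[OF x] this] show ?thesis .
  qed
  show ?thesis using GDERIV_mult[OF gP[OF x] 1] by (simp add: \<beta>_def[abs_def] B_def)
 qed
 have cX: "continuous_on V X" unfolding X_def by (intro continuous_intros)
 have cr: "continuous_on V r" unfolding r_def by (intro continuous_intros)
 have cs: "continuous_on V s" unfolding s_def m_def by (intro continuous_intros cr)
 have rn: "\<forall>x\<in>V. r x \<noteq> 0" "\<forall>x\<in>V. s x \<noteq> 0" using r0 s0 by force+
 have cF: "continuous_on V F" unfolding F_def using rn by (intro continuous_intros cr cs) auto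
 have cP: "continuous_on V P" unfolding P_def using rn by (intro continuous_intros cr) auto
 have cE: "continuous_on V E" unfolding E_def using rn by (intro continuous_intros cr cs cF) auto
 have ca: "continuous_on V \<alpha>" unfolding \<alpha>_def by (intro continuous_intros cP cE)
 have cb: "continuous_on V \<beta>" unfolding \<beta>_def using rn by (intro continuous_intros cP cs) auto
 have cA: "continuous_on V A" unfolding A_def using rn by (intro continuous_intros cP cE cF cr cs cX) auto
 have cB: "continuous_on V B" unfolding B_def using rn by (intro continuous_intros cP cs cr cX) auto
 define L where "L x = - (A x \<bullet> (x - q) + real DIM('n pt) * \<alpha> x + B x \<bullet> e)" for x
 have cL: "continuous_on V L" unfolding L_def by (intro continuous_intros cA ca cB)
 \<comment> \<open>L is the negative Laplacian of b. With t = r / s = 1 / (1 + cos theta) \<ge> 1/2,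
   the bracket is -(n - 2) + (n - 3) t plus a term of order l F. The first part is at most -1/2 for
   n = 2 and equal to -1 for n = 3; the condition l Fm \<le> 1/8 keeps the sum below -1/4.\<close>
 have Leq: "L x = - (P x / (r x)\<^sup>2 * ((real CARD('n) + l - 2) * l * F x - (real CARD('n) - 2) + (real CARD('n) - 3) * (r x / s x)))" if x: "x : V" for x
 proof -
  have nz: "r x \<noteq> 0" "s x \<noteq> 0" using r0[OF x] s0[OF x] by auto
  have ms: "m x = s x - r x" by (simp add: s_def)
  have AX: "A x \<bullet> X x = (l - 2) * \<alpha> x"
   unfolding A_def \<alpha>_def inner_add_left inner_diff_left inner_scaleR_left Xr ms E_def
   using nz by (simp add: field_simps power2_eq_square power3_eq_cube)
  have Be: "B x \<bullet> e = P x / (r x)\<^sup>2 * (l * (1 - r x / s x) - r x / s x)"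
   unfolding B_def inner_add_left inner_scaleR_left Xr ms
   using nz by (simp add: field_simps power2_eq_square)
  have al: "\<alpha> x = P x / (r x)\<^sup>2 * (l * F x - 1 + r x / s x)"
   unfolding \<alpha>_def E_def using nz by (simp add: field_simps power2_eq_square)
  have "L x = - ((l - 2 + real CARD('n)) * \<alpha> x + B x \<bullet> e)"
   using AX unfolding L_def X_def by (simp add: distrib_right)
  also have "... = - ((l - 2 + real CARD('n)) * (P x / (r x)\<^sup>2 * (l * F x - 1 + r x / s x)) + P x / (r x)\<^sup>2 * (l * (1 - r x / s x) - r x / s x))"
   by (simp only: al Be)
  also have "... = - (P x / (r x)\<^sup>2 * ((l - 2 + real CARD('n)) * (l * F x - 1 + r x / s x) + (l * (1 - r x / s x) - r x / s x)))"
  proof -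
   have "- (c * (Q * E1) + Q * E2) = - (Q * (c * E1 + E2))" for c Q E1 E2 :: real by (simp add: algebra_simps)
   then show ?thesis .
  qed
  also have "(l - 2 + real CARD('n)) * (l * F x - 1 + r x / s x) + (l * (1 - r x / s x) - r x / s x)
    = (real CARD('n) + l - 2) * l * F x - (real CARD('n) - 2) + (real CARD('n) - 3) * (r x / s x)"
  proof -
   have "(l - 2 + k) * (l * f - 1 + t) + (l * (1 - t) - t) = (k + l - 2) * l * f - (k - 2) + (k - 3) * t" for k f t :: real
    by (simp add: algebra_simps)
   then show ?thesis .
  qed
  finally show ?thesis .
 qed
 have Llow: "L x >= D powr (l - 2) / 4" if x: "x : V" for x
 proof -
  have rs: "r x / s x >= 1/2" using s_hi[of x] s0[OF x] by (simp add: pos_le_divide_eq)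
  have lF: "l * F x <= 1/8" using mult_left_mono[OF F1(2)[OF x], of l] l by linarith
  have lF0: "0 <= l * F x" using F1(1)[OF x] l by simp
  have "(real CARD('n) + l - 2) * l * F x - (real CARD('n) - 2) + (real CARD('n) - 3) * (r x / s x) <= - (1/4)"
   using n
  proof
   assume n2: "CARD('n) = 2"
   have "l * (l * F x) <= 1 * (1/8)" using l lF lF0 by (intro mult_mono) auto
   then show ?thesis using rs n2 by (simp add: mult.assoc)
  next
   assume n3: "CARD('n) = 3"
   have "l * (l * F x) <= 1 * (1/8)" using l lF lF0 by (intro mult_mono) auto
   then show ?thesis using lF n3 by (simp add: algebra_simps)
  qed
  then have "P x / (r x)\<^sup>2 * ((real CARD('n) + l - 2) * l * F x - (real CARD('n) - 2) + (real CARD('n) - 3) * (r x / s x)) <= P x / (r x)\<^sup>2 * (- (1/4))"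
   using P0[OF x] r0[OF x] by (intro mult_left_mono) auto
  then have "L x >= P x / (r x)\<^sup>2 / 4" unfolding Leq[OF x] by linarith
  moreover have "P x / (r x)\<^sup>2 = r x powr (l - 2)" using r0[OF x] by (simp add: P_def powr_diff powr_numeral)
  moreover have "D powr (l - 2) <= r x powr (l - 2)"
   by (rule powr_mono2') (use l r0[OF x] D(1)[OF x] in \<open>auto simp: r_def\<close>)
  ultimately show ?thesis by simp
 qed
 have Bn: "norm (\<alpha> x *\<^sub>R (x - q) + \<beta> x *\<^sub>R e) <= (l * Fm + 2 + 2 / d) * norm (x - q) powr l / norm (x - q)" if x: "x : V" for x
 proof -
  have nz: "r x > 0" "s x > 0" using r0[OF x] s0[OF x] by auto
  have rs: "r x / s x <= 1 / d" using s_lo[OF x] nz d(1) by (simp add: field_simps)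
  have lF: "0 <= l * F x" "l * F x <= l * Fm" using F1[OF x] l by (auto intro: mult_left_mono)
  have "\<alpha> x = P x / (r x)\<^sup>2 * (l * F x - 1 + r x / s x)"
   unfolding \<alpha>_def E_def using nz by (simp add: field_simps power2_eq_square)
  moreover have "\<bar>l * F x - 1 + r x / s x\<bar> <= l * Fm + 1 + 1 / d"
   using lF rs nz by (simp add: abs_le_iff) (smt (verit) divide_pos_pos)
  ultimately have "\<bar>\<alpha> x\<bar> <= P x / (r x)\<^sup>2 * (l * Fm + 1 + 1 / d)"
   using P0[OF x] nz by (simp add: abs_mult mult_left_mono divide_right_mono)
  then have "\<bar>\<alpha> x\<bar> * r x <= P x / (r x)\<^sup>2 * (l * Fm + 1 + 1 / d) * r x" using nz by (intro mult_right_mono) auto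
  also have "... = P x / r x * (l * Fm + 1 + 1 / d)" using nz by (simp add: power2_eq_square)
  finally have 1: "\<bar>\<alpha> x\<bar> * r x <= P x / r x * (l * Fm + 1 + 1 / d)" .
  have "\<bar>\<beta> x\<bar> = P x / r x * (r x / s x)" using P0[OF x] nz by (simp add: \<beta>_def)
  also have "... <= P x / r x * (1 / d)" using P0[OF x] nz rs by (intro mult_left_mono) auto
  finally have 2: "\<bar>\<beta> x\<bar> <= P x / r x * (1 / d)" .
  have "norm (\<alpha> x *\<^sub>R (x - q) + \<beta> x *\<^sub>R e) <= \<bar>\<alpha> x\<bar> * r x + \<bar>\<beta> x\<bar>"
   using norm_triangle_ineq[of "\<alpha> x *\<^sub>R (x - q)" "\<beta> x *\<^sub>R e"] e by (simp add: r_def)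
  also have "... <= P x / r x * (l * Fm + 1 + 1 / d) + P x / r x * (1 / d)" using 1 2 by linarith
  also have "... = P x / r x * (l * Fm + 1 + 2 / d)" by (simp add: algebra_simps)
  also have "... <= P x / r x * (l * Fm + 2 + 2 / d)" using P0[OF x] nz by (intro mult_left_mono) auto
  finally show ?thesis by (simp add: P_def r_def mult.commute)
 qed
 have "(LB x. (\<alpha> x *\<^sub>R (x - q) + \<beta> x *\<^sub>R e) \<bullet> Z x) = (LB x. L x * z x)" if "C1c V z Z" for z Z
  using ibp_radial[OF V that ga cA gB cB, of q e] unfolding L_def mult_minus_left Bochner_Integration.integral_minus by simp
 then show "\<exists>B L. (\<forall>x\<in>V. GDERIV b x :> B x) \<and> continuous_on V B \<and> continuous_on V L \<and> (\<forall>x\<in>V. L x >= D powr (l - 2) / 4) \<and>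
    (\<forall>x\<in>V. norm (B x) <= (l * Fm + 2 + 2 / d) * norm (x - q) powr l / norm (x - q)) \<and>
    (\<forall>z Z. C1c V z Z --> (LB x. B x \<bullet> Z x) = (LB x. L x * z x))"
  using gb cL Llow Bn by (intro exI[of _ "%x. \<alpha> x *\<^sub>R (x - q) + \<beta> x *\<^sub>R e"] exI[of _ L])
   (auto intro!: continuous_intros ca cb)
qed

text \<open>A boundary point is not in the open set, so it lies on or below the graph. By the
  Lipschitz bound the points of Om near p then lie above the cone of slope L that opens downwards
  from p.\<close>

lemma lipschitz_cone:
 fixes Om :: "'n::finite pt set"
 assumes "lipschitz_domain Om" "p : frontier Om"
 obtains e r L where "norm e = 1" "r > 0" "L >= 0"
  "!!x. x : Om ==> x : ball p r ==> (x - p) \<bullet> e > - L * norm ((x - p) - ((x - p) \<bullet> e) *\<^sub>R e)"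
proof -
 obtain e r L h where H: "norm e = 1" "r > 0" "L-lipschitz_on {v. v \<bullet> e = 0} (h :: 'n pt => real)"
  "Om \<inter> ball p r = {x : ball p r. x \<bullet> e > h (x - (x \<bullet> e) *\<^sub>R e)}"
  using assms unfolding lipschitz_domain_def by blast
 have ee: "e \<bullet> e = 1" using H(1) by (simp add: norm_eq_1)
 have L: "L >= 0" using H(3) by (simp add: lipschitz_on_def)
 have "open Om" using assms by (simp add: lipschitz_domain_def)
 then have "p \<notin> Om" using assms(2) by (simp add: frontier_def interior_open)
 moreover have "p : ball p r" using H(2) by simp
 ultimately have hp: "p \<bullet> e <= h (p - (p \<bullet> e) *\<^sub>R e)" using H(4) by (metis (mono_tags, lifting) IntD1 mem_Collect_eq not_le)
 show ?thesis
 proof (rule that[OF H(1,2) L])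
  fix x assume x: "x : Om" "x : ball p r"
  let ?x = "x - (x \<bullet> e) *\<^sub>R e" and ?p = "p - (p \<bullet> e) *\<^sub>R e"
  have "x \<bullet> e > h ?x" using H(4) x by blast
  moreover have "?x : {v. v \<bullet> e = 0}" "?p : {v. v \<bullet> e = 0}" using ee by (simp_all add: inner_diff_left)
  then have "dist (h ?x) (h ?p) <= L * dist ?x ?p" using H(3) by (simp add: lipschitz_on_def)
  moreover have "?x - ?p = (x - p) - ((x - p) \<bullet> e) *\<^sub>R e" by (simp add: inner_diff_left algebra_simps)
  ultimately show "(x - p) \<bullet> e > - L * norm ((x - p) - ((x - p) \<bullet> e) *\<^sub>R e)"
   using hp by (simp add: dist_norm inner_diff_left abs_le_iff)
 qed
qed

text \<open>The vertex q of the barrier is p moved outwards by s. The barrier is then smooth with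
  bounded gradient on V, and near p its values are of order \<open>s powr l\<close>, hence small
  with s, while its multiple A is fixed before s.\<close>

lemma boundary_small:
 fixes Om :: "'n::finite pt set"
 assumes n: "CARD('n) = 2 \<or> CARD('n) = 3" and dom: "lipschitz_domain Om" and R: "Om \<subseteq> cball 0 R" "R >= 0"
  and y: "h10 Om y G" and g: "l2 lb g"
  and yw: "!!z Z. C1c Om z Z ==> (!!x. z x >= 0) ==> (LB x. G x \<bullet> Z x) <= (LB x. g x * z x)"
  and gc: "AE x in lb. x : Om --> g x <= c" "c >= 0"
  and p: "p : frontier Om" and ep: "ep > 0"
 shows "\<exists>d>0. AE x in lb. x : Om \<and> x : ball p d --> y x <= ep"
proof -
 have oO: "open Om" using dom by (simp add: lipschitz_domain_def)
 obtain e r L where C: "norm e = 1" "r > 0" "L >= 0"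
  "!!x. x : Om ==> x : ball p r ==> (x - p) \<bullet> e > - L * norm ((x - p) - ((x - p) \<bullet> e) *\<^sub>R e)"
  using lipschitz_cone[OF dom p] by metis
 have ee: "e \<bullet> e = 1" using C(1) by (simp add: norm_eq_1)
 define V where "V = Om \<inter> ball p r"
 have oV: "open V" using oO by (auto simp: V_def)
 \<comment> \<open>For a point above the cone with negative cosine, the squared cosine is at most
   L^2 / (1 + L^2) = 1 - 2 d, which is at most (1 - d)^2. This gives the condition of
   \<open>cone_barrier\<close>.\<close>
 define d where "d = 1 / (2 * (1 + L\<^sup>2))"
 have L2: "1 + L\<^sup>2 >= 1" by simp
 have d: "0 < d" "d <= 1/2" "2 * d * (1 + L\<^sup>2) = 1"
 proof -
  have p: "1 + L\<^sup>2 > 0" using L2 by linarith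
  show d0: "0 < d" using p by (simp add: d_def)
  show d1: "2 * d * (1 + L\<^sup>2) = 1" using p by (simp add: d_def)
  show "d <= 1/2" using mult_left_mono[OF L2, of "2 * d"] d0 d1 by simp
 qed
 define Fm where "Fm = 1 - ln d + ln 2"
 have Fm: "Fm >= 1"
 proof -
  have "ln d <= ln 1" using d by (subst ln_le_cancel_iff) auto
  moreover have "ln (2::real) >= 0" by simp
  ultimately show ?thesis unfolding Fm_def ln_one by linarith
 qed
 define l where "l = 1 / (8 * Fm)"
 have l: "0 < l" "l <= 1" "l * Fm <= 1/8" using Fm by (auto simp: l_def field_simps)
 define D where "D = 2 * R + r + 1"
 have D1: "D >= 1" using R C by (simp add: D_def)
 define C0 where "C0 = c * R\<^sup>2"
 have yC0: "AE x in lb. y x <= C0" unfolding C0_def by (rule sup_bound[OF oO R y g yw gc])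
 \<comment> \<open>The summands serve three purposes: A \<ge> 1, the differential inequality for A b
   with right-hand side c (the barrier has negative Laplacian at least
   \<open>D powr (l - 2) / 4\<close>), and the domination of the global bound C0 at distance at
   least r/4 from the vertex.\<close>
 define A where "A = 1 + 4 * c / D powr (l - 2) + C0 / (r / 4) powr l"
 have C00: "C0 >= 0" using gc by (simp add: C0_def)
 have pw: "D powr (l - 2) > 0" "(r / 4) powr l > 0" using D1 C by auto
 have A1: "A >= 1" using gc C00 pw by (simp add: A_def)
 have Ac: "A * (D powr (l - 2) / 4) >= c"
 proof -
  have "4 * c / D powr (l - 2) <= A" using C00 pw by (simp add: A_def)
  then show ?thesis using pw by (simp add: pos_divide_le_eq)
 qed
 have AC: "A * (r / 4) powr l >= C0"
 proof -
  have "C0 / (r / 4) powr l <= A" using gc pw by (simp add: A_def)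
  then show ?thesis using pw by (simp add: pos_divide_le_eq)
 qed
 have AF: "A * Fm > 0" using A1 Fm by simp
 \<comment> \<open>Small enough that A b is at most ep within distance 2 s of the vertex, and that
   points outside the ball of radius r/2 around p keep distance r/4 from the vertex.\<close>
 define s where "s = min (r / 8) ((ep / (A * Fm)) powr (1 / l) / 2)"
 have s: "s > 0" "s < r / 4" using C ep AF by (auto simp: s_def)
 have s2: "A * Fm * (2 * s) powr l <= ep"
 proof -
  have "(2 * s) powr l <= ((ep / (A * Fm)) powr (1 / l)) powr l"
   using s l by (intro powr_mono2) (auto simp: s_def)
  also have "... = ep / (A * Fm)" using l ep AF by (simp add: powr_powr)
  finally show ?thesis using AF by (simp add: pos_le_divide_eq mult.commute)
 qed
 define q where "q = p - s *\<^sub>R e"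
 have geo: "(x - q) \<bullet> e >= (d - 1) * norm (x - q) \<and> norm (x - q) > s / (1 + L)" if x: "x : V" for x
 proof -
  define u where "u = (x - p) \<bullet> e"
  define w where "w = norm ((x - p) - u *\<^sub>R e)"
  define m where "m = (x - q) \<bullet> e"
  define Nx where "Nx = norm (x - q)"
  have m: "m = u + s" using ee by (simp add: m_def u_def q_def inner_diff_left inner_add_left algebra_simps)
  have c1: "u > - L * w" using C(4)[of x] x by (simp add: u_def w_def V_def)
  have xe: "x - q = ((x - p) - u *\<^sub>R e) + m *\<^sub>R e" by (simp add: m q_def algebra_simps)
  have orth: "((x - p) - u *\<^sub>R e) \<bullet> e = 0" using ee by (simp add: inner_diff_left u_def)
  have N2: "Nx\<^sup>2 = m\<^sup>2 + w\<^sup>2"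
   unfolding Nx_def w_def power2_norm_eq_inner by (subst (1 2) xe) (use orth ee in \<open>simp add: inner_add_left inner_add_right inner_commute power2_eq_square\<close>)
  have N0: "Nx >= 0" "w >= 0" by (simp_all add: Nx_def w_def)
  have le: "m <= Nx" "w <= Nx" by (rule power2_le_imp_le, use N2 N0 in simp, use N0 in simp)+
  have "s < m + L * w" using c1 m by simp
  also have "... <= Nx + L * Nx" using le C(3) by (intro add_mono mult_left_mono) auto
  finally have "s < Nx * (1 + L)" by (simp add: algebra_simps)
  then have g2: "Nx > s / (1 + L)" using C(3) by (simp add: pos_divide_less_eq)
  have "m >= (d - 1) * Nx"
  proof (cases "m >= 0")
   case True
   have "(d - 1) * Nx <= 0" using d N0 by (intro mult_nonpos_nonneg) auto
   then show ?thesis using True by linarith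
  next
   case False
   have "- m <= L * w" using c1 m s by linarith
   then have "(- m)\<^sup>2 <= (L * w)\<^sup>2" using False by (intro power_mono) auto
   then have "m\<^sup>2 * (1 + L\<^sup>2) <= L\<^sup>2 * Nx\<^sup>2" unfolding N2 by (simp add: power_mult_distrib algebra_simps)
   moreover have "L\<^sup>2 * Nx\<^sup>2 = (1 - 2 * d) * Nx\<^sup>2 * (1 + L\<^sup>2)"
   proof -
    have "(1 - 2 * d) * (1 + L\<^sup>2) = L\<^sup>2" using d(3) by (simp add: algebra_simps)
    then show ?thesis by (simp add: mult.commute mult.left_commute)
   qed
   ultimately have "m\<^sup>2 * (1 + L\<^sup>2) <= ((1 - 2 * d) * Nx\<^sup>2) * (1 + L\<^sup>2)" by simp
   then have "m\<^sup>2 <= (1 - 2 * d) * Nx\<^sup>2" using L2 by (simp add: mult_le_cancel_right)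
   also have "... <= (1 - d)\<^sup>2 * Nx\<^sup>2" by (intro mult_right_mono) (auto simp: power2_diff)
   finally have "(- m)\<^sup>2 <= ((1 - d) * Nx)\<^sup>2" by (simp add: power_mult_distrib)
   then have "- m <= (1 - d) * Nx" by (rule power2_le_imp_le) (use d N0 in auto)
   then show ?thesis by (simp add: algebra_simps)
  qed
  then show ?thesis using g2 by (simp add: m_def Nx_def)
 qed
 have pR: "norm p <= R"
 proof -
  have "p : closure Om" using p by (simp add: frontier_def)
  then have "p : cball 0 R" using closure_minimal[OF R(1) closed_cball] by blast
  then show ?thesis by simp
 qed
 have sL: "s / (1 + L) > 0" using s C by simp
 have nD: "norm (x - q) <= D" if "x : V" for x
 proof -
  have "norm x <= R" using that R(1) by (auto simp: V_def)
  moreover have "norm (x - q) <= norm x + norm p + s"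
   using norm_triangle_ineq4[of x q] norm_triangle_ineq4[of p "s *\<^sub>R e"] C(1) s(1) by (simp add: q_def)
  ultimately show ?thesis using pR s C by (simp add: D_def)
 qed
 define b where "b x = norm (x - q) powr l * (1 - ln d + ln (norm (x - q) + (x - q) \<bullet> e) - ln (norm (x - q)))" for x
 have Vq: "x \<noteq> q" if "x : V" for x using geo[OF that] sL by auto
 note CB = cone_barrier[OF n C(1) oV d(1) conjunct1[OF geo] Vq nD D1 Fm_def l, folded b_def[abs_def]]
 have b_lo: "norm (x - q) powr l <= b x" if "x : V" for x using CB(1)[OF _ _ _ that] by (simp add: b_def)
 have b_hi: "b x <= Fm * norm (x - q) powr l" if "x : V" for x using CB(2)[OF _ _ _ that] by (simp add: b_def)
 have "\<exists>B L. (\<forall>x\<in>V. GDERIV b x :> B x) \<and> continuous_on V B \<and> continuous_on V L \<and> (\<forall>x\<in>V. L x >= D powr (l - 2) / 4) \<and>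
    (\<forall>x\<in>V. norm (B x) <= (l * Fm + 2 + 2 / d) * norm (x - q) powr l / norm (x - q)) \<and>
    (\<forall>z Z. C1c V z Z --> (LB x. B x \<bullet> Z x) = (LB x. L x * z x))"
  unfolding b_def[abs_def] by (rule cone_barrier(3)[OF n C(1) oV d(1) _ _ _ D1 Fm_def l]) (use geo Vq nD in blast)+
 then obtain B Lb where B': "\<forall>x\<in>V. GDERIV b x :> B x" "continuous_on V B" "continuous_on V Lb" "\<forall>x\<in>V. Lb x >= D powr (l - 2) / 4"
   "\<forall>x\<in>V. norm (B x) <= (l * Fm + 2 + 2 / d) * norm (x - q) powr l / norm (x - q)"
   "\<forall>z Z. C1c V z Z --> (LB x. B x \<bullet> Z x) = (LB x. Lb x * z x)"
  by (elim exE conjE)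
 note B = B'(1)[rule_format] B'(2,3) B'(4)[rule_format] B'(5)[rule_format] B'(6)[rule_format]
 define M1 where "M1 = (l * Fm + 2 + 2 / d) * D powr l / (s / (1 + L))"
 have BM: "norm (B x) <= M1" if x: "x : V" for x
 proof -
  have "(l * Fm + 2 + 2 / d) * norm (x - q) powr l / norm (x - q) <= (l * Fm + 2 + 2 / d) * D powr l / (s / (1 + L))"
   using geo[OF x] sL nD[OF x] l Fm d by (intro frac_le mult_left_mono powr_mono2 mult_nonneg_nonneg add_nonneg_nonneg) auto
  then show ?thesis using B(5)[OF x] by (simp add: M1_def)
 qed
 have bo: "bounded V" using R(1) bounded_subset[OF bounded_cball, of V 0 R] by (auto simp: V_def)
 have "AE x in lb. x : Om \<inter> ball p r --> y x <= A * b x"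
 proof (rule comparison_smooth[OF oO R open_ball compact_cball[of p "r/2"] _ y g, where B="%x. A *\<^sub>R B x" and L="%x. c" and M="max (A * (Fm * D powr l)) (A * M1)"], unfold V_def[symmetric])
  show "cball p (r/2) \<subseteq> ball p r" using C by auto
  show "(LB x. G x \<bullet> Z x) <= (LB x. g x * z x)" if "C1c V z Z" "!!x. z x >= 0" for z Z
   using yw[OF C1c_mono[OF that(1)]] that(2) by (auto simp: V_def)
  show "GDERIV (%x. A * b x) x :> A *\<^sub>R B x" if "x : V" for x
   using GDERIV_mult[OF GDERIV_const[of A] B(1)[OF that]] by simp
  show "continuous_on V (%x. A *\<^sub>R B x)" by (intro continuous_intros B(2))
  show "0 <= A * b x \<and> A * b x <= max (A * (Fm * D powr l)) (A * M1) \<and> norm (A *\<^sub>R B x) <= max (A * (Fm * D powr l)) (A * M1)" if x: "x : V" for x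
  proof -
   have "0 <= b x" using b_lo[OF x] powr_ge_zero order_trans by blast
   moreover have "b x <= Fm * D powr l"
    using b_hi[OF x] powr_mono2[of l "norm (x - q)" D] l nD[OF x] Fm by (smt (verit) mult_left_mono norm_ge_zero)
   ultimately show ?thesis using A1 BM[OF x] by (auto simp: le_max_iff_disj intro: mult_left_mono)
  qed
  show "l2 lb (%x. indicator V x * c)"
   using indicator_continuous_l2[OF oV bo, of "%x. c" c] gc(2) by simp
  show "(LB x. c * z x) <= (LB x. (A *\<^sub>R B x) \<bullet> Z x)" if z: "C1c V z Z" "!!x. 0 <= z x" for z Z
  proof -
   have "(LB x. c * z x) <= (LB x. A * (Lb x * z x))"
   proof (rule integral_mono)
    show "c * z x <= A * (Lb x * z x)" for x
    proof (cases "x : V")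
     case True
     have "c <= A * Lb x" using Ac mult_left_mono[OF B(4)[OF True], of A] A1 by linarith
     then show ?thesis using z(2)[of x] by (simp add: mult_right_mono mult.assoc[symmetric])
    qed (use C1cD(5)[OF z(1)] in simp)
   qed (use C1c_l2(3)[OF z(1)] C1c_mult_integrable(1)[OF oV z(1) B(3)] in auto)
   then show ?thesis using B(6)[OF z(1)] by simp
  qed
  show "AE x in lb. x : V - cball p (r/2) --> y x <= A * b x"
   using yC0
  proof eventually_elim
   case (elim x)
   show ?case
   proof
    assume x: "x : V - cball p (r/2)"
    have "norm (x - p) <= norm (x - q) + s"
     using norm_triangle_ineq4[of "x - q" "s *\<^sub>R e"] C(1) s(1) by (simp add: q_def)
    then have "r / 4 <= norm (x - q)" using x s(2) by (simp add: dist_norm norm_minus_commute)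
    then have "(r / 4) powr l <= norm (x - q) powr l" using C(2) l by (intro powr_mono2) auto
    also have "... <= b x" using b_lo x by blast
    finally have "A * (r / 4) powr l <= A * b x" using A1 by (intro mult_left_mono) auto
    then show "y x <= A * b x" using elim AC by linarith
   qed
  qed
  show "AE x in lb. x : V \<and> A * b x < y x --> g x <= c" using gc(1) by eventually_elim (auto simp: V_def)
 qed
 then have "AE x in lb. x : Om \<and> x : ball p s --> y x <= ep"
 proof eventually_elim
  case (elim x)
  show ?case
  proof
   assume x: "x : Om \<and> x : ball p s"
   then have xV: "x : V" using s by (auto simp: V_def)
   have "norm (x - q) <= norm (x - p) + s"
    using norm_triangle_ineq[of "x - p" "s *\<^sub>R e"] C(1) s(1) by (simp add: q_def algebra_simps)
   then have "norm (x - q) <= 2 * s" using x by (simp add: dist_norm norm_minus_commute)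
   then have "norm (x - q) powr l <= (2 * s) powr l" using l by (intro powr_mono2) auto
   then have "A * (Fm * norm (x - q) powr l) <= A * (Fm * (2 * s) powr l)" using A1 Fm by (intro mult_left_mono) auto
   moreover have "A * b x <= A * (Fm * norm (x - q) powr l)" using b_hi[OF xV] A1 by (intro mult_left_mono) auto
   moreover have "y x <= A * b x" using elim xV by (simp add: V_def)
   ultimately show "y x <= ep" using s2 by (simp add: mult.assoc)
  qed
 qed
 then show ?thesis using s(1) by blast
qed

lemma infdist_complement:
 fixes Om :: "'n::finite pt set"
 assumes "open Om" "bounded Om"
 shows "- Om \<noteq> {}" "closed (- Om)" "x \<notin> Om ==> infdist x (- Om) = 0" "infdist x (- Om) > 0 \<longleftrightarrow> x : Om"
  "x : Om ==> infdist x (- Om) < d ==> \<exists>p\<in>frontier Om. dist p x < d"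
proof -
 show ne: "- Om \<noteq> {}" using assms(2) not_bounded_UNIV by (metis Compl_UNIV_eq double_compl)
 show cl: "closed (- Om)" by (rule closed_Compl[OF assms(1)])
 show z: "x \<notin> Om ==> infdist x (- Om) = 0" for x by simp
 show "infdist x (- Om) > 0 \<longleftrightarrow> x : Om"
  using z[of x] infdist_pos_not_in_closed[OF cl ne, of x] by (cases "x : Om") auto
 assume x: "x : Om" "infdist x (- Om) < d"
 obtain p' where p': "p' : - Om" "infdist x (- Om) = dist x p'" using infdist_attains_inf[OF cl ne] by metis
 have "ball x d \<inter> frontier Om \<noteq> {}"
 proof (rule connected_Int_frontier)
  have "d > 0" using p'(2) x(2) zero_le_dist[of x p'] by linarith
  then have "x : ball x d" by simp
  then show "ball x d \<inter> Om \<noteq> {}" using x(1) by blast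
  show "ball x d - Om \<noteq> {}" using p' x by auto
 qed simp
 then show "\<exists>p\<in>frontier Om. dist p x < d" by (auto simp: dist_commute)
qed

text \<open>The one-sided estimate is applied to y and to - y, and compactness of the boundary makes
  it uniform.\<close>

lemma near_boundary:
 fixes Om :: "'n::finite pt set"
 assumes n: "CARD('n) = 2 \<or> CARD('n) = 3" and dom: "lipschitz_domain Om"
  and y: "h10 Om y G" and g: "l2 lb g" and yw: "wsol Om G g"
  and gc: "AE x in lb. x : Om --> \<bar>g x\<bar> <= c" "c >= 0" and ep: "ep > 0"
 shows "\<exists>d>0. AE x in lb. infdist x (- Om) < d --> \<bar>y x\<bar> <= ep"
proof -
 have oO: "open Om" "bounded Om" using dom by (auto simp: lipschitz_domain_def)
 obtain R where R: "Om \<subseteq> cball 0 R" "R >= 0"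
  using bounded_subset_ballD[OF oO(2), of 0] ball_subset_cball[of 0] by (metis less_imp_le order_trans)
 have "\<forall>p\<in>frontier Om. \<exists>d. d > 0 \<and> (AE x in lb. x : Om \<and> x : ball p d --> \<bar>y x\<bar> <= ep)"
 proof
  fix p assume p: "p : frontier Om"
  have "\<exists>d>0. AE x in lb. x : Om \<and> x : ball p d --> y x <= ep"
   by (rule boundary_small[OF n dom R y g _ _ gc(2) p ep])
    (use yw gc(1) in \<open>auto simp: wsol_def elim: eventually_mono\<close>)
  moreover have "\<exists>d>0. AE x in lb. x : Om \<and> x : ball p d --> (-1) * y x <= ep"
   by (rule boundary_small[OF n dom R h10_scaleR[OF y] l2_scaleR[OF g, of "-1"] _ _ gc(2) p ep])
    (use yw gc(1) in \<open>auto simp: wsol_def elim: eventually_mono\<close>)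
  ultimately obtain d1 d2 where d: "d1 > 0" "d2 > 0" "AE x in lb. x : Om \<and> x : ball p d1 --> y x <= ep"
   "AE x in lb. x : Om \<and> x : ball p d2 --> (-1) * y x <= ep" by blast
  have "AE x in lb. x : Om \<and> x : ball p (min d1 d2) --> \<bar>y x\<bar> <= ep"
   using d(3,4) by eventually_elim auto
  then show "\<exists>d. d > 0 \<and> (AE x in lb. x : Om \<and> x : ball p d --> \<bar>y x\<bar> <= ep)" using d(1,2) by (intro exI[of _ "min d1 d2"]) auto
 qed
 from bchoice[OF this] obtain f where f: "!!p. p : frontier Om ==> f p > 0 \<and> (AE x in lb. x : Om \<and> x : ball p (f p) --> \<bar>y x\<bar> <= ep)" by blast
 have cf: "compact (frontier Om)" by (rule compact_frontier_bounded[OF oO(2)])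
 have cov: "frontier Om \<subseteq> (\<Union>p\<in>frontier Om. ball p (f p))" using f by force
 obtain T where T: "T \<subseteq> frontier Om" "finite T" "frontier Om \<subseteq> (\<Union>p\<in>T. ball p (f p))"
  using compactE_image[OF cf open_ball cov] by blast
 obtain d where d: "d > 0" "(\<Union>x\<in>frontier Om. cball x d) \<subseteq> (\<Union>p\<in>T. ball p (f p))"
  using compact_subset_open_imp_cball_epsilon_subset[OF cf open_UN[OF ballI[OF open_ball]] T(3)] by blast
 have "AE x in lb. \<forall>p\<in>T. x : Om \<and> x : ball p (f p) --> \<bar>y x\<bar> <= ep"
  using f T(1) by (intro AE_finite_allI[OF T(2)]) blast
 then have "AE x in lb. infdist x (- Om) < d --> \<bar>y x\<bar> <= ep"
  using h10_zero_outside[OF y]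
 proof eventually_elim
  case (elim x)
  show ?case
  proof
   assume a: "infdist x (- Om) < d"
   show "\<bar>y x\<bar> <= ep"
   proof (cases "x : Om")
    case True
    then obtain p where "p : frontier Om" "dist p x < d" using infdist_complement(5)[OF oO True a] by blast
    then have "x : (\<Union>x\<in>frontier Om. cball x d)" by force
    then obtain p' where "p' : T" "x : ball p' (f p')" using d(2) by blast
    then show ?thesis using elim True by blast
   qed (use elim ep in auto)
  qed
 qed
 then show ?thesis using d(1) by blast
qed

section \<open>Continuity up to the boundary\<close>

lemma C1c_shift:
 fixes \<tau> :: "'a::euclidean_space"
 assumes z: "C1c V z Z" and V: "!!x. x : V ==> x + \<tau> : U"
 shows "C1c U (%x. z (x - \<tau>)) (%x. Z (x - \<tau>))"
proof -
 obtain K where K: "compact K" "K \<subseteq> V" "!!x. x \<notin> K ==> z x = 0 \<and> Z x = 0" using C1cD(4)[OF z] by blast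
 have g: "GDERIV (%x. z (x - \<tau>)) x :> Z (x - \<tau>)" for x
 proof -
  have "((%x. x - \<tau>) has_derivative (%h. h)) (at x)" by (auto intro!: derivative_eq_intros)
  from has_derivative_compose[OF this C1cD(1)[OF z, of "x - \<tau>", unfolded gderiv_def]]
  show ?thesis by (simp add: gderiv_def)
 qed
 have c: "continuous_on UNIV (%x. Z (x - \<tau>))"
  by (intro continuous_on_compose2[OF C1cD(2)[OF z]] continuous_intros) auto
 let ?K = "(+) \<tau> ` K"
 have "compact ?K" by (rule compact_translation[OF K(1)])
 moreover have "?K \<subseteq> U"
 proof
  fix x assume "x : ?K"
  then obtain k where "k : K" "x = k + \<tau>" by (auto simp: add.commute)
  then show "x : U" using V K(2) by blast
 qed
 moreover have "z (x - \<tau>) = 0 \<and> Z (x - \<tau>) = 0" if "x \<notin> ?K" for x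
 proof -
  have "x - \<tau> \<notin> K" using that by (metis add.commute diff_add_cancel image_eqI)
  then show ?thesis using K(3) by blast
 qed
 ultimately show ?thesis unfolding C1c_def using g c by blast
qed

text \<open>Where \<open>x\<close> or \<open>x + \<tau>\<close> is close to the boundary both values are small; elsewhere the translate of \<open>y\<close> solves an
 equation with a close right-hand side, and a paraboloid absorbs the difference.\<close>
lemma translation_close_aux:
 fixes Om :: "'n::finite pt set"
 assumes n: "CARD('n) = 2 \<or> CARD('n) = 3" and dom: "lipschitz_domain Om"
  and y: "h10 Om y G" and h: "continuous_on UNIV h" "compact K" "!!x. x \<notin> K ==> h x = 0" and yw: "wsol Om G h"
  and ep: "ep > 0"
 shows "\<exists>d>0. \<forall>\<tau>. norm \<tau> < d --> (AE x in lb. y (x + \<tau>) - y x <= ep)"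
proof -
 have oO: "open Om" "bounded Om" using dom by (auto simp: lipschitz_domain_def)
 obtain R where R: "Om \<subseteq> cball 0 R" "R >= 0"
  using bounded_subset_ballD[OF oO(2), of 0] ball_subset_cball[of 0] by (metis less_imp_le order_trans)
 note I = infdist_complement[OF oO]
 obtain c where c: "!!x. norm (h x) <= c" "c >= 0" using bounded_compact_support[OF h] by blast
 note hl = continuous_compact_integrable(2)[OF h]
 \<comment> \<open>The budget: 2 e1 bounds the difference of two values near the boundary, and e1
   R^2 bounds the paraboloid with negative Laplacian e1, where e1 also bounds the change of h under
   the translation.\<close>
 define e1 where "e1 = ep / (3 + R\<^sup>2)"
 have e1: "e1 > 0" "2 * e1 + e1 * R\<^sup>2 <= ep"
 proof -
  have p: "3 + R\<^sup>2 > 0" by (simp add: add_pos_nonneg)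
  show e0: "e1 > 0" using ep p by (simp add: e1_def)
  have "e1 * (3 + R\<^sup>2) = ep" using p by (simp add: e1_def)
  then show "2 * e1 + e1 * R\<^sup>2 <= ep" using e0 by (simp add: algebra_simps)
 qed
 obtain d0 where d0: "d0 > 0" "AE x in lb. infdist x (- Om) < d0 --> \<bar>y x\<bar> <= e1"
  using near_boundary[OF n dom y hl yw _ c(2) e1(1)] c(1) by auto
 obtain d1 where d1: "d1 > 0" "!!x x'. norm (x - x') < d1 ==> norm (h x - h x') < e1"
  using uniform_continuity_compact_support[OF h e1(1)] by blast
 \<comment> \<open>For translations shorter than d0/4, V is carried into Om, and if x is outside K'
   (distance less than d0/2) then both x and its translate are within d0 of the complement, where
   the solution is small.\<close>
 define V where "V = {x. d0 / 4 < infdist x (- Om)}"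
 have oV: "open V" unfolding V_def by (intro open_Collect_less continuous_intros)
 have VO: "V \<subseteq> Om"
 proof
  fix x assume "x : V"
  then have "infdist x (- Om) > 0" using d0(1) by (simp add: V_def)
  then show "x : Om" using I(4) by blast
 qed
 have VR: "V \<subseteq> cball 0 R" using VO R by blast
 have bV: "bounded V" using VO oO(2) bounded_subset by blast
 define K' where "K' = {x. d0 / 2 <= infdist x (- Om)}"
 have K'V: "K' \<subseteq> V" using d0(1) by (auto simp: K'_def V_def)
 have "closed K'" unfolding K'_def by (intro closed_Collect_le continuous_intros)
 then have K'c: "compact K'" using bounded_subset[OF bV K'V] by (simp add: compact_eq_bounded_closed)
 obtain ch Ch where ch: "C1c V ch Ch" "!!x. x : K' ==> ch x = 1" "!!x. x : K' ==> Ch x = 0" "!!x. 0 <= ch x" "!!x. ch x <= 1"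
  using cutoff[OF K'c K'V oV] by metis
 obtain Bc where Bc: "!!x. norm (Ch x) <= Bc" using C1c_bounded[OF ch(1)] by blast
 obtain ps Ps where p: "!!k. C1c Om (ps k) (Ps k)" "l2lim lb ps y" "l2lim lb Ps G"
  using y unfolding h10_def by blast
 let ?I = "%x. indicator V x :: real"
 let ?P = "%x::'n pt. e1 * (R\<^sup>2 - x \<bullet> x) / (2 * real CARD('n))" and ?Q = "%x::'n pt. (- e1 / real CARD('n)) *\<^sub>R x"
 have n1: "real CARD('n) >= 1" by (simp add: Suc_leI)
 have P: "0 <= ?P x" "?P x <= e1 * R\<^sup>2" "norm (?Q x) <= e1 * R" if "x : Om" for x
 proof -
  have xR: "x \<bullet> x <= R\<^sup>2" "norm x <= R" using that R by (auto simp: dot_square_norm intro!: power_mono)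
  show "0 <= ?P x" using xR e1 by simp
  have "e1 * (R\<^sup>2 - x \<bullet> x) / (2 * real CARD('n)) <= e1 * (R\<^sup>2 - x \<bullet> x) / 1"
   using xR e1 n1 by (intro divide_left_mono mult_nonneg_nonneg) linarith+
  also have "... <= e1 * R\<^sup>2" using e1 by (simp add: mult_left_mono)
  finally show "?P x <= e1 * R\<^sup>2" .
  have "e1 / real CARD('n) <= e1" using e1 n1 by (simp add: divide_le_eq mult_le_cancel_left1)
  then have "e1 / real CARD('n) * norm x <= e1 * R" using xR e1 by (intro mult_mono) auto
  then show "norm (?Q x) <= e1 * R" using e1 by simp
 qed
 have Im: "?I : bml" by (rule borel_measurable_indicator[OF open_lebesgue[OF oV]])
 have Ib: "AE x in lb. \<bar>?I x\<bar> <= 1" by (auto simp: indicator_def)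
 have main: "AE x in lb. y (x + \<tau>) - y x <= ep" if t: "norm \<tau> < min (d0 / 4) d1" for \<tau>
 proof -
  have inf_t: "\<bar>infdist (x + \<tau>) (- Om) - infdist x (- Om)\<bar> < d0 / 4" for x
   using infdist_triangle_abs[of "x + \<tau>" "- Om" x] t by (simp add: dist_norm)
  have shV: "x + \<tau> : Om" if "x : V" for x
  proof -
   have "d0 / 4 < infdist x (- Om)" using that by (simp add: V_def)
   then have "infdist (x + \<tau>) (- Om) > 0" using inf_t[of x] by linarith
   then show ?thesis using I(4) by blast
  qed
  have cP: "continuous_on V (%x. 2 * e1 + ?P x)" by (intro continuous_intros) auto
  have lP: "l2 lb (%x. ?I x *\<^sub>R (2 * e1 + ?P x))"
  proof (rule indicator_continuous_l2[OF oV bV cP])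
   show "norm (2 * e1 + ?P x) <= 2 * e1 + e1 * R\<^sup>2" if "x : V" for x
    using P(1,2)[of x] VO that e1 by (auto simp: abs_le_iff)
  qed
  have lQ: "l2 lb (%x. ?I x *\<^sub>R ?Q x)"
   by (rule indicator_continuous_l2[OF oV bV, of _ "e1 * R"]) (use P(3) VO in \<open>auto intro!: continuous_intros simp del: norm_scaleR\<close>)
  have l1: "l2lim lb (%k x. ?I x *\<^sub>R (ps k (x + \<tau>) - ps k x - (2 * e1 + ?P x))) (%x. ?I x *\<^sub>R (y (x + \<tau>) - y x - (2 * e1 + ?P x)))"
   using l2lim_diff[OF l2lim_mult_const[OF l2lim_diff[OF l2lim_shift[OF p(2), of \<tau>] p(2)] Im Ib] l2lim_const[OF lP]]
   by (simp only: scaleR_diff_right)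
  have l2': "l2lim lb (%k x. ?I x *\<^sub>R (Ps k (x + \<tau>) - Ps k x - ?Q x)) (%x. ?I x *\<^sub>R (G (x + \<tau>) - G x - ?Q x))"
   using l2lim_diff[OF l2lim_mult_const[OF l2lim_diff[OF l2lim_shift[OF p(3), of \<tau>] p(3)] Im Ib] l2lim_const[OF lQ]]
   by (simp only: scaleR_diff_right)
  have hs: "l2 lb (%x. h (x + \<tau>))" by (rule l2_shift(1)[OF hl])
  have lI: "l2 lb (%x. ?I x *\<^sub>R e1)"
   by (rule indicator_continuous_l2[OF oV bV continuous_on_const, of _ "\<bar>e1\<bar>"]) simp
  have lr: "l2 lb (%x. ?I x *\<^sub>R (h (x + \<tau>) - h x) - ?I x *\<^sub>R e1)"
   by (rule l2_diff[OF l2_mult_bounded(1)[OF l2_diff[OF hs hl] Im Ib] lI])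
  have "AE x in lb. ?I x *\<^sub>R (y (x + \<tau>) - y x - (2 * e1 + ?P x)) <= 0"
  proof (rule comparison[OF oV VR R(2) _ _ l1 l2' C1cD(1,2)[OF ch(1)] ch(4,5) Bc])
   show "GDERIV (%x. ps k (x + \<tau>) - ps k x - (2 * e1 + ?P x)) x :> Ps k (x + \<tau>) - Ps k x - ?Q x" for k x
   proof -
    have "((%x. x + \<tau>) has_derivative (%h. h)) (at x)" by (auto intro!: derivative_eq_intros)
    from has_derivative_compose[OF this C1cD(1)[OF p(1)[of k], of "x + \<tau>", unfolded gderiv_def]]
    have 1: "GDERIV (%x. ps k (x + \<tau>)) x :> Ps k (x + \<tau>)" by (simp add: gderiv_def)
    show ?thesis
     using GDERIV_diff[OF GDERIV_diff[OF 1 C1cD(1)[OF p(1)[of k], of x]] GDERIV_add[OF GDERIV_const[of "2 * e1"] paraboloid_GDERIV[of e1 R x]]] by simp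
   qed
   show "continuous_on V (%x. Ps k (x + \<tau>) - Ps k x - ?Q x)" for k
    by (intro continuous_intros continuous_on_compose2[OF C1cD(2)[OF p(1)[of k]], of V] continuous_on_subset[OF C1cD(2)[OF p(1)[of k]]]) auto
   show "\<exists>K. compact K \<and> K \<subseteq> V \<and> (\<forall>x\<in>V - K. (ch x = 0 \<and> Ch x = 0) \<or> ps k (x + \<tau>) - ps k x - (2 * e1 + ?P x) <= 0)" for k
    using C1cD(4)[OF ch(1)] by blast
   show "AE x in lb. ?I x *\<^sub>R (y (x + \<tau>) - y x - (2 * e1 + ?P x)) <= 0 \<or> (ch x = 1 \<and> Ch x = 0)"
    using d0(2) AE_shift[OF d0(2), of \<tau>]
   proof eventually_elim
    case (elim x)
    show ?case
    proof (cases "x : V - K'")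
     case True
     then have "infdist x (- Om) < d0 / 2" by (simp add: K'_def not_le)
     then have "\<bar>y x\<bar> <= e1" "\<bar>y (x + \<tau>)\<bar> <= e1" using elim inf_t[of x] d0(1) by (auto simp: abs_less_iff)
     then show ?thesis using P(1)[of x] VO True by (auto simp: abs_le_iff)
    qed (use ch in \<open>auto simp: indicator_def\<close>)
   qed
   show "l2 lb (%x. ?I x *\<^sub>R (h (x + \<tau>) - h x) - ?I x *\<^sub>R e1)" by (rule lr)
   show "AE x in lb. 0 < ?I x *\<^sub>R (y (x + \<tau>) - y x - (2 * e1 + ?P x)) --> ?I x *\<^sub>R (h (x + \<tau>) - h x) - ?I x *\<^sub>R e1 <= 0"
   proof (rule AE_I2, rule impI)
    fix x
    have "norm (h (x + \<tau>) - h x) < e1" using d1(2)[of "x + \<tau>" x] t by simp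
    then show "?I x *\<^sub>R (h (x + \<tau>) - h x) - ?I x *\<^sub>R e1 <= 0" by (simp add: indicator_def abs_less_iff)
   qed
   show "(LB x. (?I x *\<^sub>R (G (x + \<tau>) - G x - ?Q x)) \<bullet> Z x) <= (LB x. (?I x *\<^sub>R (h (x + \<tau>) - h x) - ?I x *\<^sub>R e1) * z x)"
    if z: "C1c V z Z" "!!x. z x >= 0" for z Z
   proof -
    have Iz: "?I x *\<^sub>R Z x = Z x" "?I x * z x = z x" for x using C1cD(5,6)[OF z(1), of x] by (auto simp: indicator_def)
    note zl = C1c_l2[OF z(1)]
    note Gl = h10_l2(2)[OF y]
    have Gs: "l2 lb (%x. G (x + \<tau>))" by (rule l2_shift(1)[OF Gl])
    have iQ: "integrable lb (%x. ?Q x \<bullet> Z x)"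
     by (rule C1c_mult_integrable(2)[OF oV z(1)]) (intro continuous_intros)
    have A: "(LB x. G (x + \<tau>) \<bullet> Z x) = (LB x. h (x + \<tau>) * z x)"
    proof -
     note zs = C1c_shift[OF z(1) shV]
     have "(LB x. G (x + \<tau>) \<bullet> Z x) = (LB x. (%x. G x \<bullet> Z (x - \<tau>)) (x + \<tau>))" by simp
     also have "... = (LB x. G x \<bullet> Z (x - \<tau>))"
      by (rule integral_shift) (use l2_inner_integrable[OF Gl C1c_l2(2)[OF zs]] in auto)
     also have "... = (LB x. h x * z (x - \<tau>))" using yw zs unfolding wsol_def by blast
     also have "... = (LB x. (%x. h x * z (x - \<tau>)) (x + \<tau>))"
      by (rule integral_shift[symmetric]) (use l2_real_mult[OF hl C1c_l2(1)[OF zs]] in auto)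
     finally show ?thesis by simp
    qed
    have B: "(LB x. G x \<bullet> Z x) = (LB x. h x * z x)"
     using yw C1c_mono[OF z(1) VO] unfolding wsol_def by blast
    have Qe: "(LB x. ?Q x \<bullet> Z x) = (LB x. e1 * z x)" by (rule paraboloid[OF z(1) oV])
    have "(LB x. (?I x *\<^sub>R (G (x + \<tau>) - G x - ?Q x)) \<bullet> Z x) = (LB x. G (x + \<tau>) \<bullet> Z x - G x \<bullet> Z x - ?Q x \<bullet> Z x)"
    proof (intro int_cong refl)
     fix x
     have "((G (x + \<tau>) - G x - q)) \<bullet> Z x = G (x + \<tau>) \<bullet> Z x - G x \<bullet> Z x - q \<bullet> Z x" for q by (simp only: inner_diff_left)
     then show "(?I x *\<^sub>R (G (x + \<tau>) - G x - ?Q x)) \<bullet> Z x = G (x + \<tau>) \<bullet> Z x - G x \<bullet> Z x - ?Q x \<bullet> Z x"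
      using C1cD(6)[OF z(1), of x] by (cases "x : V") (simp_all only: simp_thms indicator_simps scaleR_one scaleR_zero_left inner_zero_left inner_zero_right diff_self)
    qed
    also have "... = (LB x. G (x + \<tau>) \<bullet> Z x) - (LB x. G x \<bullet> Z x) - (LB x. ?Q x \<bullet> Z x)"
     by (simp only: Bochner_Integration.integral_diff int_diff l2_inner_integrable[OF Gs zl(2)] l2_inner_integrable[OF Gl zl(2)] iQ)
    also have "... = (LB x. h (x + \<tau>) * z x) - (LB x. h x * z x) - (LB x. e1 * z x)"
     by (simp only: A B Qe)
    also have "... = (LB x. h (x + \<tau>) * z x - h x * z x - e1 * z x)"
     using l2_real_mult[OF hs zl(1)] l2_real_mult[OF hl zl(1)] zl(3) by simp
    also have "... = (LB x. (?I x *\<^sub>R (h (x + \<tau>) - h x) - ?I x *\<^sub>R e1) * z x)"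
    proof (intro int_cong refl)
     fix x
     show "h (x + \<tau>) * z x - h x * z x - e1 * z x = (?I x *\<^sub>R (h (x + \<tau>) - h x) - ?I x *\<^sub>R e1) * z x"
      using C1cD(5)[OF z(1), of x] by (cases "x : V") (simp_all add: algebra_simps)
    qed
    finally show ?thesis by simp
   qed
  qed
  then show ?thesis using d0(2) AE_shift[OF d0(2), of \<tau>]
  proof eventually_elim
   case (elim x)
   show ?case
   proof (cases "x : V")
    case True
    then have "?P x <= e1 * R\<^sup>2" using P(2)[of x] VO by blast
    then show ?thesis using elim(1) True e1 by simp
   next
    case False
    then have "\<bar>y x\<bar> <= e1" "\<bar>y (x + \<tau>)\<bar> <= e1" using elim inf_t[of x] d0(1) by (auto simp: V_def abs_less_iff)
    moreover have "e1 * R\<^sup>2 >= 0" using e1 by simp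
    ultimately show ?thesis using e1(2) by linarith
   qed
  qed
 qed
 then show ?thesis using d0(1) d1(1) by (intro exI[of _ "min (d0 / 4) d1"]) auto
qed

lemma translation_close:
 fixes Om :: "'n::finite pt set"
 assumes n: "CARD('n) = 2 \<or> CARD('n) = 3" and dom: "lipschitz_domain Om"
  and y: "h10 Om y G" and h: "continuous_on UNIV h" "compact K" "!!x. x \<notin> K ==> h x = 0" and yw: "wsol Om G h"
  and ep: "ep > 0"
 shows "\<exists>d>0. \<forall>\<tau>. norm \<tau> < d --> (AE x in lb. \<bar>y (x + \<tau>) - y x\<bar> <= ep)"
proof -
 obtain d where d: "d > 0" "!!\<tau>. norm \<tau> < d ==> (AE x in lb. y (x + \<tau>) - y x <= ep)"
  using translation_close_aux[OF assms] by blast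
 have "AE x in lb. \<bar>y (x + \<tau>) - y x\<bar> <= ep" if t: "norm \<tau> < d" for \<tau>
 proof -
  have "norm (- \<tau>) < d" using t by simp
  from AE_shift[OF d(2)[OF this], of \<tau>] d(2)[OF t] show ?thesis
   by eventually_elim (auto simp: abs_le_iff)
 qed
 then show ?thesis using d(1) by blast
qed

text \<open>By Fubini's theorem almost every x satisfies the estimate for almost every translation.
  Two such points that are close are compared through a common third point, so y is uniformly
  continuous on a set of full measure; this set is dense, and the uniformly continuous extension is
  the representative.\<close>

lemma continuous_representative:
 fixes y :: "'n::finite pt => real"
 assumes ym: "y : bml"
  and cl: "!!ep. ep > 0 ==> \<exists>d>0. \<forall>\<tau>. norm \<tau> < d --> (AE x in lb. \<bar>y (x + \<tau>) - y x\<bar> <= ep)"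
 obtains Y where "continuous_on UNIV Y" "AE x in lb. y x = Y x"
proof -
 \<comment> \<open>A Borel version of y is needed for \<open>Q\<close> to be measurable on the
   product space.\<close>
 obtain y' where y' [measurable]: "y' : borel_measurable lborel" and ae: "AE x in lborel. y x = y' x"
  using completion_ex_borel_measurable_real[OF ym] by blast
 have aeL: "AE x in lb. y x = y' x" using ae by (rule AE_completion)
 have "\<forall>m. \<exists>d. d > 0 \<and> (\<forall>\<tau>. norm \<tau> < d --> (AE x in lb. \<bar>y (x + \<tau>) - y x\<bar> <= inverse (real (Suc m))))"
  using cl by simp
 from choice[OF this] obtain d where d: "!!m. d m > 0" "!!m \<tau>. norm \<tau> < d m ==> (AE x in lb. \<bar>y (x + \<tau>) - y x\<bar> <= inverse (real (Suc m)))"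
  by blast
 define Q where "Q x \<tau> \<longleftrightarrow> (\<forall>m. norm \<tau> < d m --> \<bar>y' (x + \<tau>) - y' x\<bar> <= inverse (real (Suc m)))" for x \<tau> :: "'n pt"
 have "AE x in lborel. Q x \<tau>" for \<tau>
 proof -
  have "AE x in lb. norm \<tau> < d m --> \<bar>y' (x + \<tau>) - y' x\<bar> <= inverse (real (Suc m))" for m
  proof (cases "norm \<tau> < d m")
   case True
   show ?thesis using d(2)[OF True] aeL AE_shift[OF aeL, of \<tau>] by eventually_elim simp
  qed simp
  then have "AE x in lb. Q x \<tau>" unfolding Q_def by (simp add: AE_all_countable)
  then show ?thesis
   by (rule AE_completion_iff[THEN iffD1, rotated])
 qed
 then have "AE \<tau> in lborel. AE x in lborel. Q x \<tau>" by simp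
 moreover have "{z : space (lborel \<Otimes>\<^sub>M lborel). Q (fst z) (snd z)} : sets (lborel \<Otimes>\<^sub>M lborel)"
  unfolding Q_def by measurable
 ultimately have "AE x in lborel. AE \<tau> in lborel. Q x \<tau>" using lborel_pair.AE_commute[of Q] by simp
 then have aeE: "AE x in lb. (AE \<tau> in lborel. Q x \<tau>)" by (rule AE_completion)
 define E where "E = {x. AE \<tau> in lborel. Q x \<tau>}"
 have clo: "\<bar>y' x1 - y' x2\<bar> <= 2 * inverse (real (Suc m))" if x: "x1 : E" "x2 : E" "dist x1 x2 < d m" for x1 x2 m
 proof -
  have s1: "AE s in lb. Q x (s - x)" if "x : E" for x
  proof -
   have "AE \<tau> in lb. Q x \<tau>" using that by (auto simp: E_def intro: AE_completion)
   from AE_shift[OF this, of "- x"] show ?thesis by simp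
  qed
  have "AE s in lb. Q x1 (s - x1) \<and> Q x2 (s - x2)" using s1[OF x(1)] s1[OF x(2)] by eventually_elim simp
  moreover have "open (ball x1 (d m) \<inter> ball x2 (d m))" by auto
  moreover have "x1 : ball x1 (d m) \<inter> ball x2 (d m)" using x(3) d(1)[of m] by (simp add: dist_commute)
  then have "ball x1 (d m) \<inter> ball x2 (d m) \<noteq> {}" by blast
  ultimately obtain s where s: "s : ball x1 (d m) \<inter> ball x2 (d m)" "Q x1 (s - x1)" "Q x2 (s - x2)"
   using AE_open_ex[of "%s. Q x1 (s - x1) \<and> Q x2 (s - x2)"] by blast
  have "norm (s - x1) < d m" "norm (s - x2) < d m" using s(1) by (auto simp: dist_norm norm_minus_commute)
  then have "\<bar>y' (x1 + (s - x1)) - y' x1\<bar> <= inverse (real (Suc m))" "\<bar>y' (x2 + (s - x2)) - y' x2\<bar> <= inverse (real (Suc m))"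
   using s(2,3) unfolding Q_def by blast+
  then show ?thesis by (simp add: abs_le_iff)
 qed
 have uc: "uniformly_continuous_on E y'"
  unfolding uniformly_continuous_on_def
 proof (intro allI impI)
  fix e :: real assume "e > 0"
  then obtain m where m: "inverse (real (Suc m)) < e / 2" using reals_Archimedean[of "e/2"] by auto
  show "\<exists>d>0. \<forall>x\<in>E. \<forall>x'\<in>E. dist x' x < d --> dist (y' x') (y' x) < e"
  proof (intro exI[of _ "d m"] conjI ballI impI)
   fix x x' assume "x : E" "x' : E" "dist x' x < d m"
   then show "dist (y' x') (y' x) < e" using clo[of x' x m] m by (simp add: dist_real_def)
  qed (rule d(1))
 qed
 have dense: "closure E = UNIV"
 proof (rule ccontr)
  assume "closure E \<noteq> UNIV"
  then have "- closure E \<noteq> {}" by auto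
  from AE_open_ex[OF aeE open_Compl[OF closed_closure] this] obtain x where "x : - closure E" "x : E" by (auto simp: E_def)
  then show False using closure_subset by blast
 qed
 obtain Y where Y: "uniformly_continuous_on (closure E) Y" "!!x. x : E ==> y' x = Y x"
  using uniformly_continuous_on_extension_on_closure[OF uc] by metis
 have "AE x in lb. y x = Y x" using aeE aeL by eventually_elim (auto simp: E_def Y(2))
 moreover have "continuous_on UNIV Y" using uniformly_continuous_imp_continuous[OF Y(1)] dense by simp
 ultimately show ?thesis using that by blast
qed

lemma AE_continuous_le:
 fixes Y :: "'a::euclidean_space => real"
 assumes "AE x in lb. x : U --> Y x <= F x" "open U" "continuous_on U Y" "continuous_on U F" "x : U"
 shows "Y x <= F x"
proof (rule ccontr)
 assume nt: "\<not> ?thesis"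
 have o: "open (U \<inter> (%x. Y x - F x) -` {0<..})"
  by (rule continuous_open_preimage[OF _ assms(2)]) (auto intro!: continuous_intros assms)
 have "x : U \<inter> (%x. Y x - F x) -` {0<..}" using nt assms(5) by simp
 then have ne: "U \<inter> (%x. Y x - F x) -` {0<..} \<noteq> {}" by blast
 from AE_open_ex[OF assms(1) o ne] show False by force
qed

theorem poisson_continuous:
 fixes Om :: "'n::finite pt set"
 assumes n: "CARD('n) = 2 \<or> CARD('n) = 3" and dom: "lipschitz_domain Om"
  and h: "continuous_on UNIV h" "compact K" "!!x. x \<notin> K ==> h x = 0"
 obtains Y G where "continuous_on UNIV Y" "!!x. x \<notin> Om ==> Y x = 0" "h10 Om Y G" "wsol Om G h"
proof -
 have oO: "open Om" "bounded Om" using dom by (auto simp: lipschitz_domain_def)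
 obtain R where R: "Om \<subseteq> cball 0 R" "R >= 0"
  using bounded_subset_ballD[OF oO(2), of 0] ball_subset_cball[of 0] by (metis less_imp_le order_trans)
 note hl = continuous_compact_integrable(2)[OF h]
 obtain c where c: "!!x. norm (h x) <= c" "c >= 0" using bounded_compact_support[OF h] by blast
 obtain y G where y: "h10 Om y G" "wsol Om G (%x. h x - 0 * y x)" using linear_solver[OF R order_refl hl] by blast
 then have yw: "wsol Om G h" by simp
 have ym: "y : bml" using h10_l2(1)[OF y(1)] by (simp add: l2_def)
 obtain Y where Y: "continuous_on UNIV Y" "AE x in lb. y x = Y x"
  using continuous_representative[OF ym translation_close[OF n dom y(1) h yw]] by blast
 have "h10 Om Y G" by (rule h10_cong_AE[OF y(1) Y(2) continuous_borel_lebesgue[OF Y(1)]])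
 moreover have "Y x = 0" if x: "x \<notin> Om" for x
 proof -
  have "\<bar>Y x\<bar> <= ep" if ep: "ep > 0" for ep
  proof -
   obtain d where d: "d > 0" "AE x in lb. infdist x (- Om) < d --> \<bar>y x\<bar> <= ep"
    using near_boundary[OF n dom y(1) hl yw _ c(2) ep] c(1) by auto
   have "AE x in lb. x : {x. infdist x (- Om) < d} --> \<bar>Y x\<bar> <= ep" using d(2) Y(2) by eventually_elim simp
   then show ?thesis
    by (rule AE_continuous_le[where F="%x. ep"])
     (use x d(1) infdist_complement(3)[OF oO x] in \<open>auto intro!: open_Collect_less continuous_intros continuous_on_subset[OF Y(1)]\<close>)
  qed
  then show ?thesis by (metis abs_ge_zero dense_ge order_antisym abs_eq_0)
 qed
 ultimately show ?thesis using that Y(1) yw by blast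
qed

section \<open>Right-hand sides in \<open>L\<^sup>p\<close>\<close>

definition rS :: "'n::finite pt => real => 'n pt => real" where
 "rS z e x = (x - z) \<bullet> (x - z) + e\<^sup>2"

lemma rS_pos: "e > 0 ==> rS z e x > 0"
 by (simp add: rS_def add_nonneg_pos)

lemma rS_GDERIV: "GDERIV (rS z e) x :> 2 *\<^sub>R (x - z)"
 unfolding gderiv_def rS_def[abs_def] by (auto intro!: derivative_eq_intros simp: inner_diff_left inner_diff_right inner_commute algebra_simps)

lemma rS_powr_GDERIV:
 assumes "e > 0" shows "GDERIV (%x. rS z e x powr c) x :> (2 * c * rS z e x powr (c - 1)) *\<^sub>R (x - z)"
proof -
 have "((%t. t powr c) has_real_derivative c * rS z e x powr (c - 1)) (at (rS z e x))"
  using rS_pos[OF assms, of z x] by (rule has_real_derivative_powr)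
 from GDERIV_DERIV_compose[OF rS_GDERIV this] show ?thesis by (simp add: mult_ac)
qed

lemma rS_continuous: "continuous_on V (rS z e)"
 unfolding rS_def[abs_def] by (intro continuous_intros)

lemma rS_powr_continuous: "e > 0 ==> continuous_on V (%x. rS z e x powr c)"
 using rS_pos[of e z] by (intro continuous_on_powr rS_continuous continuous_on_const) (auto simp: less_imp_neq[THEN not_sym])

text \<open>The function b is \<open>rS powr (-1/2)\<close> for n = 3 and a logarithm for n = 2. A
  logarithm is dominated by every power, so k remains free for n = 2 and both dimensions share one
  bound of power type. La normalises the logarithm to be nonnegative where \<open>rS\<close> is at
  most La.\<close>

lemma kernel:
 fixes z :: "'n::finite pt"
 assumes n: "CARD('n) = 2 \<or> CARD('n) = 3" and e: "e > 0" and k: "k > 0" "CARD('n) = 3 ==> k = 1/2" and La: "La > 0"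
 shows "\<exists>b. (\<forall>x. GDERIV b x :> (- (rS z e x powr (- real CARD('n) / 2))) *\<^sub>R (x - z)) \<and>
  (\<forall>x. rS z e x <= La --> 0 <= b x \<and> b x <= max 1 (La powr k / (2 * k)) * rS z e x powr (- k))"
 using n
proof
 assume n3: "CARD('n) = 3"
 show ?thesis
 proof (intro exI[of _ "%x. rS z e x powr (-1/2)"] conjI allI impI)
  show "GDERIV (%x. rS z e x powr (-1/2)) x :> (- (rS z e x powr (- real CARD('n) / 2))) *\<^sub>R (x - z)" for x
   using rS_powr_GDERIV[OF e, of z "-1/2" x] n3 by simp
  show "0 <= rS z e x powr (- 1 / 2)" for x by simp
  show "rS z e x powr (- 1 / 2) <= max 1 (La powr k / (2 * k)) * rS z e x powr (- k)" for x
   using mult_right_mono[of 1 "max 1 (La powr k / (2 * k))" "rS z e x powr (-1/2)"] unfolding k(2)[OF n3] by simp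
 qed
next
 assume n2: "CARD('n) = 2"
 show ?thesis
 proof (intro exI[of _ "%x. (ln La - ln (rS z e x)) / 2"] conjI allI impI)
  show "GDERIV (%x. (ln La - ln (rS z e x)) / 2) x :> (- (rS z e x powr (- real CARD('n) / 2))) *\<^sub>R (x - z)" for x
  proof -
   have "((%t. (ln La - ln t) / 2) has_real_derivative - (1 / (2 * rS z e x))) (at (rS z e x))"
    using rS_pos[OF e, of z x] by (auto intro!: derivative_eq_intros)
   from GDERIV_DERIV_compose[OF rS_GDERIV this]
   moreover have "rS z e x powr (- real CARD('n) / 2) = 1 / rS z e x"
    using rS_pos[OF e, of z x] n2 by (simp add: powr_minus_divide)
   ultimately show ?thesis by simp
  qed
  fix x assume x: "rS z e x <= La"
  have S: "rS z e x > 0" by (rule rS_pos[OF e])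
  then show "0 <= (ln La - ln (rS z e x)) / 2" using x La by simp
  have "ln ((La / rS z e x) powr k) <= (La / rS z e x) powr k - 1"
   using S La by (intro ln_le_minus_one) simp
  then have "k * (ln La - ln (rS z e x)) <= (La / rS z e x) powr k"
   using S La by (simp add: ln_powr ln_div)
  then have "(ln La - ln (rS z e x)) / 2 <= La powr k / (2 * k) * rS z e x powr (- k)"
   using k S La by (simp add: powr_divide powr_minus field_simps)
  also have "... <= max 1 (La powr k / (2 * k)) * rS z e x powr (- k)" by (intro mult_right_mono) auto
  finally show "(ln La - ln (rS z e x)) / 2 <= max 1 (La powr k / (2 * k)) * rS z e x powr (- k)" .
 qed
qed

text \<open>\<open>(x - z) |x - z|\<^sup>-\<^sup>n\<close> is, up to a factor, the gradient of the fundamental solution; \<open>e\<close> regularises it.\<close>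
lemma kernel_equation:
 fixes z :: "'n::finite pt"
 assumes e: "e > 0" and w: "C1c V w W" "open V"
 shows "(LB x. ((- (rS z e x powr (- real CARD('n) / 2))) *\<^sub>R (x - z)) \<bullet> W x)
  = (LB x. (real CARD('n) * e\<^sup>2 * rS z e x powr (- real CARD('n) / 2 - 1)) * w x)"
proof -
 let ?n = "real CARD('n)"
 let ?A = "%x. (?n * rS z e x powr (- ?n / 2 - 1)) *\<^sub>R (x - z)"
 have "(LB x. ((- (rS z e x powr (- ?n / 2))) *\<^sub>R (x - z) + 0 *\<^sub>R z) \<bullet> W x)
   = - (LB x. (?A x \<bullet> (x - z) + real DIM('n pt) * (- (rS z e x powr (- ?n / 2))) + 0 \<bullet> z) * w x)"
 proof (rule ibp_radial[OF w(2,1)])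
  show "GDERIV (%x. - (rS z e x powr (- ?n / 2))) x :> ?A x" for x
   by (rule GDERIV_subst[OF GDERIV_minus[OF rS_powr_GDERIV[OF e]]]) simp
  show "continuous_on V ?A" by (intro continuous_intros rS_powr_continuous[OF e])
 qed (auto intro: GDERIV_const)
 also have "... = (LB x. - ((?A x \<bullet> (x - z) + real DIM('n pt) * (- (rS z e x powr (- ?n / 2))) + 0 \<bullet> z) * w x))"
  by (rule Bochner_Integration.integral_minus[symmetric])
 also have "... = (LB x. (?n * e\<^sup>2 * rS z e x powr (- ?n / 2 - 1)) * w x)"
 proof (intro int_cong refl)
  fix x
  define P where "P = rS z e x powr (- ?n / 2 - 1)"
  have "rS z e x powr (- ?n / 2) = P * rS z e x"
   using rS_pos[OF e, of z x] by (simp add: P_def powr_diff)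
  moreover have "(x - z) \<bullet> (x - z) = rS z e x - e\<^sup>2" by (simp add: rS_def)
  ultimately have "?A x \<bullet> (x - z) + real DIM('n pt) * (- (rS z e x powr (- ?n / 2))) + 0 \<bullet> z = ?n * P * (rS z e x - e\<^sup>2) - ?n * (P * rS z e x)"
   by (simp add: P_def)
  also have "... = - (?n * e\<^sup>2 * P)" by (simp add: algebra_simps)
  finally show "- ((?A x \<bullet> (x - z) + real DIM('n pt) * (- (rS z e x powr (- ?n / 2))) + 0 \<bullet> z) * w x) = (?n * e\<^sup>2 * rS z e x powr (- ?n / 2 - 1)) * w x"
   by (simp only: P_def) simp
 qed
 finally show ?thesis by simp
qed

text \<open>The bound is uniform in z and e. The field \<open>c * rS powr (- a / 2) (x - z)\<close>
  has a divergence with integral zero whose main part is at least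
  \<open>(n - a) c * rS powr (- a / 2)\<close>. What remains lives where the cut-off c varies; there
  x has distance at least 1 and at most 2 R + 2 from z, so the singularity is not felt.\<close>

lemma kernel_integral:
 fixes R a :: real
 assumes R: "R >= 0" and a: "0 <= a" "a < real CARD('n::finite)"
 shows "\<exists>C\<ge>0. \<forall>(z::'n pt) e. norm z <= R --> e > 0 --> (LB x. indicator (cball 0 R) x * rS z e x powr (- a / 2)) <= C"
proof -
 let ?n = "real CARD('n)"
 obtain c C where c: "C1c (ball 0 (R + 2)) c C" "!!x::'n pt. x : cball 0 (R + 1) ==> c x = 1" "!!x. x : cball 0 (R + 1) ==> C x = 0" "!!x. 0 <= c x" "!!x. c x <= 1"
 proof -
  have sub: "cball (0::'n pt) (R + 1) \<subseteq> ball 0 (R + 2)" by auto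
  show ?thesis by (rule cutoff[OF compact_cball sub open_ball]) (rule that)
 qed
 define Q where "Q = (2 * R + 2) * (LB x. norm (C x)) / (?n - a)"
 have "(LB x. indicator (cball 0 R) x * rS z e x powr (- a / 2)) <= Q" if z: "norm z <= R" and e: "e > 0" for z :: "'n pt" and e
 proof -
  let ?s = "%x. rS z e x powr (- a / 2)"
  let ?w = "%x. c x * ?s x" and ?W = "%x. c x *\<^sub>R ((2 * (- a / 2) * rS z e x powr (- a / 2 - 1)) *\<^sub>R (x - z)) + ?s x *\<^sub>R C x"
  have cU: "C1c UNIV c C" using C1c_mono[OF c(1)] by simp
  have w: "C1c UNIV ?w ?W"
   by (rule C1c_mult[OF cU rS_powr_GDERIV[OF e]]) (auto intro!: continuous_intros rS_powr_continuous[OF e])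
  have iw: "integrable lb ?w" by (rule C1c_l2(3)[OF w])
  have iC: "integrable lb (%x. norm (C x))" using C1c_l2(4)[OF c(1)] by simp
  have "- ?n * (LB x. ?w x) = (LB x. ?W x \<bullet> (x - z))"
   using C1c_div_identity[OF w, of z] by simp
  also have "... >= (LB x. - a * ?w x - (2 * R + 2) * norm (C x))"
  proof (rule integral_mono)
   have ie: "(%x. ?W x \<bullet> (x - z)) = (%x. (x - z) \<bullet> ?W x)" by (rule ext, rule inner_commute)
   show "integrable lb (%x. ?W x \<bullet> (x - z))"
    unfolding ie by (rule C1c_mult_integrable(2)[OF open_UNIV w]) (intro continuous_intros)
   show "- a * ?w x - (2 * R + 2) * norm (C x) <= ?W x \<bullet> (x - z)" for x
   proof -
    have S: "rS z e x > 0" by (rule rS_pos[OF e])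
    have "rS z e x powr (- a / 2 - 1) * ((x - z) \<bullet> (x - z)) <= rS z e x powr (- a / 2 - 1) * rS z e x"
     by (intro mult_left_mono) (auto simp: rS_def)
    also have "... = ?s x" using S by (simp add: powr_diff)
    finally have "a * c x * (rS z e x powr (- a / 2 - 1) * ((x - z) \<bullet> (x - z))) <= a * c x * ?s x"
     using a c(4) by (intro mult_left_mono) auto
    then have 1: "- a * ?w x <= (c x *\<^sub>R ((2 * (- a / 2) * rS z e x powr (- a / 2 - 1)) *\<^sub>R (x - z))) \<bullet> (x - z)"
     by (simp add: algebra_simps)
    have 2: "- ((2 * R + 2) * norm (C x)) <= (?s x *\<^sub>R C x) \<bullet> (x - z)"
    proof (cases "x : cball 0 (R + 1) \<or> x \<notin> ball 0 (R + 2)")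
     case True
     then have "C x = 0" using c(3) C1cD(6)[OF c(1)] by blast
     then show ?thesis by simp
    next
     case False
     then have x: "norm x > R + 1" "norm x < R + 2" by auto
     have xz: "norm (x - z) >= 1" "norm (x - z) <= 2 * R + 2"
      using norm_triangle_ineq2[of x z] norm_triangle_ineq4[of x z] x z by linarith+
     have "(x - z) \<bullet> (x - z) >= 1" using xz(1) one_le_power[of "norm (x - z)" 2] by (simp add: dot_square_norm)
     then have "rS z e x >= 1" by (simp add: rS_def add_increasing2)
     then have s1: "?s x <= 1" using a powr_mono2'[of "- a / 2" 1 "rS z e x"] by simp
     have "\<bar>(?s x *\<^sub>R C x) \<bullet> (x - z)\<bar> <= norm (?s x *\<^sub>R C x) * norm (x - z)" by (rule Cauchy_Schwarz_ineq2)
     also have "... <= norm (C x) * (2 * R + 2)"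
      using s1 xz by (intro mult_mono) (auto simp: mult_left_le_one_le)
     finally show ?thesis by (simp add: mult.commute abs_le_iff)
    qed
    show ?thesis unfolding inner_add_left using 1 2 by linarith
   qed
  qed (use iw iC in \<open>auto intro!: int_diff\<close>)
  also have "(LB x. - a * ?w x - (2 * R + 2) * norm (C x)) = - a * (LB x. ?w x) - (2 * R + 2) * (LB x. norm (C x))"
   using iw iC by simp
  finally have "(?n - a) * (LB x. ?w x) <= (2 * R + 2) * (LB x. norm (C x))" by (simp add: algebra_simps)
  then have q: "(LB x. ?w x) <= Q" using a by (simp add: Q_def pos_le_divide_eq mult.commute)
  have "(LB x. indicator (cball 0 R) x * ?s x) <= (LB x. ?w x)"
  proof (rule integral_mono)
   have "continuous_on UNIV ?s" by (rule rS_powr_continuous[OF e])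
   then have sm: "?s : bml" by (rule continuous_borel_lebesgue)
   show le: "indicator (cball 0 R) x * ?s x <= ?w x" for x using c(2)[of x] c(4)[of x] by (auto simp: indicator_def)
   have "(indicator (cball 0 R) :: 'n pt => real) : bml"
    by (rule borel_measurable_indicator[OF compact_lebesgue(1)[OF compact_cball]])
   then show "integrable lb (%x. indicator (cball 0 R) x * ?s x)"
   proof (intro int_bound[OF iw] AE_I2)
    show "norm (indicator (cball 0 R) x * ?s x) <= norm (?w x)" for x
     using le[of x] c(4)[of x] by (simp add: abs_mult)
   qed (intro borel_measurable_times sm, assumption)
  qed (rule iw)
  then show ?thesis using q by linarith
 qed
 moreover have "Q >= 0" unfolding Q_def using R a by (intro divide_nonneg_pos mult_nonneg_nonneg integral_nonneg_AE) auto
 ultimately show ?thesis by blast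
qed

text \<open>This takes the place of Hoelder's inequality: estimates then contain the integral of
  \<open>|h| powr p\<close> itself and not its root. The parameter t is used to make the
  contribution of the kernel as small as desired.\<close>

lemma young_scaled:
 fixes a b p q t :: real
 assumes "p > 1" "1/p + 1/q = 1" "a >= 0" "b >= 0" "t > 0"
 shows "a * b <= t powr (- p) * a powr p + t powr q * b powr q"
proof -
 have q: "q > 1"
 proof -
  have "1/q = 1 - 1/p" using assms(2) by simp
  moreover have "1/p > 0" "1/p < 1" using assms(1) by auto
  ultimately have "1/q > 0" "1/q < 1" by linarith+
  then show ?thesis by (simp add: divide_less_eq)
 qed
 have "(a / t) * (b * t) <= (a / t) powr p / p + (b * t) powr q / q"
  by (rule Youngs_inequality) (use assms q in auto)
 also have "... <= (a / t) powr p + (b * t) powr q"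
  using assms q by (intro add_mono) (auto simp: divide_le_eq mult_le_cancel_left1)
 also have "... = t powr (- p) * a powr p + t powr q * b powr q"
 proof -
  have "(a / t) powr p = t powr (- p) * a powr p" using assms by (subst powr_divide) (auto simp: powr_minus field_simps)
  moreover have "(b * t) powr q = t powr q * b powr q" using assms by (subst powr_mult) auto
  ultimately show ?thesis by simp
 qed
 finally show ?thesis using assms(5) by simp
qed

lemma measure_ball_scale: "e >= 0 ==> measure lb (ball (z::'n::finite pt) e) = e ^ CARD('n) * measure lb (ball (0::'n pt) 1)"
 using content_ball_conv_unit_ball[of e z] by simp

text \<open>Duality: the mean of \<open>Y\<close> over a small ball around \<open>z\<close> is the integral of \<open>h\<close> against the solution for the normalised
 indicator of the ball, which lies below a regularised fundamental solution.\<close>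
theorem sup_bound_Lp:
 fixes Om :: "'n::finite pt set"
 assumes n: "CARD('n) = 2 \<or> CARD('n) = 3" and Om: "open Om" "Om \<subseteq> cball 0 R" "R >= 0"
  and p: "p > 1" "p > real CARD('n) / 2" and d: "d > 0"
 shows "\<exists>C\<ge>0. \<forall>h Y G. continuous_on UNIV Y --> h10 Om Y G --> wsol Om G h --> l2 lb h -->
   integrable lb (%x. indicator Om x * \<bar>h x\<bar> powr p) -->
   (\<forall>z\<in>Om. \<bar>Y z\<bar> <= d + C * (LB x. indicator Om x * \<bar>h x\<bar> powr p))"
proof -
 let ?n = "real CARD('n)"
 define q where "q = p / (p - 1)"
 have q: "1 / p + 1 / q = 1" "q > 0" using p by (auto simp: q_def field_simps)
 \<comment> \<open>The kernel behaves like the power - 2 k of the distance, and its q-th power is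
   locally integrable for 2 k q < n. For n = 3 this is the condition p > 3/2; for n = 2 the choice
   gives 2 k q = 1.\<close>
 define k where "k = (if CARD('n) = 3 then 1/2 else 1 / (2 * q))"
 have k: "k > 0" "CARD('n) = 3 ==> k = 1/2" using q by (auto simp: k_def)
 have kq: "2 * k * q < ?n"
  using n
 proof
  assume "CARD('n) = 3"
  then show ?thesis using p by (simp add: k_def q_def field_simps)
 qed (use q in \<open>simp add: k_def\<close>)
 \<comment> \<open>A bound for \<open>rS z e\<close> on Om, because two points of Om have distance
   at most 2 R and e will be at most 1.\<close>
 define La where "La = 4 * R\<^sup>2 + 1"
 have La: "La > 0" by (simp add: La_def add_nonneg_pos)
 define Ck where "Ck = max 1 (La powr k / (2 * k))"
 define om where "om = measure lb (ball (0::'n pt) 1)"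
 have om: "om > 0" unfolding om_def using content_ball_pos[of 1 "0::'n pt"] by simp
 \<comment> \<open>On the ball of radius e one has rS \<le> 2 e^2, and c0 is the factor for which
   the negative Laplacian of c0 b at the value rS = 2 e^2 equals the reciprocal of the volume of
   this ball.\<close>
 define c0 where "c0 = 2 powr (?n / 2 + 1) / (?n * om)"
 have n0: "?n > 0" by simp
 have c0: "c0 > 0" using om n0 by (simp add: c0_def)
 have kq0: "0 <= 2 * k * q" using k q by simp
 obtain A where A: "A >= 0" "!!(z::'n pt) e. norm z <= R ==> e > 0 ==> (LB x. indicator (cball 0 R) x * rS z e x powr (- (2 * k * q) / 2)) <= A"
  using kernel_integral[where 'n='n, OF Om(3) kq0 kq] by blast
 have Ck: "Ck >= 1" by (simp add: Ck_def)
 \<comment> \<open>Chosen so that the kernel term \<open>c0 * Ck * t powr q * A\<close> is at most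
   d/2; the other half of d is spent on the oscillation of Y over the small ball. The summand 1 in A
   + 1 guards against A = 0.\<close>
 define t where "t = (d / (2 * c0 * Ck * (A + 1))) powr (1 / q)"
 have den: "2 * c0 * Ck * (A + 1) > 0" using c0 Ck A(1) by (intro mult_pos_pos) auto
 have t: "t > 0" "t powr q = d / (2 * c0 * Ck * (A + 1))" using d den q by (auto simp: t_def powr_powr)
 define C where "C = c0 * Ck * t powr (- p)"
 have "\<bar>Y z\<bar> <= d + C * (LB x. indicator Om x * \<bar>h x\<bar> powr p)"
  if Y: "continuous_on UNIV Y" "h10 Om Y G" "wsol Om G h" "l2 lb h" and hp: "integrable lb (%x. indicator Om x * \<bar>h x\<bar> powr p)" and z: "z : Om" for h Y G z
 proof -
  have hm: "h : bml" using Y(4) by (simp add: l2_def)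
  have "isCont Y z" using Y(1) by (simp add: continuous_on_eq_continuous_at)
  then obtain e1 where e1: "e1 > 0" "!!x. dist x z < e1 ==> dist (Y x) (Y z) < d / 2"
   unfolding continuous_at_eps_delta using d by (metis half_gt_zero)
  obtain e2 where e2: "e2 > 0" "ball z e2 \<subseteq> Om" using Om(1) z open_contains_ball by blast
  define e where "e = min 1 (min e1 e2)"
  have e: "e > 0" "e <= 1" "e <= e1" "e <= e2" using e1 e2 by (auto simp: e_def)
  have eb: "ball z e \<subseteq> Om" using e2(2) e(4) by (meson subset_ball order_trans)
  define mu where "mu = e ^ CARD('n) * om"
  have mu: "mu > 0" "measure lb (ball z e) = mu" using e om measure_ball_scale[of e z] by (auto simp: mu_def om_def)
  define g where "g x = indicator (ball z e) x / mu" for x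
  have bm: "ball z e : sets lb" by simp
  have gm: "g : bml" unfolding g_def by (intro borel_measurable_divide borel_measurable_indicator bm borel_measurable_const)
  have gl: "l2 lb g"
   by (rule l2_bounded_support(1)[OF gm bounded_ball[of z e], of "1 / mu"]) (use mu in \<open>auto simp: g_def indicator_def\<close>)
  obtain v V where v0: "h10 Om v V" "wsol Om V (%x. g x - 0 * v x)" using linear_solver[OF Om(2,3) order_refl gl] by blast
  then have v: "h10 Om v V" "wsol Om V g" by simp_all
  note vl = h10_l2[OF v(1)]
  have vpos: "AE x in lb. - v x <= 0"
  proof -
   have "AE x in lb. (-1) * v x <= 0"
   proof (rule max_principle[OF Om h10_scaleR[OF v(1)] l2_scaleR[OF gl, of "-1"]])
    show "(LB x. (- 1 *\<^sub>R V x) \<bullet> Z x) <= (LB x. (- 1 *\<^sub>R g x) * z x)" if "C1c Om z Z" for z Z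
     using v(2) that unfolding wsol_def by simp
    show "AE x in lb. 0 < - 1 * v x --> - 1 *\<^sub>R g x <= 0" using mu by (auto simp: g_def indicator_def)
   qed
   then show ?thesis by simp
  qed
  have zR: "norm z <= R" using z Om(2) by auto
  have SLa: "rS z e x <= La" if "x : Om" for x
  proof -
   have "norm (x - z) <= 2 * R" using norm_triangle_ineq4[of x z] zR that Om(2) by force
   then have "(norm (x - z))\<^sup>2 <= (2 * R)\<^sup>2" by (intro power_mono) auto
   moreover have "e\<^sup>2 <= 1" using e by (simp add: power_le_one)
   ultimately show ?thesis by (simp add: rS_def La_def power2_norm_eq_inner power_mult_distrib)
  qed
  obtain b where b: "!!x. GDERIV b x :> (- (rS z e x powr (- ?n / 2))) *\<^sub>R (x - z)"
   "!!x. rS z e x <= La ==> 0 <= b x \<and> b x <= Ck * rS z e x powr (- k)"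
   using kernel[OF n e(1) k La, of z] unfolding Ck_def by blast
  let ?B = "%x. c0 *\<^sub>R ((- (rS z e x powr (- ?n / 2))) *\<^sub>R (x - z))"
  let ?L = "%x. c0 * (?n * e\<^sup>2 * rS z e x powr (- ?n / 2 - 1))"
  have cB: "continuous_on UNIV ?B" by (intro continuous_intros rS_powr_continuous[OF e(1)])
  have cL: "continuous_on UNIV ?L" by (intro continuous_intros rS_powr_continuous[OF e(1)])
  have cb: "continuous_on UNIV b" using b(1) GDERIV_continuous by (auto simp: continuous_on_eq_continuous_at)
  have bdd: "\<exists>M. \<forall>x\<in>Om. norm (F x) <= M" if "continuous_on UNIV F" for F :: "'n pt => 'b::real_normed_vector"
  proof -
   have "compact (F ` cball 0 R)" using that by (intro compact_continuous_image) (auto intro: continuous_on_subset)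
   then obtain M where "\<forall>y\<in>F ` cball 0 R. norm y <= M" using compact_imp_bounded bounded_iff by blast
   then show ?thesis using Om(2) by blast
  qed
  obtain M1 M2 M3 where M: "!!x. x : Om ==> norm (?B x) <= M1" "!!x. x : Om ==> norm (?L x) <= M2" "!!x. x : Om ==> norm (c0 * b x) <= M3"
   using bdd[OF cB] bdd[OF cL] bdd[OF continuous_on_mult_left[OF cb]] by metis
  have bO: "bounded Om" using Om(2) bounded_cball bounded_subset by blast
  have vb: "AE x in lb. x : Om \<inter> UNIV --> v x <= c0 * b x"
  proof (rule comparison_smooth[OF Om open_UNIV compact_cball[of 0 R] subset_UNIV v(1) gl, where B="?B" and L="?L" and M="max M1 M3"])
   show "(LB x. V x \<bullet> Z x) <= (LB x. g x * z x)" if "C1c (Om \<inter> UNIV) z Z" for z Z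
    using v(2) that unfolding wsol_def by simp
   show "GDERIV (%x. c0 * b x) x :> ?B x" for x using GDERIV_mult[OF GDERIV_const[of c0] b(1)[of x]] by simp
   show "continuous_on (Om \<inter> UNIV) ?B" using cB by (rule continuous_on_subset) simp
   show "0 <= c0 * b x \<and> c0 * b x <= max M1 M3 \<and> norm (?B x) <= max M1 M3" if x: "x : Om \<inter> UNIV" for x
   proof -
    have "0 <= b x" using b(2)[OF SLa] x by blast
    then show ?thesis using M(1)[of x] M(3)[of x] c0 x by (auto simp: le_max_iff_disj simp del: norm_scaleR)
   qed
   show "l2 lb (%x. indicator (Om \<inter> UNIV) x * ?L x)"
    using indicator_continuous_l2[OF Om(1) bO continuous_on_subset[OF cL] M(2)] by simp
   show "(LB x. ?L x * w x) <= (LB x. ?B x \<bullet> W x)" if "C1c (Om \<inter> UNIV) w W" for w W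
   proof -
    have oU: "open (Om \<inter> UNIV)" using Om(1) by simp
    have "(LB x. ?L x * w x) = c0 * (LB x. (?n * e\<^sup>2 * rS z e x powr (- ?n / 2 - 1)) * w x)"
     by (subst Bochner_Integration.integral_mult_right_zero[symmetric]) (simp add: mult.assoc)
    also have "... = c0 * (LB x. ((- (rS z e x powr (- ?n / 2))) *\<^sub>R (x - z)) \<bullet> W x)"
     by (simp only: kernel_equation[OF e(1) that oU, of z])
    also have "... = (LB x. c0 * (((- (rS z e x powr (- ?n / 2))) *\<^sub>R (x - z)) \<bullet> W x))"
     by (rule Bochner_Integration.integral_mult_right_zero[symmetric])
    also have "... = (LB x. ?B x \<bullet> W x)"
     by (intro int_cong refl) (rule inner_scaleR_left[symmetric])
    finally show ?thesis by simp
   qed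
   show "AE x in lb. x : Om \<inter> UNIV - cball 0 R --> v x <= c0 * b x" by (intro AE_I2) (use Om(2) in auto)
   have "g x <= ?L x" for x
   proof (cases "x : ball z e")
    case True
    have S: "rS z e x > 0" by (rule rS_pos[OF e(1)])
    have "norm (x - z) <= e" using True by (simp add: dist_norm norm_minus_commute)
    then have "(norm (x - z))\<^sup>2 <= e\<^sup>2" by (intro power_mono) auto
    then have "rS z e x <= 2 * e\<^sup>2" by (simp add: rS_def power2_norm_eq_inner)
    then have "(2 * e\<^sup>2) powr (- ?n / 2 - 1) <= rS z e x powr (- ?n / 2 - 1)" using S by (intro powr_mono2') auto
    then have "c0 * (?n * e\<^sup>2 * (2 * e\<^sup>2) powr (- ?n / 2 - 1)) <= ?L x" using c0 e by (intro mult_left_mono) auto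
    moreover have "c0 * (?n * e\<^sup>2 * (2 * e\<^sup>2) powr (- ?n / 2 - 1)) = 1 / mu"
    proof -
     have e2p: "e\<^sup>2 = e powr 2" using e by simp
     have "(2 * e\<^sup>2) powr (- ?n / 2 - 1) = 2 powr (- ?n / 2 - 1) * (e powr 2) powr (- ?n / 2 - 1)"
      unfolding e2p using e by (simp add: powr_mult)
     also have "(e powr 2) powr (- ?n / 2 - 1) = e powr (- ?n - 2)" by (simp add: powr_powr algebra_simps)
     finally have "c0 * (?n * e\<^sup>2 * (2 * e\<^sup>2) powr (- ?n / 2 - 1)) = c0 * ?n * (2 powr (- ?n / 2 - 1)) * (e powr 2 * e powr (- ?n - 2))"
      unfolding e2p by simp
     also have "e powr 2 * e powr (- ?n - 2) = e powr (- ?n)" by (simp add: powr_add[symmetric])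
     also have "c0 * ?n * (2 powr (- ?n / 2 - 1)) = 1 / om"
     proof -
      have "(2::real) powr (?n / 2 + 1) * 2 powr (- ?n / 2 - 1) = 1" by (simp add: powr_add[symmetric])
      then show ?thesis using om n0 by (simp add: c0_def)
     qed
     also have "e powr (- ?n) = 1 / e ^ CARD('n)" using e by (simp add: powr_minus powr_realpow divide_inverse)
     finally show ?thesis by (simp add: mu_def)
    qed
    ultimately show ?thesis using True by (simp add: g_def)
   next
    case False
    then show ?thesis using c0 by (simp add: g_def)
   qed
   then show "AE x in lb. x : Om \<inter> UNIV \<and> c0 * b x < v x --> g x <= ?L x" by simp
  qed
  have Yg: "(LB x. g x * Y x) = (LB x. h x * v x)"
  proof -
   have "(LB x. V x \<bullet> G x) = (LB x. g x * Y x)" by (rule wsol_h10[OF v(2) vl(2) gl Y(2)])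
   moreover have "(LB x. G x \<bullet> V x) = (LB x. h x * v x)" by (rule wsol_h10[OF Y(3) h10_l2(2)[OF Y(2)] Y(4) v(1)])
   ultimately show ?thesis by (simp add: inner_commute)
  qed
  let ?Ip = "LB x. indicator Om x * \<bar>h x\<bar> powr p" and ?K = "%x. indicator (cball 0 R) x * rS z e x powr (- (2 * k * q) / 2)"
  have Km: "?K : bml"
   by (intro borel_measurable_times borel_measurable_indicator compact_lebesgue compact_cball continuous_borel_lebesgue rS_powr_continuous[OF e(1)])
  have Ki: "integrable lb ?K"
  proof -
   obtain B where B: "\<forall>y\<in>(%x. rS z e x powr (- (2 * k * q) / 2)) ` cball 0 R. norm y <= B"
    using compact_imp_bounded[OF compact_continuous_image[OF rS_powr_continuous[OF e(1), of "cball 0 R"] compact_cball]] bounded_iff by blast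
   show ?thesis
    by (rule l2_bounded_support(2)[OF Km bounded_cball[of 0 R], of "max 0 B"])
     (use B in \<open>auto simp: indicator_def le_max_iff_disj intro!: AE_I2\<close>)
  qed
  have "\<bar>LB x. h x * v x\<bar> <= (LB x. \<bar>h x * v x\<bar>)" by (rule integral_abs_bound)
  also have "... <= (LB x. c0 * Ck * (t powr (- p) * (indicator Om x * \<bar>h x\<bar> powr p) + t powr q * ?K x))"
  proof (rule integral_mono_AE)
   show "integrable lb (%x. \<bar>h x * v x\<bar>)" using l2_real_mult[OF Y(4) vl(1)] by simp
   show "integrable lb (%x. c0 * Ck * (t powr (- p) * (indicator Om x * \<bar>h x\<bar> powr p) + t powr q * ?K x))"
    using hp Ki by simp
   show "AE x in lb. \<bar>h x * v x\<bar> <= c0 * Ck * (t powr (- p) * (indicator Om x * \<bar>h x\<bar> powr p) + t powr q * ?K x)"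
    using vpos vb h10_zero_outside[OF v(1)]
   proof eventually_elim
    case (elim x)
    show ?case
    proof (cases "x : Om")
     case True
     have xR: "x : cball 0 R" using True Om(2) by blast
     have "v x <= c0 * (Ck * rS z e x powr (- k))"
      using elim True b(2)[OF SLa[OF True]] c0 by (auto intro: order_trans mult_left_mono)
     then have "\<bar>h x * v x\<bar> <= \<bar>h x\<bar> * (c0 * (Ck * rS z e x powr (- k)))"
      unfolding abs_mult using elim by (intro mult_left_mono) auto
     also have "... = c0 * Ck * (\<bar>h x\<bar> * rS z e x powr (- k))" by simp
     also have "... <= c0 * Ck * (t powr (- p) * \<bar>h x\<bar> powr p + t powr q * (rS z e x powr (- k)) powr q)"
      using young_scaled[OF p(1) q(1) _ _ t(1), of "\<bar>h x\<bar>" "rS z e x powr (- k)"] c0 Ck by (intro mult_left_mono) auto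
     also have "(rS z e x powr (- k)) powr q = rS z e x powr (- (2 * k * q) / 2)" by (simp add: powr_powr)
     finally show ?thesis using True xR by simp
    next
     case False
     then have "v x = 0" using elim by blast
     then show ?thesis using c0 Ck by (simp add: indicator_def)
    qed
   qed
  qed
  also have "... = c0 * Ck * (t powr (- p) * ?Ip + t powr q * (LB x. ?K x))" using hp Ki by simp
  also have "... <= c0 * Ck * (t powr (- p) * ?Ip + t powr q * A)"
   using A(2)[OF zR e(1)] c0 Ck by (intro mult_left_mono add_left_mono) auto
  also have "... <= C * ?Ip + d / 2"
  proof -
   have "c0 * Ck * (t powr q * A) = d / 2 * (A / (A + 1))"
   proof -
    have "t powr q = d / (2 * (c0 * Ck) * (A + 1))" using t(2) by (simp add: mult.assoc)
    moreover have "c0 * Ck \<noteq> 0" using c0 Ck by simp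
    ultimately show ?thesis by (simp add: mult_ac)
   qed
   also have "... <= d / 2 * 1" using d A(1) by (intro mult_left_mono) (auto simp: divide_le_eq)
   finally show ?thesis by (simp add: C_def distrib_left mult.assoc)
  qed
  finally have 1: "\<bar>LB x. g x * Y x\<bar> <= C * ?Ip + d / 2" unfolding Yg .
  have gi: "integrable lb g" "(LB x. g x) = 1"
  proof -
   have "integrable lb (indicator (ball z e) :: 'n pt => real)"
    using bm emeasure_bounded_finite[OF bounded_ball[of z e]] by (intro integrable_real_indicator) auto
   then show "integrable lb g" unfolding g_def by simp
   show "(LB x. g x) = 1" unfolding g_def using mu by simp
  qed
  have gY: "integrable lb (%x. g x * Y x)" by (rule l2_real_mult[OF gl h10_l2(1)[OF Y(2)]])
  have "\<bar>(LB x. g x * Y x) - Y z\<bar> = \<bar>LB x. g x * Y x - Y z * g x\<bar>" using gi gY by simp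
  also have "... <= (LB x. \<bar>g x * Y x - Y z * g x\<bar>)" by (rule integral_abs_bound)
  also have "... <= (LB x. d / 2 * g x)"
  proof (rule integral_mono)
   show "\<bar>g x * Y x - Y z * g x\<bar> <= d / 2 * g x" for x
   proof (cases "x : ball z e")
    case True
    then have "\<bar>Y x - Y z\<bar> <= d / 2" using e1(2)[of x] e(3) by (simp add: dist_real_def dist_commute)
    then have "g x * \<bar>Y x - Y z\<bar> <= g x * (d / 2)" using mu by (intro mult_left_mono) (auto simp: g_def)
    moreover have "g x >= 0" using mu by (simp add: g_def)
    moreover have "\<bar>g x * Y x - Y z * g x\<bar> = g x * \<bar>Y x - Y z\<bar>"
     using \<open>g x >= 0\<close> by (metis abs_mult abs_of_nonneg mult.commute right_diff_distrib)
    ultimately show ?thesis by (simp add: mult.commute)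
   qed (simp add: g_def)
  qed (use gi gY in auto)
  also have "... = d / 2" using gi by simp
  finally show ?thesis using 1 by linarith
 qed
 moreover have "C >= 0" using c0 Ck by (simp add: C_def)
 ultimately show ?thesis by blast
qed

section \<open>Passage to the limit in the right-hand side\<close>

lemma h10_limit:
 assumes y: "!!k::nat. h10 U (y k) (G k)" and l: "l2lim lb y Y" "l2lim lb G H"
 shows "h10 U Y H"
proof -
 have "\<exists>p P. C1c U p P \<and> l2n lb (%x. p x - y k x) < inverse (real (Suc k)) \<and> l2n lb (%x. P x - G k x) < inverse (real (Suc k))" for k
 proof -
  obtain ps Ps where p: "!!k. C1c U (ps k) (Ps k)" "l2lim lb ps (y k)" "l2lim lb Ps (G k)"
   using y[of k] unfolding h10_def by blast
  have "eventually (%j. l2n lb (%x. ps j x - y k x) < inverse (real (Suc k))) sequentially"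
   by (rule order_tendstoD(2)[OF l2limD(3)[OF p(2)]]) simp
  moreover have "eventually (%j. l2n lb (%x. Ps j x - G k x) < inverse (real (Suc k))) sequentially"
   by (rule order_tendstoD(2)[OF l2limD(3)[OF p(3)]]) simp
  ultimately have "eventually (%j. l2n lb (%x. ps j x - y k x) < inverse (real (Suc k)) \<and> l2n lb (%x. Ps j x - G k x) < inverse (real (Suc k))) sequentially"
   by eventually_elim simp
  then obtain j where "l2n lb (%x. ps j x - y k x) < inverse (real (Suc k))" "l2n lb (%x. Ps j x - G k x) < inverse (real (Suc k))"
   by (auto simp: eventually_sequentially)
  then show ?thesis using p(1) by blast
 qed
 then obtain p P where p: "!!k. C1c U (p k) (P k)" "!!k. l2n lb (%x. p k x - y k x) < inverse (real (Suc k))"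
  "!!k. l2n lb (%x. P k x - G k x) < inverse (real (Suc k))" by metis
 note pl = C1c_l2[OF p(1)]
 have "l2lim lb p Y"
 proof (rule l2limI_le[OF pl(1) l2limD(2)[OF l(1)]])
  show "l2n lb (%x. p k x - Y x) <= inverse (real (Suc k)) + l2n lb (%x. y k x - Y x)" for k
   using l2n_triangle3[OF pl(1)[of k] h10_l2(1)[OF y[of k]] l2limD(2)[OF l(1)]] p(2)[of k] by linarith
  show "(%k. inverse (real (Suc k)) + l2n lb (%x. y k x - Y x)) ----> 0"
   using tendsto_add[OF LIMSEQ_inverse_real_of_nat l2limD(3)[OF l(1)]] by simp
 qed
 moreover have "l2lim lb P H"
 proof (rule l2limI_le[OF pl(2) l2limD(2)[OF l(2)]])
  show "l2n lb (%x. P k x - H x) <= inverse (real (Suc k)) + l2n lb (%x. G k x - H x)" for k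
   using l2n_triangle3[OF pl(2)[of k] h10_l2(2)[OF y[of k]] l2limD(2)[OF l(2)]] p(3)[of k] by linarith
  show "(%k. inverse (real (Suc k)) + l2n lb (%x. G k x - H x)) ----> 0"
   using tendsto_add[OF LIMSEQ_inverse_real_of_nat l2limD(3)[OF l(2)]] by simp
 qed
 ultimately show ?thesis using p(1) unfolding h10_def by blast
qed

definition solvable :: "'n::finite pt set => ('n pt => real) => bool" where
 "solvable Om h \<longleftrightarrow> (\<exists>Y G. continuous_on UNIV Y \<and> (\<forall>x. x \<notin> Om --> Y x = 0) \<and> h10 Om Y G \<and> wsol Om G h)"

lemma powr_add_le:
 fixes a b p :: real
 assumes "a >= 0" "b >= 0" "p >= 0" shows "(a + b) powr p <= 2 powr p * (a powr p + b powr p)"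
proof -
 have "(a + b) powr p <= (2 * max a b) powr p" using assms by (intro powr_mono2) auto
 also have "... = 2 powr p * max a b powr p" using assms by (simp add: powr_mult)
 also have "... <= 2 powr p * (a powr p + b powr p)" by (intro mult_left_mono) (auto simp: max_def)
 finally show ?thesis .
qed

text \<open>For a > t the factor \<open>(a / t) powr (p - 1)\<close> is at least 1. This controls
  \<open>L\<^sup>1\<close> norms by the integral of the p-th power.\<close>

lemma abs_le_powr:
 fixes a p t :: real
 assumes "p >= 1" "t > 0" "a >= 0" shows "a <= t + t powr (1 - p) * a powr p"
proof (cases "a <= t")
 case True
 then show ?thesis by (simp add: add_increasing2)
next
 case False
 then have a: "a > 0" "a >= t" using assms by auto
 have "t powr (p - 1) <= a powr (p - 1)" using assms a by (intro powr_mono2) auto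
 then have "t powr (1 - p) * t powr (p - 1) <= t powr (1 - p) * a powr (p - 1)" by (intro mult_left_mono) auto
 then have "1 <= t powr (1 - p) * a powr (p - 1)" using assms by (simp add: powr_add[symmetric])
 then have "a * 1 <= a * (t powr (1 - p) * a powr (p - 1))" using a by (intro mult_left_mono) auto
 also have "... = t powr (1 - p) * a powr p" using a by (simp add: powr_diff)
 finally show ?thesis using assms by simp
qed

context
 fixes Om :: "'n::finite pt set" and p :: real
 assumes n: "CARD('n) = 2 \<or> CARD('n) = 3" and dom: "lipschitz_domain Om" and p: "p > 1" "p > real CARD('n) / 2"
begin

abbreviation Ip :: "('n pt => real) => real" where "Ip h \<equiv> LB x. indicator Om x * \<bar>h x\<bar> powr p"
definition lp :: "('n pt => real) => bool" where
 "lp h \<longleftrightarrow> h : bml \<and> integrable lb (%x. indicator Om x * \<bar>h x\<bar> powr p)"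

lemma dom_facts: "open Om" "bounded Om" "\<exists>R\<ge>0. Om \<subseteq> cball 0 R" "(indicator Om :: 'n pt => real) : bml"
 "integrable lb (indicator Om :: 'n pt => real)"
proof -
 show o: "open Om" and b: "bounded Om" using dom by (auto simp: lipschitz_domain_def)
 show "\<exists>R\<ge>0. Om \<subseteq> cball 0 R" using bounded_subset_ballD[OF b, of 0] ball_subset_cball[of 0] by (metis less_imp_le order_trans)
 show m: "(indicator Om :: 'n pt => real) : bml" by (rule borel_measurable_indicator[OF open_lebesgue[OF o]])
 show "integrable lb (indicator Om :: 'n pt => real)"
  by (rule l2_bounded_support(2)[OF m b, of 1]) (auto simp: indicator_def)
qed

lemma lp_diff:
 assumes "lp f" "lp g" shows "lp (%x. f x - g x)" "Ip (%x. f x - g x) <= 2 powr p * (Ip f + Ip g)"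
proof -
 have [measurable]: "f : bml" "g : bml" using assms by (auto simp: lp_def)
 note [measurable] = dom_facts(4)
 have le: "indicator Om x * \<bar>f x - g x\<bar> powr p <= 2 powr p * (indicator Om x * \<bar>f x\<bar> powr p + indicator Om x * \<bar>g x\<bar> powr p)" for x
 proof -
  have "\<bar>f x - g x\<bar> powr p <= (\<bar>f x\<bar> + \<bar>g x\<bar>) powr p" using p by (intro powr_mono2) auto
  also have "... <= 2 powr p * (\<bar>f x\<bar> powr p + \<bar>g x\<bar> powr p)" by (rule powr_add_le) (use p in auto)
  finally show ?thesis by (simp add: indicator_def)
 qed
 have i: "integrable lb (%x. 2 powr p * (indicator Om x * \<bar>f x\<bar> powr p + indicator Om x * \<bar>g x\<bar> powr p))"
  using assms by (simp add: lp_def)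
 have j: "integrable lb (%x. indicator Om x * \<bar>f x - g x\<bar> powr p)"
  by (rule int_bound[OF i]) (use le in \<open>auto intro!: AE_I2 order_trans[OF le]\<close>)
 then show "lp (%x. f x - g x)" by (simp add: lp_def)
 have "Ip (%x. f x - g x) <= (LB x. 2 powr p * (indicator Om x * \<bar>f x\<bar> powr p + indicator Om x * \<bar>g x\<bar> powr p))"
  by (rule integral_mono[OF j i]) (rule le)
 then show "Ip (%x. f x - g x) <= 2 powr p * (Ip f + Ip g)" using assms by (simp add: lp_def)
qed

lemma lp_integrable:
 assumes "lp f" "t > 0"
 shows "integrable lb (%x. indicator Om x * \<bar>f x\<bar>)"
  "(LB x. indicator Om x * \<bar>f x\<bar>) <= t * measure lb Om + t powr (1 - p) * Ip f"
proof -
 have [measurable]: "f : bml" using assms by (auto simp: lp_def)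
 note [measurable] = dom_facts(4)
 have le: "indicator Om x * \<bar>f x\<bar> <= t * indicator Om x + t powr (1 - p) * (indicator Om x * \<bar>f x\<bar> powr p)" for x
  using abs_le_powr[of p t "\<bar>f x\<bar>"] p assms by (simp add: indicator_def)
 have i: "integrable lb (%x. t * indicator Om x + t powr (1 - p) * (indicator Om x * \<bar>f x\<bar> powr p))"
  using assms dom_facts(5) by (simp add: lp_def)
 show j: "integrable lb (%x. indicator Om x * \<bar>f x\<bar>)"
  by (rule int_bound[OF i]) (auto intro!: AE_I2 order_trans[OF le])
 have "(LB x. indicator Om x * \<bar>f x\<bar>) <= (LB x. t * indicator Om x + t powr (1 - p) * (indicator Om x * \<bar>f x\<bar> powr p))"
  by (rule integral_mono[OF j i]) (rule le)
 also have "... = t * (LB x. indicator Om x) + t powr (1 - p) * Ip f"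
  using assms dom_facts(5) by (simp add: lp_def)
 finally show "(LB x. indicator Om x * \<bar>f x\<bar>) <= t * measure lb Om + t powr (1 - p) * Ip f" by simp
qed

lemma C1c_mult_lp:
 assumes "lp f" "C1c Om z Z" "!!x. \<bar>z x\<bar> <= B"
 shows "integrable lb (%x. f x * z x)" "\<bar>LB x. f x * z x\<bar> <= B * (LB x. indicator Om x * \<bar>f x\<bar>)"
proof -
 have fm: "f : bml" using assms by (auto simp: lp_def)
 note i = lp_integrable(1)[OF assms(1) zero_less_one]
 have le: "\<bar>f x * z x\<bar> <= B * (indicator Om x * \<bar>f x\<bar>)" for x
  using C1cD(5)[OF assms(2), of x] mult_left_mono[OF assms(3)[of x], of "\<bar>f x\<bar>"]
  by (cases "x : Om") (auto simp: abs_mult mult.commute)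
 show j: "integrable lb (%x. f x * z x)"
  by (rule int_bound[OF integrable_mult_right[OF i, of B]])
   (use fm C1c_measurable[OF assms(2)] order_trans[OF le abs_ge_self] in \<open>auto intro!: AE_I2\<close>)
 have "\<bar>LB x. f x * z x\<bar> <= (LB x. \<bar>f x * z x\<bar>)" by (rule integral_abs_bound)
 also have "... <= (LB x. B * (indicator Om x * \<bar>f x\<bar>))"
  by (rule integral_mono) (use j i le in auto)
 finally show "\<bar>LB x. f x * z x\<bar> <= B * (LB x. indicator Om x * \<bar>f x\<bar>)" by simp
qed

lemma lp_tendsto_l1:
 assumes "!!k. lp (%x. f k x)" "(%k. Ip (f k)) ----> 0"
 shows "(%k. LB x. indicator Om x * \<bar>f k x\<bar>) ----> 0"
proof (rule LIMSEQ_I)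
 fix e :: real assume e: "e > 0"
 define m where "m = measure lb Om"
 have m: "m >= 0" by (simp add: m_def)
 define t where "t = e / (2 * (m + 1))"
 have t: "t > 0" using e m by (simp add: t_def)
 have tm: "t * m <= e / 2"
 proof -
  have "t * m <= t * (m + 1)" using t by simp
  also have "... = e / 2" using m by (simp add: t_def divide_simps)
  finally show ?thesis .
 qed
 have "t powr (1 - p) > 0" using t by simp
 then have "e / (2 * t powr (1 - p)) > 0" using e by simp
 from order_tendstoD(2)[OF assms(2) this] obtain K where K: "!!k. k >= K ==> Ip (f k) < e / (2 * t powr (1 - p))" by (auto simp: eventually_sequentially)
 have "norm ((LB x. indicator Om x * \<bar>f k x\<bar>) - 0) < e" if "k >= K" for k
 proof -
  have "t powr (1 - p) * Ip (f k) < e / 2" using K[OF that] t by (simp add: pos_less_divide_eq mult.commute)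
  moreover have "(LB x. indicator Om x * \<bar>f k x\<bar>) <= t * m + t powr (1 - p) * Ip (f k)"
   using lp_integrable(2)[OF assms(1) t, of k] by (simp add: m_def)
  moreover have "(LB x. indicator Om x * \<bar>f k x\<bar>) >= 0" by (intro integral_nonneg_AE) auto
  ultimately show ?thesis using tm by simp
 qed
 then show "\<exists>K. \<forall>k\<ge>K. norm ((LB x. indicator Om x * \<bar>f k x\<bar>) - 0) < e" by blast
qed

text \<open>The solutions converge uniformly by \<open>sup_bound_Lp\<close>. Their gradients
  converge in \<open>L\<^sup>2\<close> because the energy of a difference is the integral of
  \<open>(h i - h j) * (Y i - Y j)\<close>, at most a supremum times an \<open>L\<^sup>1\<close>
  norm. This is how a limit H outside \<open>L\<^sup>2\<close> becomes admissible.\<close>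

theorem solvable_limit:
 assumes hk: "!!k::nat. solvable Om (h k)" "!!k. l2 lb (h k)" "!!k. lp (h k)" and h: "lp H"
  and lim: "(%k. Ip (%x. h k x - H x)) ----> 0"
 shows "solvable Om H"
proof -
 obtain R where R: "R >= 0" "Om \<subseteq> cball 0 R" using dom_facts(3) by blast
 have "\<forall>k. \<exists>YG. continuous_on UNIV (fst YG) \<and> (\<forall>x. x \<notin> Om --> fst YG x = 0) \<and> h10 Om (fst YG) (snd YG) \<and> wsol Om (snd YG) (h k)"
  using hk(1) unfolding solvable_def by (metis fst_conv snd_conv)
 from choice[OF this] obtain YG where YG: "!!k. continuous_on UNIV (fst (YG k)) \<and> (\<forall>x. x \<notin> Om --> fst (YG k) x = 0) \<and> h10 Om (fst (YG k)) (snd (YG k)) \<and> wsol Om (snd (YG k)) (h k)" by blast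
 define Y where "Y k = fst (YG k)" for k
 define G where "G k = snd (YG k)" for k
 have Y: "continuous_on UNIV (Y k)" "x \<notin> Om ==> Y k x = 0" "h10 Om (Y k) (G k)" "wsol Om (G k) (h k)" for k x
  using YG by (auto simp: Y_def G_def)
 have dlp: "lp (%x. h k x - h j x)" for k j by (rule lp_diff(1)[OF hk(3) hk(3)])
 have dH: "lp (%x. h k x - H x)" for k by (rule lp_diff(1)[OF hk(3) h])
 have dI: "Ip (%x. h k x - h j x) <= 2 powr p * (Ip (%x. h k x - H x) + Ip (%x. h j x - H x))" for k j
  using lp_diff(2)[OF dH dH, of k j] by simp
 have small: "\<exists>K. \<forall>k\<ge>K. \<forall>j\<ge>K. Ip (%x. h k x - h j x) < e" if e: "e > 0" for e
 proof -
  have "e / (2 * 2 powr p) > 0" using e by simp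
  from order_tendstoD(2)[OF lim this] obtain K where K: "!!k. k >= K ==> Ip (%x. h k x - H x) < e / (2 * 2 powr p)"
   by (auto simp: eventually_sequentially)
  have "Ip (%x. h k x - h j x) < e" if "k >= K" "j >= K" for k j
  proof -
   have "2 powr p * (Ip (%x. h k x - H x) + Ip (%x. h j x - H x)) < 2 powr p * (e / (2 * 2 powr p) + e / (2 * 2 powr p))"
    using K[OF that(1)] K[OF that(2)] by (intro mult_strict_left_mono add_strict_mono) auto
   also have "... = e" by (simp add: field_simps)
   finally show ?thesis using dI[of k j] by linarith
  qed
  then show ?thesis by blast
 qed
 have Yd: "h10 Om (%x. Y k x - Y j x) (%x. G k x - G j x)" "wsol Om (%x. G k x - G j x) (%x. h k x - h j x)" for k j
  using Y(3) by (auto intro!: h10_diff wsol_diff Y(4) hk(2) h10_l2(2))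
 have supY: "\<exists>K. \<forall>k\<ge>K. \<forall>j\<ge>K. \<forall>x. \<bar>Y k x - Y j x\<bar> <= e" if e: "e > 0" for e
 proof -
  have e2: "e / 2 > 0" using e by simp
  obtain C where C: "C >= 0" "!!h Y G z. continuous_on UNIV Y ==> h10 Om Y G ==> wsol Om G h ==> l2 lb h ==>
   integrable lb (%x. indicator Om x * \<bar>h x\<bar> powr p) ==> z : Om ==> \<bar>Y z\<bar> <= e / 2 + C * Ip h"
   using sup_bound_Lp[OF n dom_facts(1) R(2,1) p e2] by blast
  have "e / (2 * (C + 1)) > 0" using e C(1) by simp
  from small[OF this] obtain K where K: "!!k j. k >= K ==> j >= K ==> Ip (%x. h k x - h j x) < e / (2 * (C + 1))" by blast
  have "\<bar>Y k x - Y j x\<bar> <= e" if "k >= K" "j >= K" for k j x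
  proof (cases "x : Om")
   case True
   have "\<bar>Y k x - Y j x\<bar> <= e / 2 + C * Ip (%x. h k x - h j x)"
    using dlp[of k j] by (intro C(2)[OF continuous_on_diff[OF Y(1) Y(1)] Yd l2_diff[OF hk(2) hk(2)] _ True]) (simp add: lp_def)
   also have "C * Ip (%x. h k x - h j x) <= C * (e / (2 * (C + 1)))"
    using K[OF that] C(1) by (intro mult_left_mono) auto
   also have "C * (e / (2 * (C + 1))) <= (C + 1) * (e / (2 * (C + 1)))" using e C(1) by (intro mult_right_mono) auto
   also have "... = e / 2" using C(1) by (simp add: field_simps)
   finally show ?thesis by simp
  next
   case False
   then show ?thesis using Y(2) e by simp
  qed
  then show ?thesis by blast
 qed
 have "uniformly_Cauchy_on UNIV Y"
  unfolding uniformly_Cauchy_on_def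
 proof (intro allI impI)
  fix e :: real assume "e > 0"
  then obtain K where "\<forall>k\<ge>K. \<forall>j\<ge>K. \<forall>x. \<bar>Y k x - Y j x\<bar> <= e / 2" using supY[of "e/2"] by auto
  then have "dist (Y m x) (Y n x) < e" if "m >= K" "n >= K" for m n x
   using that \<open>e > 0\<close> by (metis dist_real_def field_sum_of_halves le_less_trans less_add_same_cancel1 half_gt_zero)
  then show "\<exists>M. \<forall>x\<in>UNIV. \<forall>m\<ge>M. \<forall>n\<ge>M. dist (Y m x) (Y n x) < e" by blast
 qed
 then obtain Yl where Yl: "uniform_limit UNIV Y Yl sequentially" using Cauchy_uniformly_convergent unfolding uniformly_convergent_on_def by blast
 have cY: "continuous_on UNIV Yl" by (rule uniform_limit_theorem[OF _ Yl]) (simp_all add: Y(1))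
 have ptw: "(%k. Y k x) ----> Yl x" for x using tendsto_uniform_limitI[OF Yl] by simp
 have Y0: "Yl x = 0" if "x \<notin> Om" for x using ptw[of x] Y(2)[OF that] by (simp add: LIMSEQ_const_iff)
 have Yl2: "l2lim lb Y Yl"
 proof -
  obtain K where K: "!!k j x. k >= K ==> j >= K ==> \<bar>Y k x - Y j x\<bar> <= 1" using supY[of 1] by auto
  have "compact (Y K ` cball 0 R)" by (intro compact_continuous_image continuous_on_subset[OF Y(1)]) auto
  then obtain B where B: "\<forall>y\<in>Y K ` cball 0 R. norm y <= B" using compact_imp_bounded bounded_iff by blast
  have b: "\<bar>Y (k + K) x\<bar> <= \<bar>B\<bar> + 1" if "x : Om" for k x
   using K[of "k + K" K x] B that R(2) by fastforce
  have wl: "l2 lb (%x. indicator Om x *\<^sub>R (\<bar>B\<bar> + 1))"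
   by (rule indicator_continuous_l2[OF dom_facts(1,2) continuous_on_const, of _ "\<bar>B\<bar> + 1"]) simp
  have "l2lim lb (%k. Y (k + K)) Yl"
  proof (rule l2lim_dominated[OF _ _ wl])
   show "AE x in lb. norm (Y (k + K) x) <= norm (indicator Om x *\<^sub>R (\<bar>B\<bar> + 1))" for k
   proof (rule AE_I2)
    fix x show "norm (Y (k + K) x) <= norm (indicator Om x *\<^sub>R (\<bar>B\<bar> + 1))"
     using b[of x k] Y(2)[of x "k + K"] by (cases "x : Om") auto
   qed
   show "AE x in lb. (%k. Y (k + K) x) ----> Yl x" using ptw by (auto intro!: LIMSEQ_ignore_initial_segment)
  qed (auto intro!: continuous_borel_lebesgue Y(1) cY)
  then have "(%k. l2n lb (%x. Y (k + K) x - Yl x)) ----> 0" "l2 lb Yl" by (auto simp: l2lim_def)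
  then show ?thesis using LIMSEQ_offset[of "%k. l2n lb (%x. Y k x - Yl x)" K 0] h10_l2(1)[OF Y(3)] by (auto simp: l2lim_def)
 qed
 have GC: "\<exists>K. \<forall>i\<ge>K. \<forall>j\<ge>K. l2n lb (%x. G i x - G j x) < e" if e: "e > 0" for e
 proof -
  obtain K0 where K0: "!!k j. k >= K0 ==> j >= K0 ==> Ip (%x. h k x - h j x) < 1" using small[of 1] by auto
  define m where "m = measure lb Om + 1"
  have m: "m > 0" by (simp add: m_def add_nonneg_pos)
  have "e\<^sup>2 / (2 * m) > 0" using e m by simp
  from supY[OF this] obtain K1 where K1: "!!k j x. k >= K1 ==> j >= K1 ==> \<bar>Y k x - Y j x\<bar> <= e\<^sup>2 / (2 * m)" by blast
  have "l2n lb (%x. G i x - G j x) < e" if "i >= max K0 K1" "j >= max K0 K1" for i j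
  proof -
   have il: "(LB x. indicator Om x * \<bar>h i x - h j x\<bar>) <= m"
    using lp_integrable(2)[OF dlp[of i j] zero_less_one] K0[of i j] that by (simp add: m_def)
   have "(l2n lb (%x. G i x - G j x))\<^sup>2 = (LB x. (G i x - G j x) \<bullet> (G i x - G j x))"
    by (simp add: l2n_sq power2_norm_eq_inner)
   also have "... = (LB x. (h i x - h j x) * (Y i x - Y j x))"
    using Y(3) by (intro wsol_h10[OF Yd(2) _ _ Yd(1)] l2_diff hk(2) h10_l2(2))
   also have "... <= (LB x. e\<^sup>2 / (2 * m) * (indicator Om x * \<bar>h i x - h j x\<bar>))"
   proof (rule integral_mono)
    show "integrable lb (%x. (h i x - h j x) * (Y i x - Y j x))"
     by (intro l2_real_mult l2_diff hk(2) h10_l2(1)[OF Y(3)])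
    show "integrable lb (%x. e\<^sup>2 / (2 * m) * (indicator Om x * \<bar>h i x - h j x\<bar>))"
     using lp_integrable(1)[OF dlp[of i j] zero_less_one] by simp
    show "(h i x - h j x) * (Y i x - Y j x) <= e\<^sup>2 / (2 * m) * (indicator Om x * \<bar>h i x - h j x\<bar>)" for x
    proof (cases "x : Om")
     case True
     have "(h i x - h j x) * (Y i x - Y j x) <= \<bar>h i x - h j x\<bar> * \<bar>Y i x - Y j x\<bar>" by (metis abs_ge_self abs_mult)
     also have "... <= \<bar>h i x - h j x\<bar> * (e\<^sup>2 / (2 * m))" using K1[of i j x] that by (intro mult_left_mono) auto
     finally show ?thesis using True by (simp add: mult.commute)
    qed (use Y(2) in simp)
   qed
   also have "... = e\<^sup>2 / (2 * m) * (LB x. indicator Om x * \<bar>h i x - h j x\<bar>)" by simp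
   also have "... <= e\<^sup>2 / (2 * m) * m" using il m by (intro mult_left_mono) auto
   also have "... = e\<^sup>2 / 2" using m by simp
   also have "... < e\<^sup>2" using e by simp
   finally show ?thesis using e by (metis less_imp_le power_less_imp_less_base)
  qed
  then show ?thesis by blast
 qed
 obtain Gl where Gl: "l2lim lb G Gl" using l2_complete[OF h10_l2(2)[OF Y(3)] GC] by blast
 have "h10 Om Yl Gl" by (rule h10_limit[OF Y(3) Yl2 Gl])
 moreover have "wsol Om Gl H"
  unfolding wsol_def
 proof (intro allI impI)
  fix z Z assume z: "C1c Om z Z"
  obtain B where B: "B >= 0" "!!x. \<bar>z x\<bar> <= B" using C1c_bounded[OF z] by blast
  have 1: "(%k. LB x. G k x \<bullet> Z x) ----> (LB x. Gl x \<bullet> Z x)"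
   by (rule l2lim_inner[OF Gl l2lim_const[OF C1c_l2(2)[OF z]]])
  have e: "(LB x. G k x \<bullet> Z x) = (LB x. h k x * z x)" for k using Y(4) z unfolding wsol_def by blast
  have "(%k. (LB x. h k x * z x) - (LB x. H x * z x)) ----> 0"
  proof (rule Lim_null_comparison[OF always_eventually[OF allI]])
   show "norm ((LB x. h k x * z x) - (LB x. H x * z x)) <= B * (LB x. indicator Om x * \<bar>h k x - H x\<bar>)" for k
   proof -
    have "(LB x. h k x * z x) - (LB x. H x * z x) = (LB x. (h k x - H x) * z x)"
     using C1c_mult_lp(1)[OF hk(3) z B(2)] C1c_mult_lp(1)[OF h z B(2)] by (simp add: left_diff_distrib)
    then show ?thesis using C1c_mult_lp(2)[OF dH z B(2), of k] by simp
   qed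
   show "(%k. B * (LB x. indicator Om x * \<bar>h k x - H x\<bar>)) ----> 0"
    using tendsto_mult_right_zero[OF lp_tendsto_l1[OF dH lim]] .
  qed
  then have "(%k. LB x. h k x * z x) ----> (LB x. H x * z x)" by (rule Lim_null[THEN iffD2])
  then show "(LB x. Gl x \<bullet> Z x) = (LB x. H x * z x)" using 1 unfolding e by (rule LIMSEQ_unique[rotated])
 qed
 ultimately show ?thesis unfolding solvable_def using cY Y0 by blast
qed

lemma bounded_lp:
 assumes "h : bml" "!!x. \<bar>h x\<bar> <= M" shows "lp h"
proof -
 have "integrable lb (%x. indicator Om x * \<bar>h x\<bar> powr p)"
 proof (rule l2_bounded_support(2)[OF _ dom_facts(2), of _ "M powr p"])
  show "(%x. indicator Om x * \<bar>h x\<bar> powr p) : bml" using assms(1) dom_facts(4) by measurable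
  have "\<bar>h x\<bar> powr p <= M powr p" for x using assms(2) p by (intro powr_mono2) auto
  then show "AE x in lb. norm (indicator Om x * \<bar>h x\<bar> powr p) <= M powr p" by (intro AE_I2) (auto simp: indicator_def)
 qed auto
 then show ?thesis using assms(1) by (simp add: lp_def)
qed

lemma Ip_dominated:
 assumes f: "!!k. f k : bml" and F: "lp F" and b: "!!k x. x : Om ==> \<bar>f k x\<bar> <= \<bar>F x\<bar>"
  and l: "AE x in lb. x : Om --> (%k. f k x) ----> 0"
 shows "(%k. Ip (f k)) ----> 0"
proof -
 have "(%k. Ip (f k)) ----> integral\<^sup>L lb (%x::'n pt. 0::real)"
 proof (rule integral_dominated_convergence[where w="%x. indicator Om x * \<bar>F x\<bar> powr p"])
  show "(%x. indicator Om x * \<bar>f k x\<bar> powr p) : bml" for k using f[of k] dom_facts(4) by measurable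
  show "integrable lb (%x. indicator Om x * \<bar>F x\<bar> powr p)" using F by (simp add: lp_def)
  show "AE x in lb. (%k. indicator Om x * \<bar>f k x\<bar> powr p) ----> 0"
   using l
  proof eventually_elim
   case (elim x)
   show ?case
   proof (cases "x : Om")
    case True
    then have "(%k. \<bar>f k x\<bar>) ----> 0" using elim tendsto_rabs_zero by blast
    then have "(%k. \<bar>f k x\<bar> powr p) ----> 0 powr p" using p by (intro tendsto_powr2 tendsto_const) auto
    then show ?thesis using True p by simp
   qed simp
  qed
  show "AE x in lb. norm (indicator Om x * \<bar>f k x\<bar> powr p) <= indicator Om x * \<bar>F x\<bar> powr p" for k
  proof (rule AE_I2)
   fix x
   show "norm (indicator Om x * \<bar>f k x\<bar> powr p) <= indicator Om x * \<bar>F x\<bar> powr p"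
    using b[of x k] p by (cases "x : Om") (auto intro: powr_mono2)
  qed
 qed simp
 then show ?thesis by simp
qed

text \<open>A measurable function is the limit almost everywhere of continuous ones. Clamped to
  [- M, M] and multiplied by a cut-off, they are data for \<open>poisson_continuous\<close> and
  converge in \<open>L\<^sup>p\<close> by dominated convergence.\<close>

lemma solvable_bounded:
 assumes hm: "h : bml" and M: "!!x. \<bar>h x\<bar> <= M"
 shows "solvable Om h"
proof -
 have M0: "M >= 0" using M[of 0] by simp
 have "h measurable_on UNIV" using hm by (simp add: measurable_on_iff_borel_measurable lebesgue_on_UNIV_eq)
 then obtain N g where g: "negligible N" "!!k. continuous_on UNIV (g k)" "!!x. x \<notin> N ==> (%k. g k x) ----> h x"
  unfolding measurable_on_def by auto
 \<comment> \<open>It vanishes where the distance to the complement of Om is at most 1/k and equals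
   1 at each point of Om from some k on.\<close>
 define c where "c k x = max 0 (min 1 (real k * infdist x (- Om) - 1))" for k :: nat and x
 define f where "f k x = c k x * max (- M) (min M (g k x))" for k x
 have cc: "continuous_on UNIV (c k)" for k unfolding c_def by (intro continuous_intros)
 have fc: "continuous_on UNIV (f k)" for k unfolding f_def by (intro continuous_intros cc g)
 have cb: "0 <= c k x" "c k x <= 1" for k x by (auto simp: c_def)
 have fb: "\<bar>f k x\<bar> <= M" for k x
 proof -
  have "\<bar>max (- M) (min M (g k x))\<bar> <= M" using M0 by (auto simp: max_def min_def abs_if)
  then have "c k x * \<bar>max (- M) (min M (g k x))\<bar> <= 1 * M" using cb M0 by (intro mult_mono) auto
  then show ?thesis using cb[of k x] by (simp add: f_def abs_mult)
 qed
 have sup: "\<exists>K. compact K \<and> (\<forall>x. x \<notin> K --> f k x = 0)" for k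
 proof -
  have "f k x = 0" if "x \<notin> closure Om" for x
  proof -
   have "x \<notin> Om" using that closure_subset by blast
   then show ?thesis using infdist_complement(3)[OF dom_facts(1,2)] by (simp add: f_def c_def)
  qed
  then show ?thesis using dom_facts(2) compact_closure by metis
 qed
 have fs: "solvable Om (f k)" for k
  using poisson_continuous[OF n dom fc[of k]] sup[of k] unfolding solvable_def by metis
 have fl2: "l2 lb (f k)" for k using sup[of k] continuous_compact_integrable(2)[OF fc[of k]] by blast
 have fm: "f k : bml" for k by (rule continuous_borel_lebesgue[OF fc])
 have conv: "(%k. f k x) ----> h x" if "x \<notin> N" "x : Om" for x
 proof -
  have "infdist x (- Om) > 0" using infdist_complement(4)[OF dom_facts(1,2)] that(2) by blast
  then obtain k0 where k0: "2 < real k0 * infdist x (- Om)" using ex_less_of_nat_mult by blast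
  have "c k x = 1" if "k >= k0" for k
  proof -
   have "real k0 * infdist x (- Om) <= real k * infdist x (- Om)" using that by (intro mult_right_mono infdist_nonneg) auto
   then show ?thesis using k0 by (simp add: c_def)
  qed
  then have "eventually (%k. c k x = 1) sequentially" by (auto simp: eventually_sequentially)
  then have "(%k. c k x) ----> 1" by (rule tendsto_eventually)
  moreover have "(%k. max (- M) (min M (g k x))) ----> max (- M) (min M (h x))"
   by (intro tendsto_intros g that)
  ultimately have "(%k. f k x) ----> 1 * max (- M) (min M (h x))" unfolding f_def by (rule tendsto_mult)
  moreover have "max (- M) (min M (h x)) = h x" using M[of x] by (auto simp: abs_le_iff)
  ultimately show ?thesis by simp
 qed
 have ae: "AE x in lb. x \<notin> N" using g(1) by (intro AE_not_in) (simp add: negligible_iff_null_sets)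
 show ?thesis
 proof (rule solvable_limit[OF fs fl2 bounded_lp[OF fm fb] bounded_lp[OF hm M]])
  show "(%k. Ip (%x. f k x - h x)) ----> 0"
  proof (rule Ip_dominated[OF _ bounded_lp[of "%x. 2 * M" "2 * M"]])
   show "(%x. f k x - h x) : bml" for k using fm hm by measurable
   show "\<bar>f k x - h x\<bar> <= \<bar>2 * M\<bar>" for k x using fb[of k x] M[of x] by linarith
   show "AE x in lb. x : Om --> (%k. f k x - h x) ----> 0"
    using ae by eventually_elim (auto simp: Lim_null[symmetric] intro: conv)
  qed (use M0 in auto)
 qed
qed

theorem solvable_lp:
 assumes h: "lp h" shows "solvable Om h"
proof -
 define f where "f k x = indicator Om x * max (- real k) (min (real k) (h x))" for k x
 have hm: "h : bml" using h by (simp add: lp_def)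
 have fm: "f k : bml" for k unfolding f_def using hm dom_facts(4) by measurable
 have fb: "\<bar>f k x\<bar> <= real k" for k x by (auto simp: f_def indicator_def abs_le_iff)
 have fl2: "l2 lb (f k)" for k
  by (rule l2_bounded_support(1)[OF fm dom_facts(2), of _ "real k"]) (use fb in \<open>auto simp: f_def\<close>)
 show ?thesis
 proof (rule solvable_limit[OF solvable_bounded[OF fm fb] fl2 bounded_lp[OF fm fb] h])
  show "(%k. Ip (%x. f k x - h x)) ----> 0"
  proof (rule Ip_dominated[OF _ h])
   show "(%x. f k x - h x) : bml" for k using fm hm by measurable
   show "\<bar>f k x - h x\<bar> <= \<bar>h x\<bar>" if "x : Om" for k x using that by (auto simp: f_def max_def min_def abs_if)
   show "AE x in lb. x : Om --> (%k. f k x - h x) ----> 0"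
   proof (rule AE_I2, rule impI)
    fix x assume x: "x : Om"
    obtain k0 where k0: "\<bar>h x\<bar> <= real k0" using real_arch_simple by blast
    have "f k x - h x = 0" if "k >= k0" for k
    proof -
     have "real k0 <= real k" using that by simp
     then show ?thesis using k0 x by (auto simp: f_def max_def min_def abs_le_iff)
    qed
    then have "eventually (%k. f k x - h x = 0) sequentially" by (auto simp: eventually_sequentially)
    then show "(%k. f k x - h x) ----> 0" by (rule tendsto_eventually)
   qed
  qed
 qed
qed

end

section \<open>Monotone semilinear equations\<close>

lemma wsol_indicator: "wsol U G (%x. indicator U x * r x) \<longleftrightarrow> wsol U G r"
proof -
 have "(LB x. indicator U x * r x * z x) = (LB x. r x * z x)" if "C1c U z Z" for z Z
  using C1cD(5)[OF that] by (intro int_cong refl) (auto simp: indicator_def)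
 then show ?thesis unfolding wsol_def by simp
qed

text \<open>The equation is tested with its own solution: the sign of r d leaves no energy, and the
  Poincare inequality concludes.\<close>

lemma wsol_energy:
 assumes U: "U \<subseteq> cball 0 R" "R >= 0" and d: "h10 U d G" "wsol U G r" "l2 lb r" and s: "AE x in lb. r x * d x <= 0"
 shows "AE x in lb. d x = 0"
proof -
 have "(l2n lb G)\<^sup>2 = (LB x. r x * d x)"
  using wsol_h10[OF d(2) h10_l2(2)[OF d(1)] d(3,1)] by (simp add: l2n_sq power2_norm_eq_inner)
 also have "... <= (LB x. 0 * d x)"
  using l2_real_mult[OF d(3) h10_l2(1)[OF d(1)]] s by (intro integral_mono_AE) auto
 finally have "l2n lb G = 0" by simp
 then have "l2n lb d <= 0" using h10_poincare[OF d(1) U] by simp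
 then show ?thesis by (intro l2n_eq_0 h10_l2(1)[OF d(1)]) (simp add: antisym)
qed

text \<open>Here the dimension makes the exponent 2 admissible, 2 > n/2, so that square integrable
  right-hand sides have solutions continuous up to the boundary.\<close>

lemma l2_lp:
 fixes Om :: "'n::finite pt set"
 assumes n: "CARD('n) = 2 \<or> CARD('n) = 3" and dom: "lipschitz_domain Om" and r: "l2 lb r"
 shows "lp Om 2 r"
proof -
 have p: "(2::real) > 1" "2 > real CARD('n) / 2" using n by auto
 show ?thesis
  using integrable_mult_indicator[of Om lb "%x. (r x)\<^sup>2"] r dom_facts(1)[OF n dom p]
  by (auto simp: lp_def[OF n dom p] l2_def)
qed

text \<open>The solution is the fixed point of \<open>y \<mapsto> (- \<Delta> + L)\<^sup>-\<^sup>1 (u + L y - B y)\<close>, a contraction of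
 \<open>L\<^sup>2\<close> because \<open>L y - B y\<close> is \<open>L\<close>-Lipschitz and \<open>- \<Delta>\<close> is coercive.\<close>
lemma monotone_solver:
 fixes U :: "'a::euclidean_space set" and B :: "'a => real => real"
 assumes U: "U \<subseteq> cball 0 R" "R >= 0" and u: "l2 lb u"
  and Bm: "!!y. y : bml ==> (%x. B x (y x)) : bml"
  and B0: "l2 lb (%x. B x 0)" and L: "L >= 0"
  and BL: "AE x in lb. \<forall>s t. s <= t --> 0 <= B x t - B x s \<and> B x t - B x s <= L * (t - s)"
 obtains y G where "h10 U y G" "wsol U G (%x. u x - B x (y x))" "l2 lb (%x. u x - B x (y x))"
proof -
 define h where "h y x = u x + L * y x - B x (y x)" for y x
 have BL2: "AE x in lb. \<forall>s t. \<bar>B x s - B x t\<bar> <= L * \<bar>s - t\<bar> \<and> \<bar>(L * s - B x s) - (L * t - B x t)\<bar> <= L * \<bar>s - t\<bar>"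
  using BL
 proof eventually_elim
  case (elim x)
  have "\<bar>B x s - B x t\<bar> <= L * \<bar>s - t\<bar> \<and> \<bar>(L * s - B x s) - (L * t - B x t)\<bar> <= L * \<bar>s - t\<bar>" for s t
  proof (cases "s <= t")
   case True
   then have "0 <= B x t - B x s \<and> B x t - B x s <= L * (t - s)" using elim by blast
   then show ?thesis using True by (simp add: right_diff_distrib abs_le_iff)
  next
   case False
   then have "0 <= B x s - B x t \<and> B x s - B x t <= L * (s - t)" using elim by simp
   then show ?thesis using False by (simp add: right_diff_distrib abs_le_iff)
  qed
  then show ?case by blast
 qed
 have Bl: "l2 lb (%x. B x (y x))" if y: "l2 lb y" for y
 proof -
  have m: "(%x. B x (y x) - B x 0) : bml" using Bm[of y] y B0 by (auto simp: l2_def)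
  have b: "AE x in lb. norm (B x (y x) - B x 0) <= norm (L *\<^sub>R y x)"
   using BL2 by eventually_elim (metis L abs_mult abs_of_nonneg diff_zero real_norm_def real_scaleR_def)
  have "l2 lb (%x. B x (y x) - B x 0)"
   by (rule l2_bound(1)[OF l2_scaleR[OF y, of L] m b])
  from l2_add[OF this B0] show ?thesis by simp
 qed
 have hl: "l2 lb (h y)" if y: "l2 lb y" for y
  unfolding h_def using l2_diff[OF l2_add[OF u l2_scaleR[OF y, of L]] Bl[OF y]] by simp
 have hd: "l2n lb (%x. h y x - h z x) <= L * l2n lb (%x. y x - z x)" if y: "l2 lb y" "l2 lb z" for y z
 proof -
  have "l2n lb (%x. h y x - h z x) <= l2n lb (%x. L *\<^sub>R (y x - z x))"
  proof (rule l2_bound(2)[OF l2_scaleR[OF l2_diff[OF y]] l2_measurable[OF l2_diff[OF hl hl]]])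
   show "AE x in lb. norm (h y x - h z x) <= norm (L *\<^sub>R (y x - z x))"
    using BL2
   proof eventually_elim
    case (elim x)
    have "h y x - h z x = (L * y x - B x (y x)) - (L * z x - B x (z x))" by (simp add: h_def)
    then show ?case using elim L by (simp add: abs_mult)
   qed
  qed (use y in auto)
  then show ?thesis using L by (simp only: l2n_scaleR abs_of_nonneg)
 qed
 have "\<exists>y' G. l2 lb y --> h10 U y' G \<and> wsol U G (%x. h y x - L * y' x)" for y
  using linear_solver[OF U L hl, of y] by metis
 then obtain T DT where T: "!!y. l2 lb y ==> h10 U (T y) (DT y)" "!!y. l2 lb y ==> wsol U (DT y) (%x. h y x - L * T y x)" by metis
 have Tl: "l2 lb (T y)" if "l2 lb y" for y using h10_l2(1)[OF T(1)[OF that]] .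
 \<comment> \<open>The coercivity constant from the Poincare inequality, with R + 1 in place of R to
   keep the denominator positive when R = 0. The energy identity for a difference then gives the
   contraction factor L / (c + L).\<close>
 define c where "c = 1 / (2 * (R + 1))\<^sup>2"
 have c: "c > 0" using U(2) by (simp add: c_def)
 define q where "q = L / (c + L)"
 have q: "0 <= q" "q < 1" using L c by (auto simp: q_def)
 have contr: "l2n lb (%x. T y x - T z x) <= q * l2n lb (%x. y x - z x)" if y: "l2 lb y" and z: "l2 lb z" for y z
 proof -
  let ?d = "%x. T y x - T z x" and ?G = "%x. DT y x - DT z x" and ?r = "%x. h y x - h z x"
  note rl = l2_diff[OF hl[OF y] hl[OF z]] and dl = l2_diff[OF Tl[OF y] Tl[OF z]]
  have dh: "h10 U ?d ?G" by (intro h10_diff T y z)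
  have sl: "l2 lb (%x. h y x - L * T y x)" if "l2 lb y" for y
   using l2_diff[OF hl[OF that] l2_scaleR[OF Tl[OF that], of L]] by simp
  have "wsol U ?G (%x. (h y x - L * T y x) - (h z x - L * T z x))"
   by (intro wsol_diff T y z sl h10_l2(2)[OF T(1)])
  then have "(LB x. ?G x \<bullet> ?G x) = (LB x. ((h y x - L * T y x) - (h z x - L * T z x)) * ?d x)"
   by (rule wsol_h10[OF _ h10_l2(2)[OF dh] l2_diff[OF sl[OF y] sl[OF z]] dh])
  also have "... = (LB x. ?r x * ?d x - L * (?d x * ?d x))"
   by (intro int_cong refl) (simp add: algebra_simps)
  also have "... = (LB x. ?r x \<bullet> ?d x) - L * (LB x. (norm (?d x))\<^sup>2)"
   using l2_real_mult[OF rl dl] l2_real_mult[OF dl dl] by (simp add: power2_eq_square)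
  also have "... <= L * l2n lb (%x. y x - z x) * l2n lb ?d - L * (l2n lb ?d)\<^sup>2"
   using l2_Cauchy_Schwarz[OF rl dl] mult_right_mono[OF hd[OF y z] l2n_nonneg[of lb ?d]] unfolding l2n_sq by linarith
  finally have 1: "(l2n lb ?G)\<^sup>2 <= L * l2n lb (%x. y x - z x) * l2n lb ?d - L * (l2n lb ?d)\<^sup>2"
   by (simp add: l2n_sq power2_norm_eq_inner)
  have "l2n lb ?d <= 2 * (R + 1) * l2n lb ?G"
   by (rule h10_poincare[OF dh]) (use U in auto)
  then have "(l2n lb ?d)\<^sup>2 <= (2 * (R + 1) * l2n lb ?G)\<^sup>2" by (intro power_mono) auto
  then have "c * (l2n lb ?d)\<^sup>2 <= (l2n lb ?G)\<^sup>2"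
   using U(2) by (simp add: c_def power_mult_distrib pos_divide_le_eq mult.commute)
  with 1 have 2: "(c + L) * (l2n lb ?d)\<^sup>2 <= L * l2n lb (%x. y x - z x) * l2n lb ?d" by (simp add: algebra_simps)
  show ?thesis
  proof (cases "l2n lb ?d = 0")
   case False
   then have p: "l2n lb ?d > 0" using l2n_nonneg[of lb ?d] by linarith
   from 2 have "((c + L) * l2n lb ?d) * l2n lb ?d <= (L * l2n lb (%x. y x - z x)) * l2n lb ?d"
    by (simp add: power2_eq_square mult.assoc)
   then have "(c + L) * l2n lb ?d <= L * l2n lb (%x. y x - z x)" using p by (simp only: mult_le_cancel_right_pos)
   then show ?thesis using c L by (simp add: q_def pos_le_divide_eq mult.commute)
  qed (use q in simp)
 qed
 define ys where "ys k = (T ^^ k) (%x. 0)" for k :: nat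
 have ysS: "ys (Suc k) = T (ys k)" "ys 0 = (%x. 0)" for k by (auto simp: ys_def)
 have yl: "l2 lb (ys k)" for k by (induction k) (auto simp: ysS Tl)
 define C where "C = l2n lb (%x. ys 1 x - ys 0 x) / (1 - q)"
 have C: "C >= 0" "q * C + l2n lb (%x. ys 1 x - ys 0 x) = C" using q by (auto simp: C_def field_simps)
 have i0: "l2n lb (%x. ys i x - ys 0 x) <= C" for i
 proof (induction i)
  case 0 then show ?case using C(1) by (simp add: l2n_def)
 next
  case (Suc i)
  have "l2n lb (%x. ys (Suc i) x - ys 0 x) <= l2n lb (%x. ys (Suc i) x - ys 1 x) + l2n lb (%x. ys 1 x - ys 0 x)"
   by (rule l2n_triangle3[OF yl yl yl])
  also have "l2n lb (%x. ys (Suc i) x - ys 1 x) <= q * l2n lb (%x. ys i x - ys 0 x)"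
   using contr[OF yl yl, of i 0] by (simp add: ysS)
  also have "... <= q * C" using q Suc by (intro mult_left_mono)
  finally show ?case using C(2) by linarith
 qed
 have ik: "l2n lb (%x. ys (k + i) x - ys k x) <= q ^ k * C" for k i
 proof (induction k)
  case (Suc k)
  have "l2n lb (%x. ys (Suc k + i) x - ys (Suc k) x) <= q * l2n lb (%x. ys (k + i) x - ys k x)"
   using contr[OF yl yl, of "k + i" k] by (simp add: ysS)
  also have "... <= q * (q ^ k * C)" using q Suc by (intro mult_left_mono)
  finally show ?case by (simp add: mult.assoc)
 qed (use i0[of i] in simp)
 have qk: "(%k. q ^ k * C) ----> 0" using tendsto_mult_left_zero[OF LIMSEQ_power_zero[of q], of C] q by simp
 have "\<exists>K. \<forall>i\<ge>K. \<forall>j\<ge>K. l2n lb (%x. ys i x - ys j x) < e" if e: "e > 0" for e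
 proof -
  obtain K where K: "!!k. k >= K ==> q ^ k * C < e" using order_tendstoD(2)[OF qk e] by (auto simp: eventually_sequentially)
  have "l2n lb (%x. ys i x - ys j x) < e" if "i >= K" "j >= K" for i j
  proof (cases "j <= i")
   case True
   then show ?thesis using ik[of j "i - j"] K[OF that(2)] by simp
  next
   case False
   then show ?thesis using ik[of i "j - i"] K[OF that(1)] by (simp add: l2n_minus_commute[of _ "ys i"])
  qed
  then show ?thesis by blast
 qed
 from l2_complete[OF yl this] obtain y where y: "l2lim lb ys y" by blast
 note l = l2limD(2)[OF y]
 have "l2n lb (%x. T y x - y x) <= 0"
 proof (rule LIMSEQ_le_const)
  have "(%k. q * l2n lb (%x. ys k x - y x) + l2n lb (%x. ys (Suc k) x - y x)) ----> q * 0 + 0"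
   by (intro tendsto_add tendsto_mult tendsto_const l2limD(3)[OF y] LIMSEQ_Suc[OF l2limD(3)[OF y]])
  then show "(%k. q * l2n lb (%x. ys k x - y x) + l2n lb (%x. ys (Suc k) x - y x)) ----> 0" by simp
  have "l2n lb (%x. T y x - y x) <= q * l2n lb (%x. ys k x - y x) + l2n lb (%x. ys (Suc k) x - y x)" for k
   using l2n_triangle3[OF Tl[OF l] yl[of "Suc k"] l] contr[OF l yl, of k] by (simp add: ysS l2n_minus_commute[of _ y])
  then show "\<exists>K. \<forall>k\<ge>K. l2n lb (%x. T y x - y x) <= q * l2n lb (%x. ys k x - y x) + l2n lb (%x. ys (Suc k) x - y x)" by blast
 qed
 then have ae: "AE x in lb. T y x - y x = 0"
  by (intro l2n_eq_0 l2_diff Tl l) (simp add: antisym)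
 show thesis
 proof (rule that[OF T(1)[OF l]])
  show l2: "l2 lb (%x. u x - B x (T y x))" by (intro l2_diff u Bl Tl l)
  have "l2 lb (%x. h y x - L * T y x)" using l2_diff[OF hl[OF l] l2_scaleR[OF Tl[OF l], of L]] by simp
  then show "wsol U (DT y) (%x. u x - B x (T y x))"
   by (intro wsol_cong_AE[OF T(2)[OF l] _ l2_measurable l2_measurable[OF l2]])
    (use ae in \<open>auto elim!: eventually_mono simp: h_def\<close>)
 qed
qed

text \<open>Once a solution is known, its right-hand side is a fixed square integrable function. The
  linear problem with this function has a continuous solution, which agrees with the given one
  almost everywhere by the energy identity.\<close>

theorem monotone_continuous:
 fixes Om :: "'n::finite pt set" and B :: "'n pt => real => real"
 assumes n: "CARD('n) = 2 \<or> CARD('n) = 3" and dom: "lipschitz_domain Om" and u: "l2 lb u"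
  and Bm: "!!y. y : bml ==> (%x. B x (y x)) : bml"
  and B0: "l2 lb (%x. B x 0)" and L: "L >= 0"
  and BL: "AE x in lb. \<forall>s t. s <= t --> 0 <= B x t - B x s \<and> B x t - B x s <= L * (t - s)"
 obtains Y G where "continuous_on UNIV Y" "!!x. x \<notin> Om ==> Y x = 0" "h10 Om Y G" "wsol Om G (%x. u x - B x (Y x))"
  "l2 lb (%x. u x - B x (Y x))"
proof -
 have p: "(2::real) > 1" "2 > real CARD('n) / 2" using n by auto
 obtain R where R: "R >= 0" "Om \<subseteq> cball 0 R" using dom_facts(3)[OF n dom p] by blast
 obtain y G where y: "h10 Om y G" "wsol Om G (%x. u x - B x (y x))" "l2 lb (%x. u x - B x (y x))"
  using monotone_solver[OF R(2,1) u Bm B0 L BL] by metis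
 have "solvable Om (%x. u x - B x (y x))"
  using solvable_lp[OF n dom p l2_lp[OF n dom y(3)]] .
 then obtain Y H where Y: "continuous_on UNIV Y" "\<forall>x. x \<notin> Om --> Y x = 0" "h10 Om Y H" "wsol Om H (%x. u x - B x (y x))"
  unfolding solvable_def by blast
 have d: "h10 Om (%x. y x - Y x) (%x. G x - H x)" "wsol Om (%x. G x - H x) (%x. (u x - B x (y x)) - (u x - B x (y x)))"
  by (intro h10_diff wsol_diff y Y h10_l2(2)[OF y(1)] h10_l2(2)[OF Y(3)])+
 have ae: "AE x in lb. y x - Y x = 0"
  by (rule wsol_energy[OF R(2,1) d]) auto
 have Yl: "l2 lb (%x. u x - B x (Y x))"
  by (rule l2_cong_AE[OF y(3)]) (use ae u Bm[OF l2_measurable[OF h10_l2(1)[OF Y(3)]]] in \<open>auto elim!: eventually_mono simp: l2_def\<close>)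
 have "wsol Om H (%x. u x - B x (Y x))"
  by (rule wsol_cong_AE[OF Y(4) _ l2_measurable[OF y(3)] l2_measurable[OF Yl]]) (use ae in \<open>auto elim!: eventually_mono\<close>)
 then show thesis using that Y Yl by blast
qed

section \<open>Weak solutions in terms of test functions\<close>

lemma integral_on: "open Om ==> (LINT x|lebesgue_on Om. g x) = (LB x. indicator Om x * g x)"
 for g :: "'n::finite pt => real"
 by (simp add: integral_restrict_space)

lemma integrable_on_iff: "open Om ==> integrable (lebesgue_on Om) g \<longleftrightarrow> integrable lb (%x. indicator Om x * g x)"
 for g :: "'n::finite pt => real"
 by (simp add: integrable_restrict_space)

lemma Lp_iff:
 fixes y :: "'n::finite pt => real"
 assumes "open Om"
 shows "Lp p Om y \<longleftrightarrow> (%x. indicator Om x * y x) : bml \<and> integrable lb (%x. indicator Om x * \<bar>y x\<bar> powr p)"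
 using assms by (simp add: Lp_def integrable_on_iff borel_measurable_restrict_space_iff mult.commute)

lemma Lp_2: "open Om ==> Lp 2 Om y \<longleftrightarrow> l2 lb (%x. indicator Om x * y x)" for y :: "'n::finite pt => real"
proof -
 have "indicator Om x * \<bar>y x\<bar> powr 2 = (norm (indicator Om x * y x))\<^sup>2" for x by (simp add: indicator_def)
 then show "open Om ==> ?thesis" by (simp add: Lp_iff l2_def)
qed

lemma l2_vec:
 fixes G :: "'a => 'n::finite pt"
 shows "l2 M G \<longleftrightarrow> (\<forall>i. l2 M (%x. G x $ i))"
  "l2 M G ==> (l2n M G)\<^sup>2 = (\<Sum>i\<in>UNIV. (l2n M (%x. G x $ i))\<^sup>2)"
proof -
 have sq: "(norm (G x))\<^sup>2 = (\<Sum>i\<in>UNIV. (norm (G x $ i))\<^sup>2)" for x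
  unfolding power2_norm_eq_inner inner_vec_def by (simp add: power2_eq_square)
 have c: "l2 M (%x. G x $ i)" if "l2 M G" for i
 proof (rule l2_bound(1)[OF that])
  show "(%x. G x $ i) : borel_measurable M"
   using borel_measurable_inner[OF l2_measurable[OF that] borel_measurable_const[of "axis i 1"]] by (simp add: inner_axis)
 qed (simp add: component_le_norm_cart)
 have "l2 M G" if a: "\<forall>i. l2 M (%x. G x $ i)"
  using a unfolding l2_def sq
  by (auto simp: borel_measurable_euclidean_space[of G] Basis_vec_def inner_axis intro!: Bochner_Integration.integrable_sum)
 with c show "l2 M G \<longleftrightarrow> (\<forall>i. l2 M (%x. G x $ i))" by blast
 show "(l2n M G)\<^sup>2 = (\<Sum>i\<in>UNIV. (l2n M (%x. G x $ i))\<^sup>2)" if "l2 M G"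
  unfolding l2n_sq sq using c[OF that] by (intro Bochner_Integration.integral_sum) (auto simp: l2_def)
qed

lemma H1_l2:
 fixes y :: "'n::finite pt => real"
 assumes "open Om" "H1 Om y G"
 shows "l2 lb (%x. indicator Om x * y x)" "l2 lb (%x. indicator Om x *\<^sub>R G x)"
 using assms unfolding H1_def by (auto simp: Lp_2 l2_vec(1)[of _ "%x. indicator Om x *\<^sub>R G x"])

lemma test_fun_partial:
 fixes U :: "'n::finite pt set"
 assumes "test_fun U \<psi>" shows "test_fun U (partial i \<psi>)"
proof -
 have it: "iter_dd vs (iter_dd ws g) = iter_dd (vs @ ws) g" for vs ws and g :: "'n pt => real" by (induction vs) auto
 have p: "partial i \<psi> = iter_dd [axis i 1] \<psi>" by (simp add: partial_def fun_eq_iff)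
 obtain K where K: "compact K" "K \<subseteq> U" "!!x. x \<notin> K ==> grad \<psi> x = 0" using C1cD(4)[OF test_fun_C1c[OF assms]] by blast
 have "{x. partial i \<psi> x \<noteq> 0} \<subseteq> K" using K(3) by (auto simp: grad_def vec_eq_iff)
 then have s: "closure {x. partial i \<psi> x \<noteq> 0} \<subseteq> K" using K(1) by (simp add: closure_minimal compact_imp_closed)
 then have "compact (closure {x. partial i \<psi> x \<noteq> 0})" using K(1) by (metis compact_Int_closed closed_closure inf.absorb_iff2 inf_commute)
 moreover have "smooth_fun (partial i \<psi>)" unfolding p smooth_fun_def it using assms by (simp add: test_fun_def smooth_fun_def)
 ultimately show ?thesis using s K(2) by (auto simp: test_fun_def)
qed

lemma grad_nth: "grad g x $ i = partial i g x" by (simp add: grad_def)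

lemma test_fun_l2:
 assumes "test_fun U q" shows "l2 lb q" "l2 lb (grad q)" "l2 lb (partial i q)"
 using C1c_l2[OF test_fun_C1c[OF assms]] l2_vec(1)[of lb "grad q"] by (auto simp: grad_nth)

lemma test_fun_zero:
 assumes "test_fun U q" "x \<notin> U" shows "q x = 0" "grad q x = 0" "partial i q x = 0"
 using C1cD(5,6)[OF test_fun_C1c[OF assms(1)] assms(2)] by (auto simp: grad_def vec_eq_iff)

lemma H1_dist:
 fixes y :: "'n::finite pt => real"
 assumes Om: "open Om" and y: "l2 lb (%x. indicator Om x * y x)" "l2 lb (%x. indicator Om x *\<^sub>R G x)" and q: "test_fun Om q"
 shows "(LINT x|lebesgue_on Om. (q x - y x)\<^sup>2) + (\<Sum>i\<in>UNIV. LINT x|lebesgue_on Om. (partial i q x - G x $ i)\<^sup>2)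
  = (l2n lb (%x. q x - indicator Om x * y x))\<^sup>2 + (l2n lb (%x. grad q x - indicator Om x *\<^sub>R G x))\<^sup>2"
proof -
 have "(l2n lb (%x. grad q x - indicator Om x *\<^sub>R G x))\<^sup>2 = (\<Sum>i\<in>UNIV. (l2n lb (%x. partial i q x - indicator Om x * G x $ i))\<^sup>2)"
  by (subst l2_vec(2)[OF l2_diff[OF test_fun_l2(2)[OF q] y(2)]]) (simp add: grad_nth)
 moreover have "(l2n lb (%x. partial i q x - indicator Om x * G x $ i))\<^sup>2 = (LINT x|lebesgue_on Om. (partial i q x - G x $ i)\<^sup>2)" for i
  unfolding l2n_sq integral_on[OF Om]
  by (intro int_cong refl) (auto simp: indicator_def test_fun_zero(3)[OF q])
 moreover have "(l2n lb (%x. q x - indicator Om x * y x))\<^sup>2 = (LINT x|lebesgue_on Om. (q x - y x)\<^sup>2)"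
  unfolding l2n_sq integral_on[OF Om]
  by (intro int_cong refl) (auto simp: indicator_def test_fun_zero(1)[OF q])
 ultimately show ?thesis by simp
qed

lemma H10_h10:
 fixes y :: "'n::finite pt => real"
 assumes Om: "open Om" and y: "H10 Om y"
 obtains G where "H1 Om y G" "h10 Om (%x. indicator Om x * y x) (%x. indicator Om x *\<^sub>R G x)"
proof -
 obtain G q where G: "H1 Om y G" and q: "!!k. test_fun Om (q k)"
  and l: "(%k. (LINT x|lebesgue_on Om. (q k x - y x)\<^sup>2) + (\<Sum>i\<in>UNIV. LINT x|lebesgue_on Om. (partial i (q k) x - G x $ i)\<^sup>2)) ----> 0"
  using y unfolding H10_def by blast
 note H = H1_l2[OF Om G]
 let ?a = "%k. l2n lb (%x. q k x - indicator Om x * y x)" and ?b = "%k. l2n lb (%x. grad (q k) x - indicator Om x *\<^sub>R G x)"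
 have l: "(%k. sqrt ((?a k)\<^sup>2 + (?b k)\<^sup>2)) ----> 0"
  using tendsto_real_sqrt[OF l] by (simp add: H1_dist[OF Om H q])
 have "l2lim lb q (%x. indicator Om x * y x)" "l2lim lb (%k. grad (q k)) (%x. indicator Om x *\<^sub>R G x)"
  by (rule l2limI_le[OF test_fun_l2(1)[OF q] H(1) _ l], simp) (rule l2limI_le[OF test_fun_l2(2)[OF q] H(2) _ l], simp)
 then have "h10 Om (%x. indicator Om x * y x) (%x. indicator Om x *\<^sub>R G x)"
  unfolding h10_def using test_fun_C1c[OF q] by (intro exI[of _ q] exI[of _ "%k. grad (q k)"]) simp
 then show thesis using that[OF G] by blast
qed

text \<open>Membership in \<open>H10\<close> and the weak equation each come with a weak gradient of
  their own. Tested with the gradient of \<psi>, both give the integral of - y times the Laplacian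
  of \<psi>.\<close>

lemma H1_grad_unique:
 fixes y :: "'n::finite pt => real"
 assumes Om: "open Om" and G: "H1 Om y G" "H1 Om y H" and \<psi>: "test_fun Om \<psi>"
 shows "(LINT x|lebesgue_on Om. G x \<bullet> grad \<psi> x) = (LINT x|lebesgue_on Om. H x \<bullet> grad \<psi> x)"
proof -
 have e: "(LINT x|lebesgue_on Om. G x \<bullet> grad \<psi> x) = (\<Sum>i\<in>UNIV. - (LINT x|lebesgue_on Om. y x * partial i (partial i \<psi>) x))" if G: "H1 Om y G" for G
 proof -
  have i: "integrable (lebesgue_on Om) (%x. G x $ i * partial i \<psi> x)" for i
   using l2_real_mult[OF H1_l2(2)[OF Om G, THEN l2_vec(1)[THEN iffD1], rule_format, of i] test_fun_l2(3)[OF \<psi>, of i]]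
   by (simp add: integrable_on_iff[OF Om] mult.assoc)
  have e: "(LINT x|lebesgue_on Om. G x \<bullet> grad \<psi> x) = (\<Sum>i\<in>UNIV. LINT x|lebesgue_on Om. G x $ i * partial i \<psi> x)"
   unfolding inner_vec_def grad_nth using i by (simp add: Bochner_Integration.integral_sum)
  then show ?thesis using G test_fun_partial[OF \<psi>] by (simp add: H1_def weak_grad_def)
 qed
 show ?thesis by (simp only: e[OF G(1)] e[OF G(2)])
qed

text \<open>The converse of \<open>H10_h10\<close>. Integration by parts holds for the C^1
  approximations and passes to the limit; replacing each of them by a nearby smooth test function
  gives the sequence required by \<open>H10\<close>.\<close>

lemma h10_H1:
 fixes y :: "'n::finite pt => real"
 assumes Om: "open Om" and y: "h10 Om y G" and y0: "!!x. x \<notin> Om ==> y x = 0"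
 shows "H1 Om y G" "H10 Om y"
proof -
 obtain ps Ps where p: "!!k. C1c Om (ps k) (Ps k)" "l2lim lb ps y" "l2lim lb Ps G" using y unfolding h10_def by blast
 have iy: "indicator Om x * y x = y x" for x using y0 by (cases "x : Om") auto
 have im: "(indicator Om :: 'n pt => real) : bml" using open_lebesgue[OF Om] by simp
 have Gl: "l2 lb (%x. indicator Om x *\<^sub>R G x)"
  by (rule l2_mult_bounded(1)[OF h10_l2(2)[OF y] im, of 1]) (simp add: indicator_def)
 have wg: "weak_grad Om y G"
  unfolding weak_grad_def
 proof (intro allI impI)
  fix \<psi> i assume t: "test_fun Om \<psi>"
  have z: "(LB x. ps k x * partial i \<psi> x) = - (LB x. Ps k x \<bullet> (\<psi> x *\<^sub>R axis i 1))" for k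
  proof -
   have "0 = (LB x. (ps k x *\<^sub>R grad \<psi> x + \<psi> x *\<^sub>R Ps k x) \<bullet> axis i 1)"
    using C1c_integral_zero[OF C1c_mult[OF p(1)[of k] C1cD(1)[OF test_fun_C1c[OF t]] continuous_on_subset[OF C1cD(2)[OF test_fun_C1c[OF t]]] Om]] by simp
   also have "... = (LB x. ps k x * partial i \<psi> x + Ps k x \<bullet> (\<psi> x *\<^sub>R axis i 1))"
    by (intro int_cong refl) (simp add: inner_add_left inner_axis grad_nth)
   also have "... = (LB x. ps k x * partial i \<psi> x) + (LB x. Ps k x \<bullet> (\<psi> x *\<^sub>R axis i 1))"
    using l2_real_mult[OF C1c_l2(1)[OF p(1)] test_fun_l2(3)[OF t]] l2_real_mult[OF l2_vec(1)[THEN iffD1, rule_format, OF C1c_l2(2)[OF p(1)]] test_fun_l2(1)[OF t]]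
    by (intro Bochner_Integration.integral_add) (auto simp: inner_axis mult.commute)
   finally show ?thesis by simp
  qed
  have ax: "l2 lb (%x. \<psi> x *\<^sub>R (axis i 1 :: 'n pt))"
   by (rule l2_bound(1)[OF test_fun_l2(1)[OF t]]) (use test_fun_l2(1)[OF t] in \<open>auto simp: l2_def\<close>)
  have "(%k. LB x. ps k x * partial i \<psi> x) ----> (LB x. y x * partial i \<psi> x)"
   using l2lim_inner[OF p(2) l2lim_const[OF test_fun_l2(3)[OF t, of i]]] by simp
  moreover have "(%k. LB x. ps k x * partial i \<psi> x) ----> - (LB x. G x \<bullet> (\<psi> x *\<^sub>R axis i 1))"
   unfolding z by (rule tendsto_minus[OF l2lim_inner[OF p(3) l2lim_const[OF ax]]])
  ultimately have "(LB x. y x * partial i \<psi> x) = - (LB x. G x \<bullet> (\<psi> x *\<^sub>R axis i 1))" by (rule LIMSEQ_unique)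
  moreover have "(LB x. G x \<bullet> (\<psi> x *\<^sub>R axis i 1)) = (LINT x|lebesgue_on Om. G x $ i * \<psi> x)"
   unfolding integral_on[OF Om]
   by (intro int_cong refl) (auto simp: inner_axis indicator_def test_fun_zero(1)[OF t])
  moreover have "(LB x. y x * partial i \<psi> x) = (LINT x|lebesgue_on Om. y x * partial i \<psi> x)"
   unfolding integral_on[OF Om] by (simp add: mult.assoc[symmetric] iy)
  ultimately show "(LINT x|lebesgue_on Om. y x * partial i \<psi> x) = - (LINT x|lebesgue_on Om. G x $ i * \<psi> x)" by simp
 qed
 show H: "H1 Om y G"
  unfolding H1_def using wg h10_l2(1)[OF y] Gl[THEN l2_vec(1)[THEN iffD1]] by (simp add: Lp_2[OF Om] iy)
 have "\<exists>q. test_fun Om q \<and> l2n lb (%x. q x - ps k x) < inverse (real (Suc k)) \<and> l2n lb (%x. grad q x - Ps k x) < inverse (real (Suc k))" for k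
 proof -
  obtain K qs where q: "!!j. test_fun Om (qs j)" "l2lim lb qs (ps k)" "l2lim lb (%j. grad (qs j)) (Ps k)"
   using C1c_approx[OF Om p(1)] by metis
  have "eventually (%j. l2n lb (%x. qs j x - ps k x) < inverse (real (Suc k)) \<and> l2n lb (%x. grad (qs j) x - Ps k x) < inverse (real (Suc k))) sequentially"
   by (intro eventually_conj order_tendstoD(2)[OF l2limD(3)[OF q(2)]] order_tendstoD(2)[OF l2limD(3)[OF q(3)]]) simp_all
  then obtain j where "l2n lb (%x. qs j x - ps k x) < inverse (real (Suc k)) \<and> l2n lb (%x. grad (qs j) x - Ps k x) < inverse (real (Suc k))"
   unfolding eventually_sequentially by blast
  then show ?thesis using q(1)[of j] by blast
 qed
 from choice[OF allI[OF this]] obtain q where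
  "\<forall>k. test_fun Om (q k) \<and> l2n lb (%x. q k x - ps k x) < inverse (real (Suc k)) \<and> l2n lb (%x. grad (q k) x - Ps k x) < inverse (real (Suc k))" ..
 then have q: "test_fun Om (q k)" "l2n lb (%x. q k x - ps k x) < inverse (real (Suc k))"
  "l2n lb (%x. grad (q k) x - Ps k x) < inverse (real (Suc k))" for k by auto
 have 1: "(%k. inverse (real (Suc k)) + l2n lb (%x. ps k x - y x)) ----> 0"
  using tendsto_add[OF LIMSEQ_inverse_real_of_nat l2limD(3)[OF p(2)]] by simp
 have "(%k. l2n lb (%x. q k x - y x)) ----> 0"
 proof (rule Lim_null_comparison[OF always_eventually[OF allI] 1])
  show "norm (l2n lb (%x. q k x - y x)) <= inverse (real (Suc k)) + l2n lb (%x. ps k x - y x)" for k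
   using l2n_triangle3[OF test_fun_l2(1)[OF q(1)] C1c_l2(1)[OF p(1)] h10_l2(1)[OF y], of k k] q(2)[of k] by simp
 qed
 moreover have "(%k. l2n lb (%x. grad (q k) x - indicator Om x *\<^sub>R G x)) ----> 0"
 proof (rule Lim_null_comparison[OF always_eventually[OF allI]])
  show "norm (l2n lb (%x. grad (q k) x - indicator Om x *\<^sub>R G x)) <= inverse (real (Suc k)) + l2n lb (%x. Ps k x - G x)" for k
  proof -
   have "l2n lb (%x. Ps k x - indicator Om x *\<^sub>R G x) <= l2n lb (%x. Ps k x - G x)"
    by (rule l2_bound(2)[OF l2_diff[OF C1c_l2(2)[OF p(1)] h10_l2(2)[OF y]] l2_measurable[OF l2_diff[OF C1c_l2(2)[OF p(1)] Gl]]])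
     (use C1cD(6)[OF p(1)] in \<open>auto simp: indicator_def\<close>)
   then show ?thesis using l2n_triangle3[OF test_fun_l2(2)[OF q(1)] C1c_l2(2)[OF p(1)] Gl, of k k] q(3)[of k] by simp
  qed
  show "(%k. inverse (real (Suc k)) + l2n lb (%x. Ps k x - G x)) ----> 0"
   using tendsto_add[OF LIMSEQ_inverse_real_of_nat l2limD(3)[OF p(3)]] by simp
 qed
 ultimately have "(%k. (l2n lb (%x. q k x - y x))\<^sup>2 + (l2n lb (%x. grad (q k) x - indicator Om x *\<^sub>R G x))\<^sup>2) ----> 0\<^sup>2 + 0\<^sup>2"
  by (rule tendsto_add[OF tendsto_power tendsto_power])
 then have "(%k. (LINT x|lebesgue_on Om. (q k x - y x)\<^sup>2) + (\<Sum>i\<in>UNIV. LINT x|lebesgue_on Om. (partial i (q k) x - G x $ i)\<^sup>2)) ----> 0"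
  using H1_dist[OF Om _ Gl q(1), of y] h10_l2(1)[OF y] by (simp add: iy)
 then show "H10 Om y" unfolding H10_def using H q(1) by blast
qed

text \<open>As r is merely integrable, the passage from smooth to C^1 test functions uses their
  uniform convergence on the right and the \<open>L\<^sup>2\<close> convergence of their gradients
  on the left.\<close>

lemma wsol_test:
 fixes Om :: "'n::finite pt set"
 assumes Om: "open Om" and G: "l2 lb G" and r: "integrable lb (%x. indicator Om x * r x)"
  and t: "!!\<psi>. test_fun Om \<psi> ==> (LINT x|lebesgue_on Om. G x \<bullet> grad \<psi> x) = (LINT x|lebesgue_on Om. r x * \<psi> x)"
 shows "wsol Om G r"
 unfolding wsol_def
proof (intro allI impI)
 fix z Z assume z: "C1c Om z Z"
 obtain K ps where p: "!!k. test_fun Om (ps k)" "!!k x. \<bar>ps k x - z x\<bar> <= inverse (real (Suc k))"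
  "l2lim lb (%k. grad (ps k)) Z" using C1c_approx[OF Om z] by metis
 obtain B where B: "!!x. \<bar>z x\<bar> <= B" using C1c_bounded[OF z] by blast
 have e: "(LB x. G x \<bullet> grad (ps k) x) = (LB x. (indicator Om x * r x) * ps k x)" for k
 proof -
  have "(LB x. G x \<bullet> grad (ps k) x) = (LINT x|lebesgue_on Om. G x \<bullet> grad (ps k) x)"
   unfolding integral_on[OF Om] by (intro int_cong refl) (auto simp: indicator_def test_fun_zero(2)[OF p(1)])
  then show ?thesis using t[OF p(1), of k] unfolding integral_on[OF Om] by (simp add: mult.assoc)
 qed
 have "(%k. LB x. (indicator Om x * r x) * ps k x) ----> (LB x. (indicator Om x * r x) * z x)"
 proof (rule integral_dominated_convergence[where w="%x. (B + 1) * \<bar>indicator Om x * r x\<bar>"])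
  show "(%x. (indicator Om x * r x) * z x) : bml"
   by (rule borel_measurable_times[OF borel_measurable_integrable[OF r] C1c_measurable(1)[OF z]])
  show "(%x. (indicator Om x * r x) * ps k x) : bml" for k
   by (rule borel_measurable_times[OF borel_measurable_integrable[OF r] C1c_measurable(1)[OF test_fun_C1c[OF p(1)]]])
  show "integrable lb (%x. (B + 1) * \<bar>indicator Om x * r x\<bar>)" using r by (intro integrable_mult_right integrable_abs)
  show "AE x in lb. (%k. (indicator Om x * r x) * ps k x) ----> (indicator Om x * r x) * z x"
  proof (intro AE_I2 tendsto_mult tendsto_const)
   fix x
   have "(%k. ps k x - z x) ----> 0"
    by (rule Lim_null_comparison[OF always_eventually[OF allI] LIMSEQ_inverse_real_of_nat]) (use p(2) in simp)
   then show "(%k. ps k x) ----> z x" by (rule Lim_null[THEN iffD2])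
  qed
  show "AE x in lb. norm ((indicator Om x * r x) * ps k x) <= (B + 1) * \<bar>indicator Om x * r x\<bar>" for k
  proof (rule AE_I2)
   fix x
   have "inverse (real (Suc k)) <= 1" by (simp add: inverse_le_1_iff)
   then have "\<bar>ps k x\<bar> <= B + 1" using p(2)[of k x] B[of x] by linarith
   then show "norm ((indicator Om x * r x) * ps k x) <= (B + 1) * \<bar>indicator Om x * r x\<bar>"
    by (metis abs_ge_zero abs_mult mult.commute mult_left_mono real_norm_def)
  qed
 qed
 moreover have "(%k. LB x. (indicator Om x * r x) * ps k x) ----> (LB x. G x \<bullet> Z x)"
  using l2lim_inner[OF l2lim_const[OF G] p(3)] unfolding e .
 ultimately have "(LB x. G x \<bullet> Z x) = (LB x. (indicator Om x * r x) * z x)" by (rule LIMSEQ_unique[rotated])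
 also have "... = (LB x. r x * z x)"
  by (intro int_cong refl) (use C1cD(5)[OF z] in \<open>auto simp: indicator_def\<close>)
 finally show "(LB x. G x \<bullet> Z x) = (LB x. r x * z x)" .
qed

text \<open>The common shape of the state and the adjoint equation with all zero-order terms on the
  right, so that both uniqueness claims become instances of \<open>weak_sol_unique\<close>.\<close>

definition weak_sol :: "'n::finite pt set => ('n pt => real => real) => ('n pt => real) => bool" where
 "weak_sol Om F y \<longleftrightarrow> continuous_on (closure Om) y \<and> (\<forall>x. x \<notin> closure Om --> y x = 0) \<and> H10 Om y \<and>
   (\<exists>G. H1 Om y G \<and> (\<forall>\<psi>. test_fun Om \<psi> -->
    (LINT x|lebesgue_on Om. G x \<bullet> grad \<psi> x) = (LINT x|lebesgue_on Om. F x (y x) * \<psi> x)))"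

lemma weak_solI:
 assumes Om: "open Om" and y: "continuous_on UNIV y" "!!x. x \<notin> Om ==> y x = 0" "h10 Om y G" "wsol Om G (%x. F x (y x))"
 shows "weak_sol Om F y"
proof -
 have "(LINT x|lebesgue_on Om. G x \<bullet> grad \<psi> x) = (LINT x|lebesgue_on Om. F x (y x) * \<psi> x)" if t: "test_fun Om \<psi>" for \<psi>
 proof -
  have "(LINT x|lebesgue_on Om. G x \<bullet> grad \<psi> x) = (LB x. G x \<bullet> grad \<psi> x)"
   unfolding integral_on[OF Om] by (intro int_cong refl) (auto simp: indicator_def test_fun_zero(2)[OF t])
  also have "... = (LB x. F x (y x) * \<psi> x)" using y(4) test_fun_C1c[OF t] unfolding wsol_def by blast
  also have "... = (LINT x|lebesgue_on Om. F x (y x) * \<psi> x)"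
   unfolding integral_on[OF Om] by (intro int_cong refl) (auto simp: indicator_def test_fun_zero(1)[OF t])
  finally show ?thesis .
 qed
 then show ?thesis
  unfolding weak_sol_def using continuous_on_subset[OF y(1)] closure_subset[of Om] h10_H1[OF Om y(3,2)] y(2) by blast
qed

lemma weak_solD:
 assumes Om: "open Om" and y: "weak_sol Om F y" and r: "integrable lb (%x. indicator Om x * F x (y x))"
 obtains G where "h10 Om (%x. indicator Om x * y x) G" "wsol Om G (%x. F x (y x))"
proof -
 obtain G where G: "H1 Om y G" "!!\<psi>. test_fun Om \<psi> ==> (LINT x|lebesgue_on Om. G x \<bullet> grad \<psi> x) = (LINT x|lebesgue_on Om. F x (y x) * \<psi> x)"
  using y unfolding weak_sol_def by blast
 obtain H where H: "H1 Om y H" "h10 Om (%x. indicator Om x * y x) (%x. indicator Om x *\<^sub>R H x)"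
  using H10_h10[OF Om, of y] y unfolding weak_sol_def by blast
 have "wsol Om (%x. indicator Om x *\<^sub>R H x) (%x. F x (y x))"
 proof (rule wsol_test[OF Om h10_l2(2)[OF H(2)] r])
  fix \<psi> assume t: "test_fun Om \<psi>"
  have "(LINT x|lebesgue_on Om. (indicator Om x *\<^sub>R H x) \<bullet> grad \<psi> x) = (LINT x|lebesgue_on Om. H x \<bullet> grad \<psi> x)"
   unfolding integral_on[OF Om] by (intro int_cong refl) (auto simp: indicator_def)
  then show "(LINT x|lebesgue_on Om. (indicator Om x *\<^sub>R H x) \<bullet> grad \<psi> x) = (LINT x|lebesgue_on Om. F x (y x) * \<psi> x)"
   using H1_grad_unique[OF Om G(1) H(1) t] G(2)[OF t] by simp
 qed
 then show thesis using that H(2) by blast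
qed

text \<open>Each right-hand side alone is only integrable, so the subtraction is carried out against
  bounded test functions. The difference may be square integrable and can then be tested with the
  difference of the solutions.\<close>

lemma wsol_diff_integrable:
 assumes w: "wsol Om G r" "wsol Om H s" and l: "l2 lb G" "l2 lb H"
  and ri: "integrable lb (%x. indicator Om x * r x)" and si: "integrable lb (%x. indicator Om x * s x)"
 shows "wsol Om (%x. G x - H x) (%x. indicator Om x * (r x - s x))"
 unfolding wsol_def
proof (intro allI impI)
 fix p P assume p: "C1c Om p P"
 obtain B where B: "B >= 0" "!!x. \<bar>p x\<bar> <= B" using C1c_bounded[OF p] by blast
 have i: "integrable lb (%x. (indicator Om x * r x) * p x)" if "integrable lb (%x. indicator Om x * r x)" for r :: "_ => real"
 proof (rule int_bound[OF integrable_mult_right[OF integrable_abs[OF that], of B]])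
  show "(%x. (indicator Om x * r x) * p x) : bml"
   by (rule borel_measurable_times[OF borel_measurable_integrable[OF that] C1c_measurable(1)[OF p]])
  show "AE x in lb. norm ((indicator Om x * r x) * p x) <= norm (B * \<bar>indicator Om x * r x\<bar>)"
  proof (rule AE_I2)
   fix x
   have "\<bar>indicator Om x * r x\<bar> * \<bar>p x\<bar> <= \<bar>indicator Om x * r x\<bar> * B" by (rule mult_left_mono[OF B(2)]) simp
   then show "norm ((indicator Om x * r x) * p x) <= norm (B * \<bar>indicator Om x * r x\<bar>)"
    using B(1) by (simp add: abs_mult mult.commute)
  qed
 qed
 have e: "(LB x. r x * p x) = (LB x. (indicator Om x * r x) * p x)" for r
  by (intro int_cong refl) (use C1cD(5)[OF p] in \<open>auto simp: indicator_def\<close>)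
 have "(LB x. (G x - H x) \<bullet> P x) = (LB x. G x \<bullet> P x) - (LB x. H x \<bullet> P x)"
  using l2_inner_integrable[OF l(1) C1c_l2(2)[OF p]] l2_inner_integrable[OF l(2) C1c_l2(2)[OF p]]
  by (simp add: inner_diff_left)
 also have "... = (LB x. (indicator Om x * r x) * p x) - (LB x. (indicator Om x * s x) * p x)"
  using w(1)[unfolded wsol_def, rule_format, OF p] w(2)[unfolded wsol_def, rule_format, OF p]
  by (simp only: e[of r] e[of s])
 also have "... = (LB x. indicator Om x * (r x - s x) * p x)"
  using i[OF ri] i[OF si] by (simp add: algebra_simps)
 finally show "(LB x. (G x - H x) \<bullet> P x) = (LB x. indicator Om x * (r x - s x) * p x)" .
qed

text \<open>Testing the difference of the equations with \<open>y - z\<close> gives \<open>\<integral>|\<nabla>(y - z)|\<^sup>2 <= 0\<close>.\<close>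
lemma weak_sol_unique:
 fixes Om :: "'n::finite pt set"
 assumes Om: "open Om" "bounded Om" and y: "weak_sol Om F y" "weak_sol Om F z"
  and ry: "integrable lb (%x. indicator Om x * F x (y x))" and rz: "integrable lb (%x. indicator Om x * F x (z x))"
  and d: "l2 lb (%x. indicator Om x * (F x (y x) - F x (z x)))"
  and m: "AE x in lb. x : Om --> (F x (y x) - F x (z x)) * (y x - z x) <= 0"
 shows "y = z"
proof -
 obtain R where R: "R >= 0" "Om \<subseteq> cball 0 R" using bounded_subset_ballD[OF Om(2), of 0] ball_subset_cball[of 0] by (metis less_imp_le order_trans)
 obtain G H where G: "h10 Om (%x. indicator Om x * y x) G" "wsol Om G (%x. F x (y x))"
  and H: "h10 Om (%x. indicator Om x * z x) H" "wsol Om H (%x. F x (z x))"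
  using weak_solD[OF Om(1) y(1) ry] weak_solD[OF Om(1) y(2) rz] by metis
 have w: "wsol Om (%x. G x - H x) (%x. indicator Om x * (F x (y x) - F x (z x)))"
  by (rule wsol_diff_integrable[OF G(2) H(2) h10_l2(2)[OF G(1)] h10_l2(2)[OF H(1)] ry rz])
 have ae: "AE x in lb. indicator Om x * y x - indicator Om x * z x = 0"
  by (rule wsol_energy[OF R(2,1) h10_diff[OF G(1) H(1)] w d]) (use m in \<open>auto elim!: eventually_mono simp: indicator_def\<close>)
 have c: "continuous_on (closure Om) y" "continuous_on (closure Om) z" using y by (auto simp: weak_sol_def)
 note cO = c[THEN continuous_on_subset, OF closure_subset]
 have le: "y x <= z x" "z x <= y x" if "x : Om" for x
 proof -
  have "AE x in lb. x : Om --> y x <= z x" "AE x in lb. x : Om --> z x <= y x"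
   using ae by (auto elim!: eventually_mono)
  then show "y x <= z x" "z x <= y x" using AE_continuous_le[OF _ Om(1) cO that] AE_continuous_le[OF _ Om(1) cO(2,1) that] by auto
 qed
 \<comment> \<open>A definite description asks for equality at every point. Equality almost
   everywhere extends to Om and to its closure by continuity, and outside the closure both functions
   are 0 by convention.\<close>
 have "y x = z x" for x
 proof (cases "x : closure Om")
  case True
  then show ?thesis
   using continuous_constant_on_closure[of Om "%x. y x - z x" 0 x] continuous_on_diff[OF c] le by (auto simp: antisym)
 qed (use y in \<open>auto simp: weak_sol_def\<close>)
 then show ?thesis by blast
qed

section \<open>State and adjoint state\<close>

lemma continuous_zero_bounded:
 fixes Y :: "'a::euclidean_space => real"
 assumes "continuous_on (closure Om) Y" "bounded Om"
 obtains m where "m > 0" "!!x. x : Om ==> \<bar>Y x\<bar> <= m"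
proof -
 have "bounded (Y ` closure Om)"
  using assms by (intro compact_imp_bounded compact_continuous_image) (simp_all add: compact_closure)
 then obtain m where "m > 0" "\<forall>y\<in>Y ` closure Om. norm y <= m" using bounded_pos by blast
 then show thesis using that closure_subset by fastforce
qed

locale elliptic =
 fixes Om om :: "('n::finite) pt set" and f f1 f2 :: "'n pt => real => real"
 assumes dim: "CARD('n) = 2 \<or> CARD('n) = 3"
  and dom: "lipschitz_domain Om"
  and om: "open om" "om \<subseteq> Om"
  and f_borel: "case_prod f : borel_measurable borel"
  and f_C2: "!!x y. (f x has_real_derivative f1 x y) (at y)" "!!x y. (f1 x has_real_derivative f2 x y) (at y)"
  and f0: "\<exists>p. p > real CARD('n) / 2 \<and> Lp p Om (%x. f x 0)"
  and f_mono: "AE x in lebesgue_on Om. \<forall>y. f1 x y >= 0"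
  and f_bd: "!!M. M > 0 ==> \<exists>C. AE x in lebesgue_on Om. \<forall>y. \<bar>y\<bar> <= M --> \<bar>f1 x y\<bar> + \<bar>f2 x y\<bar> <= C"
begin

lemma Om: "open Om" "bounded Om" using dom by (auto simp: lipschitz_domain_def)

lemma Om_ball: obtains R where "R >= 0" "Om \<subseteq> cball 0 R"
 using bounded_subset_ballD[OF Om(2), of 0] ball_subset_cball[of 0] by (metis less_imp_le order_trans)

lemma ind_measurable: "(indicator Om :: 'n pt => real) : bml"
 by (rule borel_measurable_indicator[OF open_lebesgue[OF Om(1)]])

lemma AE_Om: "(AE x in lebesgue_on Om. P x) \<longleftrightarrow> (AE x in lb. x : Om --> P x)"
 using Om(1) by (simp add: AE_restrict_space_iff)

lemma l2_Om_bounded: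
 fixes h :: "'n pt => real"
 assumes "(%x. indicator Om x * h x) : bml" "AE x in lb. x : Om --> \<bar>h x\<bar> <= M" "M >= 0"
 shows "l2 lb (%x. indicator Om x * h x)" "integrable lb (%x. indicator Om x * h x)"
proof -
 have "AE x in lb. norm (indicator Om x * h x) <= M" using assms(2) by eventually_elim (use assms(3) in \<open>auto simp: indicator_def\<close>)
 then show "l2 lb (%x. indicator Om x * h x)" "integrable lb (%x. indicator Om x * h x)"
  by (auto intro!: l2_bounded_support[OF assms(1) Om(2)])
qed

text \<open>All pointwise consequences of the hypotheses on f at one x: monotonicity, and on
  [- M, M] the Lipschitz and the quadratic Taylor bound. One statement almost everywhere per bound M
  then serves for all values of the solutions.\<close>

definition f_ok :: "real => real => 'n pt => bool" where
 "f_ok M C x \<longleftrightarrow> (\<forall>s t. s <= t --> f x s <= f x t) \<and> (\<forall>s. 0 <= f1 x s) \<and>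
  (\<forall>s. \<bar>s\<bar> <= M --> f1 x s <= C) \<and>
  (\<forall>s t. \<bar>s\<bar> <= M --> \<bar>t\<bar> <= M --> \<bar>f x t - f x s\<bar> <= C * \<bar>t - s\<bar> \<and> \<bar>f x t - f x s - f1 x s * (t - s)\<bar> <= C * (t - s)\<^sup>2)"

lemma f_okD:
 assumes "f_ok M C x"
 shows "s <= t ==> f x s <= f x t" "0 <= f1 x s" "\<bar>s\<bar> <= M ==> f1 x s <= C"
  "\<bar>s\<bar> <= M ==> \<bar>t\<bar> <= M ==> \<bar>f x t - f x s\<bar> <= C * \<bar>t - s\<bar>"
  "\<bar>s\<bar> <= M ==> \<bar>t\<bar> <= M ==> \<bar>f x t - f x s - f1 x s * (t - s)\<bar> <= C * (t - s)\<^sup>2"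
 using assms by (auto simp: f_ok_def)

text \<open>The mean value theorem for f and then for f1. The intermediate points remain in
  [- M, M], and applying it twice gives the Taylor remainder with the constant C instead of C /
  2.\<close>

lemma f_bounds:
 assumes "M > 0"
 obtains C where "C >= 0" "AE x in lb. x : Om --> f_ok M C x"
proof -
 obtain C where C: "AE x in lebesgue_on Om. \<forall>y. \<bar>y\<bar> <= M --> \<bar>f1 x y\<bar> + \<bar>f2 x y\<bar> <= C" using f_bd[OF assms] by blast
 have mv: "\<exists>z. \<bar>z - s\<bar> <= \<bar>t - s\<bar> \<and> (\<bar>s\<bar> <= M \<and> \<bar>t\<bar> <= M --> \<bar>z\<bar> <= M) \<and> g t - g s = g' z * (t - s)"
  if g: "!!y. (g has_real_derivative g' y) (at y)" for g g' :: "real => real" and s t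
 proof (cases s t rule: linorder_cases)
  case less
  from MVT2[OF this g] obtain z where "s < z" "z < t" "g t - g s = (t - s) * g' z" by blast
  then show ?thesis by (intro exI[of _ z]) (auto simp: mult.commute)
 next
  case greater
  from MVT2[OF this g] obtain z where "t < z" "z < s" "g s - g t = (s - t) * g' z" by blast
  then show ?thesis by (intro exI[of _ z]) (auto simp: algebra_simps)
 qed auto
 have "AE x in lb. x : Om --> f_ok M (max 0 C) x"
 proof (rule eventually_mono[OF eventually_conj[OF f_mono[unfolded AE_Om] C[unfolded AE_Om]]], rule impI, goal_cases)
  case (1 x)
  then have p: "0 <= f1 x s" for s by blast
  have b: "\<bar>f1 x s\<bar> <= max 0 C \<and> \<bar>f2 x s\<bar> <= max 0 C" if "\<bar>s\<bar> <= M" for s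
  proof -
   have "\<bar>f1 x s\<bar> + \<bar>f2 x s\<bar> <= C" using 1 that by blast
   then have "\<bar>f1 x s\<bar> <= C" "\<bar>f2 x s\<bar> <= C" using abs_ge_zero[of "f1 x s"] abs_ge_zero[of "f2 x s"] by linarith+
   then show ?thesis by (auto simp: le_max_iff_disj)
  qed
  have "f x s <= f x t" if st: "s <= t" for s t
  proof -
   obtain z where "f x t - f x s = f1 x z * (t - s)" using mv[OF f_C2(1), of s t x] by blast
   then show ?thesis using p[of z] st by (metis diff_ge_0_iff_ge mult_nonneg_nonneg)
  qed
  moreover have "\<bar>f x t - f x s\<bar> <= max 0 C * \<bar>t - s\<bar> \<and> \<bar>f x t - f x s - f1 x s * (t - s)\<bar> <= max 0 C * (t - s)\<^sup>2"
   if st: "\<bar>s\<bar> <= M" "\<bar>t\<bar> <= M" for s t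
  proof -
   obtain z where z: "\<bar>z - s\<bar> <= \<bar>t - s\<bar>" "\<bar>z\<bar> <= M" "f x t - f x s = f1 x z * (t - s)" using mv[OF f_C2(1), of s t x] st by blast
   obtain w where w: "\<bar>w\<bar> <= M" "f1 x z - f1 x s = f2 x w * (z - s)" using mv[OF f_C2(2), of s z x] st(1) z(2) by blast
   have "\<bar>f1 x z - f1 x s\<bar> <= max 0 C * \<bar>t - s\<bar>"
    unfolding w(2) abs_mult using b[OF w(1)] z(1) by (intro mult_mono) auto
   then have "\<bar>f1 x z - f1 x s\<bar> * \<bar>t - s\<bar> <= max 0 C * \<bar>t - s\<bar> * \<bar>t - s\<bar>" by (intro mult_right_mono) auto
   moreover have "f x t - f x s - f1 x s * (t - s) = (f1 x z - f1 x s) * (t - s)" using z(3) by (simp add: algebra_simps)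
   moreover have "\<bar>f x t - f x s\<bar> <= max 0 C * \<bar>t - s\<bar>" unfolding z(3) abs_mult using b[OF z(2)] by (intro mult_right_mono) auto
   moreover have "\<bar>t - s\<bar> * \<bar>t - s\<bar> = (t - s)\<^sup>2" by (simp add: power2_eq_square flip: abs_mult)
   ultimately show ?thesis by (simp only: abs_mult mult.assoc simp_thms)
  qed
  ultimately show ?case unfolding f_ok_def using p b abs_le_D1 by blast
 qed
 then show thesis by (rule that[rotated]) simp
qed

lemma f_meas:
 assumes "g : bml" shows "(%x. f x (g x)) : bml"
proof -
 have "(%x. x) : borel_measurable (lb :: 'n pt measure)" by (rule continuous_borel_lebesgue) (rule continuous_on_id)
 from measurable_compose[OF borel_measurable_Pair[OF this assms] f_borel] show ?thesis by simp
qed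

text \<open>Measurability is inherited from f by difference quotients.\<close>

lemma f1_meas:
 assumes "g : bml" shows "(%x. f1 x (g x)) : bml"
proof (rule borel_measurable_LIMSEQ_real)
 show "(%x. (f x (g x + inverse (real (Suc k))) - f x (g x)) / inverse (real (Suc k))) : bml" for k
  by (intro borel_measurable_divide borel_measurable_diff f_meas borel_measurable_add assms borel_measurable_const)
 show "(%k. (f x (g x + inverse (real (Suc k))) - f x (g x)) / inverse (real (Suc k))) ----> f1 x (g x)" for x
 proof -
  have "((%h. (f x (g x + h) - f x (g x)) / h) \<longlongrightarrow> f1 x (g x)) (at 0)" using f_C2(1)[of x "g x"] by (simp add: DERIV_def)
  moreover have "filterlim (%k. inverse (real (Suc k))) (at 0) sequentially"
   using LIMSEQ_inverse_real_of_nat by (simp add: filterlim_at)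
  ultimately show ?thesis by (rule filterlim_compose)
 qed
qed

lemma f_integrable:
 fixes y :: "'n pt => real"
 assumes y: "(%x. indicator Om x * y x) : bml" "M > 0" "!!x. x : Om ==> \<bar>y x\<bar> <= M"
 shows "integrable lb (%x. indicator Om x * f x (y x))"
proof -
 obtain p where p: "p > real CARD('n) / 2" "Lp p Om (%x. f x 0)" using f0 by blast
 have p1: "p > 1" using p(1) dim by auto
 note lpd = lp_def[OF dim dom p1 p(1)]
 have m0: "(%x. f x 0) : bml" by (rule f_meas) simp
 have "lp Om p (%x. f x 0)" using p(2) m0 by (simp add: lpd Lp_iff[OF Om(1)])
 from lp_integrable(1)[OF dim dom p1 p(1) this zero_less_one]
 have i0: "integrable lb (%x. indicator Om x * f x 0)"
  by (rule int_bound) (use m0 ind_measurable in \<open>auto simp: abs_mult\<close>)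
 obtain C where C: "C >= 0" "AE x in lb. x : Om --> f_ok M C x"
  using f_bounds[OF y(2)] by blast
 have e: "indicator Om x * (f x (y x) - f x 0) = indicator Om x * (f x (indicator Om x * y x) - f x 0)" for x by (simp add: indicator_def)
 have m: "(%x. indicator Om x * (f x (y x) - f x 0)) : bml"
  unfolding e by (intro borel_measurable_times ind_measurable borel_measurable_diff f_meas y(1) m0)
 have "AE x in lb. x : Om --> \<bar>f x (y x) - f x 0\<bar> <= C * M"
 proof (rule eventually_mono[OF C(2)], rule impI, goal_cases)
  case (1 x)
  have "\<bar>0::real\<bar> <= M" using y(2) by simp
  then have "\<bar>f x (y x) - f x 0\<bar> <= C * \<bar>y x - 0\<bar>" using f_okD(4)[OF 1(1)[rule_format, OF 1(2)]] y(3)[OF 1(2)] by blast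
  also have "... <= C * M" using y(3)[OF 1(2)] C(1) by (intro mult_left_mono) auto
  finally show ?case .
 qed
 from l2_Om_bounded(2)[OF m this] have "integrable lb (%x. indicator Om x * (f x (y x) - f x 0))" using C(1) y(2) by simp
 from Bochner_Integration.integrable_add[OF this i0] show ?thesis by (simp add: algebra_simps)
qed

text \<open>The solution is sought as w + Y, where w absorbs f(., 0) and Y solves an equation with f
  truncated at the level M, hence globally Lipschitz and within reach of
  \<open>monotone_continuous\<close>. The truncation turns out to be inactive, because |Y| is at
  most W + m, where W is the solution for |u|.\<close>

theorem state_exists:
 assumes u: "Lp 2 om u"
 obtains y G where "continuous_on UNIV y" "!!x. x \<notin> Om ==> y x = 0" "h10 Om y G"
  "wsol Om G (%x. indicator om x * u x - f x (y x))"
proof -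
 obtain R where R: "R >= 0" "Om \<subseteq> cball 0 R" by (rule Om_ball)
 let ?u = "%x. indicator om x * u x"
 have ul: "l2 lb ?u" using u Lp_2[OF om(1)] by blast
 have two: "(2::real) > 1" "2 > real CARD('n) / 2" using dim by auto
 obtain p where p: "p > real CARD('n) / 2" "Lp p Om (%x. f x 0)" using f0 by blast
 have p1: "p > 1" using p(1) dim by auto
 have m0: "(%x. f x 0) : bml" by (rule f_meas) simp
 have lp0: "lp Om p (%x. - f x 0)" using p(2) m0 by (simp add: lp_def[OF dim dom p1 p(1)] Lp_iff[OF Om(1)])
 obtain w G0 where w: "continuous_on UNIV w" "!!x. x \<notin> Om ==> w x = 0" "h10 Om w G0" "wsol Om G0 (%x. - f x 0)"
  using solvable_lp[OF dim dom p1 p(1) lp0] unfolding solvable_def by blast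
 have al: "l2 lb (%x. \<bar>?u x\<bar>)" by (rule l2_bound(1)[OF ul]) (use ul in \<open>auto simp: l2_def\<close>)
 obtain W G1 where W: "continuous_on UNIV W" "!!x. x \<notin> Om ==> W x = 0" "h10 Om W G1" "wsol Om G1 (%x. \<bar>?u x\<bar>)"
  using solvable_lp[OF dim dom two l2_lp[OF dim dom al]] unfolding solvable_def by blast
 have W0: "AE x in lb. - 1 * W x <= 0"
  by (rule max_principle[OF Om(1) R(2,1) h10_scaleR[OF W(3)] l2_scaleR[OF al, of "-1"]])
   (use wsol_scaleR[OF W(4), of "-1"] in \<open>auto simp: wsol_def\<close>)
 obtain m where m: "m > 0" "!!x. x : Om ==> \<bar>w x\<bar> <= m"
  using continuous_zero_bounded[OF continuous_on_subset[OF w(1)] Om(2)] by blast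
 obtain m1 where m1: "m1 > 0" "!!x. x : Om ==> \<bar>W x\<bar> <= m1"
  using continuous_zero_bounded[OF continuous_on_subset[OF W(1)] Om(2)] by blast
 \<comment> \<open>|w + Y| \<le> m + (m + m1), since |w| \<le> m, |Y| \<le> W + m and W \<le> m1 on
   Om. M depends on w and W only, so it is available before Y.\<close>
 define M where "M = 2 * m + m1"
 have M: "M > 0" using m m1 by (simp add: M_def)
 define cl where "cl s = max (- M) (min M s)" for s :: real
 have cl: "\<bar>cl s\<bar> <= M" "s <= t ==> cl s <= cl t" "\<bar>cl t - cl s\<bar> <= \<bar>t - s\<bar>" "\<bar>s\<bar> <= M ==> cl s = s" "s >= 0 ==> cl s >= 0" "s <= 0 ==> cl s <= 0" for s t
  using M by (auto simp: cl_def max_def min_def abs_le_iff abs_if[of "_ - _"])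
 obtain C where C: "C >= 0" and fC: "AE x in lb. x : Om --> f_ok M C x"
  using f_bounds[OF M] by blast
 define B where "B x s = indicator Om x * (f x (cl (w x + s)) - f x 0)" for x s
 have Bm: "(%x. B x (y x)) : bml" if y: "y : bml" for y
  unfolding B_def cl_def
  by (intro borel_measurable_times ind_measurable borel_measurable_diff f_meas m0 borel_measurable_max borel_measurable_min
    borel_measurable_add continuous_borel_lebesgue[OF w(1)] y borel_measurable_const)
 have B0: "l2 lb (%x. B x 0)"
 proof -
  have "AE x in lb. x : Om --> \<bar>f x (cl (w x + 0)) - f x 0\<bar> <= C * M"
  proof (rule eventually_mono[OF fC], rule impI, goal_cases)
   case (1 x)
   have "\<bar>0::real\<bar> <= M" using M by simp
   then have "\<bar>f x (cl (w x + 0)) - f x 0\<bar> <= C * \<bar>cl (w x + 0) - 0\<bar>" using f_okD(4)[OF 1(1)[rule_format, OF 1(2)]] cl(1) by blast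
   also have "... <= C * M" using cl(1)[of "w x + 0"] C by (intro mult_left_mono) auto
   finally show ?case .
  qed
  then show ?thesis
   unfolding B_def using C M by (intro l2_Om_bounded(1)[OF Bm[unfolded B_def], of "%x. 0" "C * M"]) auto
 qed
 have BL: "AE x in lb. \<forall>s t. s <= t --> 0 <= B x t - B x s \<and> B x t - B x s <= C * (t - s)"
  using fC
 proof (eventually_elim, intro allI impI)
  fix x s t :: _
  assume e: "x : Om --> f_ok M C x"
   and st: "(s::real) <= t"
  show "0 <= B x t - B x s \<and> B x t - B x s <= C * (t - s)"
  proof (cases "x : Om")
   case True
   have c: "cl (w x + s) <= cl (w x + t)" using cl(2) st by simp
   have "\<bar>f x (cl (w x + t)) - f x (cl (w x + s))\<bar> <= C * \<bar>cl (w x + t) - cl (w x + s)\<bar>" using f_okD(4)[OF e[rule_format, OF True] cl(1) cl(1)] .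
   also have "... <= C * (t - s)" using cl(3)[of "w x + t" "w x + s"] st C by (intro mult_left_mono) auto
   finally show ?thesis using f_okD(1)[OF e[rule_format, OF True] c] True by (simp add: B_def)
  next
   case False
   then show ?thesis using C st by (simp add: B_def)
  qed
 qed
 obtain Y G where Y: "continuous_on UNIV Y" "!!x. x \<notin> Om ==> Y x = 0" "h10 Om Y G" "wsol Om G (%x. ?u x - B x (Y x))"
  and rl: "l2 lb (%x. ?u x - B x (Y x))"
  using monotone_continuous[where B=B, OF dim dom ul Bm B0 C BL] by blast
 note dd = h10_l2(2)[OF Y(3)] h10_l2(2)[OF W(3)]
 \<comment> \<open>Where Y exceeds W + m, one has W \<ge> 0 and hence w + Y \<ge> 0. Monotonicity
   then gives B \<ge> 0, so the right-hand side of the equation for Y - W is at most 0 and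
   \<open>max_level\<close> applies.\<close>
 have Y1: "AE x in lb. Y x - W x <= m"
 proof (rule max_level[OF Om(1) R(2,1) h10_diff[OF Y(3) W(3)] l2_diff[OF rl al]])
  show "(LB x. (G x - G1 x) \<bullet> Z x) <= (LB x. (?u x - B x (Y x) - \<bar>?u x\<bar>) * z x)" if "C1c Om z Z" for z Z
   using wsol_diff[OF Y(4) W(4) dd rl al] that unfolding wsol_def by simp
  show "AE x in lb. x : Om \<and> m < Y x - W x --> ?u x - B x (Y x) - \<bar>?u x\<bar> <= 0"
  proof (rule eventually_mono[OF eventually_conj[OF fC W0]], rule impI, goal_cases)
   case (1 x)
   then have "0 <= w x + Y x" using m(2)[of x] by auto
   from cl(5)[OF this] have "f x 0 <= f x (cl (w x + Y x))" using f_okD(1) 1 by blast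
   then show ?case using 1 by (simp add: B_def)
  qed
 qed (use m in simp)
 have Y2: "AE x in lb. - 1 * Y x - W x <= m"
 proof (rule max_level[OF Om(1) R(2,1) h10_diff[OF h10_scaleR[OF Y(3)] W(3)] l2_diff[OF l2_scaleR[OF rl, of "-1"] al]])
  show "(LB x. (- 1 *\<^sub>R G x - G1 x) \<bullet> Z x) <= (LB x. (- 1 *\<^sub>R (?u x - B x (Y x)) - \<bar>?u x\<bar>) * z x)" if "C1c Om z Z" for z Z
   using wsol_diff[OF wsol_scaleR[OF Y(4), of "-1"] W(4) l2_scaleR[OF dd(1)] dd(2) _ al] l2_scaleR[OF rl, of "-1"] that unfolding wsol_def by simp
  show "AE x in lb. x : Om \<and> m < - 1 * Y x - W x --> - 1 *\<^sub>R (?u x - B x (Y x)) - \<bar>?u x\<bar> <= 0"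
  proof (rule eventually_mono[OF eventually_conj[OF fC W0]], rule impI, goal_cases)
   case (1 x)
   then have "w x + Y x <= 0" using m(2)[of x] by auto
   from cl(6)[OF this] have "f x (cl (w x + Y x)) <= f x 0" using f_okD(1) 1 by blast
   then show ?case using 1 by (simp add: B_def)
  qed
 qed (use m in simp)
 have clY: "AE x in lb. x : Om --> cl (w x + Y x) = w x + Y x"
 proof (rule eventually_mono[OF eventually_conj[OF Y1 Y2]], rule impI, rule cl(4), goal_cases)
  case (1 x)
  then show ?case using m(2)[of x] m1(2)[of x] unfolding M_def by linarith
 qed
 show thesis
 proof (rule that)
  show "continuous_on UNIV (%x. w x + Y x)" by (intro continuous_intros w Y)
  show "w x + Y x = 0" if "x \<notin> Om" for x using w(2) Y(2) that by simp
  show "h10 Om (%x. w x + Y x) (%x. G0 x + G x)" by (intro h10_add w Y)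
  show "wsol Om (%x. G0 x + G x) (%x. ?u x - f x (w x + Y x))"
   unfolding wsol_def
  proof (intro allI impI)
   fix z Z assume z: "C1c Om z Z"
   obtain b where b: "!!x. \<bar>z x\<bar> <= b" using C1c_bounded[OF z] by blast
   note i1 = C1c_mult_lp(1)[OF dim dom p1 p(1) lp0 z b] and i2 = l2_real_mult[OF rl C1c_l2(1)[OF z]]
   have "(LB x. (G0 x + G x) \<bullet> Z x) = (LB x. G0 x \<bullet> Z x) + (LB x. G x \<bullet> Z x)"
    using l2_inner_integrable[OF h10_l2(2)[OF w(3)] C1c_l2(2)[OF z]] l2_inner_integrable[OF dd(1) C1c_l2(2)[OF z]] by (simp add: inner_add_left)
   also have "... = (LB x. - f x 0 * z x) + (LB x. (?u x - B x (Y x)) * z x)"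
    using w(4) Y(4) z unfolding wsol_def by simp
   also have "... = (LB x. - f x 0 * z x + (?u x - B x (Y x)) * z x)" by (rule Bochner_Integration.integral_add[OF i1 i2, symmetric])
   also have "... = (LB x. (?u x - f x (w x + Y x)) * z x)"
   proof (rule integral_cong_AE)
    show "(%x. - f x 0 * z x + (?u x - B x (Y x)) * z x) : bml"
     using Bochner_Integration.integrable_add[OF i1 i2] by (rule borel_measurable_integrable)
    show "(%x. (?u x - f x (w x + Y x)) * z x) : bml"
     by (intro borel_measurable_times borel_measurable_diff l2_measurable[OF ul] f_meas borel_measurable_add
       continuous_borel_lebesgue w(1) Y(1) C1c_measurable(1)[OF z])
    show "AE x in lb. - f x 0 * z x + (?u x - B x (Y x)) * z x = (?u x - f x (w x + Y x)) * z x"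
     using clY
    proof eventually_elim
     case (elim x)
     then show ?case using C1cD(5)[OF z, of x] by (cases "x : Om") (auto simp: B_def algebra_simps)
    qed
   qed
   finally show "(LB x. (G0 x + G x) \<bullet> Z x) = (LB x. (?u x - f x (w x + Y x)) * z x)" .
  qed
 qed
qed

text \<open>Replaces the definite description in \<open>state\<close> by the facts used from here
  on: continuity on the whole space, zero values outside Om and the weak equation in the form
  \<open>wsol\<close>.\<close>

theorem state_props:
 assumes u: "Lp 2 om u"
 obtains G where "continuous_on UNIV (state Om om f u)" "!!x. x \<notin> Om ==> state Om om f u x = 0" "h10 Om (state Om om f u) G"
  "wsol Om G (%x. indicator om x * u x - f x (state Om om f u x))"
proof -
 let ?F = "%x s. indicator om x * u x - f x s"
 have ul: "l2 lb (%x. indicator om x * u x)" using u Lp_2[OF om(1)] by blast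
 have iu: "integrable lb (%x. indicator Om x * (indicator om x * u x))"
  using l2_real_mult[OF _ ul, of "indicator Om"] l2_Om_bounded(1)[of "%x. 1" 1] ind_measurable by simp
 have yb: "\<exists>M>0. \<forall>x\<in>Om. \<bar>y x\<bar> <= M" and ym: "(%x. indicator Om x * y x) : bml" if "weak_sol Om F y \<or> state_sol Om om f u y" for y F
 proof -
  have c: "continuous_on (closure Om) y" using that by (auto simp: weak_sol_def state_sol_def)
  from continuous_zero_bounded[OF c Om(2)] obtain M where M: "M > 0" "!!x. x : Om ==> \<bar>y x\<bar> <= M" by blast
  then show "\<exists>M>0. \<forall>x\<in>Om. \<bar>y x\<bar> <= M" by blast
  show "(%x. indicator Om x * y x) : bml"
   using l2_measurable[OF indicator_continuous_l2[OF Om continuous_on_subset[OF c closure_subset], of M]] M(2) by simp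
 qed
 have fi: "integrable lb (%x. indicator Om x * f x (y x))" if "weak_sol Om F y \<or> state_sol Om om f u y" for y F
  using yb[OF that] f_integrable[OF ym[OF that]] by blast
 \<comment> \<open>The two formulations differ by splitting the integral of a sum. This is
   legitimate because every candidate is continuous on the compact closure, thus bounded, which
   makes f(x, y x) integrable; hence the disjunctive premises above.\<close>
 have eq: "state_sol Om om f u y \<longleftrightarrow> weak_sol Om ?F y" for y
 proof -
  have e: "(LINT x|lebesgue_on Om. G x \<bullet> grad \<psi> x + f x (y x) * \<psi> x) = (LINT x|lebesgue_on om. u x * \<psi> x) \<longleftrightarrow>
   (LINT x|lebesgue_on Om. G x \<bullet> grad \<psi> x) = (LINT x|lebesgue_on Om. ?F x (y x) * \<psi> x)"
   if h: "weak_sol Om ?F y \<or> state_sol Om om f u y" "H1 Om y G" "test_fun Om \<psi>" for G \<psi>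
  proof -
   obtain b where b: "!!x. \<bar>\<psi> x\<bar> <= b" using C1c_bounded[OF test_fun_C1c[OF h(3)]] by blast
   have bi: "integrable lb (%x. indicator Om x * (r x * \<psi> x))" if r: "integrable lb (%x. indicator Om x * r x)" for r :: "'n pt => real"
   proof -
    have "integrable lb (%x. \<psi> x *\<^sub>R (indicator Om x * r x))"
    proof (rule int_bound[OF integrable_mult_right[OF r, of b]])
     show "(%x. \<psi> x *\<^sub>R (indicator Om x * r x)) : bml"
      by (rule borel_measurable_scaleR[OF C1c_measurable(1)[OF test_fun_C1c[OF h(3)]] borel_measurable_integrable[OF r]])
     show "AE x in lb. norm (\<psi> x *\<^sub>R (indicator Om x * r x)) <= norm (b * (indicator Om x * r x))"
      unfolding norm_scaleR norm_mult by (intro AE_I2 mult_right_mono) (use b in \<open>auto intro: order_trans[OF _ abs_ge_self]\<close>)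
    qed
    then show ?thesis by (simp add: mult_ac)
   qed
   have i1: "integrable (lebesgue_on Om) (%x. G x \<bullet> grad \<psi> x)"
    using l2_inner_integrable[OF H1_l2(2)[OF Om(1) h(2)] test_fun_l2(2)[OF h(3)]] by (simp add: integrable_on_iff[OF Om(1)])
   have i2: "integrable (lebesgue_on Om) (%x. f x (y x) * \<psi> x)" using bi[OF fi[OF h(1)]] by (simp add: integrable_on_iff[OF Om(1)])
   have i3: "integrable (lebesgue_on Om) (%x. indicator om x * u x * \<psi> x)" using bi[OF iu] by (simp add: integrable_on_iff[OF Om(1)])
   have "(LINT x|lebesgue_on om. u x * \<psi> x) = (LINT x|lebesgue_on Om. indicator om x * u x * \<psi> x)"
    unfolding integral_on[OF om(1)] integral_on[OF Om(1)] using om(2)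
    by (intro int_cong refl) (auto simp: indicator_def)
   then show ?thesis using i1 i2 i3 by (auto simp: left_diff_distrib)
  qed
  show ?thesis
  proof
   assume a: "state_sol Om om f u y"
   then show "weak_sol Om ?F y" using e[OF disjI2[OF a]] unfolding weak_sol_def state_sol_def by blast
  next
   assume a: "weak_sol Om ?F y"
   then show "state_sol Om om f u y" using e[OF disjI1[OF a]] unfolding weak_sol_def state_sol_def by blast
  qed
 qed
 have uniq: "y = z" if yz: "weak_sol Om ?F y" "weak_sol Om ?F z" for y z
 proof -
  note fy = fi[OF disjI1[OF yz(1)]] and fz = fi[OF disjI1[OF yz(2)]]
  obtain M1 M2 where M12: "M1 > 0" "M2 > 0" "!!x. x : Om ==> \<bar>y x\<bar> <= M1 \<and> \<bar>z x\<bar> <= M2"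
   using yb[OF disjI1[OF yz(1)]] yb[OF disjI1[OF yz(2)]] by blast
  define M where "M = max M1 M2"
  have M: "M > 0" "!!x. x : Om ==> \<bar>y x\<bar> <= M \<and> \<bar>z x\<bar> <= M" using M12 by (auto simp: M_def le_max_iff_disj)
  obtain C where C: "C >= 0" "AE x in lb. x : Om --> f_ok M C x"
   using f_bounds[OF M(1)] by blast
  show ?thesis
  proof (rule weak_sol_unique[OF Om yz])
   show "integrable lb (%x. indicator Om x * ?F x (y x))" "integrable lb (%x. indicator Om x * ?F x (z x))"
    using int_diff[OF iu fy] int_diff[OF iu fz] by (simp_all add: right_diff_distrib)
   then have m: "(%x. indicator Om x * (?F x (y x) - ?F x (z x))) : bml"
    unfolding right_diff_distrib[of "indicator Om _" "?F _ _"] by (intro borel_measurable_diff borel_measurable_integrable)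
   have "AE x in lb. x : Om --> \<bar>?F x (y x) - ?F x (z x)\<bar> <= C * (2 * M)"
   proof (rule eventually_mono[OF C(2)], rule impI, goal_cases)
    case (1 x)
    have "\<bar>f x (z x) - f x (y x)\<bar> <= C * \<bar>z x - y x\<bar>" using f_okD(4)[OF 1(1)[rule_format, OF 1(2)]] M(2)[OF 1(2)] by blast
    also have "... <= C * (2 * M)" using M(2)[OF 1(2)] C(1) by (intro mult_left_mono) auto
    finally show ?case by simp
   qed
   then show "l2 lb (%x. indicator Om x * (?F x (y x) - ?F x (z x)))" using l2_Om_bounded(1)[OF m] C(1) M(1) by simp
   show "AE x in lb. x : Om --> (?F x (y x) - ?F x (z x)) * (y x - z x) <= 0"
   proof (rule eventually_mono[OF C(2)], rule impI, goal_cases)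
    case (1 x)
    then show ?case using f_okD(1)[of M C x "y x" "z x"] f_okD(1)[of M C x "z x" "y x"] by (cases "y x <= z x") (auto simp: mult_le_0_iff)
   qed
  qed
 qed
 obtain y G where y: "continuous_on UNIV y" "!!x. x \<notin> Om ==> y x = 0" "h10 Om y G" "wsol Om G (%x. ?F x (y x))"
  using state_exists[OF u] by blast
 have "weak_sol Om ?F y" by (rule weak_solI[where F="?F", OF Om(1) y])
 then have "state Om om f u = y" unfolding state_def eq by (intro the_equality uniq)
 then show thesis using that y by metis
qed

text \<open>The adjoint equation is the linear instance \<open>B x s = f1 x (y x) * s\<close> of the
  monotone equation: y is bounded on Om, so the coefficient is bounded, and it is nonnegative almost
  everywhere.\<close>

theorem adjoint_props:
 fixes y yd :: "'n pt => real"
 assumes y: "continuous_on UNIV y" and yd: "Lp 2 Om yd"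
 obtains G where "continuous_on UNIV (adjoint Om f1 y yd)" "!!x. x \<notin> Om ==> adjoint Om f1 y yd x = 0" "h10 Om (adjoint Om f1 y yd) G"
  "wsol Om G (%x. (y x - yd x) - f1 x (y x) * adjoint Om f1 y yd x)"
  "l2 lb (%x. indicator Om x * ((y x - yd x) - f1 x (y x) * adjoint Om f1 y yd x))"
proof -
 let ?F = "%x s. (y x - yd x) - f1 x (y x) * s"
 obtain M where M: "M > 0" "!!x. x : Om ==> \<bar>y x\<bar> <= M" using continuous_zero_bounded[OF continuous_on_subset[OF y] Om(2)] by blast
 obtain C where C: "C >= 0" and "AE x in lb. x : Om --> f_ok M C x"
  using f_bounds[OF M(1)] by blast
 then have fC: "AE x in lb. x : Om --> 0 <= f1 x (y x) \<and> \<bar>f1 x (y x)\<bar> <= C"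
  by eventually_elim (use M(2) f_okD(2,3) in fastforce)
 have am: "(%x. indicator Om x * f1 x (y x)) : bml" by (intro borel_measurable_times ind_measurable f1_meas continuous_borel_lebesgue y)
 have aC: "AE x in lb. \<bar>indicator Om x * f1 x (y x)\<bar> <= C" using fC by eventually_elim (use C in \<open>auto simp: indicator_def\<close>)
 have "l2 lb (%x. indicator Om x * y x)"
  using indicator_continuous_l2[OF Om continuous_on_subset[OF y], of M] M(2) by simp
 with yd have ul: "l2 lb (%x. indicator Om x * (y x - yd x))"
  using l2_diff[of lb "%x. indicator Om x * y x" "%x. indicator Om x * yd x"] by (simp add: Lp_2[OF Om(1)] right_diff_distrib)
 have one: "l2 lb (indicator Om :: 'n pt => real)" using l2_Om_bounded(1)[of "%x. 1" 1] ind_measurable by simp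
 have Fl: "l2 lb (%x. indicator Om x * ?F x (z x))" "integrable lb (%x. indicator Om x * ?F x (z x))"
  if z: "l2 lb (%x. indicator Om x * z x)" for z
 proof -
  have "l2 lb (%x. (indicator Om x * f1 x (y x)) *\<^sub>R (indicator Om x * z x))" by (rule l2_mult_bounded(1)[OF z am aC])
  from l2_diff[OF ul this] have l: "l2 lb (%x. indicator Om x * (y x - yd x) - (indicator Om x * f1 x (y x)) *\<^sub>R (indicator Om x * z x))" .
  have "(%x. indicator Om x * (y x - yd x) - (indicator Om x * f1 x (y x)) *\<^sub>R (indicator Om x * z x)) = (%x. indicator Om x * ?F x (z x))"
   by (auto simp: fun_eq_iff indicator_def)
  with l show l: "l2 lb (%x. indicator Om x * ?F x (z x))" by simp
  have "(%x. indicator Om x * (indicator Om x * ?F x (z x))) = (%x. indicator Om x * ?F x (z x))" by (auto simp: fun_eq_iff indicator_def)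
  then show "integrable lb (%x. indicator Om x * ?F x (z x))" using l2_real_mult[OF one l] by simp
 qed
 have wl: "l2 lb (%x. indicator Om x * z x)" if z: "continuous_on (closure Om) z" for z :: "'n pt => real"
 proof -
  obtain m where "m > 0" "!!x. x : Om ==> \<bar>z x\<bar> <= m" using continuous_zero_bounded[OF z Om(2)] by blast
  then show ?thesis using indicator_continuous_l2[OF Om continuous_on_subset[OF z closure_subset], of m] by simp
 qed
 have eq: "adjoint_sol Om f1 y yd z \<longleftrightarrow> weak_sol Om ?F z" for z
 proof (cases "continuous_on (closure Om) z")
  case True
  have e: "(LINT x|lebesgue_on Om. G x \<bullet> grad \<psi> x + f1 x (y x) * z x * \<psi> x) = (LINT x|lebesgue_on Om. (y x - yd x) * \<psi> x) \<longleftrightarrow>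
   (LINT x|lebesgue_on Om. G x \<bullet> grad \<psi> x) = (LINT x|lebesgue_on Om. ?F x (z x) * \<psi> x)"
   if h: "H1 Om z G" "test_fun Om \<psi>" for G \<psi>
  proof -
   have i1: "integrable (lebesgue_on Om) (%x. G x \<bullet> grad \<psi> x)"
    using l2_inner_integrable[OF H1_l2(2)[OF Om(1) h(1)] test_fun_l2(2)[OF h(2)]] by (simp add: integrable_on_iff[OF Om(1)])
   have i2: "integrable (lebesgue_on Om) (%x. ?F x (z x) * \<psi> x)"
    using l2_real_mult[OF Fl(1)[OF wl[OF True]] test_fun_l2(1)[OF h(2)]] by (simp add: integrable_on_iff[OF Om(1)] mult.assoc)
   have i3: "integrable (lebesgue_on Om) (%x. (y x - yd x) * \<psi> x)"
    using l2_real_mult[OF ul test_fun_l2(1)[OF h(2)]] by (simp add: integrable_on_iff[OF Om(1)] mult.assoc)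
   have "(LINT x|lebesgue_on Om. G x \<bullet> grad \<psi> x + f1 x (y x) * z x * \<psi> x) =
    (LINT x|lebesgue_on Om. G x \<bullet> grad \<psi> x - ?F x (z x) * \<psi> x + (y x - yd x) * \<psi> x)"
    by (intro int_cong refl) (simp add: algebra_simps)
   also have "... = (LINT x|lebesgue_on Om. G x \<bullet> grad \<psi> x) - (LINT x|lebesgue_on Om. ?F x (z x) * \<psi> x) + (LINT x|lebesgue_on Om. (y x - yd x) * \<psi> x)"
    by (simp only: Bochner_Integration.integral_add[OF int_diff[OF i1 i2] i3] Bochner_Integration.integral_diff[OF i1 i2])
   finally show ?thesis by linarith
  qed
  show ?thesis unfolding adjoint_sol_def weak_sol_def using e by blast
 qed (simp add: adjoint_sol_def weak_sol_def)
 have uniq: "z = w" if zw: "weak_sol Om ?F z" "weak_sol Om ?F w" for z w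
 proof (rule weak_sol_unique[OF Om zw])
  have l: "l2 lb (%x. indicator Om x * z x)" "l2 lb (%x. indicator Om x * w x)" using zw wl by (auto simp: weak_sol_def)
  show "integrable lb (%x. indicator Om x * ?F x (z x))" "integrable lb (%x. indicator Om x * ?F x (w x))" by (rule Fl(2)[OF l(1)] Fl(2)[OF l(2)])+
  show "l2 lb (%x. indicator Om x * (?F x (z x) - ?F x (w x)))"
   using l2_diff[OF Fl(1)[OF l(1)] Fl(1)[OF l(2)]] by (simp add: right_diff_distrib)
  show "AE x in lb. x : Om --> (?F x (z x) - ?F x (w x)) * (z x - w x) <= 0"
  proof (rule eventually_mono[OF fC], rule impI, goal_cases)
   case (1 x)
   have "(?F x (z x) - ?F x (w x)) * (z x - w x) = - (f1 x (y x) * (z x - w x)\<^sup>2)" by (simp add: power2_eq_square algebra_simps)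
   then show ?case using 1 by simp
  qed
 qed
 obtain z G where z: "continuous_on UNIV z" "!!x. x \<notin> Om ==> z x = 0" "h10 Om z G"
   "wsol Om G (%x. indicator Om x * (y x - yd x) - (indicator Om x * f1 x (y x)) * z x)"
 proof (rule monotone_continuous[where B="%x s. (indicator Om x * f1 x (y x)) * s", OF dim dom ul _ _ C])
  show "(%x. (indicator Om x * f1 x (y x)) * z x) : bml" if "z : bml" for z
   by (intro borel_measurable_times[OF am that])
  show "AE x in lb. \<forall>s t. s <= t --> 0 <= (indicator Om x * f1 x (y x)) * t - (indicator Om x * f1 x (y x)) * s \<and>
    (indicator Om x * f1 x (y x)) * t - (indicator Om x * f1 x (y x)) * s <= C * (t - s)"
   using fC
  proof (eventually_elim, intro allI impI)
   fix x and s t :: real assume e: "x : Om --> 0 <= f1 x (y x) \<and> \<bar>f1 x (y x)\<bar> <= C" and st: "s <= t"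
   have "0 <= indicator Om x * f1 x (y x)" "indicator Om x * f1 x (y x) <= C" using e C by (auto simp: indicator_def)
   then show "0 <= (indicator Om x * f1 x (y x)) * t - (indicator Om x * f1 x (y x)) * s \<and>
    (indicator Om x * f1 x (y x)) * t - (indicator Om x * f1 x (y x)) * s <= C * (t - s)"
    using st unfolding right_diff_distrib[symmetric] by (metis diff_ge_0_iff_ge mult_nonneg_nonneg mult_right_mono)
  qed
 qed (simp, blast)
 have "(%x. indicator Om x * (y x - yd x) - (indicator Om x * f1 x (y x)) * z x) = (%x. indicator Om x * ?F x (z x))" by (auto simp: algebra_simps)
 with z(4) have zw: "wsol Om G (%x. ?F x (z x))" by (simp only: wsol_indicator)
 have "weak_sol Om ?F z" by (rule weak_solI[where F="?F", OF Om(1) z(1-3) zw])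
 then have a: "adjoint Om f1 y yd = z" unfolding adjoint_def eq by (intro the_equality uniq)
 show thesis
  by (rule that[of G]; unfold a) (use z(1-3) zw Fl(1)[OF wl[OF continuous_on_subset[OF z(1)]]] in auto)
qed

end

section \<open>Derivative of the tracking term\<close>

context elliptic
begin

text \<open>With \<open>d = y\<^sub>t - y\<^sub>0\<close>, testing the adjoint equation with \<open>d\<close> and the equation of \<open>d\<close> with the adjoint
 state \<open>\<phi>\<close> expresses \<open>\<integral>(y\<^sub>0 - y\<^sub>d) d\<close> by \<open>t \<integral> \<phi> v\<close> up to the Taylor remainder of \<open>f\<close>, which is
 \<open>O(t\<^sup>2)\<close> because \<open>|d| <= t Z\<close> for the solution \<open>Z\<close> of \<open>- \<Delta> Z = |v|\<close>.\<close>
theorem tracking_derivative: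
 assumes u: "Lp 2 om u" and v: "Lp 2 om v" and yd: "Lp 2 Om yd"
 shows "\<exists>K. \<forall>t. 0 < t --> t <= 1 -->
  \<bar>1/2 * (LINT x|lebesgue_on Om. (state Om om f (%x. u x + t * v x) x - yd x)\<^sup>2)
   - 1/2 * (LINT x|lebesgue_on Om. (state Om om f u x - yd x)\<^sup>2)
   - t * (LINT x|lebesgue_on om. adjoint Om f1 (state Om om f u) yd x * v x)\<bar> <= K * t\<^sup>2"
proof -
 obtain R where R: "R >= 0" "Om \<subseteq> cball 0 R" by (rule Om_ball)
 let ?v = "%x. indicator om x * v x"
 define y0 where "y0 = state Om om f u"
 define \<phi> where "\<phi> = adjoint Om f1 y0 yd"
 have vl: "l2 lb ?v" and ul: "l2 lb (%x. indicator om x * u x)" using u v Lp_2[OF om(1)] by blast+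
 have iom: "indicator Om x * (indicator om x * r) = indicator om x * (r::real)" for x r using om(2) by (auto simp: indicator_def)
 have one: "l2 lb (indicator Om :: 'n pt => real)" using l2_Om_bounded(1)[of "%x. 1" 1] ind_measurable by simp
 have bl: "l2 lb (%x. indicator Om x * z x)" if z: "continuous_on UNIV z" for z :: "'n pt => real"
 proof -
  obtain m where "m > 0" "!!x. x : Om ==> \<bar>z x\<bar> <= m" using continuous_zero_bounded[OF continuous_on_subset[OF z] Om(2)] by blast
  then show ?thesis using indicator_continuous_l2[OF Om continuous_on_subset[OF z], of m] by simp
 qed
 have sl: "l2 lb (%x. indicator Om x * (z x - yd x))" if z: "continuous_on UNIV z" for z :: "'n pt => real"
  using l2_diff[OF bl[OF z] yd[unfolded Lp_2[OF Om(1)]]] by (simp add: right_diff_distrib)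
 have iu: "integrable lb (%x. indicator Om x * (indicator om x * w x))" if "l2 lb (%x. indicator om x * w x)" for w :: "'n pt => real"
  using l2_real_mult[OF one that] .
 obtain G0 where y0: "continuous_on UNIV y0" "!!x. x \<notin> Om ==> y0 x = 0" "h10 Om y0 G0" "wsol Om G0 (%x. indicator om x * u x - f x (y0 x))"
  using state_props[OF u] unfolding y0_def[symmetric] by blast
 obtain H where \<phi>: "continuous_on UNIV \<phi>" "!!x. x \<notin> Om ==> \<phi> x = 0" "h10 Om \<phi> H" "wsol Om H (%x. (y0 x - yd x) - f1 x (y0 x) * \<phi> x)"
  and Pl: "l2 lb (%x. indicator Om x * ((y0 x - yd x) - f1 x (y0 x) * \<phi> x))"
  using adjoint_props[OF y0(1) yd] unfolding \<phi>_def[symmetric] by blast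
 have two: "(2::real) > 1" "2 > real CARD('n) / 2" using dim by auto
 have al: "l2 lb (%x. \<bar>?v x\<bar>)" by (rule l2_bound(1)[OF vl]) (use vl in \<open>auto simp: l2_def\<close>)
 obtain Z GZ where Z: "continuous_on UNIV Z" "!!x. x \<notin> Om ==> Z x = 0" "h10 Om Z GZ" "wsol Om GZ (%x. \<bar>?v x\<bar>)"
  using solvable_lp[OF dim dom two l2_lp[OF dim dom al]] unfolding solvable_def by blast
 have Z0: "AE x in lb. - 1 * Z x <= 0"
  by (rule max_principle[OF Om(1) R(2,1) h10_scaleR[OF Z(3)] l2_scaleR[OF al, of "-1"]])
   (use wsol_scaleR[OF Z(4), of "-1"] in \<open>auto simp: wsol_def\<close>)
 obtain m where m: "m > 0" "!!x. x : Om ==> \<bar>Z x\<bar> <= m" using continuous_zero_bounded[OF continuous_on_subset[OF Z(1)] Om(2)] by blast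
 obtain m0 where m0: "m0 > 0" "!!x. x : Om ==> \<bar>y0 x\<bar> <= m0" using continuous_zero_bounded[OF continuous_on_subset[OF y0(1)] Om(2)] by blast
 obtain b where b: "b > 0" "!!x. x : Om ==> \<bar>\<phi> x\<bar> <= b" using continuous_zero_bounded[OF continuous_on_subset[OF \<phi>(1)] Om(2)] by blast
 have M: "m0 + m > 0" using m m0 by simp
 obtain C where C: "C >= 0" and fC: "AE x in lb. x : Om --> f_ok (m0 + m) C x" using f_bounds[OF M] by blast
 have fi: "integrable lb (%x. indicator Om x * f x (z x))" if z: "continuous_on UNIV z" for z :: "'n pt => real"
 proof -
  obtain m where "m > 0" "!!x. x : Om ==> \<bar>z x\<bar> <= m" using continuous_zero_bounded[OF continuous_on_subset[OF z] Om(2)] by blast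
  then show ?thesis by (rule f_integrable[OF l2_measurable[OF bl[OF z]]])
 qed
 define K where "K = (1/2 + C * b) * m\<^sup>2"
 have "\<bar>1/2 * (LINT x|lebesgue_on Om. (state Om om f (%x. u x + t * v x) x - yd x)\<^sup>2)
   - 1/2 * (LINT x|lebesgue_on Om. (y0 x - yd x)\<^sup>2) - t * (LINT x|lebesgue_on om. \<phi> x * v x)\<bar> <= (K * measure lb Om) * t\<^sup>2"
  if t: "0 < t" "t <= 1" for t
 proof -
  have utl: "l2 lb (%x. indicator om x * (u x + t * v x))"
   using l2_add[OF ul l2_scaleR[OF vl, of t]] by (simp add: algebra_simps)
  define y where "y = state Om om f (%x. u x + t * v x)"
  obtain G where y: "continuous_on UNIV y" "!!x. x \<notin> Om ==> y x = 0" "h10 Om y G" "wsol Om G (%x. indicator om x * (u x + t * v x) - f x (y x))"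
   using state_props[of "%x. u x + t * v x"] utl unfolding y_def[symmetric] Lp_2[OF om(1)] by blast
  define d where "d x = y x - y0 x" for x
  define r where "r x = indicator Om x * ((indicator om x * (u x + t * v x) - f x (y x)) - (indicator om x * u x - f x (y0 x)))" for x
  have r_eq: "r x = t * ?v x - indicator Om x * (f x (y x) - f x (y0 x))" for x
   using iom[of x "u x"] iom[of x "v x"] by (simp add: r_def algebra_simps)
  have D: "h10 Om d (%x. G x - G0 x)" unfolding d_def by (rule h10_diff[OF y(3) y0(3)])
  have rw: "wsol Om (%x. G x - G0 x) r"
   unfolding r_def
   by (rule wsol_diff_integrable[OF y(4) y0(4) h10_l2(2)[OF y(3)] h10_l2(2)[OF y0(3)]])
    (use int_diff[OF iu[OF utl] fi[OF y(1)]] int_diff[OF iu[OF ul] fi[OF y0(1)]] in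
     \<open>simp_all only: right_diff_distrib\<close>)
  have rl: "l2 lb r"
  proof -
   \<comment> \<open>A bound that depends on t is enough for square integrability. The bound m0 + m,
     uniform in t, is available only after the comparison below.\<close>
   obtain m' where m': "m' > 0" "!!x. x : Om ==> \<bar>y x\<bar> <= m'" using continuous_zero_bounded[OF continuous_on_subset[OF y(1)] Om(2)] by blast
   define M' where "M' = m0 + m'"
   have M': "M' > 0" "\<bar>y x\<bar> <= M'" "\<bar>y0 x\<bar> <= M'" if "x : Om" for x using m0(1) m'(1) m0(2)[OF that] m'(2)[OF that] by (auto simp: M'_def)
   have M'0: "M' > 0" using m0(1) m'(1) by (simp add: M'_def)
   obtain C' where C': "C' >= 0" "AE x in lb. x : Om --> f_ok M' C' x" using f_bounds[OF M'0] by blast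
   have "AE x in lb. x : Om --> \<bar>f x (y x) - f x (y0 x)\<bar> <= C' * (2 * M')"
   proof (rule eventually_mono[OF C'(2)], rule impI, goal_cases)
    case (1 x)
    have "\<bar>f x (y x) - f x (y0 x)\<bar> <= C' * \<bar>y x - y0 x\<bar>" using f_okD(4)[OF 1(1)[rule_format, OF 1(2)]] M'[OF 1(2)] by blast
    also have "... <= C' * (2 * M')" using M'[OF 1(2)] C'(1) by (intro mult_left_mono) auto
    finally show ?case .
   qed
   moreover have "(%x. indicator Om x * (f x (y x) - f x (y0 x))) : bml"
    by (intro borel_measurable_times ind_measurable borel_measurable_diff f_meas continuous_borel_lebesgue y(1) y0(1))
   ultimately have "l2 lb (%x. indicator Om x * (f x (y x) - f x (y0 x)))"
    using C'(1) M'0 by (intro l2_Om_bounded(1)[where M="C' * (2 * M')"]) simp_all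
   from l2_diff[OF l2_scaleR[OF vl, of t] this] show ?thesis unfolding r_eq[abs_def] by simp
  qed
  have tal: "l2 lb (%x. t * \<bar>?v x\<bar>)" using l2_scaleR[OF al, of t] by simp
  note tZ = h10_scaleR[OF Z(3), of t] and wZ = wsol_scaleR[OF Z(4), of t]
  \<comment> \<open>Where d > t Z \<ge> 0 the perturbed state is the larger one, so by monotonicity
    of f the right-hand side r of the equation for d is at most t |v|, which is that of t Z.\<close>
  have "AE x in lb. d x - t * Z x <= 0"
  proof (rule max_principle[OF Om(1) R(2,1) h10_diff[OF D tZ] l2_diff[OF rl tal]])
   show "(LB x. (G x - G0 x - t *\<^sub>R GZ x) \<bullet> P x) <= (LB x. (r x - t * \<bar>?v x\<bar>) * p x)" if "C1c Om p P" for p P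
    using wsol_diff[OF rw wZ h10_l2(2)[OF D] h10_l2(2)[OF tZ] rl tal] that unfolding wsol_def by simp
   show "AE x in lb. 0 < d x - t * Z x --> r x - t * \<bar>?v x\<bar> <= 0"
   proof (rule eventually_mono[OF eventually_conj[OF fC Z0]], rule impI, goal_cases)
    case (1 x)
    have x: "x : Om" by (rule ccontr) (use 1(2) y(2)[of x] y0(2)[of x] Z(2)[of x] in \<open>simp add: d_def\<close>)
    have "0 <= t * Z x" using 1(1) t by simp
    then have "y0 x <= y x" using 1(2) by (simp add: d_def)
    then have "f x (y0 x) <= f x (y x)" using f_okD(1) 1(1) x by blast
    moreover have "t * ?v x <= t * \<bar>?v x\<bar>" using t by (intro mult_left_mono) auto
    ultimately show ?case using x by (simp add: r_eq)
   qed
  qed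
  moreover have "AE x in lb. - 1 * d x - t * Z x <= 0"
  proof (rule max_principle[OF Om(1) R(2,1) h10_diff[OF h10_scaleR[OF D, of "-1"] tZ] l2_diff[OF l2_scaleR[OF rl, of "-1"] tal]])
   show "(LB x. (- 1 *\<^sub>R (G x - G0 x) - t *\<^sub>R GZ x) \<bullet> P x) <= (LB x. (- 1 *\<^sub>R r x - t * \<bar>?v x\<bar>) * p x)" if "C1c Om p P" for p P
    using wsol_diff[OF wsol_scaleR[OF rw, of "-1"] wZ l2_scaleR[OF h10_l2(2)[OF D]] h10_l2(2)[OF tZ] _ tal] l2_scaleR[OF rl, of "-1"] that
    unfolding wsol_def by simp
   show "AE x in lb. 0 < - 1 * d x - t * Z x --> - 1 *\<^sub>R r x - t * \<bar>?v x\<bar> <= 0"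
   proof (rule eventually_mono[OF eventually_conj[OF fC Z0]], rule impI, goal_cases)
    case (1 x)
    have x: "x : Om" by (rule ccontr) (use 1(2) y(2)[of x] y0(2)[of x] Z(2)[of x] in \<open>simp add: d_def\<close>)
    have "0 <= t * Z x" using 1(1) t by simp
    then have "y x <= y0 x" using 1(2) by (simp add: d_def)
    then have "f x (y x) <= f x (y0 x)" using f_okD(1) 1(1) x by blast
    moreover have "t * - ?v x <= t * \<bar>?v x\<bar>" using t by (intro mult_left_mono) auto
    ultimately show ?case using x by (simp add: r_eq)
   qed
  qed
  ultimately have dZ: "AE x in lb. \<bar>d x\<bar> <= t * Z x" by eventually_elim auto
  define P where "P x = indicator Om x * ((y0 x - yd x) - f1 x (y0 x) * \<phi> x)" for x
  have "(LB x. H x \<bullet> (G x - G0 x)) = (LB x. P x * d x)"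
   unfolding P_def by (rule wsol_h10[OF _ h10_l2(2)[OF \<phi>(3)] Pl D]) (use \<phi>(4) in \<open>simp add: wsol_indicator\<close>)
  moreover have "(LB x. (G x - G0 x) \<bullet> H x) = (LB x. r x * \<phi> x)"
   by (rule wsol_h10[OF rw h10_l2(2)[OF D] rl \<phi>(3)])
  ultimately have id: "(LB x. P x * d x) = (LB x. r x * \<phi> x)" by (simp add: inner_commute)
  let ?A = "%x. (indicator Om x * (y x - yd x)) * (indicator Om x * (y x - yd x))" and ?E = "%x. (indicator Om x * (y0 x - yd x)) * (indicator Om x * (y0 x - yd x))"
  have i: "integrable lb ?A" "integrable lb ?E" "integrable lb (%x. ?v x * \<phi> x)" "integrable lb (%x. P x * d x)" "integrable lb (%x. r x * \<phi> x)"
   using Pl unfolding P_def[symmetric]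
   by (intro l2_real_mult sl y(1) y0(1) vl rl h10_l2(1)[OF \<phi>(3)] h10_l2(1)[OF D]; assumption)+
  \<comment> \<open>The density of the error. Its last two terms cancel after integration, by
    \<open>id\<close>; pointwise they turn q into \<open>(d x)\<^sup>2 / 2 - T * \<phi> x\<close>
    with the Taylor remainder T, which is quadratic in d.\<close>
  define q where "q x = 1/2 * ?A x - 1/2 * ?E x - t * (?v x * \<phi> x) - P x * d x + r x * \<phi> x" for x
  have qi: "integrable lb q" unfolding q_def[abs_def] by (intro Bochner_Integration.integrable_add int_diff integrable_mult_right i)
  have "(LB x. q x) = 1/2 * (LB x. ?A x) - 1/2 * (LB x. ?E x) - t * (LB x. ?v x * \<phi> x)"
   unfolding q_def using i id by simp
  also have "... = 1/2 * (LINT x|lebesgue_on Om. (y x - yd x)\<^sup>2) - 1/2 * (LINT x|lebesgue_on Om. (y0 x - yd x)\<^sup>2) - t * (LINT x|lebesgue_on om. \<phi> x * v x)"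
  proof -
   have e: "indicator Om x * c\<^sup>2 = (indicator Om x * c) * (indicator Om x * (c::real))" for x c by (simp add: indicator_def power2_eq_square)
   show ?thesis unfolding integral_on[OF Om(1)] integral_on[OF om(1)] e by (simp only: mult_ac)
  qed
  finally have Q: "(LB x. q x) = ..." .
  have qb: "AE x in lb. \<bar>q x\<bar> <= (K * t\<^sup>2) * indicator Om x"
  proof (rule eventually_mono[OF eventually_conj[OF fC dZ]], goal_cases)
   case (1 x)
   show ?case
   proof (cases "x : Om")
    case True
    define T where "T = f x (y x) - f x (y0 x) - f1 x (y0 x) * (y x - y0 x)"
    have "\<bar>d x\<bar> <= t * Z x" using 1 by simp
    also have "t * Z x <= t * m" using m(2)[OF True] t by (intro mult_left_mono) auto
    finally have dm: "\<bar>d x\<bar> <= t * m" .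
    have "t * m <= 1 * m" using t m by (intro mult_right_mono) auto
    then have "\<bar>y x\<bar> <= m0 + m" "\<bar>y0 x\<bar> <= m0 + m" using dm m0(2)[OF True] m(1) unfolding d_def by linarith+
    then have T: "\<bar>T\<bar> <= C * (d x)\<^sup>2" unfolding T_def d_def using f_okD(5) 1(1) True by blast
    have "(d x)\<^sup>2 = \<bar>d x\<bar>\<^sup>2" by simp
    also have "... <= (t * m)\<^sup>2" using dm by (intro power_mono) auto
    finally have d2: "(d x)\<^sup>2 <= m\<^sup>2 * t\<^sup>2" by (simp add: power_mult_distrib mult.commute)
    have "\<bar>T * \<phi> x\<bar> <= (C * (d x)\<^sup>2) * b" unfolding abs_mult using T b(2)[OF True] C by (intro mult_mono) auto
    moreover have "q x = (d x)\<^sup>2 / 2 - T * \<phi> x"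
     using True by (simp add: q_def r_eq P_def d_def T_def field_simps power2_eq_square)
    moreover have "(d x)\<^sup>2 >= 0" "(1/2 + C * b) * (d x)\<^sup>2 = (d x)\<^sup>2 / 2 + (C * (d x)\<^sup>2) * b" by (simp_all add: algebra_simps)
    ultimately have "\<bar>q x\<bar> <= (1/2 + C * b) * (d x)\<^sup>2" by linarith
    also have "... <= (1/2 + C * b) * (m\<^sup>2 * t\<^sup>2)" using d2 C b(1) by (intro mult_left_mono) auto
    finally show ?thesis using True by (simp add: K_def mult.assoc)
   next
    case False
    then have "x \<notin> om" using om(2) by blast
    then show ?thesis using False \<phi>(2) by (simp add: q_def P_def)
   qed
  qed
  have "integrable lb (%x. (K * t\<^sup>2) * indicator Om x)" using l2_Om_bounded(2)[of "%x. 1" 1] ind_measurable by (intro integrable_mult_right) simp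
  from order_trans[OF integral_abs_bound integral_mono_AE[OF integrable_abs[OF qi] this qb]]
  have "\<bar>LB x. q x\<bar> <= (K * measure lb Om) * t\<^sup>2" by (simp add: mult_ac)
  then show ?thesis unfolding Q y_def by simp
 qed
 then show ?thesis unfolding y0_def \<phi>_def by blast
qed

end

section \<open>Signed measures\<close>

definition smeas :: "('n::finite) pt set => ('n pt set => real) => bool" where
 "smeas om \<nu> \<longleftrightarrow> (\<forall>A. A \<notin> borel_sets_on om --> \<nu> A = 0) \<and> \<nu> {} = 0 \<and>
   (\<forall>A :: nat => 'n pt set. range A \<subseteq> borel_sets_on om --> disjoint_family A -->
    (%k. \<nu> (A k)) sums \<nu> (\<Union>k. A k))"

lemma vmeasure_component: assumes "vmeasure om \<mu>" shows "smeas om (%A. \<mu> A $ i)"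
 using assms unfolding vmeasure_def smeas_def
 by (auto intro: bounded_linear.sums[OF bounded_linear_vec_nth])

lemma vmeasure_linear:
 assumes "vmeasure om \<mu>" "vmeasure om \<nu>" shows "vmeasure om (%A. a *\<^sub>R \<mu> A + b *\<^sub>R \<nu> A)"
 using assms unfolding vmeasure_def by (auto intro!: sums_add sums_scaleR_right)

lemma smeas_linear:
 assumes "smeas om \<mu>" "smeas om \<nu>" shows "smeas om (%A. a * \<mu> A + b * \<nu> A)"
 using assms unfolding smeas_def by (auto intro!: sums_add sums_mult)

lemma smeas_uminus: "smeas om \<nu> ==> smeas om (%A. - \<nu> A)"
 using smeas_linear[of om \<nu> \<nu> "-1" 0] by simp

context
 fixes om :: "('n::finite) pt set"
 assumes om: "open om"
begin

lemma borel_sets_on_restrict: "borel_sets_on om = sets (restrict_space borel om)"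
 using om by (auto simp: borel_sets_on_def sets_restrict_space image_iff intro: sets.Int exI[of _ _])

lemma sigma_algebra_borel_sets_on: "sigma_algebra om (borel_sets_on om)"
 using sets.sigma_algebra_axioms[of "restrict_space borel om"] by (simp add: borel_sets_on_restrict space_restrict_space)

lemma bsets [intro]:
 "{} : borel_sets_on om" "om : borel_sets_on om"
 "A : borel_sets_on om ==> B : borel_sets_on om ==> A \<union> B : borel_sets_on om"
 "A : borel_sets_on om ==> B : borel_sets_on om ==> A \<inter> B : borel_sets_on om"
 "A : borel_sets_on om ==> B : borel_sets_on om ==> A - B : borel_sets_on om"
 "(!!k::nat. F k : borel_sets_on om) ==> (\<Union>k. F k) : borel_sets_on om"
 using om by (auto simp: borel_sets_on_def)

lemma smeas_sums:
 assumes "smeas om \<nu>" "!!k::nat. F k : borel_sets_on om" "disjoint_family F"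
 shows "(%k. \<nu> (F k)) sums \<nu> (\<Union>k. F k)"
 using assms unfolding smeas_def by auto

lemma smeas_Un:
 assumes "smeas om \<nu>" "A : borel_sets_on om" "B : borel_sets_on om" "A \<inter> B = {}"
 shows "\<nu> (A \<union> B) = \<nu> A + \<nu> B"
proof -
 have "(%k. \<nu> (binaryset A B k)) sums \<nu> (\<Union>k. binaryset A B k)"
  using assms by (intro smeas_sums) (auto simp: binaryset_def disjoint_family_on_def)
 moreover have "(%k. \<nu> (binaryset A B k)) sums (\<nu> A + \<nu> B)"
  by (rule binaryset_sums) (use assms(1) in \<open>simp add: smeas_def\<close>)
 ultimately show ?thesis by (simp add: UN_binaryset_eq sums_unique2)
qed

lemma smeas_Diff:
 assumes "smeas om \<nu>" "A : borel_sets_on om" "B : borel_sets_on om" "B \<subseteq> A"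
 shows "\<nu> (A - B) = \<nu> A - \<nu> B"
proof -
 have "\<nu> ((A - B) \<union> B) = \<nu> (A - B) + \<nu> B" using assms by (intro smeas_Un) auto
 moreover have "(A - B) \<union> B = A" using assms(4) by auto
 ultimately show ?thesis by simp
qed

text \<open>This makes the supremum in \<open>pos_part\<close> meaningful. If the values on the
  subsets of a set are unbounded, a piece of modulus at least 1 can be split off so that the rest
  has the same defect. Repetition yields disjoint pieces whose values do not tend to 0, against
  countable additivity.\<close>

lemma smeas_bounded:
 assumes s: "smeas om \<nu>" shows "\<exists>C. \<forall>A\<in>borel_sets_on om. \<bar>\<nu> A\<bar> <= C"
proof (rule ccontr)
 define bad where "bad A \<longleftrightarrow> A : borel_sets_on om \<and> \<not> (\<exists>C. \<forall>D\<in>borel_sets_on om. D \<subseteq> A --> \<bar>\<nu> D\<bar> <= C)" for A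
 assume "\<not> ?thesis"
 then have b0: "bad om" using bsets(2) by (auto simp: bad_def borel_sets_on_def)
 have step: "\<exists>A'. bad A' \<and> A' \<subseteq> A \<and> \<bar>\<nu> (A - A')\<bar> >= 1" if A: "bad A" for A
 proof -
  have "\<not> (\<forall>D\<in>borel_sets_on om. D \<subseteq> A --> \<bar>\<nu> D\<bar> <= \<bar>\<nu> A\<bar> + 1)" using A unfolding bad_def by blast
  \<comment> \<open>The surplus 1 gives both B and A - B a value of modulus at least 1, so whichever
    of them has bounded values on its subsets may be the one that is split off.\<close>
  then obtain B where B: "B : borel_sets_on om" "B \<subseteq> A" "\<bar>\<nu> B\<bar> > \<bar>\<nu> A\<bar> + 1" by (auto simp: not_le)
  have AB: "A : borel_sets_on om" using A by (simp add: bad_def)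
  have d: "\<nu> (A - B) = \<nu> A - \<nu> B" using smeas_Diff[OF s AB B(1,2)] .
  have dd: "A - (A - B) = B" using B(2) by auto
  have "bad B \<or> bad (A - B)"
  proof (rule ccontr)
   assume "\<not> ?thesis"
   then obtain C1 C2 where C: "!!D. D : borel_sets_on om ==> D \<subseteq> B ==> \<bar>\<nu> D\<bar> <= C1"
    "!!D. D : borel_sets_on om ==> D \<subseteq> A - B ==> \<bar>\<nu> D\<bar> <= C2"
    unfolding bad_def using AB B(1) by (metis bsets(5))
   have "\<bar>\<nu> D\<bar> <= C1 + C2" if D: "D : borel_sets_on om" "D \<subseteq> A" for D
   proof -
    have "\<nu> ((D \<inter> B) \<union> (D - B)) = \<nu> (D \<inter> B) + \<nu> (D - B)"
     using D B by (intro smeas_Un[OF s]) auto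
    moreover have "(D \<inter> B) \<union> (D - B) = D" by auto
    moreover have "\<bar>\<nu> (D \<inter> B)\<bar> <= C1" "\<bar>\<nu> (D - B)\<bar> <= C2" using D B by (auto intro!: C)
    ultimately have "\<nu> D = \<nu> (D \<inter> B) + \<nu> (D - B)" "\<bar>\<nu> (D \<inter> B)\<bar> <= C1" "\<bar>\<nu> (D - B)\<bar> <= C2" by simp_all
    then show ?thesis by linarith
   qed
   then show False using A unfolding bad_def by blast
  qed
  moreover have "\<bar>\<nu> (A - B)\<bar> >= 1" using d B(3) by linarith
  moreover have "\<bar>\<nu> (A - (A - B))\<bar> >= 1" using dd B(3) by simp
  ultimately show ?thesis using B(2) by (metis Diff_subset)
 qed
 have "\<exists>f. \<forall>n::nat. bad (f n) \<and> (f (Suc n) \<subseteq> f n \<and> \<bar>\<nu> (f n - f (Suc n))\<bar> >= 1)"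
  using b0 step by (intro dependent_nat_choice[where P="%n. bad" and Q="%n A A'. A' \<subseteq> A \<and> \<bar>\<nu> (A - A')\<bar> >= 1"]) blast+
 then obtain f where f: "!!n. bad (f n)" "!!n. f (Suc n) \<subseteq> f n" "!!n. \<bar>\<nu> (f n - f (Suc n))\<bar> >= 1" by blast
 have dec: "decseq f" using f(2) by (simp add: decseq_Suc_iff)
 have "disjoint_family (%n. f n - f (Suc n))"
 proof (unfold disjoint_family_on_def, intro ballI impI)
  fix m n :: nat assume "m \<noteq> n"
  then consider "Suc m <= n" | "Suc n <= m" by linarith
  then show "(f m - f (Suc m)) \<inter> (f n - f (Suc n)) = {}"
   by cases (use decseqD[OF dec] in blast)+
 qed
 then have "(%n. \<nu> (f n - f (Suc n))) sums \<nu> (\<Union>n. f n - f (Suc n))"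
  using f(1) by (intro smeas_sums[OF s]) (auto simp: bad_def)
 then have "(%n. \<nu> (f n - f (Suc n))) ----> 0" by (intro summable_LIMSEQ_zero) (rule sums_summable)
 then have "eventually (%n. \<bar>\<nu> (f n - f (Suc n))\<bar> < 1) sequentially"
  using tendsto_rabs_zero order_tendstoD(2) zero_less_one by blast
 then obtain N where "\<forall>n\<ge>N. \<bar>\<nu> (f n - f (Suc n))\<bar> < 1" by (auto simp: eventually_sequentially)
 then show False using f(3)[of N] by (meson order.refl not_less)
qed

section \<open>Positive variation and Jordan decomposition\<close>

lemma pos_part_props:
 assumes s: "smeas om \<nu>" and A: "A : borel_sets_on om"
 shows "pos_part om \<nu> A >= 0"
  "B : borel_sets_on om ==> B \<subseteq> A ==> \<nu> B <= pos_part om \<nu> A"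
  "(!!B. B : borel_sets_on om ==> B \<subseteq> A ==> \<nu> B <= c) ==> pos_part om \<nu> A <= c"
proof -
 obtain C where C: "\<forall>A\<in>borel_sets_on om. \<bar>\<nu> A\<bar> <= C" using smeas_bounded[OF s] by blast
 have bdd: "bdd_above {\<nu> B | B. B : borel_sets_on om \<and> B \<subseteq> A}"
  using C by (intro bdd_aboveI[of _ C]) force
 show u: "\<nu> B <= pos_part om \<nu> A" if "B : borel_sets_on om" "B \<subseteq> A" for B
  unfolding pos_part_def by (rule cSup_upper[OF _ bdd]) (use that in blast)
 show "pos_part om \<nu> A >= 0" using u[of "{}"] s by (auto simp: smeas_def)
 show "pos_part om \<nu> A <= c" if "!!B. B : borel_sets_on om ==> B \<subseteq> A ==> \<nu> B <= c"
  unfolding pos_part_def using that by (intro cSup_least) auto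
qed

lemma pos_part_mono:
 assumes s: "smeas om \<nu>" and "A : borel_sets_on om" "B : borel_sets_on om" "A \<subseteq> B"
 shows "pos_part om \<nu> A <= pos_part om \<nu> B"
 using assms by (intro pos_part_props(3) pos_part_props(2)) auto

lemma pos_part_Un:
 assumes s: "smeas om \<nu>" and A: "A : borel_sets_on om" and B: "B : borel_sets_on om" and d: "A \<inter> B = {}"
 shows "pos_part om \<nu> A + pos_part om \<nu> B <= pos_part om \<nu> (A \<union> B)"
proof -
 have "pos_part om \<nu> A <= pos_part om \<nu> (A \<union> B) - pos_part om \<nu> B"
 proof (rule pos_part_props(3)[OF s A])
  fix C assume C: "C : borel_sets_on om" "C \<subseteq> A"
  have "pos_part om \<nu> B <= pos_part om \<nu> (A \<union> B) - \<nu> C"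
  proof (rule pos_part_props(3)[OF s B])
   fix D assume D: "D : borel_sets_on om" "D \<subseteq> B"
   have "\<nu> (C \<union> D) = \<nu> C + \<nu> D" using C D d by (intro smeas_Un[OF s]) auto
   moreover have "\<nu> (C \<union> D) <= pos_part om \<nu> (A \<union> B)" using A B C D by (intro pos_part_props(2)[OF s]) auto
   ultimately show "\<nu> D <= pos_part om \<nu> (A \<union> B) - \<nu> C" by simp
  qed
  then show "\<nu> C <= pos_part om \<nu> (A \<union> B) - pos_part om \<nu> B" by simp
 qed
 then show ?thesis by simp
qed

text \<open>Superadditivity bounds the partial sums by the value of the union; conversely, a
  competitor B for the union is cut along the sets F k and each piece is a competitor for its own F
  k.\<close>

lemma pos_part_sums:
 assumes s: "smeas om \<nu>" and F: "!!k::nat. F k : borel_sets_on om" and d: "disjoint_family F"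
 shows "(%k. pos_part om \<nu> (F k)) sums pos_part om \<nu> (\<Union>k. F k)"
proof -
 let ?p = "pos_part om \<nu>"
 have UF: "(\<Union>k. F k) : borel_sets_on om" using F by blast
 have Un: "(\<Union>k<n. F k) : borel_sets_on om" for n
  by (induction n) (use F in \<open>auto simp: lessThan_Suc\<close>)
 have le: "(\<Sum>k<n. ?p (F k)) <= ?p (\<Union>k<n. F k)" for n
 proof (induction n)
  case 0
  then show ?case using pos_part_props(1)[OF s bsets(1)] by simp
 next
  case (Suc n)
  have "?p (F n) + ?p (\<Union>k<n. F k) <= ?p (F n \<union> (\<Union>k<n. F k))"
  proof (intro pos_part_Un[OF s] F Un)
   show "F n \<inter> (\<Union>k<n. F k) = {}"
   proof (intro equals0I)
    fix x assume "x : F n \<inter> (\<Union>k<n. F k)"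
    then obtain k where k: "k < n" "x : F n" "x : F k" by auto
    moreover have "F n \<inter> F k = {}" using disjoint_family_onD[OF d, of n k] \<open>k < n\<close> by auto
    ultimately show False using k by (metis IntI empty_iff)
   qed
  qed
  then show ?case using Suc by (simp add: lessThan_Suc)
 qed
 have le2: "(\<Sum>k<n. ?p (F k)) <= ?p (\<Union>k. F k)" for n
  using le[of n] pos_part_mono[OF s Un UF, of n] by force
 have nn: "?p (F k) >= 0" for k using pos_part_props(1)[OF s F] .
 have sm: "summable (%k. ?p (F k))"
  by (rule summableI_nonneg_bounded[OF nn le2])
 have "?p (\<Union>k. F k) <= (\<Sum>k. ?p (F k))"
 proof (rule pos_part_props(3)[OF s UF])
  fix B assume B: "B : borel_sets_on om" "B \<subseteq> (\<Union>k. F k)"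
  have "(%k. \<nu> (B \<inter> F k)) sums \<nu> (\<Union>k. B \<inter> F k)"
  proof (intro smeas_sums[OF s] bsets B F)
   show "disjoint_family (%k. B \<inter> F k)" using d unfolding disjoint_family_on_def by (simp add: Int_assoc Int_left_commute)
  qed
  moreover have "(\<Union>k. B \<inter> F k) = B" using B by auto
  ultimately have "\<nu> B = (\<Sum>k. \<nu> (B \<inter> F k))" "summable (%k. \<nu> (B \<inter> F k))" by (auto simp: sums_iff)
  moreover have "\<nu> (B \<inter> F k) <= ?p (F k)" for k using B F by (intro pos_part_props(2)[OF s]) auto
  ultimately show "\<nu> B <= (\<Sum>k. ?p (F k))" using suminf_le[OF _ _ sm] by metis
 qed
 moreover have "(\<Sum>k. ?p (F k)) <= ?p (\<Union>k. F k)" by (rule suminf_le_const[OF sm le2])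
 ultimately show ?thesis using sm by (simp add: sums_iff)
qed

lemma pos_measure_basic:
 assumes s: "smeas om \<nu>"
 shows "space (pos_measure om \<nu>) = om" "sets (pos_measure om \<nu>) = borel_sets_on om"
  "A : borel_sets_on om ==> emeasure (pos_measure om \<nu>) A = ennreal (pos_part om \<nu> A)"
  "A : borel_sets_on om ==> measure (pos_measure om \<nu>) A = pos_part om \<nu> A"
  "finite_measure (pos_measure om \<nu>)"
proof -
 have sub: "borel_sets_on om \<subseteq> Pow om" by (auto simp: borel_sets_on_def)
 have ss: "sigma_sets om (borel_sets_on om) = borel_sets_on om"
  by (rule sigma_algebra.sigma_sets_eq[OF sigma_algebra_borel_sets_on])
 show sp: "space (pos_measure om \<nu>) = om" unfolding pos_measure_def by (rule space_measure_of[OF sub])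
 show st: "sets (pos_measure om \<nu>) = borel_sets_on om" unfolding pos_measure_def using sets_measure_of[OF sub] ss by simp
 show em: "emeasure (pos_measure om \<nu>) A = ennreal (pos_part om \<nu> A)" if "A : borel_sets_on om" for A
 proof (rule emeasure_measure_of[OF pos_measure_def sub])
  have "pos_part om \<nu> {} = 0"
   using pos_part_props(1)[OF s bsets(1)] pos_part_props(3)[OF s bsets(1), of 0] s by (force simp: smeas_def)
  then show "positive (sets (pos_measure om \<nu>)) (%A. ennreal (pos_part om \<nu> A))" by (simp add: positive_def)
  show "countably_additive (sets (pos_measure om \<nu>)) (%A. ennreal (pos_part om \<nu> A))"
  proof (rule countably_additiveI, unfold st)
   fix F :: "nat => 'n pt set" assume F: "range F \<subseteq> borel_sets_on om" "disjoint_family F"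
   have "(%k. pos_part om \<nu> (F k)) sums pos_part om \<nu> (\<Union>k. F k)" using F by (intro pos_part_sums[OF s]) auto
   then show "(\<Sum>k. ennreal (pos_part om \<nu> (F k))) = ennreal (pos_part om \<nu> (\<Union>(range F)))"
    using F pos_part_props(1)[OF s] by (intro suminf_ennreal_eq) auto
  qed
 qed (use that st in auto)
 show "measure (pos_measure om \<nu>) A = pos_part om \<nu> A" if "A : borel_sets_on om" for A
  using em[OF that] pos_part_props(1)[OF s that] by (simp add: measure_def)
 show "finite_measure (pos_measure om \<nu>)"
  by (rule finite_measureI) (use em[OF bsets(2)] sp in auto)
qed

text \<open>Complementation in A exchanges the competitors of the two variations, since \<nu> (A -
  B) = \<nu> A - \<nu> B.\<close>

lemma jordan:
 assumes s: "smeas om \<nu>" and A: "A : borel_sets_on om"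
 shows "\<nu> A = pos_part om \<nu> A - pos_part om (%A. - \<nu> A) A"
proof (rule antisym)
 note sm = smeas_uminus[OF s]
 have "pos_part om (%A. - \<nu> A) A <= pos_part om \<nu> A - \<nu> A"
 proof (rule pos_part_props(3)[OF sm A])
  fix B assume B: "B : borel_sets_on om" "B \<subseteq> A"
  have "\<nu> (A - B) <= pos_part om \<nu> A" using A B by (intro pos_part_props(2)[OF s]) auto
  then show "- \<nu> B <= pos_part om \<nu> A - \<nu> A" using smeas_Diff[OF s A B] by simp
 qed
 then show "\<nu> A <= pos_part om \<nu> A - pos_part om (%A. - \<nu> A) A" by simp
 have "pos_part om \<nu> A <= \<nu> A + pos_part om (%A. - \<nu> A) A"
 proof (rule pos_part_props(3)[OF s A])
  fix B assume B: "B : borel_sets_on om" "B \<subseteq> A"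
  have "- \<nu> (A - B) <= pos_part om (%A. - \<nu> A) A" using A B by (intro pos_part_props(2)[OF sm]) auto
  then show "\<nu> B <= \<nu> A + pos_part om (%A. - \<nu> A) A" using smeas_Diff[OF s A B] by simp
 qed
 then show "pos_part om \<nu> A - pos_part om (%A. - \<nu> A) A <= \<nu> A" by simp
qed

section \<open>Integration against signed measures\<close>

definition bmf :: "('n pt => real) => bool" where
 "bmf g \<longleftrightarrow> g : borel_measurable (restrict_space borel om) \<and> (\<exists>C. \<forall>x\<in>om. \<bar>g x\<bar> <= C)"

lemma pos_measure_measurable:
 assumes "smeas om \<nu>"
 shows "borel_measurable (pos_measure om \<nu>) = borel_measurable (restrict_space borel om)"
 using pos_measure_basic[OF assms] borel_sets_on_restrict by (intro measurable_cong_sets) auto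

lemma bmf_integrable:
 assumes "smeas om \<nu>" "bmf g" shows "integrable (pos_measure om \<nu>) g"
proof -
 interpret finite_measure "pos_measure om \<nu>" by (rule pos_measure_basic(5)[OF assms(1)])
 obtain C where "\<forall>x\<in>om. \<bar>g x\<bar> <= C" using assms(2) by (auto simp: bmf_def)
 then show ?thesis
  using assms pos_measure_basic(1)[OF assms(1)] pos_measure_measurable[OF assms(1)]
  by (intro integrable_const_bound[of _ C]) (auto simp: bmf_def)
qed

lemma sint_add: assumes "smeas om \<nu>" "bmf f" "bmf g" shows "sint om \<nu> (%x. f x + g x) = sint om \<nu> f + sint om \<nu> g"
 unfolding sint_def using assms smeas_uminus[OF assms(1)] by (simp add: bmf_integrable)

lemma sint_cmult: "sint om \<nu> (%x. c * f x) = c * sint om \<nu> f"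
 unfolding sint_def by (simp add: algebra_simps)

lemma sint_indicator:
 assumes "smeas om \<nu>" "A : borel_sets_on om" shows "sint om \<nu> (indicator A) = \<nu> A"
proof -
 have "A \<inter> om = A" using assms(2) by (auto simp: borel_sets_on_def)
 then show ?thesis
  unfolding sint_def using jordan[OF assms] assms smeas_uminus[OF assms(1)] by (simp add: pos_measure_basic)
qed

lemma sint_lim:
 assumes s: "smeas om \<nu>" and m: "!!k. gs k : borel_measurable (restrict_space borel om)" "g : borel_measurable (restrict_space borel om)"
  and b: "!!k x. x : om ==> \<bar>gs k x\<bar> <= C" and l: "!!x. x : om ==> (%k. gs k x) ----> g x"
 shows "(%k. sint om \<nu> (gs k)) ----> sint om \<nu> g"
proof -
 have *: "(%k. integral\<^sup>L (pos_measure om \<nu>) (gs k)) ----> integral\<^sup>L (pos_measure om \<nu>) g" if s: "smeas om \<nu>" for \<nu>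
 proof (rule integral_dominated_convergence[where w="%x. C"])
  interpret finite_measure "pos_measure om \<nu>" by (rule pos_measure_basic(5)[OF s])
  show "integrable (pos_measure om \<nu>) (%x. C)" by simp
 qed (use m b l s in \<open>auto simp: pos_measure_measurable pos_measure_basic\<close>)
 show ?thesis unfolding sint_def by (intro tendsto_diff * s smeas_uminus)
qed

text \<open>The Jordan decomposition does not depend linearly on the measure, so linearity of
  \<open>sint\<close> in the measure is not visible from its definition. It holds for indicators,
  where \<open>sint\<close> returns the measure of the set, and extends by induction over
  nonnegative measurable functions.\<close>

lemma sint_linear_nonneg:
 assumes s: "smeas om \<mu>" "smeas om \<nu>" and u: "u : borel_measurable (restrict_space borel om)" "!!x. 0 <= u x"
 shows "(\<exists>C. \<forall>x\<in>om. u x <= C) ==> sint om (%A. a * \<mu> A + b * \<nu> A) u = a * sint om \<mu> u + b * sint om \<nu> u"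
 using u
proof (induction u rule: borel_measurable_induct_real)
 case (set A)
 then have "A : borel_sets_on om" by (simp add: borel_sets_on_restrict)
 then show ?case by (simp add: sint_indicator[OF smeas_linear[OF s]] sint_indicator[OF s(1)] sint_indicator[OF s(2)])
next
 case (mult u c)
 show ?case
 proof (cases "c = 0")
  case True
  then show ?thesis by (simp add: sint_cmult[of _ 0, simplified])
 next
  case False
  then have c: "c > 0" using mult by simp
  obtain C where "\<forall>x\<in>om. c * u x <= C" using mult by blast
  then have "\<forall>x\<in>om. u x <= C / c" using c by (simp add: field_simps)
  then show ?thesis using mult by (simp add: sint_cmult algebra_simps exI[of _ "C/c"])
 qed
next
 case (add u v)
 obtain C where C: "\<forall>x\<in>om. v x + u x <= C" using add by blast
 have nn: "0 <= u x" "0 <= v x" for x using add by auto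
 have b: "\<forall>x\<in>om. u x <= C" "\<forall>x\<in>om. v x <= C" by (metis C nn add_increasing add_increasing2 order.trans order_refl)+
 have "bmf u" "bmf v" using add b unfolding bmf_def by (auto intro!: exI[of _ C])
 moreover have "sint om (%A. a * \<mu> A + b * \<nu> A) u = a * sint om \<mu> u + b * sint om \<nu> u"
   "sint om (%A. a * \<mu> A + b * \<nu> A) v = a * sint om \<mu> v + b * sint om \<nu> v" using add b by blast+
 ultimately show ?case
  by (simp add: sint_add[OF smeas_linear[OF s]] sint_add[OF s(1)] sint_add[OF s(2)] algebra_simps)
next
 case (seq U)
 obtain C where C: "\<forall>x\<in>om. u x <= C" using seq by blast
 have Uu: "U i x <= u x" if "x : om" for i x
  using incseq_le[of "%i. U i x" "u x" i] seq that by (auto simp: incseq_def le_fun_def space_restrict_space)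
 then have UC: "U i x <= C" if "x : om" for i x using C that order_trans by blast
 have l: "(%k. sint om \<kappa> (U k)) ----> sint om \<kappa> u" if "smeas om \<kappa>" for \<kappa>
  using seq UC u by (intro sint_lim[OF that, of _ _ C]) (auto simp: space_restrict_space)
 have e: "sint om (%A. a * \<mu> A + b * \<nu> A) (U k) = a * sint om \<mu> (U k) + b * sint om \<nu> (U k)" for k
  using seq UC by blast
 have "(%k. a * sint om \<mu> (U k) + b * sint om \<nu> (U k)) ----> a * sint om \<mu> u + b * sint om \<nu> u"
  by (intro tendsto_intros l s)
 then show ?case using l[OF smeas_linear[OF s, of a b]] unfolding e by (rule LIMSEQ_unique[rotated])
qed

lemma sint_linear:
 assumes s: "smeas om \<mu>" "smeas om \<nu>" and g: "bmf g"
 shows "sint om (%A. a * \<mu> A + b * \<nu> A) g = a * sint om \<mu> g + b * sint om \<nu> g"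
proof -
 obtain C where C: "\<forall>x\<in>om. \<bar>g x\<bar> <= C" using g by (auto simp: bmf_def)
 have [measurable]: "g : borel_measurable (restrict_space borel om)" using g by (simp add: bmf_def)
 let ?p = "%x. max 0 (g x)" and ?n = "%x. max 0 (- g x)"
 have "\<forall>x\<in>om. ?p x <= max 0 C" "\<forall>x\<in>om. ?n x <= max 0 C" using C by (auto simp: abs_le_iff)
 then have b: "bmf ?p" "bmf (%x. (-1) * ?n x)"
  and e: "sint om (%A. a * \<mu> A + b * \<nu> A) ?p = a * sint om \<mu> ?p + b * sint om \<nu> ?p"
   "sint om (%A. a * \<mu> A + b * \<nu> A) ?n = a * sint om \<mu> ?n + b * sint om \<nu> ?n"
  unfolding bmf_def by (auto intro!: sint_linear_nonneg[OF s] exI[of _ "max 0 C"])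
 have "sint om \<kappa> g = sint om \<kappa> ?p - sint om \<kappa> ?n" if k: "smeas om \<kappa>" for \<kappa>
 proof -
  have "sint om \<kappa> g = sint om \<kappa> (%x. ?p x + (-1) * ?n x)" by (rule arg_cong[of _ _ "sint om \<kappa>"]) (auto simp: fun_eq_iff max_def)
  also have "... = sint om \<kappa> ?p + sint om \<kappa> (%x. (-1) * ?n x)" by (rule sint_add[OF k b])
  also have "... = sint om \<kappa> ?p - sint om \<kappa> ?n" unfolding sint_cmult by simp
  finally show ?thesis .
 qed
 note key = this
 show ?thesis unfolding key[OF smeas_linear[OF s, of a b]] key[OF s(1)] key[OF s(2)] e by (simp only: right_diff_distrib)
qed

lemma sint_bound:
 assumes s: "smeas om \<nu>" and g: "g : borel_measurable (restrict_space borel om)" "!!x. x : om ==> \<bar>g x\<bar> <= C"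
 shows "\<bar>sint om \<nu> g\<bar> <= C * (pos_part om \<nu> om + pos_part om (%A. - \<nu> A) om)"
proof -
 have *: "\<bar>integral\<^sup>L (pos_measure om \<nu>) g\<bar> <= C * pos_part om \<nu> om" if s: "smeas om \<nu>" for \<nu>
 proof -
  interpret finite_measure "pos_measure om \<nu>" by (rule pos_measure_basic(5)[OF s])
  have i: "integrable (pos_measure om \<nu>) g" using bmf_integrable[OF s] g unfolding bmf_def by blast
  have "\<bar>integral\<^sup>L (pos_measure om \<nu>) g\<bar> <= (\<integral>x. \<bar>g x\<bar> \<partial>pos_measure om \<nu>)" by (rule integral_abs_bound)
  also have "... <= (\<integral>x. C \<partial>pos_measure om \<nu>)"
   using i g(2) by (intro integral_mono) (auto simp: pos_measure_basic[OF s])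
  also have "... = C * pos_part om \<nu> om" using pos_measure_basic[OF s] by (simp add: bsets)
  finally show ?thesis .
 qed
 show ?thesis unfolding sint_def using *[OF s] *[OF smeas_uminus[OF s]] by (simp add: algebra_simps)
qed

end

section \<open>Vector measures and distributional gradients\<close>

text \<open>The last claim, from compactness of the unit sphere, keeps the admissible fields bounded
  in the Euclidean norm and thereby the supremum in \<open>mnorm\<close> finite.\<close>

lemma is_norm_props:
 fixes N :: "'n::finite pt => real"
 assumes "is_norm N"
 shows "N 0 = 0" "N (- x) = N x" "N x >= 0" "\<exists>c>0. \<forall>x. c * norm x <= N x"
proof -
 have tri: "N (x + y) <= N x + N y" and hom: "N (c *\<^sub>R x) = \<bar>c\<bar> * N x" and zero: "N x = 0 \<longleftrightarrow> x = 0" for x y c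
  using assms unfolding is_norm_def by blast+
 show N0: "N 0 = 0" using zero by blast
 show Nm: "N (- x) = N x" for x using hom[of "-1" x] by simp
 show pos: "N x >= 0" for x using tri[of x "- x"] Nm[of x] N0 by simp
 have ub: "N x <= (\<Sum>i\<in>UNIV. N (axis i 1)) * norm x" for x
 proof -
  have sm: "N (\<Sum>i\<in>A. g i) <= (\<Sum>i\<in>A. N (g i))" if "finite A" for A and g :: "'n => 'n pt"
   using that by (induction A rule: finite_induct) (auto simp: N0 intro: order_trans[OF tri])
  have "N x = N (\<Sum>i\<in>UNIV. x $ i *\<^sub>R axis i 1)"
   by (simp add: basis_expansion[of x, unfolded scalar_mult_eq_scaleR])
  also have "... <= (\<Sum>i\<in>UNIV. N (x $ i *\<^sub>R axis i 1))" by (rule sm) simp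
  also have "... <= (\<Sum>i\<in>UNIV. N (axis i 1) * norm x)"
   by (intro sum_mono) (simp add: hom mult.commute[of _ "norm x"] mult_right_mono pos component_le_norm_cart)
  finally show ?thesis by (simp add: sum_distrib_right)
 qed
 define S where "S = (\<Sum>i\<in>UNIV. N (axis i (1::real) :: 'n pt))"
 have S0: "S >= 0" unfolding S_def by (intro sum_nonneg pos)
 have diff: "\<bar>N x - N y\<bar> <= S * norm (x - y)" for x y
  using tri[of y "x - y"] tri[of x "y - x"] ub[of "x - y"] ub[of "y - x"] by (simp add: S_def norm_minus_commute abs_le_iff)
 have "continuous_on (sphere 0 1) N"
 proof (rule continuous_onI)
  fix x y :: "'n pt" and e :: real assume "e > 0"
  show "\<exists>d>0. \<forall>x'\<in>sphere 0 1. dist x' x < d --> dist (N x') (N x) <= e"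
  proof (intro exI[of _ "e / (S + 1)"] conjI ballI impI)
   show "e / (S + 1) > 0" using \<open>e > 0\<close> S0 by simp
   fix x' assume "dist x' x < e / (S + 1)"
   then have "norm (x' - x) * (S + 1) < e" using S0 by (simp add: dist_norm pos_less_divide_eq)
   then have "S * norm (x' - x) <= e" by (simp add: algebra_simps) (smt (verit) norm_ge_zero)
   then show "dist (N x') (N x) <= e" using diff[of x' x] by (simp add: dist_real_def)
  qed
 qed
 moreover have "sphere (0::'n pt) 1 \<noteq> {}" by simp
 ultimately obtain x0 where x0: "x0 : sphere 0 1" "!!x. x : sphere 0 1 ==> N x0 <= N x"
  using continuous_attains_inf[OF compact_sphere] by metis
 have "N x0 > 0" using x0(1) zero[of x0] pos[of x0] by fastforce
 moreover have "N x0 * norm x <= N x" for x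
 proof (cases "x = 0")
  case False
  have "N x0 <= N ((1 / norm x) *\<^sub>R x)" using False by (intro x0(2)) simp
  then show ?thesis using False by (simp add: hom field_simps)
 qed (use N0 in simp)
 ultimately show "\<exists>c>0. \<forall>x. c * norm x <= N x" by blast
qed

lemma continuous_bmf:
 assumes om: "open om" and z: "continuous_on om z" "!!x. x : om ==> norm (z x) <= C"
 shows "bmf om (%x. z x $ i)"
proof -
 have "continuous_on om (%x. z x $ i)" using z(1) by (intro continuous_intros)
 then have "(%x. z x $ i) : borel_measurable (restrict_space borel om)" by (rule borel_measurable_continuous_on_restrict)
 moreover have "\<bar>z x $ i\<bar> <= C" if "x : om" for x using component_le_norm_cart[of "z x" i] z(2)[OF that] by simp
 ultimately show ?thesis unfolding bmf_def[OF om] by blast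
qed

context
 fixes om :: "('n::finite) pt set" and N :: "'n pt => real"
 assumes om: "open om" and N: "is_norm N"
begin

definition adm :: "('n pt => 'n pt) => bool" where
 "adm z \<longleftrightarrow> C0 om z \<and> (\<forall>x\<in>closure om. N (z x) <= 1)"

lemma adm_bmf:
 shows "\<exists>C. \<forall>z. adm z --> (\<forall>x\<in>om. norm (z x) <= C)" "adm z ==> bmf om (%x. z x $ i)"
proof -
 obtain c where c: "c > 0" "!!x. c * norm x <= N x" using is_norm_props(4)[OF N] by blast
 have b: "norm (z x) <= 1 / c" if "adm z" "x : om" for z x
  using that c(2)[of "z x"] c(1) closure_subset[of om] by (force simp: adm_def field_simps)
 then show "\<exists>C. \<forall>z. adm z --> (\<forall>x\<in>om. norm (z x) <= C)" by blast
 show "adm z ==> bmf om (%x. z x $ i)"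
  using b continuous_on_subset[OF _ closure_subset[of om], of z]
  by (intro continuous_bmf[OF om, of _ "1/c"]) (auto simp: adm_def C0_def)
qed

lemma vint_linear:
 assumes "vmeasure om \<mu>" "vmeasure om \<nu>" "adm z"
 shows "vint om (%A. a *\<^sub>R \<mu> A + b *\<^sub>R \<nu> A) z = a * vint om \<mu> z + b * vint om \<nu> z"
 unfolding vint_def
 by (simp add: sint_linear[OF om vmeasure_component[OF assms(1)] vmeasure_component[OF assms(2)] adm_bmf(2)[OF assms(3)]]
   sum.distrib sum_distrib_left)

lemma adm_minus: assumes "adm z" shows "adm (%x. - z x)"
 using assms is_norm_props(2)[OF N] by (auto simp: adm_def C0_def intro: continuous_intros)

lemma vint_minus: "vint om \<mu> (%x. - z x) = - vint om \<mu> z"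
proof -
 have "sint om (%A. \<mu> A $ i) (%x. - z x $ i) = - sint om (%A. \<mu> A $ i) (%x. z x $ i)" for i
  using sint_cmult[OF om, of "%A. \<mu> A $ i" "-1" "%x. z x $ i"] by simp
 then show ?thesis unfolding vint_def by (simp add: sum_negf)
qed

lemma adm_zero: "adm (%x. 0)" using is_norm_props(1)[OF N] by (simp add: adm_def C0_def)

lemma mnorm_upper:
 assumes \<mu>: "vmeasure om \<mu>" and z: "adm z" shows "\<bar>vint om \<mu> z\<bar> <= mnorm N om \<mu>"
proof -
 obtain C where C: "!!z x. adm z ==> x : om ==> norm (z x) <= C" using adm_bmf(1) by blast
 define B where "B = (\<Sum>i\<in>UNIV. C * (pos_part om (%A. \<mu> A $ i) om + pos_part om (%A. - \<mu> A $ i) om))"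
 have b: "\<bar>vint om \<mu> z\<bar> <= B" if "adm z" for z
  unfolding vint_def B_def
 proof (rule order_trans[OF sum_abs], rule sum_mono)
  fix i
  show "\<bar>sint om (%A. \<mu> A $ i) (%x. z x $ i)\<bar> <= C * (pos_part om (%A. \<mu> A $ i) om + pos_part om (%A. - \<mu> A $ i) om)"
   using adm_bmf(2)[OF that, of i] component_le_norm_cart[of "z x" i for x] C[OF that]
   by (intro sint_bound[OF om vmeasure_component[OF \<mu>]]) (auto simp: bmf_def[OF om] intro: order_trans)
 qed
 have e: "mnorm N om \<mu> = Sup {vint om \<mu> z | z. adm z}" by (simp add: mnorm_def adm_def)
 have bdd: "bdd_above {vint om \<mu> z | z. adm z}" using b by (intro bdd_aboveI[of _ B]) (force simp: abs_le_iff)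
 have u: "vint om \<mu> z <= mnorm N om \<mu>" if "adm z" for z
  unfolding e by (rule cSup_upper[OF _ bdd]) (use that in blast)
 show ?thesis using u[OF z] u[OF adm_minus[OF z]] by (simp add: vint_minus abs_le_iff)
qed

lemma mnorm_least:
 assumes "!!z. adm z ==> vint om \<mu> z <= c" shows "mnorm N om \<mu> <= c"
proof -
 have e: "mnorm N om \<mu> = Sup {vint om \<mu> z | z. adm z}" by (simp add: mnorm_def adm_def)
 show ?thesis unfolding e by (rule cSup_least) (use assms adm_zero in auto)
qed

lemma mnorm_nonneg: "vmeasure om \<mu> ==> mnorm N om \<mu> >= 0"
 using mnorm_upper[OF _ adm_zero, of \<mu>] by linarith

lemma mnorm_linear_le:
 assumes "vmeasure om \<mu>" "vmeasure om \<nu>"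
 shows "mnorm N om (%A. a *\<^sub>R \<mu> A + b *\<^sub>R \<nu> A) <= \<bar>a\<bar> * mnorm N om \<mu> + \<bar>b\<bar> * mnorm N om \<nu>"
proof (rule mnorm_least)
 fix z assume z: "adm z"
 have "a * vint om \<mu> z <= \<bar>a\<bar> * mnorm N om \<mu>" "b * vint om \<nu> z <= \<bar>b\<bar> * mnorm N om \<nu>"
  using mult_left_mono[OF mnorm_upper[OF assms(1) z], of "\<bar>a\<bar>"] mult_left_mono[OF mnorm_upper[OF assms(2) z], of "\<bar>b\<bar>"]
  by (simp_all add: abs_mult[symmetric] abs_le_iff)
 then show "vint om (%A. a *\<^sub>R \<mu> A + b *\<^sub>R \<nu> A) z <= \<bar>a\<bar> * mnorm N om \<mu> + \<bar>b\<bar> * mnorm N om \<nu>"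
  using vint_linear[OF assms z] by simp
qed

end

section \<open>Uniqueness and linearity of the distributional gradient\<close>

context
 fixes om :: "('n::finite) pt set"
 assumes om: "open om" and bo: "bounded om"
begin

text \<open>Test functions approximate compactly supported continuous functions uniformly, these
  converge boundedly to indicators of open sets, and the open subsets form a generator that is
  stable under intersections.\<close>

lemma smeas_eq_0:
 assumes s: "smeas om \<nu>" and z: "!!p. test_fun om p ==> sint om \<nu> p = 0"
 shows "\<nu> A = 0"
proof -
 have cont: "sint om \<nu> f = 0" if f: "continuous_on UNIV f" "compact K" "K \<subseteq> om" "!!x. x \<notin> K ==> f x = 0" for f K
 proof -
  obtain B where B: "!!x. norm (f x) <= B" using bounded_compact_support[OF f(1,2,4)] by blast
  obtain K' where K': "!!e. e > 0 ==> \<exists>p. test_fun om p \<and> (\<forall>x. \<bar>p x - f x\<bar> <= e)"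
   using approx_test_fun[OF om f(2,3,1,4)] by metis
  have "\<exists>p. test_fun om p \<and> (\<forall>x. \<bar>p x - f x\<bar> <= inverse (real (Suc k)))" for k using K' by simp
  then obtain ps where ps: "!!k. test_fun om (ps k)" "!!k x. \<bar>ps k x - f x\<bar> <= inverse (real (Suc k))" by metis
  have "(%k. sint om \<nu> (ps k)) ----> sint om \<nu> f"
  proof (rule sint_lim[OF om s, of _ _ "B + 1"])
   show "ps k : borel_measurable (restrict_space borel om)" for k
    using C1cD(3)[OF test_fun_C1c[OF ps(1)]] by (intro borel_measurable_continuous_on_restrict) (auto intro: continuous_on_subset)
   show "f : borel_measurable (restrict_space borel om)"
    using f(1) by (intro borel_measurable_continuous_on_restrict) (auto intro: continuous_on_subset)
   show "\<bar>ps k x\<bar> <= B + 1" for k x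
   proof -
    have "inverse (real (Suc k)) <= 1" by (simp add: inverse_le_1_iff)
    then show ?thesis using ps(2)[of k x] B[of x] by simp
   qed
   show "(%k. ps k x) ----> f x" for x
    using Lim_null_comparison[OF always_eventually LIMSEQ_inverse_real_of_nat, of "%k. ps k x - f x"] ps(2)
    by (simp add: Lim_null[symmetric])
  qed
  then show ?thesis using z[OF ps(1)] by (simp add: LIMSEQ_const_iff)
 qed
 have opn: "\<nu> A = 0" if A: "open A" "A \<subseteq> om" for A
 proof -
  \<comment> \<open>Boundedness of \<open>om\<close> enters here: for an empty complement
    \<open>infdist\<close> would be 0 by convention, and the functions f k would not approach the
    indicator.\<close>
  have ne: "- A \<noteq> {}" using A(2) bo by (metis Compl_empty_eq UNIV_I bounded_subset double_compl not_bounded_UNIV)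
  define f where "f k x = max 0 (min 1 (real k * infdist x (- A) - 1))" for k :: nat and x
  have "sint om \<nu> (f k) = 0" for k
  proof (rule cont)
   let ?K = "{x. infdist x (- A) >= 1 / (real k + 1)}"
   have kA: "?K \<subseteq> A"
   proof
    fix x assume "x : ?K"
    then have "infdist x (- A) > 0" by (auto intro: less_le_trans[of 0 "1 / (real k + 1)"])
    then show "x : A" using infdist_zero[of x "- A"] by fastforce
   qed
   have "closed ?K" by (intro closed_Collect_le continuous_intros)
   then show "compact ?K" using kA A(2) bo by (meson bounded_subset compact_eq_bounded_closed)
   show "?K \<subseteq> om" using kA A by blast
   show "continuous_on UNIV (f k)" unfolding f_def by (intro continuous_intros)
   show "f k x = 0" if "x \<notin> ?K" for x
   proof -
    have "infdist x (- A) * (real k + 1) < 1" using that by (simp add: not_le pos_less_divide_eq)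
    moreover have "real k * infdist x (- A) <= infdist x (- A) * (real k + 1)" using infdist_nonneg[of x "-A"] by (simp add: algebra_simps)
    ultimately show ?thesis by (simp add: f_def)
   qed
  qed
  moreover have "(%k. sint om \<nu> (f k)) ----> sint om \<nu> (indicator A)"
  proof (rule sint_lim[OF om s, of _ _ 1])
   show "f k : borel_measurable (restrict_space borel om)" for k
    unfolding f_def by (intro borel_measurable_continuous_on_restrict continuous_intros)
   show "indicator A : borel_measurable (restrict_space borel om)"
    using A by (intro measurable_restrict_space1 borel_measurable_indicator) auto
   show "\<bar>f k x\<bar> <= 1" for k x by (simp add: f_def)
   show "(%k. f k x) ----> indicator A x" for x
   proof (cases "x : A")
    case True
    then have "infdist x (- A) > 0" using infdist_pos_not_in_closed[of "- A" x] A(1) ne by auto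
    then obtain k0 where "2 < real k0 * infdist x (- A)" using ex_less_of_nat_mult by blast
    then have "f k x = 1" if "k >= k0" for k
    proof -
     have "real k0 * infdist x (- A) <= real k * infdist x (- A)" using that by (intro mult_right_mono infdist_nonneg) auto
     then show ?thesis using \<open>2 < real k0 * infdist x (- A)\<close> by (simp add: f_def)
    qed
    then have "eventually (%k. f k x = indicator A x) sequentially" using True by (auto simp: eventually_sequentially)
    then show ?thesis by (rule tendsto_eventually)
   qed (auto simp: f_def)
  qed
  ultimately have "sint om \<nu> (indicator A) = 0" by (simp add: LIMSEQ_const_iff)
  then show ?thesis using sint_indicator[OF om s, of A] A by (auto simp: borel_sets_on_def)
 qed
 have gen: "sigma_sets om {A. open A \<and> A \<subseteq> om} = borel_sets_on om"
 proof
  show "sigma_sets om {A. open A \<and> A \<subseteq> om} \<subseteq> borel_sets_on om"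
   by (rule sigma_algebra.sigma_sets_subset[OF sigma_algebra_borel_sets_on[OF om]]) (auto simp: borel_sets_on_def)
  have e: "(\<inter>) om ` {S. open S} = {A. open A \<and> A \<subseteq> om}" using om by (auto simp: image_iff)
  show "borel_sets_on om \<subseteq> sigma_sets om {A. open A \<and> A \<subseteq> om}"
  proof
   fix A assume A: "A : borel_sets_on om"
   have "(\<inter>) om ` sigma_sets UNIV {S. open S} = sigma_sets om ((\<inter>) om ` {S. open S})"
    by (rule sigma_sets_Int) (use om in auto)
   moreover have "A : (\<inter>) om ` sigma_sets UNIV {S. open S}"
    using A by (auto simp: borel_sets_on_def borel_def image_iff intro!: bexI[of _ A])
   ultimately show "A : sigma_sets om {A. open A \<and> A \<subseteq> om}" using e by simp
  qed
 qed
 show ?thesis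
 proof (cases "A : borel_sets_on om")
  case True
  have sA: "A : sigma_sets om {A. open A \<and> A \<subseteq> om}" using True gen by simp
  show ?thesis
  proof (rule sigma_sets_induct_disjoint[OF _ _ sA])
   show "Int_stable {A. open A \<and> A \<subseteq> om}" by (auto simp: Int_stable_def)
   show "\<nu> A = 0" if "A : {A. open A \<and> A \<subseteq> om}" for A using that opn by blast
   show "\<nu> {} = 0" using s by (simp add: smeas_def)
   show "\<nu> (om - A) = 0" if "A : sigma_sets om {A. open A \<and> A \<subseteq> om}" "\<nu> A = 0" for A
    using smeas_Diff[OF om s bsets(2)[OF om], of A] that gen opn[OF om] by (auto simp: borel_sets_on_def)
   show "\<nu> (\<Union>i. F i) = 0" if "disjoint_family F" "range F \<subseteq> sigma_sets om {A. open A \<and> A \<subseteq> om}" "!!i. \<nu> (F i) = 0" for F :: "nat => 'n pt set"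
   proof -
    have "(%k. \<nu> (F k)) sums \<nu> (\<Union>k. F k)" using that gen by (intro smeas_sums[OF om s]) auto
    then show ?thesis using that(3) by (simp add: sums_iff)
   qed
  qed auto
 qed (use s in \<open>simp add: smeas_def\<close>)
qed

lemma test_fun_bmf: assumes "test_fun om p" shows "bmf om p"
proof -
 note C = test_fun_C1c[OF assms]
 have "p : borel_measurable (restrict_space borel om)"
  using C1cD(3)[OF C] by (intro borel_measurable_continuous_on_restrict) (auto intro: continuous_on_subset)
 then show ?thesis using C1c_bounded[OF C] unfolding bmf_def[OF om] by blast
qed

lemma Dgrad_unique:
 assumes "is_Dgrad om u \<mu>" "is_Dgrad om u \<mu>'" shows "\<mu> = \<mu>'"
proof
 fix A
 have v: "vmeasure om \<mu>" "vmeasure om \<mu>'" using assms by (auto simp: is_Dgrad_def)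
 have "1 * \<mu> A $ i + (-1) * \<mu>' A $ i = 0" for i
 proof (rule smeas_eq_0[OF smeas_linear[OF vmeasure_component[OF v(1)] vmeasure_component[OF v(2)]]])
  fix p assume p: "test_fun om p"
  have "sint om (%A. 1 * \<mu> A $ i + (-1) * \<mu>' A $ i) p = 1 * sint om (%A. \<mu> A $ i) p + (-1) * sint om (%A. \<mu>' A $ i) p"
   by (rule sint_linear[OF om vmeasure_component[OF v(1)] vmeasure_component[OF v(2)] test_fun_bmf[OF p]])
  also have "... = 0"
  proof -
   have "(LINT x|lebesgue_on om. u x * partial i p x) = - sint om (%A. \<mu> A $ i) p"
    "(LINT x|lebesgue_on om. u x * partial i p x) = - sint om (%A. \<mu>' A $ i) p"
    using assms p unfolding is_Dgrad_def by blast+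
   then show ?thesis by simp
  qed
  finally show "sint om (%A. 1 * \<mu> A $ i + (-1) * \<mu>' A $ i) p = 0" .
 qed
 then show "\<mu> A = \<mu>' A" by (simp add: vec_eq_iff)
qed

lemma Dgrad_eq: assumes "is_Dgrad om u \<mu>" shows "Dgrad om u = \<mu>"
 unfolding Dgrad_def using assms Dgrad_unique by (intro the_equality) auto

lemma is_Dgrad_Dgrad: assumes "BV om u" shows "is_Dgrad om u (Dgrad om u)"
 using assms Dgrad_eq unfolding BV_def by metis

lemma is_Dgrad_linear:
 assumes u: "Lp 1 om u" "is_Dgrad om u \<mu>" and v: "Lp 1 om v" "is_Dgrad om v \<nu>"
 shows "is_Dgrad om (%x. a * u x + b * v x) (%A. a *\<^sub>R \<mu> A + b *\<^sub>R \<nu> A)"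
proof -
 have vm: "vmeasure om \<mu>" "vmeasure om \<nu>" using u v by (auto simp: is_Dgrad_def)
 show ?thesis
  unfolding is_Dgrad_def
 proof (intro conjI allI impI vmeasure_linear vm)
  fix p i assume p: "test_fun om p"
  note C = test_fun_C1c[OF p]
  obtain B where B: "!!x. norm (grad p x) <= B" using C1c_bounded[OF C] by blast
  have pb: "\<bar>partial i p x\<bar> <= B" for x using component_le_norm_cart[of "grad p x" i] B[of x] by (simp add: grad_def)
  have "continuous_on UNIV (%x. grad p x $ i)" by (intro continuous_intros C1cD(2)[OF C])
  then have pc: "partial i p : borel_measurable (lebesgue_on om)"
   using continuous_borel_lebesgue[of "%x. grad p x $ i"] by (auto simp: grad_def intro: measurable_restrict_space1)
  have int: "integrable (lebesgue_on om) (%x. w x * partial i p x)" if "Lp 1 om w" for w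
  proof (rule int_bound[where f="%x. B * \<bar>w x\<bar>"])
   show "integrable (lebesgue_on om) (%x. B * \<bar>w x\<bar>)" using that by (simp add: Lp_def)
   show "(%x. w x * partial i p x) : borel_measurable (lebesgue_on om)" using that pc by (auto simp: Lp_def)
   show "AE x in lebesgue_on om. norm (w x * partial i p x) <= norm (B * \<bar>w x\<bar>)"
    using pb order_trans[OF pb abs_ge_self] by (intro AE_I2) (simp add: abs_mult mult.commute[of "\<bar>B\<bar>"] mult_left_mono)
  qed
  have "(LINT x|lebesgue_on om. (a * u x + b * v x) * partial i p x)
    = (LINT x|lebesgue_on om. a * (u x * partial i p x) + b * (v x * partial i p x))"
   by (intro int_cong refl) (simp add: algebra_simps)
  also have "... = a * (LINT x|lebesgue_on om. u x * partial i p x) + b * (LINT x|lebesgue_on om. v x * partial i p x)"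
   using int[OF u(1)] int[OF v(1)] by simp
  also have "... = a * - sint om (%A. \<mu> A $ i) p + b * - sint om (%A. \<nu> A $ i) p"
  proof -
   have "(LINT x|lebesgue_on om. u x * partial i p x) = - sint om (%A. \<mu> A $ i) p"
    "(LINT x|lebesgue_on om. v x * partial i p x) = - sint om (%A. \<nu> A $ i) p"
    using u(2) v(2) p unfolding is_Dgrad_def by blast+
   then show ?thesis by simp
  qed
  also have "... = - sint om (%A. (a *\<^sub>R \<mu> A + b *\<^sub>R \<nu> A) $ i) p"
   using sint_linear[OF om vmeasure_component[OF vm(1)] vmeasure_component[OF vm(2)] test_fun_bmf[OF p], of a i b i] by simp
  finally show "(LINT x|lebesgue_on om. (a * u x + b * v x) * partial i p x) = - sint om (%A. (a *\<^sub>R \<mu> A + b *\<^sub>R \<nu> A) $ i) p" .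
 qed
qed

end

section \<open>Convex majorants and linear functionals\<close>

text \<open>Vector measures are set functions, and the pointwise operations turn them into a
  subspace of a real vector space, the setting of the extension theorem. The additive structure on
  functions is that of \<open>Function_Algebras\<close>.\<close>

instantiation "fun" :: (type, real_vector) real_vector
begin
definition scaleR_fun_def: "scaleR c f = (%x. c *\<^sub>R f x)"
instance by standard (auto simp: scaleR_fun_def fun_eq_iff scaleR_add_right scaleR_add_left)
end

text \<open>\<open>H\<close> stands for the graph of a linear functional on a subspace; it need not be assumed single valued.\<close>
definition dominated_graph :: "'v::real_vector set => ('v => real) => ('v \<times> real) set => bool" where
 "dominated_graph V q H \<longleftrightarrow> subspace H \<and> (\<forall>(x, a)\<in>H. x : V \<and> a <= q x)"

text \<open>A value c at x0 is admissible if it lies above all slopes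
  \<open>(a - q (x - t *\<^sub>R x0)) / t\<close> and below all slopes
  \<open>(q (x' + s *\<^sub>R x0) - a') / s\<close>. The convex combination with weights s / (s + t)
  and t / (s + t) eliminates x0 and shows that each lower slope is at most each upper one. As q is
  convex but not positively homogeneous, s and t vary independently and cannot be scaled to
  1.\<close>

lemma dominated_graph_extend:
 fixes V :: "'v::real_vector set"
 assumes V: "subspace V"
  and q: "!!x y s t. x : V ==> y : V ==> s >= 0 ==> t >= 0 ==> s + t = 1 ==> q (s *\<^sub>R x + t *\<^sub>R y) <= s * q x + t * q y"
  and H: "dominated_graph V q H" and x0: "x0 : V"
 shows "\<exists>H' c. dominated_graph V q H' \<and> H \<subseteq> H' \<and> (x0, c) : H'"
proof -
 have sH: "subspace H" and dH: "!!x a. (x, a) : H ==> x : V" "!!x a. (x, a) : H ==> a <= q x"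
  using H unfolding dominated_graph_def by blast+
 define Lo where "Lo = {(a - q (x - t *\<^sub>R x0)) / t | x a t. (x, a) : H \<and> t > 0}"
 have key: "(a - q (x - t *\<^sub>R x0)) / t <= (q (x' + s *\<^sub>R x0) - a') / s"
  if h: "(x, a) : H" "(x', a') : H" "s > 0" "t > 0" for x a x' a' s t
 proof -
  have "s *\<^sub>R (x, a) + t *\<^sub>R (x', a') : H" using sH h by (intro subspace_add subspace_scale)
  then have "(1 / (s + t)) *\<^sub>R (s *\<^sub>R (x, a) + t *\<^sub>R (x', a')) : H" by (rule subspace_scale[OF sH])
  then have "((s / (s + t)) *\<^sub>R x + (t / (s + t)) *\<^sub>R x', (s * a + t * a') / (s + t)) : H"
   by (simp add: scaleR_add_right add_divide_distrib)
  from dH(2)[OF this] have 1: "(s * a + t * a') / (s + t) <= q ((s / (s + t)) *\<^sub>R x + (t / (s + t)) *\<^sub>R x')" .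
  have "(s / (s + t)) *\<^sub>R x + (t / (s + t)) *\<^sub>R x' = (s / (s + t)) *\<^sub>R (x - t *\<^sub>R x0) + (t / (s + t)) *\<^sub>R (x' + s *\<^sub>R x0)"
   by (simp add: scaleR_diff_right scaleR_add_right mult.commute)
  moreover have "q ... <= s / (s + t) * q (x - t *\<^sub>R x0) + t / (s + t) * q (x' + s *\<^sub>R x0)"
   using h V x0 dH(1) by (intro q subspace_add subspace_diff subspace_scale) (auto simp: add_divide_distrib[symmetric])
  ultimately have "(s * a + t * a') / (s + t) <= (s * q (x - t *\<^sub>R x0) + t * q (x' + s *\<^sub>R x0)) / (s + t)"
   using 1 by (simp add: add_divide_distrib)
  then have "s * a + t * a' <= s * q (x - t *\<^sub>R x0) + t * q (x' + s *\<^sub>R x0)"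
   using h by (simp add: divide_le_cancel)
  then have "s * (a - q (x - t *\<^sub>R x0)) <= t * (q (x' + s *\<^sub>R x0) - a')" by (simp add: algebra_simps)
  then show ?thesis using h by (simp add: field_simps)
 qed
 have z: "(0, 0) : H" using subspace_0[OF sH] by (simp add: zero_prod_def)
 have ne: "Lo \<noteq> {}" using z unfolding Lo_def using zero_less_one by blast
 have bdd: "bdd_above Lo"
  using key[OF _ z, of _ _ 1] unfolding Lo_def by (intro bdd_aboveI[of _ "q (0 + 1 *\<^sub>R x0) - 0"]) force
 define c where "c = Sup Lo"
 have c1: "(a - q (x - t *\<^sub>R x0)) / t <= c" if "(x, a) : H" "t > 0" for x a t
  unfolding c_def by (rule cSup_upper[OF _ bdd]) (use that in \<open>auto simp: Lo_def\<close>)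
 have c2: "c <= (q (x + s *\<^sub>R x0) - a) / s" if "(x, a) : H" "s > 0" for x a s
  unfolding c_def by (rule cSup_least[OF ne]) (use key that in \<open>auto simp: Lo_def\<close>)
 define H' where "H' = {h + t *\<^sub>R (x0, c) | h t. h : H}"
 have "subspace H'"
 proof (rule subspaceI)
  have "0 = 0 + 0 *\<^sub>R (x0, c)" by (simp only: scaleR_zero_left add_0_right)
  then show "0 : H'" unfolding H'_def using subspace_0[OF sH] by blast
  show "x + y : H'" if xy: "x : H'" "y : H'" for x y
  proof -
   obtain h s k t where "x = h + s *\<^sub>R (x0, c)" "y = k + t *\<^sub>R (x0, c)" "h : H" "k : H" using xy unfolding H'_def by blast
   then have "x + y = (h + k) + (s + t) *\<^sub>R (x0, c)" "h + k : H" using subspace_add[OF sH] by (auto simp only: scaleR_add_left add_ac)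
   then show ?thesis unfolding H'_def by blast
  qed
  show "r *\<^sub>R x : H'" if xH: "x : H'" for r x
  proof -
   obtain h s where "x = h + s *\<^sub>R (x0, c)" "h : H" using xH unfolding H'_def by blast
   then have "r *\<^sub>R x = r *\<^sub>R h + (r * s) *\<^sub>R (x0, c)" "r *\<^sub>R h : H" using subspace_scale[OF sH] by (auto simp only: scaleR_add_right scaleR_scaleR)
   then show ?thesis unfolding H'_def by blast
  qed
 qed
 moreover have "y : V \<and> b <= q y" if yb: "(y, b) : H'" for y b
 proof -
  obtain x a t where h: "(x, a) : H" "y = x + t *\<^sub>R x0" "b = a + t * c" using yb unfolding H'_def by auto
  have "b <= q y"
  proof -
   consider "t = 0" | "t > 0" | "t < 0" by linarith
   then show ?thesis
   proof cases
    case 1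
    then show ?thesis using h dH by simp
   next
    case 2
    then have "t * c <= q (x + t *\<^sub>R x0) - a" using c2[OF h(1) 2] by (simp add: pos_le_divide_eq mult.commute)
    then show ?thesis using h by simp
   next
    case 3
    then have p: "- t > 0" by simp
    have "a - q (x - (- t) *\<^sub>R x0) <= c * (- t)" using c1[OF h(1) p] pos_divide_le_eq[OF p] by blast
    then show ?thesis using h by (simp add: mult.commute)
   qed
  qed
  then show ?thesis using h dH(1)[OF h(1)] V x0 by (auto intro: subspace_add subspace_scale)
 qed
 ultimately have "dominated_graph V q H'" unfolding dominated_graph_def by blast
 moreover have "H \<subseteq> H'"
 proof
  fix h assume "h : H"
  moreover have "h = h + 0 *\<^sub>R (x0, c)" by (simp only: scaleR_zero_left add_0_right)
  ultimately show "h : H'" unfolding H'_def by blast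
 qed
 moreover have "(x0, c) : H'"
 proof -
  have "(x0, c) = 0 + 1 *\<^sub>R (x0, c)" by simp
  then show ?thesis unfolding H'_def using subspace_0[OF sH] by blast
 qed
 ultimately show ?thesis by blast
qed

text \<open>A maximal graph is total by the one-dimensional extension. It is single valued because
  of q 0 \<le> 0: if (x, a) and (x, b) belong to it, so do all multiples of (0, a - b), and t (a -
  b) \<le> q 0 for every real t forces a = b.\<close>

theorem hahn_banach_convex:
 fixes V :: "'v::real_vector set"
 assumes V: "subspace V"
  and q: "!!x y s t. x : V ==> y : V ==> s >= 0 ==> t >= 0 ==> s + t = 1 ==> q (s *\<^sub>R x + t *\<^sub>R y) <= s * q x + t * q y"
  and q0: "q 0 <= 0" and H: "dominated_graph V q H"
 obtains F where "!!x y a b. x : V ==> y : V ==> F (a *\<^sub>R x + b *\<^sub>R y) = a * F x + b * F y"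
  "!!x. x : V ==> F x <= q x" "!!x a. (x, a) : H ==> F x = (a::real)"
proof -
 let ?A = "{K. dominated_graph V q K \<and> H \<subseteq> K}"
 have "\<exists>M\<in>?A. \<forall>X\<in>?A. M \<subseteq> X --> X = M"
 proof (rule subset_Zorn_nonempty)
  show "?A \<noteq> {}" using H by blast
  fix C assume C: "C \<noteq> {}" "subset.chain ?A C"
  have lin: "K \<subseteq> L \<or> L \<subseteq> K" if "K : C" "L : C" for K L using C(2) that unfolding subset.chain_def by blast
  have sub: "subspace K" if "K : C" for K using C(2) that by (auto simp: subset.chain_def dominated_graph_def)
  have "subspace (\<Union>C)"
  proof (rule subspaceI)
   show "0 : \<Union>C" using C(1) sub subspace_0 by blast
   show "x + y : \<Union>C" if xy: "x : \<Union>C" "y : \<Union>C" for x y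
   proof -
    obtain K L where "K : C" "L : C" "x : K" "y : L" using xy by blast
    with lin[of K L] obtain M where "M : C" "x : M" "y : M" by blast
    then show ?thesis using sub subspace_add by blast
   qed
   show "r *\<^sub>R x : \<Union>C" if "x : \<Union>C" for r x using that sub subspace_scale by blast
  qed
  moreover have "\<forall>(x, a)\<in>\<Union>C. x : V \<and> a <= q x" using C(2) by (auto simp: subset.chain_def dominated_graph_def)
  moreover have "H \<subseteq> \<Union>C" using C unfolding subset.chain_def by blast
  ultimately show "\<Union>C : ?A" by (simp add: dominated_graph_def)
 qed
 then obtain M where MA: "M : ?A" and mxA: "\<forall>X\<in>?A. M \<subseteq> X --> X = M" by (rule bexE)
 have M: "dominated_graph V q M" "H \<subseteq> M" using MA by simp_all
 have mx: "X = M" if "dominated_graph V q X" "H \<subseteq> X" "M \<subseteq> X" for X using mxA that by simp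
 have sM: "subspace M" and dM: "!!x a. (x, a) : M ==> x : V" "!!x a. (x, a) : M ==> a <= q x"
  using M(1) unfolding dominated_graph_def by blast+
 have tot: "\<exists>c. (x, c) : M" if xV: "x : V" for x
 proof -
  have "\<exists>H' c. dominated_graph V q H' \<and> M \<subseteq> H' \<and> (x, c) : H'"
   by (rule dominated_graph_extend[OF V _ M(1) xV]) (rule q; assumption)
  then obtain M' c where "dominated_graph V q M'" "M \<subseteq> M'" "(x, c) : M'" by blast
  then show ?thesis using mx[of M'] M(2) by blast
 qed
 have uniq: "a = b" if "(x, a) : M" "(x, b) : M" for x a b
 proof -
  have "(x, a) - (x, b) : M" by (rule subspace_diff[OF sM that])
  then have "(0, a - b) : M" by simp
  then have t: "t * (a - b) <= 0" for t using dM(2)[of 0 "t * (a - b)"] subspace_scale[OF sM, of "(0, a - b)" t] q0 by simp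
  then show ?thesis using t[of 1] t[of "-1"] by simp
 qed
 define F where "F x = (THE a. (x, a) : M)" for x
 have F: "F x = a" if "(x, a) : M" for x a unfolding F_def using that uniq by blast
 have FM: "(x, F x) : M" if "x : V" for x using tot[OF that] F by metis
 show ?thesis
 proof (rule that[of F])
  show "F (a *\<^sub>R x + b *\<^sub>R y) = a * F x + b * F y" if "x : V" "y : V" for x y a b
   using subspace_add[OF sM subspace_scale[OF sM FM[OF that(1)], of a] subspace_scale[OF sM FM[OF that(2)], of b]] by (intro F) simp
  show "F x <= q x" if "x : V" for x using dM(2)[OF FM[OF that]] .
  show "F x = a" if "(x, a) : H" for x a using F M(2) that by blast
 qed
qed

section \<open>The optimality condition\<close>

text \<open>Division by t and passage to the limit: the form in which local optimality is exploited,
  with K collecting all second-order terms.\<close>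

lemma linear_term_nonneg:
 fixes a K d :: real
 assumes d: "d > 0" and t: "!!t. 0 < t ==> t < d ==> 0 <= t * a + K * t\<^sup>2"
 shows "a >= 0"
proof (rule tendsto_lowerbound)
 show "((%t. a + K * t) \<longlongrightarrow> a) (at_right 0)" by (rule tendsto_eq_intros refl | simp)+
 have "0 <= a + K * t" if "0 < t" "t < d" for t
 proof -
  have "0 <= t * (a + K * t)" using t[OF that] by (simp add: algebra_simps power2_eq_square)
  then show ?thesis using that by (simp add: zero_le_mult_iff)
 qed
 then show "eventually (%t. 0 <= a + K * t) (at_right 0)" using d by (auto simp: eventually_at_right_field)
qed simp

lemma Lp_1_iff: "Lp 1 om y \<longleftrightarrow> integrable (lebesgue_on om) y" for y :: "'n::finite pt => real"
 by (auto simp: Lp_def integrable_abs_iff intro: borel_measurable_integrable)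

lemma BV_combination:
 fixes om :: "'n::finite pt set"
 assumes om: "open om" "bounded om" and u: "BV om u" "Lp 2 om u" and v: "BV om v" "Lp 2 om v"
 shows "BV om (%x. a * u x + b * v x)" "Lp 2 om (%x. a * u x + b * v x)"
  "Dgrad om (%x. a * u x + b * v x) = (%A. a *\<^sub>R Dgrad om u A + b *\<^sub>R Dgrad om v A)"
proof -
 have l: "Lp 1 om u" "Lp 1 om v" using u v by (auto simp: BV_def)
 have D: "is_Dgrad om (%x. a * u x + b * v x) (%A. a *\<^sub>R Dgrad om u A + b *\<^sub>R Dgrad om v A)"
  by (rule is_Dgrad_linear[OF om l(1) is_Dgrad_Dgrad[OF om u(1)] l(2) is_Dgrad_Dgrad[OF om v(1)]])
 then show "Dgrad om (%x. a * u x + b * v x) = (%A. a *\<^sub>R Dgrad om u A + b *\<^sub>R Dgrad om v A)" by (rule Dgrad_eq[OF om])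
 have "Lp 1 om (%x. a * u x + b * v x)" using l by (simp add: Lp_1_iff)
 with D show "BV om (%x. a * u x + b * v x)" by (auto simp: BV_def)
 have "l2 lb (%x. a *\<^sub>R (indicator om x * u x) + b *\<^sub>R (indicator om x * v x))"
  using u(2) v(2) by (intro l2_add l2_scaleR) (simp_all add: Lp_2[OF om(1)])
 then show "Lp 2 om (%x. a * u x + b * v x)" by (simp add: Lp_2[OF om(1)] algebra_simps)
qed

lemma Lp_2_mult_integrable:
 fixes om :: "'n::finite pt set"
 assumes "open om" "Lp 2 om u" "Lp 2 om v" shows "integrable (lebesgue_on om) (%x. u x * v x)"
proof -
 have e: "indicator om x * (u x * v x) = (indicator om x * u x) * (indicator om x * v x)" for x by (simp add: indicator_def)
 show ?thesis
  using l2_real_mult[OF assms(2,3)[unfolded Lp_2[OF assms(1)]]] by (simp only: integrable_on_iff[OF assms(1)] e)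
qed

theorem theorem4p2:
  fixes \<Omega> \<omega> :: "('n::finite) pt set"
    and f f1 f2 :: "'n pt \<Rightarrow> real \<Rightarrow> real"
    and yd ub :: "'n pt \<Rightarrow> real"
    and N :: "'n pt \<Rightarrow> real"
    and \<alpha> \<beta> \<gamma> :: real
  assumes dim: "CARD('n) = 2 \<or> CARD('n) = 3"
    and dom: "lipschitz_domain \<Omega>"
    and om: "open \<omega>" "\<omega> \<subseteq> \<Omega>"
    and N: "is_norm N"
    and par: "\<alpha> > 0" "\<beta> \<ge> 0" "\<gamma> \<ge> 0" "CARD('n) = 3 \<longrightarrow> \<gamma> > 0"
    and yd: "Lp 2 \<Omega> yd"
    and f_borel: "case_prod f \<in> borel_measurable borel"
    and f_C2: "\<And>x y. (f x has_real_derivative f1 x y) (at y)"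
              "\<And>x y. (f1 x has_real_derivative f2 x y) (at y)"
              "\<And>x. continuous_on UNIV (f2 x)"
    and f0: "\<exists>p. p > real CARD('n) / 2 \<and> Lp p \<Omega> (\<lambda>x. f x 0)"
    and f_mono: "AE x in lebesgue_on \<Omega>. \<forall>y. f1 x y \<ge> 0"
    and f_bd: "\<And>M. M > 0 \<Longrightarrow> \<exists>C. AE x in lebesgue_on \<Omega>. \<forall>y. \<bar>y\<bar> \<le> M \<longrightarrow>
                   \<bar>f1 x y\<bar> + \<bar>f2 x y\<bar> \<le> C"
    and f_uc: "\<And>M \<epsilon>. M > 0 \<Longrightarrow> \<epsilon> > 0 \<Longrightarrow> \<exists>\<delta>>0. AE x in lebesgue_on \<Omega>. \<forall>y z.
                   \<bar>y\<bar> \<le> M \<longrightarrow> \<bar>z\<bar> \<le> M \<longrightarrow> \<bar>y - z\<bar> < \<delta> \<longrightarrow> \<bar>f2 x y - f2 x z\<bar> < \<epsilon>"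
    and loc: "local_solution \<Omega> \<omega> f yd N \<alpha> \<beta> \<gamma> ub"
  shows "\<exists>\<Lambda>\<in>subdiff_g N \<omega> (Dgrad \<omega> ub). \<forall>v. BV \<omega> v \<and> Lp 2 \<omega> v \<longrightarrow>
           \<alpha> * \<Lambda> (Dgrad \<omega> v)
           + (LINT x|lebesgue_on \<omega>. (adjoint \<Omega> f1 (state \<Omega> \<omega> f ub) yd x + \<gamma> * ub x
                 + \<beta> * (LINT z|lebesgue_on \<omega>. ub z)) * v x) = 0"
proof -
 interpret elliptic \<Omega> \<omega> f f1 f2 using dim dom om f_borel f_C2(1,2) f0 f_mono f_bd by unfold_locales
 have bo: "bounded \<omega>" using Om(2) om(2) bounded_subset by blast
 obtain \<epsilon> where ub: "BV \<omega> ub" "Lp 2 \<omega> ub" and \<epsilon>: "\<epsilon> > 0"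
  and opt: "!!u. BV \<omega> u ==> Lp 2 \<omega> u ==> bvl2_norm N \<omega> (%x. u x - ub x) < \<epsilon> ==>
    Jcost \<Omega> \<omega> f yd N \<alpha> \<beta> \<gamma> ub <= Jcost \<Omega> \<omega> f yd N \<alpha> \<beta> \<gamma> u"
  using loc unfolding local_solution_def by blast
 define \<mu>0 where "\<mu>0 = Dgrad \<omega> ub"
 define \<phi> where "\<phi> = adjoint \<Omega> f1 (state \<Omega> \<omega> f ub) yd"
 define U where "U = (LINT z|lebesgue_on \<omega>. ub z)"
 define F where "F v = (LINT x|lebesgue_on \<omega>. (\<phi> x + \<gamma> * ub x + \<beta> * U) * v x)" for v
 \<comment> \<open>The linear functionals below q are those that satisfy the subgradient inequality
   of g at \<mu>0, so an extension dominated by q is already the multiplier up to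
   boundedness.\<close>
 define q where "q \<mu> = mnorm N \<omega> (%A. \<mu>0 A + \<mu> A) - mnorm N \<omega> \<mu>0" for \<mu> :: "'n pt set => 'n pt"
 have vD: "vmeasure \<omega> (Dgrad \<omega> v)" if "BV \<omega> v" for v using is_Dgrad_Dgrad[OF om(1) bo that] by (simp add: is_Dgrad_def)
 have v0: "vmeasure \<omega> \<mu>0" unfolding \<mu>0_def by (rule vD[OF ub(1)])
 have vp: "vmeasure \<omega> (%A. \<mu>0 A + \<mu> A)" if "vmeasure \<omega> \<mu>" for \<mu> using vmeasure_linear[OF v0 that, of 1 1] by simp
 note ml = mnorm_linear_le[OF om(1) N]
 have \<phi>2: "Lp 2 \<omega> \<phi>"
 proof -
  obtain G where "continuous_on UNIV (state \<Omega> \<omega> f ub)" using state_props[OF ub(2)] by blast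
  then have c: "continuous_on UNIV \<phi>" unfolding \<phi>_def using adjoint_props[OF _ yd] by metis
  obtain b where "b > 0" "!!x. x : \<omega> ==> \<bar>\<phi> x\<bar> <= b" using continuous_zero_bounded[OF continuous_on_subset[OF c] bo] by blast
  then show ?thesis using indicator_continuous_l2[OF om(1) bo continuous_on_subset[OF c], of b] by (simp add: Lp_2[OF om(1)])
 qed
 have i1: "integrable (lebesgue_on \<omega>) v" if "BV \<omega> v" for v using that by (simp add: BV_def Lp_1_iff)
 note i2 = Lp_2_mult_integrable[OF om(1)]
 have Fv: "F v = (LINT x|lebesgue_on \<omega>. \<phi> x * v x) + \<gamma> * (LINT x|lebesgue_on \<omega>. ub x * v x) + \<beta> * U * (LINT x|lebesgue_on \<omega>. v x)"
  if v: "BV \<omega> v" "Lp 2 \<omega> v" for v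
  unfolding F_def distrib_right mult.assoc using i2[OF \<phi>2 v(2)] i2[OF ub(2) v(2)] i1[OF v(1)] by simp
 have key: "0 <= F v + \<alpha> * q (Dgrad \<omega> v)" if v: "BV \<omega> v" "Lp 2 \<omega> v" for v
 proof -
  let ?\<nu> = "Dgrad \<omega> v"
  obtain K where K: "!!t. 0 < t ==> t <= 1 ==>
   \<bar>1/2 * (LINT x|lebesgue_on \<Omega>. (state \<Omega> \<omega> f (%x. ub x + t * v x) x - yd x)\<^sup>2)
   - 1/2 * (LINT x|lebesgue_on \<Omega>. (state \<Omega> \<omega> f ub x - yd x)\<^sup>2) - t * (LINT x|lebesgue_on \<omega>. \<phi> x * v x)\<bar> <= K * t\<^sup>2"
   using tracking_derivative[OF ub(2) v(2) yd] unfolding \<phi>_def by blast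
  define B where "B = bvl2_norm N \<omega> v"
  have B: "B >= 0" unfolding B_def bvl2_norm_def using mnorm_nonneg[OF om(1) N vD[OF v(1)]] by simp
  define V where "V = (LINT x|lebesgue_on \<omega>. v x)"
  \<comment> \<open>The second-order terms of the tracking functional, of the squared mean and of
    the squared norm.\<close>
  define K' where "K' = K + \<beta>/2 * V\<^sup>2 + \<gamma>/2 * (LINT x|lebesgue_on \<omega>. (v x)\<^sup>2)"
  show ?thesis
  \<comment> \<open>The norm of t v is at most t B, so t < \<epsilon> / (B + 1) keeps ub + t v in
    the neighbourhood where ub is optimal; t < 1 is needed for the convex combination and for the
    expansion of the tracking term.\<close>
  proof (rule linear_term_nonneg[of "min 1 (\<epsilon> / (B + 1))" _ K'])
   show "0 < min 1 (\<epsilon> / (B + 1))" using \<epsilon> B by simp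
   fix t :: real assume t: "0 < t" "t < min 1 (\<epsilon> / (B + 1))"
   let ?w = "%x. ub x + t * v x"
   note W = BV_combination[OF om(1) bo ub v, of 1 t, simplified]
   have "mnorm N \<omega> (%A. t *\<^sub>R ?\<nu> A + 0 *\<^sub>R ?\<nu> A) <= t * mnorm N \<omega> ?\<nu>"
    using ml[OF vD[OF v(1)] vD[OF v(1)], of t 0] t by simp
   moreover have "Dgrad \<omega> (%x. t * v x) = (%A. t *\<^sub>R ?\<nu> A)" using BV_combination(3)[OF om(1) bo v v, of t 0] by simp
   ultimately have "bvl2_norm N \<omega> (%x. t * v x) <= t * B"
    using t by (simp add: bvl2_norm_def B_def abs_mult power_mult_distrib real_sqrt_mult distrib_left)
   also have "... <= t * (B + 1)" using t by simp
   also have "... < \<epsilon>" using t(2) B by (simp add: pos_less_divide_eq)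
   finally have "Jcost \<Omega> \<omega> f yd N \<alpha> \<beta> \<gamma> ub <= Jcost \<Omega> \<omega> f yd N \<alpha> \<beta> \<gamma> ?w" using W(1,2) by (intro opt) simp_all
   \<comment> \<open>The gradient of ub + t v is the convex combination of \<mu>0 and \<mu>0 + \<nu>
     with weights 1 - t and t. Hence the nonsmooth term grows at most linearly in t, with q \<nu> as
     the slope.\<close>
   moreover have "mnorm N \<omega> (Dgrad \<omega> ?w) <= mnorm N \<omega> \<mu>0 + t * q ?\<nu>"
   proof -
    have "mnorm N \<omega> (%A. (1 - t) *\<^sub>R \<mu>0 A + t *\<^sub>R (\<mu>0 A + ?\<nu> A)) <= \<bar>1 - t\<bar> * mnorm N \<omega> \<mu>0 + \<bar>t\<bar> * mnorm N \<omega> (%A. \<mu>0 A + ?\<nu> A)"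
     by (rule ml[OF v0 vp[OF vD[OF v(1)]]])
    moreover have "(%A. (1 - t) *\<^sub>R \<mu>0 A + t *\<^sub>R (\<mu>0 A + ?\<nu> A)) = Dgrad \<omega> ?w"
     unfolding W(3) \<mu>0_def by (simp add: algebra_simps)
    ultimately show ?thesis using t by (simp add: q_def algebra_simps)
   qed
   then have "\<alpha> * mnorm N \<omega> (Dgrad \<omega> ?w) <= \<alpha> * (mnorm N \<omega> \<mu>0 + t * q ?\<nu>)" using par(1) by simp
   moreover have "(LINT x|lebesgue_on \<omega>. ?w x) = U + t * V"
    unfolding U_def V_def using i1[OF ub(1)] i1[OF v(1)] by simp
   moreover have "(LINT x|lebesgue_on \<omega>. (?w x)\<^sup>2) = (LINT x|lebesgue_on \<omega>. (ub x)\<^sup>2) + 2 * t * (LINT x|lebesgue_on \<omega>. ub x * v x) + t\<^sup>2 * (LINT x|lebesgue_on \<omega>. (v x)\<^sup>2)"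
   proof -
    have "(LINT x|lebesgue_on \<omega>. (?w x)\<^sup>2) = (LINT x|lebesgue_on \<omega>. ub x * ub x + 2 * t * (ub x * v x) + t\<^sup>2 * (v x * v x))"
     by (intro int_cong refl) (simp add: power2_eq_square algebra_simps)
    then show ?thesis using i2[OF ub(2,2)] i2[OF ub(2) v(2)] i2[OF v(2,2)] by (simp add: power2_eq_square)
   qed
   moreover have "1/2 * (LINT x|lebesgue_on \<Omega>. (state \<Omega> \<omega> f ?w x - yd x)\<^sup>2)
    <= 1/2 * (LINT x|lebesgue_on \<Omega>. (state \<Omega> \<omega> f ub x - yd x)\<^sup>2) + t * (LINT x|lebesgue_on \<omega>. \<phi> x * v x) + K * t\<^sup>2"
    using K[of t] t by linarith
   ultimately show "0 <= t * (F v + \<alpha> * q ?\<nu>) + K' * t\<^sup>2"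
    unfolding Jcost_def Fv[OF v] K'_def \<mu>0_def U_def[symmetric] V_def[symmetric] by (simp add: power2_sum field_simps)
  qed
 qed
 \<comment> \<open>The graph of v \<mapsto> - F v / \<alpha> regarded as a relation on gradients.
   That functions with equal gradients have equal values of F is not checked here; it follows from
   domination by q, as \<open>hahn_banach_convex\<close> accepts a relation.\<close>
 define H where "H = {(Dgrad \<omega> v, - F v / \<alpha>) | v. BV \<omega> v \<and> Lp 2 \<omega> v}"
 have lin: "F (%x. a * v x + b * w x) = a * F v + b * F w" if v: "BV \<omega> v" "Lp 2 \<omega> v" and w: "BV \<omega> w" "Lp 2 \<omega> w" for a b v w
 proof -
  have i: "integrable (lebesgue_on \<omega>) (%x. (\<phi> x + \<gamma> * ub x + \<beta> * U) * v x)" if v: "BV \<omega> v" "Lp 2 \<omega> v" for v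
   unfolding distrib_right mult.assoc using i2[OF \<phi>2 v(2)] i2[OF ub(2) v(2)] i1[OF v(1)] by simp
  have "F (%x. a * v x + b * w x) = (LINT x|lebesgue_on \<omega>. a * ((\<phi> x + \<gamma> * ub x + \<beta> * U) * v x) + b * ((\<phi> x + \<gamma> * ub x + \<beta> * U) * w x))"
   unfolding F_def by (intro int_cong refl) (simp add: algebra_simps)
  also have "... = a * F v + b * F w" unfolding F_def using i[OF v] i[OF w] by simp
  finally show ?thesis .
 qed
 have comb: "a *\<^sub>R x + b *\<^sub>R y = (%A. a *\<^sub>R x A + b *\<^sub>R y A)" for a b and x y :: "'n pt set => 'n pt"
  by (simp add: plus_fun_def scaleR_fun_def)
 have H: "a *\<^sub>R x + b *\<^sub>R y : H" if xy: "x : H" "y : H" for a b x y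
 proof -
  obtain v w where v: "BV \<omega> v" "Lp 2 \<omega> v" "x = (Dgrad \<omega> v, - F v / \<alpha>)" and w: "BV \<omega> w" "Lp 2 \<omega> w" "y = (Dgrad \<omega> w, - F w / \<alpha>)"
   using xy unfolding H_def by blast
  note c = BV_combination[OF om(1) bo v(1,2) w(1,2), of a b]
  have "a *\<^sub>R x + b *\<^sub>R y = (Dgrad \<omega> (%x. a * v x + b * w x), - F (%x. a * v x + b * w x) / \<alpha>)"
   unfolding v(3) w(3) c(3) lin[OF v(1,2) w(1,2)] by (simp add: comb diff_divide_distrib add_divide_distrib)
  then show ?thesis unfolding H_def using c(1,2) by blast
 qed
 have "(Dgrad \<omega> ub, - F ub / \<alpha>) : H" unfolding H_def using ub by blast
 from H[OF this this, of 0 0] have H0: "0 : H" by (simp add: zero_prod_def)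
 have "subspace H" unfolding subspace_def using H0 H[of _ _ 1 1] H[of _ _ _ 0] by simp
 moreover have "x : {\<mu>. vmeasure \<omega> \<mu>} \<and> a <= q x" if "(x, a) : H" for x a
 proof -
  from that obtain v where v: "BV \<omega> v" "Lp 2 \<omega> v" "x = Dgrad \<omega> v" "a = - F v / \<alpha>" unfolding H_def by blast
  have "\<alpha> * a <= \<alpha> * q x" using key[OF v(1,2)] par(1) v(3,4) by simp
  then show ?thesis using vD[OF v(1)] par(1) v(3) by simp
 qed
 ultimately have dg: "dominated_graph {\<mu>. vmeasure \<omega> \<mu>} q H" unfolding dominated_graph_def by blast
 have sub: "subspace {\<mu>. vmeasure \<omega> \<mu>}"
  unfolding subspace_def
  using vmeasure_linear[OF v0 v0, of 0 0] vmeasure_linear[of \<omega> _ _ 1 1] vmeasure_linear[of \<omega> _ _ _ 0]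
  by (simp add: zero_fun_def plus_fun_def scaleR_fun_def)
 obtain \<Lambda> where \<Lambda>: "!!x y a b. vmeasure \<omega> x ==> vmeasure \<omega> y ==> \<Lambda> (%A. a *\<^sub>R x A + b *\<^sub>R y A) = a * \<Lambda> x + b * \<Lambda> y"
  "!!x. vmeasure \<omega> x ==> \<Lambda> x <= q x" "!!x a. (x, a) : H ==> \<Lambda> x = a"
 proof (rule hahn_banach_convex[OF sub _ _ dg])
  fix x y :: "'n pt set => 'n pt" and s t :: real
  assume h: "x : {\<mu>. vmeasure \<omega> \<mu>}" "y : {\<mu>. vmeasure \<omega> \<mu>}" "s >= 0" "t >= 0" "s + t = 1"
  have "\<mu>0 A = s *\<^sub>R \<mu>0 A + t *\<^sub>R \<mu>0 A" for A using h(5) by (metis scaleR_left_distrib scaleR_one)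
  then have e: "(%A. \<mu>0 A + (s *\<^sub>R x + t *\<^sub>R y) A) = (%A. s *\<^sub>R (\<mu>0 A + x A) + t *\<^sub>R (\<mu>0 A + y A))"
   unfolding comb by (simp add: fun_eq_iff scaleR_right_distrib add.assoc add.left_commute)
  have "s * mnorm N \<omega> \<mu>0 + t * mnorm N \<omega> \<mu>0 = mnorm N \<omega> \<mu>0" using h(5) by (metis distrib_right mult_1)
  then show "q (s *\<^sub>R x + t *\<^sub>R y) <= s * q x + t * q y"
   using ml[OF vp vp, of x y s t] h(1-4) unfolding q_def e by (simp add: algebra_simps)
 next
  show "q 0 <= 0" by (simp add: q_def)
 next
  fix F
  assume "!!x y a b. x : {\<mu>. vmeasure \<omega> \<mu>} ==> y : {\<mu>. vmeasure \<omega> \<mu>} ==> F (a *\<^sub>R x + b *\<^sub>R y) = a * F x + b * F y"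
   "!!x. x : {\<mu>. vmeasure \<omega> \<mu>} ==> F x <= q x" "!!x a. (x, a) : H ==> F x = a"
  then show thesis by (intro that[of F]) (simp_all add: comb)
 qed
 \<comment> \<open>The triangle inequality bounds the increment q by the norm; applied to \<mu> and
   - \<mu> this makes \<Lambda> bounded with constant 1.\<close>
 have qle: "q \<mu> <= mnorm N \<omega> \<mu>" if "vmeasure \<omega> \<mu>" for \<mu> using ml[OF v0 that, of 1 1] by (simp add: q_def)
 have "\<bar>\<Lambda> \<mu>\<bar> <= 1 * mnorm N \<omega> \<mu>" if m: "vmeasure \<omega> \<mu>" for \<mu>
 proof -
  have m': "vmeasure \<omega> (%A. (- 1) *\<^sub>R \<mu> A + 0 *\<^sub>R \<mu> A)" by (rule vmeasure_linear[OF m m])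
  have "- \<Lambda> \<mu> <= mnorm N \<omega> \<mu>"
   using \<Lambda>(1)[OF m m, of "-1" 0] order_trans[OF \<Lambda>(2)[OF m'] qle[OF m']] ml[OF m m, of "-1" 0] by simp
  then show ?thesis using order_trans[OF \<Lambda>(2)[OF m] qle[OF m]] by simp
 qed
 then have "mdual N \<omega> \<Lambda>" unfolding mdual_def using \<Lambda>(1) by blast
 moreover have "mnorm N \<omega> \<mu>0 + \<Lambda> (%A. \<mu> A - \<mu>0 A) <= mnorm N \<omega> \<mu>" if m: "vmeasure \<omega> \<mu>" for \<mu>
  using \<Lambda>(2)[OF vmeasure_linear[OF m v0, of 1 "-1"]] by (simp add: q_def)
 ultimately have "\<Lambda> : subdiff_g N \<omega> \<mu>0" by (simp add: subdiff_g_def)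
 moreover have "\<alpha> * \<Lambda> (Dgrad \<omega> v) + F v = 0" if "BV \<omega> v" "Lp 2 \<omega> v" for v
  using \<Lambda>(3)[of "Dgrad \<omega> v" "- F v / \<alpha>"] that par(1) unfolding H_def by fastforce
 ultimately show ?thesis unfolding F_def U_def \<phi>_def \<mu>0_def by blast
qed

end
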